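(* Let $f:S\to S$ be a generalized pseudo-Anosov homeomorphism, $\mathcal R=\{R_i\}_{i=1}^n$ a geometric Markov partition of $f$ whose geometric type $T$ has binary incidence matrix $A=A(T)$, and let $\mathcal W=\{\underline w^1,\dots,\underline w^Q\}\subset\Sigma_A$ be a finite family of periodic codes. There exists a finite algorithm to construct a geometric refinement $(f,\mathbf S_{\mathcal W}(\mathcal R))$ of $(f,\mathcal R)$ by horizontal sub-rectangles of $\mathcal R$ with the following properties: (1) Each stable boundary component of each rectangle of $\mathbf S_{\mathcal W}(\mathcal R)$ is either a stable boundary arc of some $R_i\in\mathcal R$ or a stable arc $I_{t,\underline w}$ determined by an iteration $t\in\mathbb N$ of a code $\underline w\in\mathcal W$. Moreover, every arc $I_{t,\underline w}$ with $\underline w\in\mathcal W$ is a stable boundary component of some rectangle of $\mathbf S_{\mathcal W}(\mathcal R)$. (2) The set of periodic boundary points of $\mathbf S_{\mathcal W}(\mathcal R)$ is the union of the set of periodic boundary points of $\mathcal R$ and the set $\{\pi_{(f,\mathcal R)}(\sigma_A^t(\underline w)):\underline w\in\mathcal W,\ t\in\mathbb N\}$. (3) There are explicit formulas, in terms of the geometric type $T$ and the codes in $\mathcal W$, that compute the geometric type of $(f,\mathbf S_{\mathcal W}(\mathcal R))$.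
   Context: $S$ is a closed oriented surface. A generalized pseudo-Anosov homeomorphism is an orientation-preserving homeomorphism $f:S\to S$ for which there are measured foliations $(\mathcal F^s,\mu^s)$, $(\mathcal F^u,\mu^u)$ (singular foliations with finitely many $k$-prong singularities, $k=1$ or $k\ge3$, with transverse measures that are non-atomic, absolutely continuous with respect to Lebesgue, positive on non-degenerate transverse arcs and invariant under leaf-preserving isotopy) with the same singularities and numbers of prongs, topologically transverse elsewhere, each preserved by $f$, and $\lambda>1$ with $\mu^s(f(J))=\lambda\mu^s(J)$ for unstable arcs $J$ and $\mu^u(f(I))=\lambda^{-1}\mu^u(I)$ for stable arcs $I$. Rectangles. A connected open $D\subset S$ is trivially bi-foliated if for each $x\in D$ the component $\overset{o}{I_x}$ of (stable leaf of $x$)$\cap D$ through $x$ and the analogous unstable component $\overset{o}{J_x}$ are open arcs, with $|\overset{o}{I_x}\cap\overset{o}{J_y}|=1$ for all $x,y\in D$. A rectangle is $R=\overline D$, with interior $\overset{o}{R}=D$; it has a continuous parametrization $[0,1]^2\to R$ that is an orientation-preserving homeomorphism $(0,1)^2\to\overset{o}{R}$ and sends horizontal (vertical) segments into stable (unstable) leaves; the images of the two horizontal (vertical) sides are its stable (unstable) boundary components, forming $\partial^sR$ ($\partial^uR$), $\partial R=\partial^sR\cup\partial^uR$. Horizontal (vertical) sub-rectangles of $R$ are rectangles contained in $R$ whose horizontal (vertical) leaves coincide with those of $R$. Markov partition of $f$: a finite labelled family of rectangles $\{R_i\}_{i=1}^n$ with union $S$, pairwise disjoint interiors, such that the closures of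 the components of $\overset{o}{R_i}\cap f^{-1}(\overset{o}{R_j})$ are horizontal sub-rectangles of $R_i$ and those of $f(\overset{o}{R_i})\cap\overset{o}{R_j}$ are vertical sub-rectangles of $R_j$ (called horizontal and vertical sub-rectangles of $(f,\mathcal R)$). A geometric Markov partition is one with a chosen vertical direction in each rectangle; horizontal leaves get the direction making (horizontal, vertical) agree with the orientation of $S$. The horizontal sub-rectangles of $(f,\mathcal R)$ in $R_i$ are labelled $H^i_1,\dots,H^i_{h_i}$ from bottom to top, the vertical ones in $R_k$ are labelled $V^k_1,\dots,V^k_{v_k}$ from left to right. The geometric type of $(f,\mathcal R)$ is $T=(n,\{(h_i,v_i)\}_{i=1}^n,\rho_T,\epsilon_T)$ with $\rho_T(i,j)=(k,l)$ iff $f(H^i_j)=V^k_l$, and $\epsilon_T(i,j)=1$ if $f$ maps the vertical direction of $H^i_j$ to that of $V^k_l$, $-1$ otherwise. The incidence matrix $A(T)=(a_{ik})$ has $a_{ik}=\#\{j:\rho_T(i,j)=(k,l)\text{ for some }l\}$; it is binary if all entries are $0$ or $1$. A periodic boundary point of a Markov partition is a periodic point of $f$ lying in $\bigcup_i\partial R_i$. A geometric refinement of $(f,\mathcal R)$ by horizontal sub-rectangles is a Markov partition of $f$ consisting of rectangles $H_{(i,h)}$, $1\le i\le n$, $1\le h\le H(i)$, where $H_{(i,h)}$ is a horizontal sub-rectangle of $R_i$, $\bigcup_hH_{(i,h)}=R_i$, and $H_{(i,h)}$ is below $H_{(i,h')}$ in $R_i$ iff $h<h'$; its rectangles are relabelled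 by lexicographic order and carry the directions induced from $R_i$. Symbolic dynamics. $\Sigma_A=\{\underline w=(w_z)_{z\in\mathbb Z}\in\{1,\dots,n\}^{\mathbb Z}:a_{w_zw_{z+1}}=1\ \forall z\}$, $\sigma_A$ is the shift $(\sigma_A(\underline w))_z=w_{z+1}$, and a code is periodic if it is $\sigma_A$-periodic. The projection $\pi_{(f,\mathcal R)}:\Sigma_A\to S$ sends $\underline w$ to the unique point of $\bigcap_{N\in\mathbb N}\overline{\bigcap_{z=-N}^{N}f^{-z}(\overset{o}{R_{w_z}})}$. For a periodic code $\underline w$ and $t\in\mathbb N$, $I_{t,\underline w}=\pi_{(f,\mathcal R)}(\{\underline v\in\Sigma_A:v_m=w_{t+m}\ \forall m\in\mathbb N\})$ (with $0\in\mathbb N$), which is a horizontal (stable) arc of $R_{w_t}$. *)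

theory Defs
  imports "HOL-Complex_Analysis.Complex_Analysis" "HOL-Library.Nat_Bijection"
begin

section \<open>Oriented surfaces\<close>

abbreviation square :: "complex set"
  where "square \<equiv> cbox 0 (Complex 1 1)"

abbreviation open_square :: "complex set"
  where "open_square \<equiv> box 0 (Complex 1 1)"

text \<open>For a homeomorphism \<open>h\<close> between open subsets of the plane, preserving the orientation
  means that small positively oriented circles about \<open>z\<close> wind once around \<open>h z\<close>.\<close>

definition planar_orientation_preserving :: "complex set \<Rightarrow> (complex \<Rightarrow> complex) \<Rightarrow> bool"
  where "planar_orientation_preserving V h \<longleftrightarrow>
    (\<forall>z r. 0 < r \<and> cball z r \<subseteq> V \<longrightarrow> winding_number (h \<circ> circlepath z r) (h z) = 1)"

type_synonym 'a chart = "'a set \<times> ('a \<Rightarrow> complex)"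

definition orientation_preserving ::
    "'a chart set \<Rightarrow> 'b chart set \<Rightarrow> 'a set \<Rightarrow> ('a \<Rightarrow> 'b) \<Rightarrow> bool"
  where "orientation_preserving \<O> \<O>' X g \<longleftrightarrow>
    (\<forall>(U, \<phi>)\<in>\<O>. \<forall>(V, \<psi>)\<in>\<O>'.
       planar_orientation_preserving (\<phi> ` (U \<inter> X \<inter> g -` V)) (\<psi> \<circ> g \<circ> inv_into U \<phi>))"

definition plane_orientation :: "complex chart set"
  where "plane_orientation = {(UNIV, id)}"

definition closed_oriented_surface :: "'a::t2_space set \<Rightarrow> 'a chart set \<Rightarrow> bool"
  where "closed_oriented_surface S \<O> \<longleftrightarrow>
    compact S \<and> connected S \<and> S \<noteq> {} \<and>
    (\<forall>(U, \<phi>)\<in>\<O>. openin (top_of_set S) U \<and> open (\<phi> ` U) \<and>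
       (\<exists>\<psi>. homeomorphism U (\<phi> ` U) \<phi> \<psi>)) \<and>
    (\<Union>(U, \<phi>)\<in>\<O>. U) = S \<and>
    orientation_preserving \<O> \<O> S id"


section \<open>Singular foliations\<close>

text \<open>A foliated chart \<open>(k, U, \<phi>)\<close> identifies \<open>U\<close> with the open unit disc so that the plaques
  become the leaves of the standard \<open>k\<close>-prong model, the connected components of the level sets of
  \<open>(Im (z\<^bsup>k/2\<^esup>))\<^sup>2 = (\<bar>z\<bar>\<^bsup>k\<^esup> - Re (z\<^bsup>k\<^esup>)) / 2\<close>. For \<open>k = 2\<close> these are the horizontal
  chords; for \<open>k \<noteq> 2\<close> the centre of the chart is a singularity, and the whole \<open>k\<close>-pronged star
  through it is a single plaque. Hence the leaf of a singularity contains the singularity and all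
  its separatrices.\<close>

type_synonym 'a foliated_chart = "nat \<times> 'a set \<times> ('a \<Rightarrow> complex)"

definition model_plaques :: "nat \<Rightarrow> complex set set"
  where "model_plaques k = (\<Union>c. components {z \<in> ball 0 1. cmod z ^ k - Re (z ^ k) = c})"

definition plaques :: "'a foliated_chart \<Rightarrow> 'a set set"
  where "plaques = (\<lambda>(k, U, \<phi>). (\<lambda>C. U \<inter> \<phi> -` C) ` model_plaques k)"

definition prong_singularities :: "'a foliated_chart set \<Rightarrow> ('a \<times> nat) set"
  where "prong_singularities \<A> =
    {(p, k). k \<noteq> 2 \<and> (\<exists>U \<phi>. (k, U, \<phi>) \<in> \<A> \<and> p \<in> U \<and> \<phi> p = 0)}"

definition singular_points :: "'a foliated_chart set \<Rightarrow> 'a set"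
  where "singular_points \<A> = fst ` prong_singularities \<A>"

definition leaf :: "'a foliated_chart set \<Rightarrow> 'a \<Rightarrow> 'a set"
  where "leaf \<A> x = {y. (x, y) \<in> (\<Union>c\<in>\<A>. \<Union>P\<in>plaques c. P \<times> P)\<^sup>*}"

definition singular_foliation :: "'a::t2_space set \<Rightarrow> 'a foliated_chart set \<Rightarrow> bool"
  where "singular_foliation S \<A> \<longleftrightarrow>
    (\<forall>(k, U, \<phi>)\<in>\<A>. 1 \<le> k \<and> openin (top_of_set S) U \<and>
       (\<exists>\<psi>. homeomorphism U (ball 0 1) \<phi> \<psi>)) \<and>
    (\<forall>p\<in>S. \<exists>k U \<phi>. (k, U, \<phi>) \<in> \<A> \<and> p \<in> U \<and> \<phi> p = 0) \<and>
    (\<forall>(k, U, \<phi>)\<in>\<A>. \<forall>(l, V, \<psi>)\<in>\<A>.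
       (\<Union>P\<in>plaques (k, U, \<phi>). components (P \<inter> V)) =
       (\<Union>P\<in>plaques (l, V, \<psi>). components (P \<inter> U))) \<and>
    finite (prong_singularities \<A>)"


section \<open>Transverse measures\<close>

text \<open>Transversality is topological: an arc is transverse to the foliation if, in regular charts,
  the coordinate constant on plaques is locally injective along it.\<close>

definition transverse_arc :: "'a::t2_space foliated_chart set \<Rightarrow> (real \<Rightarrow> 'a) \<Rightarrow> bool"
  where "transverse_arc \<A> \<gamma> \<longleftrightarrow> arc \<gamma> \<and>
    (\<forall>t\<in>{0..1}. \<exists>U \<phi> e. (2, U, \<phi>) \<in> \<A> \<and> 0 < e \<and>
       \<gamma> ` ({0..1} \<inter> ball t e) \<subseteq> U \<and> inj_on (\<lambda>s. Im (\<phi> (\<gamma> s))) ({0..1} \<inter> ball t e))"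

text \<open>A transverse measure is a single set function that restricts to a finite Borel measure on every
  transverse arc. Absolute continuity refers to Lebesgue measure in the transverse coordinate of
  the regular charts of the given atlas.\<close>

definition transverse_measure ::
    "'a::t2_space foliated_chart set \<Rightarrow> ('a set \<Rightarrow> ennreal) \<Rightarrow> bool"
  where "transverse_measure \<A> \<mu> \<longleftrightarrow>
    (\<forall>\<gamma>. transverse_arc \<A> \<gamma> \<longrightarrow>
       measure_space (path_image \<gamma>) (sets (restrict_space borel (path_image \<gamma>))) \<mu> \<and>
       0 < \<mu> (path_image \<gamma>) \<and> \<mu> (path_image \<gamma>) < \<infinity> \<and>
       (\<forall>x\<in>path_image \<gamma>. \<mu> {x} = 0)) \<and>
    (\<forall>\<gamma> U \<phi> B. transverse_arc \<A> \<gamma> \<and> (2, U, \<phi>) \<in> \<A> \<and> path_image \<gamma> \<subseteq> U \<and>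
       inj_on (Im \<circ> \<phi>) (path_image \<gamma>) \<and>
       B \<in> sets (restrict_space borel (path_image \<gamma>)) \<and>
       (Im \<circ> \<phi>) ` B \<in> null_sets lborel \<longrightarrow> \<mu> B = 0) \<and>
    (\<forall>G. continuous_on ({0..1} \<times> {0..1}) (\<lambda>(s, t). G s t) \<and>
       (\<forall>s\<in>{0..1}. transverse_arc \<A> (G s)) \<and>
       (\<forall>s\<in>{0..1}. \<forall>t\<in>{0..1}. G s t \<in> leaf \<A> (G 0 t)) \<longrightarrow>
       \<mu> (path_image (G 0)) = \<mu> (path_image (G (1::real))))"

definition regular_leaf_arc ::
    "'a::t2_space set \<Rightarrow> 'a foliated_chart set \<Rightarrow> (real \<Rightarrow> 'a) \<Rightarrow> bool"
  where "regular_leaf_arc S \<A> \<gamma> \<longleftrightarrow> arc \<gamma> \<and>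
    (\<exists>x\<in>S. path_image \<gamma> \<subseteq> leaf \<A> x) \<and> path_image \<gamma> \<inter> singular_points \<A> = {}"


section \<open>Generalized pseudo-Anosov homeomorphisms\<close>

record 'a bifoliated_surface =
  surf :: "'a set"
  orient :: "'a chart set"
  stab :: "'a foliated_chart set"
  unst :: "'a foliated_chart set"

definition plaque_in :: "'a::t2_space foliated_chart set \<Rightarrow> 'a set \<Rightarrow> 'a \<Rightarrow> 'a set"
  where "plaque_in \<A> D x = connected_component_set (leaf \<A> x \<inter> D) x"

definition transverse_foliations :: "'a::t2_space bifoliated_surface \<Rightarrow> bool"
  where "transverse_foliations X \<longleftrightarrow>
    prong_singularities (stab X) = prong_singularities (unst X) \<and>
    (\<forall>p\<in>surf X - singular_points (stab X). \<exists>U \<phi> \<psi>.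
       openin (top_of_set (surf X)) U \<and> p \<in> U \<and> homeomorphism U open_square \<phi> \<psi> \<and>
       (\<forall>x\<in>U. plaque_in (stab X) U x = {y\<in>U. Im (\<phi> y) = Im (\<phi> x)} \<and>
              plaque_in (unst X) U x = {y\<in>U. Re (\<phi> y) = Re (\<phi> x)}))"

definition generalized_pseudo_Anosov ::
    "'a::t2_space bifoliated_surface \<Rightarrow> ('a set \<Rightarrow> ennreal) \<Rightarrow> ('a set \<Rightarrow> ennreal) \<Rightarrow>
     ('a \<Rightarrow> 'a) \<Rightarrow> bool"
  where "generalized_pseudo_Anosov X \<mu>s \<mu>u f \<longleftrightarrow>
    closed_oriented_surface (surf X) (orient X) \<and>
    singular_foliation (surf X) (stab X) \<and> transverse_measure (stab X) \<mu>s \<and>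
    singular_foliation (surf X) (unst X) \<and> transverse_measure (unst X) \<mu>u \<and>
    transverse_foliations X \<and>
    (\<exists>g. homeomorphism (surf X) (surf X) f g) \<and>
    orientation_preserving (orient X) (orient X) (surf X) f \<and>
    (\<forall>x\<in>surf X. f ` leaf (stab X) x = leaf (stab X) (f x) \<and>
                f ` leaf (unst X) x = leaf (unst X) (f x)) \<and>
    (\<exists>\<Lambda>>1.
       (\<forall>J. regular_leaf_arc (surf X) (unst X) J \<longrightarrow>
          \<mu>s (f ` path_image J) = ennreal \<Lambda> * \<mu>s (path_image J)) \<and>
       (\<forall>I. regular_leaf_arc (surf X) (stab X) I \<longrightarrow>
          \<mu>u (f ` path_image I) = ennreal (inverse \<Lambda>) * \<mu>u (path_image I)))"


section \<open>Rectangles\<close>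

definition trivially_bifoliated :: "'a::t2_space bifoliated_surface \<Rightarrow> 'a set \<Rightarrow> bool"
  where "trivially_bifoliated X D \<longleftrightarrow>
    openin (top_of_set (surf X)) D \<and> connected D \<and> D \<noteq> {} \<and>
    (\<forall>x\<in>D. plaque_in (stab X) D x homeomorphic {0<..<1::real} \<and>
           plaque_in (unst X) D x homeomorphic {0<..<1::real}) \<and>
    (\<forall>x\<in>D. \<forall>y\<in>D. card (plaque_in (stab X) D x \<inter> plaque_in (unst X) D y) = 1)"

text \<open>A rectangle with a chosen vertical direction is represented by a parametrization \<open>r\<close>: its interior is
  \<open>rect_interior r\<close>, the rectangle itself (the closure of \<open>rect_interior r\<close>) is \<open>rect r\<close>, and the vertical
  direction is that of increasing imaginary part. As \<open>r\<close> preserves the orientation, horizontal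
  leaves are directed by increasing real part. On the boundary \<open>r\<close> need not be injective.\<close>

definition rect_interior :: "(complex \<Rightarrow> 'a) \<Rightarrow> 'a set"
  where "rect_interior r = r ` open_square"

definition rect :: "(complex \<Rightarrow> 'a) \<Rightarrow> 'a set"
  where "rect r = r ` square"

definition horizontal_coord :: "(complex \<Rightarrow> 'a) \<Rightarrow> 'a \<Rightarrow> real"
  where "horizontal_coord r x = Re (inv_into open_square r x)"

definition vertical_coord :: "(complex \<Rightarrow> 'a) \<Rightarrow> 'a \<Rightarrow> real"
  where "vertical_coord r x = Im (inv_into open_square r x)"

definition rectangle :: "'a::t2_space bifoliated_surface \<Rightarrow> (complex \<Rightarrow> 'a) \<Rightarrow> bool"
  where "rectangle X r \<longleftrightarrow>
    trivially_bifoliated X (rect_interior r) \<and>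
    continuous_on square r \<and>
    (\<exists>g. homeomorphism open_square (rect_interior r) r g) \<and>
    orientation_preserving plane_orientation (orient X) open_square r \<and>
    (\<forall>c\<in>{0..1}. \<exists>x\<in>surf X. r ` {z\<in>square. Im z = c} \<subseteq> leaf (stab X) x) \<and>
    (\<forall>c\<in>{0..1}. \<exists>x\<in>surf X. r ` {z\<in>square. Re z = c} \<subseteq> leaf (unst X) x)"

definition bottom_side :: "(complex \<Rightarrow> 'a) \<Rightarrow> 'a set"
  where "bottom_side r = r ` {z\<in>square. Im z = 0}"

definition top_side :: "(complex \<Rightarrow> 'a) \<Rightarrow> 'a set"
  where "top_side r = r ` {z\<in>square. Im z = 1}"

definition left_side :: "(complex \<Rightarrow> 'a) \<Rightarrow> 'a set"
  where "left_side r = r ` {z\<in>square. Re z = 0}"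

definition right_side :: "(complex \<Rightarrow> 'a) \<Rightarrow> 'a set"
  where "right_side r = r ` {z\<in>square. Re z = 1}"

definition stable_boundary_components :: "(complex \<Rightarrow> 'a) \<Rightarrow> 'a set set"
  where "stable_boundary_components r = {bottom_side r, top_side r}"

definition rectangle_boundary :: "(complex \<Rightarrow> 'a) \<Rightarrow> 'a set"
  where "rectangle_boundary r = bottom_side r \<union> top_side r \<union> left_side r \<union> right_side r"

text \<open>Sub-rectangles are given by their interiors.\<close>

definition horizontal_subrectangle ::
    "'a::t2_space bifoliated_surface \<Rightarrow> (complex \<Rightarrow> 'a) \<Rightarrow> 'a set \<Rightarrow> bool"
  where "horizontal_subrectangle X r D \<longleftrightarrow>
    (\<exists>r'. rectangle X r' \<and> rect_interior r' = D) \<and> D \<subseteq> rect_interior r \<and>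
    (\<forall>x\<in>D. plaque_in (stab X) D x = plaque_in (stab X) (rect_interior r) x)"

definition vertical_subrectangle ::
    "'a::t2_space bifoliated_surface \<Rightarrow> (complex \<Rightarrow> 'a) \<Rightarrow> 'a set \<Rightarrow> bool"
  where "vertical_subrectangle X r D \<longleftrightarrow>
    (\<exists>r'. rectangle X r' \<and> rect_interior r' = D) \<and> D \<subseteq> rect_interior r \<and>
    (\<forall>x\<in>D. plaque_in (unst X) D x = plaque_in (unst X) (rect_interior r) x)"

definition below_in :: "(complex \<Rightarrow> 'a) \<Rightarrow> 'a set \<Rightarrow> 'a set \<Rightarrow> bool"
  where "below_in r C C' \<longleftrightarrow> (\<forall>x\<in>C. \<forall>y\<in>C'. vertical_coord r x < vertical_coord r y)"

definition left_of_in :: "(complex \<Rightarrow> 'a) \<Rightarrow> 'a set \<Rightarrow> 'a set \<Rightarrow> bool"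
  where "left_of_in r C C' \<longleftrightarrow> (\<forall>x\<in>C. \<forall>y\<in>C'. horizontal_coord r x < horizontal_coord r y)"


section \<open>Geometric Markov partitions and geometric types\<close>

text \<open>Families of \<open>n\<close> rectangles are indexed by \<open>{1..n}\<close>; values outside are irrelevant.\<close>

definition horizontal_subrectangles ::
    "'a::t2_space bifoliated_surface \<Rightarrow> ('a \<Rightarrow> 'a) \<Rightarrow> nat \<Rightarrow> (nat \<Rightarrow> complex \<Rightarrow> 'a) \<Rightarrow> nat \<Rightarrow> 'a set set"
  where "horizontal_subrectangles X f n r i =
    (\<Union>j\<in>{1..n}. components (rect_interior (r i) \<inter> f -` rect_interior (r j)))"

definition vertical_subrectangles ::
    "'a::t2_space bifoliated_surface \<Rightarrow> ('a \<Rightarrow> 'a) \<Rightarrow> nat \<Rightarrow> (nat \<Rightarrow> complex \<Rightarrow> 'a) \<Rightarrow> nat \<Rightarrow> 'a set set"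
  where "vertical_subrectangles X f n r k =
    (\<Union>i\<in>{1..n}. components (f ` rect_interior (r i) \<inter> rect_interior (r k)))"

definition geometric_Markov_partition ::
    "'a::t2_space bifoliated_surface \<Rightarrow> ('a \<Rightarrow> 'a) \<Rightarrow> nat \<Rightarrow> (nat \<Rightarrow> complex \<Rightarrow> 'a) \<Rightarrow> bool"
  where "geometric_Markov_partition X f n r \<longleftrightarrow>
    (\<forall>i\<in>{1..n}. rectangle X (r i)) \<and>
    (\<Union>i\<in>{1..n}. rect (r i)) = surf X \<and>
    (\<forall>i\<in>{1..n}. \<forall>j\<in>{1..n}. i \<noteq> j \<longrightarrow> rect_interior (r i) \<inter> rect_interior (r j) = {}) \<and>
    (\<forall>i\<in>{1..n}. \<forall>C\<in>horizontal_subrectangles X f n r i. horizontal_subrectangle X (r i) C) \<and>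
    (\<forall>k\<in>{1..n}. \<forall>C\<in>vertical_subrectangles X f n r k. vertical_subrectangle X (r k) C)"

datatype geometric_type = Geometric_Type
  (gt_n: nat) (gt_h: "nat \<Rightarrow> nat") (gt_v: "nat \<Rightarrow> nat")
  (gt_rho: "nat \<times> nat \<Rightarrow> nat \<times> nat") (gt_eps: "nat \<times> nat \<Rightarrow> int")

definition has_geometric_type ::
    "'a::t2_space bifoliated_surface \<Rightarrow> ('a \<Rightarrow> 'a) \<Rightarrow> nat \<Rightarrow> (nat \<Rightarrow> complex \<Rightarrow> 'a) \<Rightarrow>
     geometric_type \<Rightarrow> bool"
  where "has_geometric_type X f n r T \<longleftrightarrow> gt_n T = n \<and>
    (\<exists>H V.
      (\<forall>i\<in>{1..n}. bij_betw (H i) {1..gt_h T i} (horizontal_subrectangles X f n r i) \<and>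
         (\<forall>j\<in>{1..gt_h T i}. \<forall>j'\<in>{1..gt_h T i}. j < j' \<longrightarrow> below_in (r i) (H i j) (H i j'))) \<and>
      (\<forall>k\<in>{1..n}. bij_betw (V k) {1..gt_v T k} (vertical_subrectangles X f n r k) \<and>
         (\<forall>l\<in>{1..gt_v T k}. \<forall>l'\<in>{1..gt_v T k}. l < l' \<longrightarrow> left_of_in (r k) (V k l) (V k l'))) \<and>
      (\<forall>i\<in>{1..n}. \<forall>j\<in>{1..gt_h T i}. \<exists>k\<in>{1..n}. \<exists>l\<in>{1..gt_v T k}.
         gt_rho T (i, j) = (k, l) \<and> f ` H i j = V k l \<and>
         gt_eps T (i, j) =
           (if \<forall>x\<in>H i j. \<forall>y\<in>H i j. vertical_coord (r i) x < vertical_coord (r i) y \<longrightarrow>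
                 vertical_coord (r k) (f x) < vertical_coord (r k) (f y)
            then 1 else - 1)))"

definition incidence :: "geometric_type \<Rightarrow> nat \<Rightarrow> nat \<Rightarrow> nat"
  where "incidence T i k = card {j\<in>{1..gt_h T i}. \<exists>l. gt_rho T (i, j) = (k, l)}"

definition binary_incidence :: "geometric_type \<Rightarrow> bool"
  where "binary_incidence T \<longleftrightarrow> (\<forall>i\<in>{1..gt_n T}. \<forall>k\<in>{1..gt_n T}. incidence T i k \<in> {0, 1})"

definition periodic_boundary_points ::
    "'a::t2_space bifoliated_surface \<Rightarrow> ('a \<Rightarrow> 'a) \<Rightarrow> nat \<Rightarrow> (nat \<Rightarrow> complex \<Rightarrow> 'a) \<Rightarrow> 'a set"
  where "periodic_boundary_points X f n r =
    {x \<in> surf X. (\<exists>p>0. (f ^^ p) x = x) \<and> x \<in> (\<Union>i\<in>{1..n}. rectangle_boundary (r i))}"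

definition lex_index :: "(nat \<Rightarrow> nat) \<Rightarrow> nat \<Rightarrow> nat \<Rightarrow> nat"
  where "lex_index H i h = (\<Sum>i'\<in>{1..<i}. H i') + h"

definition geometric_refinement ::
    "'a::t2_space bifoliated_surface \<Rightarrow> ('a \<Rightarrow> 'a) \<Rightarrow> nat \<Rightarrow> (nat \<Rightarrow> complex \<Rightarrow> 'a) \<Rightarrow>
     (nat \<Rightarrow> nat) \<Rightarrow> (nat \<Rightarrow> complex \<Rightarrow> 'a) \<Rightarrow> bool"
  where "geometric_refinement X f n r H s \<longleftrightarrow>
    geometric_Markov_partition X f (\<Sum>i\<in>{1..n}. H i) s \<and>
    (\<forall>i\<in>{1..n}.
      (\<forall>h\<in>{1..H i}.
         horizontal_subrectangle X (r i) (rect_interior (s (lex_index H i h))) \<and>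
         (\<forall>x\<in>rect_interior (s (lex_index H i h)). \<forall>y\<in>rect_interior (s (lex_index H i h)).
            vertical_coord (s (lex_index H i h)) x < vertical_coord (s (lex_index H i h)) y \<longleftrightarrow>
            vertical_coord (r i) x < vertical_coord (r i) y)) \<and>
      (\<Union>h\<in>{1..H i}. rect (s (lex_index H i h))) = rect (r i) \<and>
      (\<forall>h\<in>{1..H i}. \<forall>h'\<in>{1..H i}.
         below_in (r i) (rect_interior (s (lex_index H i h))) (rect_interior (s (lex_index H i h'))) \<longleftrightarrow> h < h'))"


section \<open>Symbolic dynamics\<close>

definition subshift :: "geometric_type \<Rightarrow> (int \<Rightarrow> nat) set"
  where "subshift T =
    {w. \<forall>z. w z \<in> {1..gt_n T} \<and> incidence T (w z) (w (z + 1)) = 1}"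

definition shift :: "(int \<Rightarrow> nat) \<Rightarrow> int \<Rightarrow> nat"
  where "shift w = (\<lambda>z. w (z + 1))"

definition periodic_code :: "(int \<Rightarrow> nat) \<Rightarrow> bool"
  where "periodic_code w \<longleftrightarrow> (\<exists>p>0. (shift ^^ p) w = w)"

definition int_iterate :: "'a set \<Rightarrow> ('a \<Rightarrow> 'a) \<Rightarrow> int \<Rightarrow> 'a \<Rightarrow> 'a"
  where "int_iterate S f z =
    (if 0 \<le> z then f ^^ nat z else (inv_into S f) ^^ nat (- z))"

definition code_projection ::
    "'a::t2_space bifoliated_surface \<Rightarrow> ('a \<Rightarrow> 'a) \<Rightarrow> (nat \<Rightarrow> complex \<Rightarrow> 'a) \<Rightarrow> (int \<Rightarrow> nat) \<Rightarrow> 'a"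
  where "code_projection X f r w =
    (THE x. x \<in> (\<Inter>N::nat. closure
       {y \<in> surf X. \<forall>z\<in>{- int N..int N}. int_iterate (surf X) f z y \<in> rect_interior (r (w z))}))"

definition code_arc ::
    "'a::t2_space bifoliated_surface \<Rightarrow> ('a \<Rightarrow> 'a) \<Rightarrow> (nat \<Rightarrow> complex \<Rightarrow> 'a) \<Rightarrow> geometric_type \<Rightarrow>
     nat \<Rightarrow> (int \<Rightarrow> nat) \<Rightarrow> 'a set"
  where "code_arc X f r T t w =
    code_projection X f r ` {v \<in> subshift T. \<forall>m::nat. v (int m) = w (int t + int m)}"


section \<open>Algorithms\<close>

text \<open>The total recursive functions, with tuples coded by \<^const>\<open>prod_encode\<close>. By Kleene's normal form
  theorem, minimization of total functions with everywhere existing zeros yields all of them.\<close>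

inductive total_recursive :: "(nat \<Rightarrow> nat) \<Rightarrow> bool" where
  zero: "total_recursive (\<lambda>_. 0)"
| suc: "total_recursive Suc"
| first: "total_recursive (\<lambda>x. fst (prod_decode x))"
| second: "total_recursive (\<lambda>x. snd (prod_decode x))"
| pair: "total_recursive f \<Longrightarrow> total_recursive g \<Longrightarrow>
    total_recursive (\<lambda>x. prod_encode (f x, g x))"
| comp: "total_recursive f \<Longrightarrow> total_recursive g \<Longrightarrow> total_recursive (\<lambda>x. f (g x))"
| recursion: "total_recursive f \<Longrightarrow> total_recursive g \<Longrightarrow>
    total_recursive (\<lambda>x. rec_nat (f (fst (prod_decode x)))
      (\<lambda>k a. g (prod_encode (fst (prod_decode x), prod_encode (k, a)))) (snd (prod_decode x)))"
| minimize: "total_recursive f \<Longrightarrow> (\<And>x. \<exists>k. f (prod_encode (x, k)) = 0) \<Longrightarrow>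
    total_recursive (\<lambda>x. LEAST k. f (prod_encode (x, k)) = 0)"

text \<open>The finite data of a geometric type: for each \<open>i\<close>, the number \<open>v\<^sub>i\<close> and the list of the values
  of \<open>\<rho>\<close> and \<open>\<epsilon>\<close> at \<open>(i, 1), \<dots>, (i, h\<^sub>i)\<close>.\<close>

definition encode_type :: "geometric_type \<Rightarrow> nat"
  where "encode_type T = list_encode (map (\<lambda>i. prod_encode (gt_v T i,
      list_encode (map (\<lambda>j. prod_encode (prod_encode (gt_rho T (i, j)),
          if gt_eps T (i, j) = 1 then 1 else 0)) [1..<Suc (gt_h T i)])))
      [1..<Suc (gt_n T)])"

text \<open>A periodic code is presented to an algorithm by a finite word that it repeats.\<close>

definition repeat_word :: "nat list \<Rightarrow> int \<Rightarrow> nat"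
  where "repeat_word u = (\<lambda>z. u ! nat (z mod int (length u)))"

definition presents_codes :: "nat list list \<Rightarrow> (int \<Rightarrow> nat) set \<Rightarrow> bool"
  where "presents_codes us W \<longleftrightarrow> [] \<notin> set us \<and> repeat_word ` set us = W"

definition encode_input :: "geometric_type \<Rightarrow> nat list list \<Rightarrow> nat"
  where "encode_input T us = prod_encode (encode_type T, list_encode (map list_encode us))"

definition encode_output :: "(nat \<times> nat) list list \<Rightarrow> geometric_type \<Rightarrow> nat"
  where "encode_output cuts T' =
    prod_encode (list_encode (map (\<lambda>c. list_encode (map prod_encode c)) cuts), encode_type T')"

text \<open>The instructions \<open>cuts\<close> say how to obtain the refinement: the entry \<open>(q, t)\<close> at position
  \<open>h\<close> of the \<open>i\<close>-th list means that the \<open>h\<close>-th and the next rectangle in \<open>R\<^sub>i\<close> are separated by the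
  arc \<open>I\<^bsub>t,w\<^esub>\<close> for the code \<open>w\<close> given by the \<open>q\<close>-th word, words being numbered from \<open>0\<close>.\<close>

definition cut_along ::
    "'a::t2_space bifoliated_surface \<Rightarrow> ('a \<Rightarrow> 'a) \<Rightarrow> nat \<Rightarrow> (nat \<Rightarrow> complex \<Rightarrow> 'a) \<Rightarrow> geometric_type \<Rightarrow>
     nat list list \<Rightarrow> (nat \<times> nat) list list \<Rightarrow> (nat \<Rightarrow> nat) \<Rightarrow> (nat \<Rightarrow> complex \<Rightarrow> 'a) \<Rightarrow> bool"
  where "cut_along X f n r T us cuts H s \<longleftrightarrow> length cuts = n \<and>
    (\<forall>i\<in>{1..n}. H i = Suc (length (cuts ! (i - 1))) \<and>
       (\<forall>h\<in>{1..<H i}. \<exists>q t. cuts ! (i - 1) ! (h - 1) = (q, t) \<and>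
          q < length us \<and> repeat_word (us ! q) (int t) = i \<and>
          top_side (s (lex_index H i h)) = code_arc X f r T t (repeat_word (us ! q)) \<and>
          bottom_side (s (lex_index H i (Suc h))) = code_arc X f r T t (repeat_word (us ! q))))"

end

theory Submission
  imports Defs
begin

text \<open>Along a one-sided itinerary the unstable (stable) transverse coordinate is governed by compositions of
  monotone maps between subintervals of the unit interval. The invariant measures expand by
  \<open>\<Lambda> > 1\<close>, so these compositions cannot preserve a nondegenerate segment and each one-sided itinerary
  determines exactly one coordinate. Hence \<open>\<pi> w\<close> is the point whose height depends only on
  the future of \<open>w\<close> and whose abscissa depends only on its past, and \<open>I\<^bsub>t,w\<^esub>\<close> is a full horizontal line of
  \<open>R\<close> at the height of the shifted future. The finitely many heights obtained from \<open>W\<close> are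
  invariant under \<open>f\<close>, so cutting every \<open>R\<^sub>i\<close> along them gives a Markov partition again. Periodic points on
  such a line have, by the uniqueness of the coordinates, the periodic code itself.

  To compute everything from \<open>T\<close> and the words, compare two heights in the same rectangle through the
  ranks of their cylinders of depth twice a common period \<open>P\<close>: the doubled return map is increasing, so distinct
  periodic codes have distinct cylinders at that depth, and the order of the heights is the order
  of the ranks. Even the degenerate cases, height 0 and height 1, are read off in this way.\<close>

text \<open>The obstacle behind the bounded widths is the boundary. A parametrization need not be
  injective there, sides may contain singularities, and a transverse measure speaks only of arcs
  that avoid singularities. So arcs are slid along the transverse foliation onto one arc that
  reaches the side at a regular point. Such a point exists because a side collapsed to a singularity
  would force an open box into the star of that singularity. Only finitely many heights per
  rectangle can obstruct the sliding, so a generic line avoids them along its whole orbit. For the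
  same reason the dynamics moves to the closed unit interval: \<open>hb i j\<close> carries heights
  of the target rectangle back into \<open>H i j\<close>, and its values at 0 and 1 are forced by
  monotonicity instead of being read from \<open>f\<close> on the boundary. Binary incidence lets
  two consecutive letters name a branch. The new type needs no new columns: cuts are horizontal, so
  each piece of \<open>R_k\<close> inherits the columns of \<open>R_k\<close> with their numbers,
  and only the rows are subdivided.\<close>

section \<open>Computable functions between encoded data types\<close>

class encodable =
  fixes enc :: "'a \<Rightarrow> nat"

instantiation nat :: encodable
begin
definition enc_nat :: "nat \<Rightarrow> nat" where "enc_nat n = n"
instance ..
end

instantiation bool :: encodable
begin
definition enc_bool :: "bool \<Rightarrow> nat" where "enc_bool b = (if b then 1 else 0)"
instance ..
end

instantiation prod :: (encodable, encodable) encodable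
begin
definition enc_prod :: "'a \<times> 'b \<Rightarrow> nat" where "enc_prod p = prod_encode (enc (fst p), enc (snd p))"
instance ..
end

instantiation list :: (encodable) encodable
begin
definition enc_list :: "'a list \<Rightarrow> nat" where "enc_list xs = list_encode (map enc xs)"
instance ..
end

text \<open>The realizing function is constrained on codes only. Composition therefore works without
  deciding which numbers are codes, and no type needs a computable inverse of
  \<open>enc\<close>.\<close>

definition computable :: "('a::encodable \<Rightarrow> 'b::encodable) \<Rightarrow> bool"
  where "computable f \<longleftrightarrow> (\<exists>F. total_recursive F \<and> (\<forall>x. F (enc x) = enc (f x)))"

lemma computableI: "total_recursive F \<Longrightarrow> (\<And>x. F (enc x) = enc (f x)) \<Longrightarrow> computable f"
  unfolding computable_def by blast

lemma computableE:
  assumes "computable f"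
  obtains F where "total_recursive F" "\<And>x. F (enc x) = enc (f x)"
  using assms unfolding computable_def by blast

lemma computable_nat_iff: "computable (f :: nat \<Rightarrow> nat) \<longleftrightarrow> total_recursive f"
proof
  assume "computable f"
  then obtain F where F: "total_recursive F" "\<And>x. F (enc x) = enc (f x)" by (rule computableE) blast
  then have "F = f" by (auto simp: enc_nat_def)
  then show "total_recursive f" using F by simp
qed (auto intro: computableI simp: enc_nat_def)

lemma total_recursive_const: "total_recursive (\<lambda>_. c)"
proof (induction c)
  case 0 then show ?case by (rule total_recursive.zero)
next
  case (Suc c)
  from total_recursive.comp[OF total_recursive.suc this] show ?case by simp
qed

lemma total_recursive_id: "total_recursive (\<lambda>x. x)"
  using total_recursive.pair[OF total_recursive.first total_recursive.second] by simp

named_theorems computable_intros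

lemma computable_id [computable_intros]: "computable (\<lambda>x. x)"
  by (rule computableI[OF total_recursive_id]) simp

lemma computable_const [computable_intros]: "computable (\<lambda>_. c)"
  by (rule computableI[OF total_recursive_const]) simp

lemma computable_comp:
  assumes "computable f" "computable g"
  shows "computable (\<lambda>x. f (g x))"
proof -
  obtain F G where "total_recursive F" "\<And>x. F (enc x) = enc (f x)" "total_recursive G" "\<And>x. G (enc x) = enc (g x)"
    using assms by (metis computableE)
  then show ?thesis by (intro computableI[OF total_recursive.comp[of F G]]) auto
qed

lemma computable_Pair [computable_intros]:
  assumes "computable f" "computable g"
  shows "computable (\<lambda>x. (f x, g x))"
proof -
  obtain F G where "total_recursive F" "\<And>x. F (enc x) = enc (f x)" "total_recursive G" "\<And>x. G (enc x) = enc (g x)"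
    using assms by (metis computableE)
  then show ?thesis by (intro computableI[OF total_recursive.pair[of F G]]) (auto simp: enc_prod_def)
qed

lemma computable_fst [computable_intros]: "computable f \<Longrightarrow> computable (\<lambda>x. fst (f x))"
  by (rule computable_comp[of fst f], rule computableI[OF total_recursive.first]) (auto simp: enc_prod_def)

lemma computable_snd [computable_intros]: "computable f \<Longrightarrow> computable (\<lambda>x. snd (f x))"
  by (rule computable_comp[of snd f], rule computableI[OF total_recursive.second]) (auto simp: enc_prod_def)

lemma computable_Suc [computable_intros]: "computable f \<Longrightarrow> computable (\<lambda>x. Suc (f x))"
  by (rule computable_comp[of Suc f], rule computableI[OF total_recursive.suc]) (auto simp: enc_nat_def)

text \<open>Functions of several arguments enter as functions of one nested pair, here
  \<open>(x, k, a)\<close>. In this form the premise on the step function is again a goal for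
  \<open>computable_intros\<close>, and it matches the pairing built into the constructor
  \<open>recursion\<close>.\<close>

lemma computable_rec_nat [computable_intros]:
  assumes "computable f" "computable (\<lambda>p. g (fst p) (fst (snd p)) (snd (snd p)))" "computable n"
  shows "computable (\<lambda>x. rec_nat (f x) (g x) (n x))"
proof -
  obtain F where F: "total_recursive F" "\<And>x. F (enc x) = enc (f x)" using assms(1) by (metis computableE)
  obtain G where G: "total_recursive G" "\<And>x k a. G (prod_encode (enc x, prod_encode (k, enc a))) = enc (g x k a)"
    using assms(2) by (rule computableE) (auto simp: enc_prod_def enc_nat_def)
  have "computable (\<lambda>(x, n). rec_nat (f x) (g x) n)"
  proof (rule computableI[OF total_recursive.recursion[OF F(1) G(1)]], clarify)
    fix x and n :: nat
    show "rec_nat (F (fst (prod_decode (enc (x, n)))))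
           (\<lambda>k a. G (prod_encode (fst (prod_decode (enc (x, n))), prod_encode (k, a))))
           (snd (prod_decode (enc (x, n)))) = enc (rec_nat (f x) (g x) n)"
      unfolding enc_prod_def enc_nat_def by (induction n) (auto simp: F G)
  qed
  from computable_comp[OF this computable_Pair[OF computable_id assms(3)]] show ?thesis by simp
qed

lemma computable_pred: "computable f \<Longrightarrow> computable (\<lambda>x. f x - (1::nat))"
proof -
  assume "computable f"
  then have "computable (\<lambda>x. rec_nat 0 (\<lambda>k _. k) (f x))"
    by (intro computable_intros)
  moreover have "rec_nat 0 (\<lambda>k _. k) n = n - (1::nat)" for n by (cases n) auto
  ultimately show ?thesis by simp
qed

lemma computable_add [computable_intros]:
  assumes "computable f" "computable g" shows "computable (\<lambda>x. f x + (g x :: nat))"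
proof -
  have "computable (\<lambda>x. rec_nat (f x) (\<lambda>_ a. Suc a) (g x))"
    by (intro computable_intros assms)
  moreover have "rec_nat m (\<lambda>_ a. Suc a) n = m + n" for m n by (induction n) auto
  ultimately show ?thesis by simp
qed

lemma computable_mult [computable_intros]:
  assumes "computable f" "computable g" shows "computable (\<lambda>x. f x * (g x :: nat))"
proof -
  have "computable (\<lambda>x. rec_nat 0 (\<lambda>_ a. f x + a) (g x))"
    by (intro computable_intros assms computable_comp[of f "\<lambda>x. fst x"])
  moreover have "rec_nat 0 (\<lambda>_ a. m + a) n = m * n" for m n by (induction n) auto
  ultimately show ?thesis by simp
qed

lemma computable_diff [computable_intros]:
  assumes "computable f" "computable g" shows "computable (\<lambda>x. f x - (g x :: nat))"
proof -
  have "computable (\<lambda>x. rec_nat (f x) (\<lambda>_ a. a - 1) (g x))"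
    by (intro computable_intros computable_pred assms)
  moreover have "rec_nat m (\<lambda>_ a. a - 1) n = m - (n::nat)" for m n by (induction n) auto
  ultimately show ?thesis by simp
qed

lemma computable_if_zero:
  assumes "computable n" "computable f" "computable g"
  shows "computable (\<lambda>x. if n x = (0::nat) then f x else g x)"
proof -
  have "computable (\<lambda>x. rec_nat (f x) (\<lambda>_ _. g x) (n x))"
    by (intro computable_intros assms computable_comp[of g "\<lambda>x. fst x"])
  moreover have "rec_nat a (\<lambda>_ _. b) n = (if n = 0 then a else b)" for a b :: 'b and n by (cases n) auto
  ultimately show ?thesis by simp
qed

lemma computable_pos: "computable n \<Longrightarrow> computable (\<lambda>x. 0 < (n x :: nat))"
  using computable_if_zero[OF _ computable_const computable_const, of n False True]
  by (simp add: if_bool_eq_conj)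

lemma computable_if [computable_intros]:
  assumes "computable P" "computable f" "computable g"
  shows "computable (\<lambda>x. if P x then f x else g x)"
proof -
  \<comment> \<open>A truth value and its numerical value have the same code, so the function
    realizing \<open>P\<close> also realizes this one.\<close>
  have "computable (\<lambda>x. if P x then 1 else 0 :: nat)"
    using assms(1) unfolding computable_def by (simp add: enc_bool_def enc_nat_def)
  from computable_if_zero[OF this assms(3,2)] show ?thesis
    by (rule back_subst[of computable]) auto
qed

lemma computable_less [computable_intros]:
  assumes "computable f" "computable g" shows "computable (\<lambda>x. f x < (g x :: nat))"
  using computable_pos[OF computable_diff[OF assms(2,1)]] by simp

lemma computable_not [computable_intros]: "computable P \<Longrightarrow> computable (\<lambda>x. \<not> P x)"
  using computable_if[OF _ computable_const computable_const, of P False True]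
  by (simp add: if_bool_eq_conj)

lemma computable_conj [computable_intros]:
  "computable P \<Longrightarrow> computable Q \<Longrightarrow> computable (\<lambda>x. P x \<and> Q x)"
  using computable_if[OF _ _ computable_const, of P Q False]
  by (rule back_subst[of computable]) auto

lemma computable_disj [computable_intros]:
  "computable P \<Longrightarrow> computable Q \<Longrightarrow> computable (\<lambda>x. P x \<or> Q x)"
  using computable_not[OF computable_conj[OF computable_not computable_not], of P Q] by simp

lemma computable_le [computable_intros]:
  assumes "computable f" "computable g" shows "computable (\<lambda>x. f x \<le> (g x :: nat))"
  using computable_not[OF computable_less[OF assms(2,1)]] by (simp add: not_less)

lemma computable_eq [computable_intros]:
  assumes "computable f" "computable g" shows "computable (\<lambda>x. f x = (g x :: nat))"
  using computable_conj[OF computable_le[OF assms] computable_le[OF assms(2,1)]]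
  by (simp add: eq_iff)

lemma computable_Cons [computable_intros]:
  assumes "computable f" "computable g" shows "computable (\<lambda>x. f x # g x)"
proof -
  have "computable (\<lambda>x. Suc (prod_encode (enc (f x), enc (g x))))"
    using computable_Suc[of "\<lambda>x. prod_encode (enc (f x), enc (g x))"] computable_Pair[OF assms]
    unfolding computable_def by (auto simp: enc_prod_def enc_nat_def)
  then show ?thesis unfolding computable_def by (simp add: enc_nat_def enc_list_def)
qed

lemma length_le_list_encode: "length xs \<le> list_encode xs"
proof (induction xs)
  case (Cons a xs)
  then show ?case using le_prod_encode_2[of "list_encode xs" a] by simp
qed simp

text \<open>The code of a list bounds its length, so iterating the one-step fold that often exhausts it.\<close>

lemma computable_foldl [computable_intros]:
  fixes g :: "'a::encodable \<Rightarrow> 's::encodable \<Rightarrow> 'b::encodable \<Rightarrow> 's"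
  assumes "computable l" "computable (\<lambda>p. g (fst p) (fst (snd p)) (snd (snd p)))" "computable s"
  shows "computable (\<lambda>x. foldl (g x) (s x) (l x))"
proof -
  obtain L where L: "total_recursive L" "\<And>x. L (enc x) = enc (l x)" using assms(1) by (metis computableE)
  obtain S where S: "total_recursive S" "\<And>x. S (enc x) = enc (s x)" using assms(3) by (metis computableE)
  obtain G where G: "total_recursive G" "\<And>x a s. G (prod_encode (enc x, prod_encode (enc s, enc a))) = enc (g x s a)"
    using assms(2) by (rule computableE) (auto simp: enc_prod_def enc_nat_def)
  \<comment> \<open>\<open>list_encode\<close> sends \<open>x # xs\<close> to the successor of the
    coded pair of \<open>x\<close> and the code of \<open>xs\<close>; hence the predecessor is
    decoded. The code 0 of the empty list is left alone, so surplus iterations change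
    nothing.\<close>
  define step where "step = (\<lambda>z (c, t). if c = (0::nat) then (c, t)
    else (snd (prod_decode (c - 1)), G (prod_encode (z, prod_encode (t, fst (prod_decode (c - 1)))))))"
  define F where "F = (\<lambda>z. snd (rec_nat (L z, S z) (\<lambda>_. step z) (L z)))"
  have step_run: "snd (rec_nat (list_encode (map enc ys), enc t) (\<lambda>_. step (enc x)) N) = enc (foldl (g x) t ys)"
    if "length ys \<le> N" for ys t x N
    using that
  proof (induction ys arbitrary: t N)
    case Nil
    have "rec_nat (0, enc t) (\<lambda>_. step (enc x)) N = (0, enc t)" by (induction N) (auto simp: step_def)
    then show ?case by simp
  next
    case (Cons y ys)
    then obtain M where N: "N = Suc M" "length ys \<le> M" by (cases N) auto
    \<comment> \<open>\<open>rec_nat\<close> applies its last step outermost, while the induction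
      consumes the head of the list first; moving one step to the inside reconciles the two.\<close>
    have rot: "rec_nat p (\<lambda>_. step (enc x)) (Suc M) = rec_nat (step (enc x) p) (\<lambda>_. step (enc x)) M" for p M
      by (induction M) auto
    have "step (enc x) (list_encode (map enc (y # ys)), enc t) = (list_encode (map enc ys), enc (g x t y))"
      by (simp add: step_def G)
    with Cons.IH[OF N(2)] show ?case
      unfolding N(1) rot by simp
  qed
  have comp: "computable f" if "total_recursive f" for f using that by (simp add: computable_nat_iff)
  have dec: "computable (\<lambda>x. fst (prod_decode (h x)))" "computable (\<lambda>x. snd (prod_decode (h x)))"
    if "computable h" for h :: "'z::encodable \<Rightarrow> nat"
    using computable_comp[OF comp[OF total_recursive.first] that]
      computable_comp[OF comp[OF total_recursive.second] that] by simp_all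
  have pe: "computable (\<lambda>x. prod_encode (h x, k x))"
    if "computable h" "computable k" for h k :: "'z::encodable \<Rightarrow> nat"
    using computable_Pair[OF that] unfolding computable_def by (simp add: enc_prod_def enc_nat_def)
  have "computable F"
    unfolding F_def step_def case_prod_unfold
    by (intro computable_intros comp L S computable_comp[OF comp[OF G(1)]] dec pe
        computable_if_zero computable_pred)
  then have "total_recursive F" by (simp add: computable_nat_iff)
  then show ?thesis
  proof (rule computableI)
    fix x show "F (enc x) = enc (foldl (g x) (s x) (l x))"
      unfolding F_def L S unfolding enc_list_def
      by (rule step_run) (use length_le_list_encode[of "map enc (l x)"] in simp)
  qed
qed

lemma computable_rev [computable_intros]:
  assumes "computable f" shows "computable (\<lambda>x. rev (f x))"
proof -
  have "foldl (\<lambda>s a. a # s) t xs = rev xs @ t" for t xs :: "'b list"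
    by (induction xs arbitrary: t) auto
  from this[of "[]"] have "rev xs = foldl (\<lambda>s a. a # s) [] xs" for xs :: "'b list" by simp
  then show ?thesis by (simp only:) (intro computable_intros assms)
qed

lemma computable_foldr:
  assumes "computable l" "computable (\<lambda>p. g (fst p) (fst (snd p)) (snd (snd p)))" "computable s"
  shows "computable (\<lambda>x. foldr (g x) (l x) (s x))"
proof -
  have "computable (\<lambda>x. foldl (\<lambda>s a. g x a s) (s x) (rev (l x)))"
    by (intro computable_intros assms
      computable_comp[OF assms(2), of "\<lambda>p. (fst p, snd (snd p), fst (snd p))", simplified])
  then show ?thesis by (simp add: foldr_conv_foldl)
qed

lemma computable_map [computable_intros]:
  assumes "computable l" "computable (\<lambda>p. g (fst p) (snd p))"
  shows "computable (\<lambda>x. map (g x) (l x))"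
proof -
  have "computable (\<lambda>x. foldr (\<lambda>a s. g x a # s) (l x) [])"
    by (intro computable_foldr computable_intros assms
      computable_comp[OF assms(2), of "\<lambda>p. (fst p, fst (snd p))", simplified])
  moreover have "foldr (\<lambda>a s. g x a # s) ys [] = map (g x) ys" for x ys by (induction ys) auto
  ultimately show ?thesis by simp
qed

lemma computable_filter [computable_intros]:
  assumes "computable l" "computable (\<lambda>p. P (fst p) (snd p))"
  shows "computable (\<lambda>x. filter (P x) (l x))"
proof -
  have "computable (\<lambda>x. foldr (\<lambda>a s. if P x a then a # s else s) (l x) [])"
    by (intro computable_foldr computable_intros assms
      computable_comp[OF assms(2), of "\<lambda>p. (fst p, fst (snd p))", simplified])
  moreover have "foldr (\<lambda>a s. if P x a then a # s else s) ys [] = filter (P x) ys" for x ys by (induction ys) auto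
  ultimately show ?thesis by simp
qed

lemma computable_append [computable_intros]:
  assumes "computable f" "computable g" shows "computable (\<lambda>x. f x @ g x)"
proof -
  have "computable (\<lambda>x. foldr (\<lambda>a s. a # s) (f x) (g x))"
    by (intro computable_foldr computable_intros assms)
  moreover have "foldr (\<lambda>a s. a # s) xs ys = xs @ ys" for xs ys :: "'b list" by (induction xs) auto
  ultimately show ?thesis by simp
qed

lemma computable_concat [computable_intros]:
  assumes "computable f" shows "computable (\<lambda>x. concat (f x))"
proof -
  have "computable (\<lambda>x. foldr (\<lambda>a s. a @ s) (f x) [])"
    by (intro computable_foldr computable_intros assms)
  moreover have "foldr (\<lambda>a s. a @ s) xs [] = concat xs" for xs :: "'b list list" by (induction xs) auto
  ultimately show ?thesis by simp
qed

lemma computable_sum_list [computable_intros]: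
  assumes "computable f" shows "computable (\<lambda>x. sum_list (f x) :: nat)"
proof -
  have "computable (\<lambda>x. foldr (\<lambda>a s. a + s) (f x) (0::nat))"
    by (intro computable_foldr computable_intros assms)
  moreover have "foldr (\<lambda>a s. a + s) xs 0 = sum_list xs" for xs :: "nat list" by (induction xs) auto
  ultimately show ?thesis by simp
qed

lemma computable_prod_list [computable_intros]:
  assumes "computable f" shows "computable (\<lambda>x. prod_list (f x) :: nat)"
proof -
  have "computable (\<lambda>x. foldr (\<lambda>a s. a * s) (f x) (1::nat))"
    by (intro computable_foldr computable_intros assms)
  moreover have "foldr (\<lambda>a s. a * s) xs 1 = prod_list xs" for xs :: "nat list" by (induction xs) auto
  ultimately show ?thesis by simp
qed

lemma computable_length [computable_intros]:
  assumes "computable f" shows "computable (\<lambda>x. length (f x))"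
proof -
  have "computable (\<lambda>x. foldr (\<lambda>a s. Suc s) (f x) 0)"
    by (intro computable_foldr computable_intros assms)
  moreover have "foldr (\<lambda>a s. Suc s) xs 0 = length xs" for xs :: "'b list" by (induction xs) auto
  ultimately show ?thesis by simp
qed

lemma computable_upt [computable_intros]:
  assumes "computable f" "computable g" shows "computable (\<lambda>x. [f x..<g x])"
proof -
  have "computable (\<lambda>x. rec_nat [] (\<lambda>k s. if f x \<le> k then s @ [k] else s) (g x))"
    by (intro computable_intros assms computable_comp[of f "\<lambda>x. fst x"])
  moreover have "rec_nat [] (\<lambda>k s. if a \<le> k then s @ [k] else s) b = [a..<b]" for a b by (induction b) auto
  ultimately show ?thesis by simp
qed

lemma computable_mod [computable_intros]:
  assumes "computable f" "computable g" shows "computable (\<lambda>x. f x mod (g x :: nat))"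
proof -
  \<comment> \<open>A counter that falls back to 0 on reaching the modulus. For modulus 0 it never
    falls back, in agreement with \<open>n mod 0 = n\<close>.\<close>
  have "computable (\<lambda>x. rec_nat 0 (\<lambda>_ a. if Suc a = g x then 0 else Suc a) (f x))"
    by (intro computable_intros assms computable_comp[of g "\<lambda>x. fst x"])
  moreover have "rec_nat 0 (\<lambda>_ a. if Suc a = m then 0 else Suc a) n = n mod m" for m n
    by (induction n) (auto simp: mod_Suc)
  ultimately show ?thesis by simp
qed

text \<open>List access has no known value beyond the end of the list. The default fixes its value
  everywhere, as a total recursive realization requires.\<close>

definition nth_default :: "'a \<Rightarrow> 'a list \<Rightarrow> nat \<Rightarrow> 'a"
  where "nth_default d xs n = (if n < length xs then xs ! n else d)"

lemma computable_nth_default [computable_intros]: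
  assumes "computable f" "computable g"
  shows "computable (\<lambda>x. nth_default d (f x) (g x))"
proof -
  \<comment> \<open>The state of the fold holds the entry found so far and the current
    position.\<close>
  have "computable (\<lambda>x. fst (foldl (\<lambda>s a. (if snd s = g x then a else fst s, Suc (snd s))) (d, 0) (f x)))"
    by (intro computable_intros assms computable_comp[of g "\<lambda>x. fst x"])
  moreover have "foldl (\<lambda>s a. (if snd s = n then a else fst s, Suc (snd s))) (d, 0) xs
      = (nth_default d xs n, length xs)" for xs n
    by (induction xs rule: rev_induct) (auto simp: nth_default_def nth_append)
  ultimately show ?thesis by simp
qed

section \<open>The algorithm on tables of geometric types\<close>

text \<open>The layout copies \<open>encode_type\<close>: row \<open>i\<close> holds
  \<open>v_i\<close> and, for each horizontal sub-rectangle from bottom to top, its pair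
  \<open>(k, l)\<close> with 1 or 0 for a preserved or reversed vertical direction.\<close>

type_synonym type_rows = "(nat \<times> ((nat \<times> nat) \<times> nat) list) list"

definition row :: "type_rows \<Rightarrow> nat \<Rightarrow> nat \<times> ((nat \<times> nat) \<times> nat) list"
  where "row D i = nth_default (0, []) D (i - 1)"

definition deg :: "type_rows \<Rightarrow> nat \<Rightarrow> nat"
  where "deg D i = length (snd (row D i))"

definition edge :: "type_rows \<Rightarrow> nat \<Rightarrow> nat \<Rightarrow> (nat \<times> nat) \<times> nat"
  where "edge D i j = nth_default ((0, 0), 0) (snd (row D i)) (j - 1)"

definition tgt :: "type_rows \<Rightarrow> nat \<Rightarrow> nat \<Rightarrow> nat"
  where "tgt D i j = fst (fst (edge D i j))"

definition vpos :: "type_rows \<Rightarrow> nat \<Rightarrow> nat \<Rightarrow> nat"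
  where "vpos D i j = snd (fst (edge D i j))"

definition incr :: "type_rows \<Rightarrow> nat \<Rightarrow> nat \<Rightarrow> bool"
  where "incr D i j \<longleftrightarrow> snd (edge D i j) = 1"

text \<open>With binary incidence at most one sub-rectangle of \<open>R_i\<close> is mapped into
  \<open>R_k\<close>, so the first hit is the branch. Branches are numbered from 1; the value 0
  signals that there is none.\<close>

definition branch :: "type_rows \<Rightarrow> nat \<Rightarrow> nat \<Rightarrow> nat"
  where "branch D i k = nth_default 0 (filter (\<lambda>j. tgt D i j = k) [1..<Suc (deg D i)]) 0"

text \<open>Row sums of the \<open>N\<close>-th power of the incidence matrix: entry
  \<open>i - 1\<close> counts the admissible words with \<open>N\<close> transitions that start at
  \<open>i\<close>, that is, the horizontal cylinders of depth \<open>N\<close> in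
  \<open>R_i\<close>.\<close>

definition cylinder_counts :: "type_rows \<Rightarrow> nat \<Rightarrow> nat list"
  where "cylinder_counts D N = rec_nat (map (\<lambda>_. 1) D)
    (\<lambda>_ c. map (\<lambda>r. sum_list (map (\<lambda>e. nth_default 0 c (fst (fst e) - 1)) (snd r))) D) N"

definition cyls :: "type_rows \<Rightarrow> nat \<Rightarrow> nat \<Rightarrow> nat"
  where "cyls D N i = nth_default 0 (cylinder_counts D N) (i - 1)"

definition symbol :: "nat list list \<Rightarrow> nat \<Rightarrow> nat \<Rightarrow> nat"
  where "symbol us q t = nth_default 0 (nth_default [] us q) (t mod length (nth_default [] us q))"

text \<open>The product of the word lengths is a period common to all words. The factor 2 is there
  because one period may reverse the vertical direction.\<close>

definition depth :: "nat list list \<Rightarrow> nat"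
  where "depth us = 2 * prod_list (map length us)"

text \<open>One transition of the rank recursion: all cylinders in the sub-rectangles below the
  branch are counted, and then the rank \<open>b\<close> inside the target, read from the top when
  \<open>f\<close> reverses the vertical direction.\<close>

definition below_step :: "type_rows \<Rightarrow> nat \<Rightarrow> nat \<Rightarrow> nat \<Rightarrow> nat \<Rightarrow> nat"
  where "below_step D N i k b = sum_list (map (\<lambda>j. cyls D N (tgt D i j)) [1..<branch D i k]) +
    (if incr D i (branch D i k) then b else cyls D N k - 1 - b)"

text \<open>The recursion runs backwards through the window: after \<open>N\<close> rounds its value
  is the rank of the word with \<open>N\<close> transitions that starts at time
  \<open>t + depth us - N\<close>. Hence the subtraction of \<open>Suc N\<close> in the round that
  follows.\<close>

definition rank :: "type_rows \<Rightarrow> nat list list \<Rightarrow> nat \<Rightarrow> nat \<Rightarrow> nat"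
  where "rank D us q t = rec_nat 0 (\<lambda>N b. below_step D N
    (symbol us q (t + (depth us - Suc N))) (symbol us q (Suc (t + (depth us - Suc N)))) b) (depth us)"

definition arcs :: "nat list list \<Rightarrow> (nat \<times> nat) list"
  where "arcs us = concat (map (\<lambda>q. map (\<lambda>t. (q, t)) [0..<length (nth_default [] us q)]) [0..<length us])"

text \<open>Several pairs \<open>(q, t)\<close> may describe the same arc; one representative per
  rank is kept.\<close>

definition first_of :: "(nat \<times> nat) list \<Rightarrow> (nat \<times> nat) list"
  where "first_of xs = (if length xs = 0 then [] else [nth_default (0, 0) xs 0])"

text \<open>Scanning the ranks in increasing order sorts the cuts. Rank 0 and the last rank, one
  less than the number of cylinders, are left out: they belong to arcs on the bottom and top sides,
  which cut nothing off.\<close>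

definition cut_list :: "type_rows \<Rightarrow> nat list list \<Rightarrow> nat \<Rightarrow> (nat \<times> nat) list"
  where "cut_list D us i = concat (map (\<lambda>b. first_of (filter (\<lambda>p.
      symbol us (fst p) (snd p) = i \<and> rank D us (fst p) (snd p) = b) (arcs us)))
    [1..<cyls D (depth us) i - 1])"

text \<open>The cut heights as ranks, completed by 0 for the bottom side and by the last rank for
  the top side, so that piece \<open>h\<close> lies between levels \<open>h - 1\<close> and
  \<open>h\<close>.\<close>

definition level :: "type_rows \<Rightarrow> nat list list \<Rightarrow> nat \<Rightarrow> nat \<Rightarrow> nat"
  where "level D us i h = nth_default 0
    (0 # map (\<lambda>p. rank D us (fst p) (snd p)) (cut_list D us i) @ [cyls D (depth us) i - 1]) h"

definition pieces :: "type_rows \<Rightarrow> nat list list \<Rightarrow> nat \<Rightarrow> nat"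
  where "pieces D us i = Suc (length (cut_list D us i))"

text \<open>Decides whether the cut \<open>p\<close> of \<open>R_i\<close> lies at or below the
  lower edge of the part of the \<open>j\<close>-th sub-rectangle that is mapped into piece
  \<open>h\<close> of the target. Within the same branch the comparison is made after one iterate,
  and a reversing branch turns the upper level \<open>h\<close> into the lower edge.\<close>

definition cut_below :: "type_rows \<Rightarrow> nat list list \<Rightarrow> nat \<Rightarrow> nat \<Rightarrow> nat \<Rightarrow> nat \<times> nat \<Rightarrow> bool"
  where "cut_below D us i j h p \<longleftrightarrow>
    branch D i (symbol us (fst p) (Suc (snd p))) < j \<or>
    branch D i (symbol us (fst p) (Suc (snd p))) = j \<and>
      (if incr D i j then rank D us (fst p) (Suc (snd p)) \<le> level D us (tgt D i j) (h - 1)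
       else level D us (tgt D i j) h \<le> rank D us (fst p) (Suc (snd p)))"

definition piece_of :: "type_rows \<Rightarrow> nat list list \<Rightarrow> nat \<Rightarrow> nat \<Rightarrow> nat \<Rightarrow> nat"
  where "piece_of D us i j h = Suc (length (filter (cut_below D us i j h) (cut_list D us i)))"

text \<open>The inverse of the lexicographic numbering: position \<open>lex_index H i h - 1\<close>
  holds \<open>(i, h)\<close>.\<close>

definition block_list :: "(nat \<Rightarrow> nat) \<Rightarrow> nat \<Rightarrow> (nat \<times> nat) list"
  where "block_list H n = concat (map (\<lambda>i. map (\<lambda>h. (i, h)) [1..<Suc (H i)]) [1..<Suc n])"

text \<open>The preimages of the target pieces in the order in which they lie in \<open>R_i\<close>,
  from bottom to top; a reversing branch meets the target pieces from the top down.\<close>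

definition fine_list :: "type_rows \<Rightarrow> (nat \<Rightarrow> nat) \<Rightarrow> nat \<Rightarrow> (nat \<times> nat) list"
  where "fine_list D H i = concat (map (\<lambda>j. map (\<lambda>h. (j, h))
    (if incr D i j then [1..<Suc (H (tgt D i j))] else rev [1..<Suc (H (tgt D i j))])) [1..<Suc (deg D i)])"

definition strip_list ::
    "type_rows \<Rightarrow> (nat \<Rightarrow> nat) \<Rightarrow> (nat \<Rightarrow> nat \<Rightarrow> nat \<Rightarrow> nat) \<Rightarrow> nat \<Rightarrow> nat \<Rightarrow> (nat \<times> nat) list"
  where "strip_list D H loc i h = filter (\<lambda>p. loc i (fst p) (snd p) = h) (fine_list D H i)"

text \<open>The sum is the lexicographic index of piece \<open>snd p\<close> of the target. The
  number of columns and the column index are copied from the old row, because horizontal cuts do not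
  change the order of the columns.\<close>

definition refined_row ::
    "type_rows \<Rightarrow> (nat \<Rightarrow> nat) \<Rightarrow> (nat \<Rightarrow> nat \<Rightarrow> nat \<Rightarrow> nat) \<Rightarrow> nat \<Rightarrow> nat \<Rightarrow> nat \<times> ((nat \<times> nat) \<times> nat) list"
  where "refined_row D H loc i h = (fst (row D i), map (\<lambda>p.
    ((sum_list (map H [1..<tgt D i (fst p)]) + snd p, vpos D i (fst p)), if incr D i (fst p) then 1 else 0))
    (strip_list D H loc i h))"

definition refined_rows ::
    "type_rows \<Rightarrow> (nat \<Rightarrow> nat) \<Rightarrow> (nat \<Rightarrow> nat \<Rightarrow> nat \<Rightarrow> nat) \<Rightarrow> type_rows"
  where "refined_rows D H loc = map (\<lambda>p. refined_row D H loc (fst p) (snd p)) (block_list H (length D))"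

definition refinement :: "type_rows \<times> nat list list \<Rightarrow> (nat \<times> nat) list list \<times> type_rows"
  where "refinement p = (map (cut_list (fst p) (snd p)) [1..<Suc (length (fst p))],
    refined_rows (fst p) (pieces (fst p) (snd p)) (piece_of (fst p) (snd p)))"

lemma computable_row [computable_intros]:
  "computable D \<Longrightarrow> computable i \<Longrightarrow> computable (\<lambda>x. row (D x) (i x))"
  unfolding row_def by (intro computable_intros)

lemma computable_deg [computable_intros]:
  "computable D \<Longrightarrow> computable i \<Longrightarrow> computable (\<lambda>x. deg (D x) (i x))"
  unfolding deg_def by (intro computable_intros)

lemma computable_edge [computable_intros]:
  "computable D \<Longrightarrow> computable i \<Longrightarrow> computable j \<Longrightarrow> computable (\<lambda>x. edge (D x) (i x) (j x))"
  unfolding edge_def by (intro computable_intros)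

lemma computable_tgt [computable_intros]:
  "computable D \<Longrightarrow> computable i \<Longrightarrow> computable j \<Longrightarrow> computable (\<lambda>x. tgt (D x) (i x) (j x))"
  unfolding tgt_def by (intro computable_intros)

lemma computable_vpos [computable_intros]:
  "computable D \<Longrightarrow> computable i \<Longrightarrow> computable j \<Longrightarrow> computable (\<lambda>x. vpos (D x) (i x) (j x))"
  unfolding vpos_def by (intro computable_intros)

lemma computable_incr [computable_intros]:
  "computable D \<Longrightarrow> computable i \<Longrightarrow> computable j \<Longrightarrow> computable (\<lambda>x. incr (D x) (i x) (j x))"
  unfolding incr_def by (intro computable_intros)

text \<open>A substitution rule: it reduces a claim whose arguments depend on an input to a single
  claim about the projections of a nested tuple.\<close>

lemma computable_comp3:
  "computable (\<lambda>p. f (fst p) (fst (snd p)) (snd (snd p))) \<Longrightarrow> computable a \<Longrightarrow> computable b \<Longrightarrow> computable c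
    \<Longrightarrow> computable (\<lambda>x. f (a x) (b x) (c x))"
  using computable_comp[OF _ computable_Pair[OF _ computable_Pair], of "\<lambda>p. f (fst p) (fst (snd p)) (snd (snd p))" a b c]
  by simp

lemma computable_comp4:
  "computable (\<lambda>p. f (fst p) (fst (snd p)) (fst (snd (snd p))) (snd (snd (snd p)))) \<Longrightarrow>
    computable a \<Longrightarrow> computable b \<Longrightarrow> computable c \<Longrightarrow> computable d
    \<Longrightarrow> computable (\<lambda>x. f (a x) (b x) (c x) (d x))"
  using computable_comp[OF _ computable_Pair[OF _ computable_Pair[OF _ computable_Pair]],
      of "\<lambda>p. f (fst p) (fst (snd p)) (fst (snd (snd p))) (snd (snd (snd p)))" a b c d]
  by simp

lemma computable_branch [computable_intros]:
  "computable D \<Longrightarrow> computable i \<Longrightarrow> computable k \<Longrightarrow> computable (\<lambda>x. branch (D x) (i x) (k x))"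
  by (rule computable_comp3[of branch]) (unfold branch_def, intro computable_intros)

lemma computable_cyls [computable_intros]:
  "computable D \<Longrightarrow> computable N \<Longrightarrow> computable i \<Longrightarrow> computable (\<lambda>x. cyls (D x) (N x) (i x))"
  by (rule computable_comp3[of cyls]) (unfold cyls_def cylinder_counts_def, intro computable_intros)

lemma computable_symbol [computable_intros]:
  "computable us \<Longrightarrow> computable q \<Longrightarrow> computable t \<Longrightarrow> computable (\<lambda>x. symbol (us x) (q x) (t x))"
  by (rule computable_comp3[of symbol]) (unfold symbol_def, intro computable_intros)

lemma computable_depth [computable_intros]: "computable us \<Longrightarrow> computable (\<lambda>x. depth (us x))"
  by (rule computable_comp[of depth]) (unfold depth_def, intro computable_intros)

lemma computable_rank [computable_intros]:
  "computable D \<Longrightarrow> computable us \<Longrightarrow> computable q \<Longrightarrow> computable t \<Longrightarrow>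
    computable (\<lambda>x. rank (D x) (us x) (q x) (t x))"
  by (rule computable_comp4[of rank]) (unfold rank_def below_step_def, intro computable_intros)

lemma computable_arcs [computable_intros]: "computable us \<Longrightarrow> computable (\<lambda>x. arcs (us x))"
  by (rule computable_comp[of arcs]) (unfold arcs_def, intro computable_intros)

lemma computable_first_of [computable_intros]: "computable xs \<Longrightarrow> computable (\<lambda>x. first_of (xs x))"
  by (rule computable_comp[of first_of]) (unfold first_of_def, intro computable_intros)

lemma computable_cut_list [computable_intros]:
  "computable D \<Longrightarrow> computable us \<Longrightarrow> computable i \<Longrightarrow> computable (\<lambda>x. cut_list (D x) (us x) (i x))"
  by (rule computable_comp3[of cut_list]) (unfold cut_list_def, intro computable_intros)

lemma computable_level [computable_intros]:
  "computable D \<Longrightarrow> computable us \<Longrightarrow> computable i \<Longrightarrow> computable h \<Longrightarrow>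
    computable (\<lambda>x. level (D x) (us x) (i x) (h x))"
  by (rule computable_comp4[of level]) (unfold level_def, intro computable_intros)

lemma computable_pieces [computable_intros]:
  "computable D \<Longrightarrow> computable us \<Longrightarrow> computable i \<Longrightarrow> computable (\<lambda>x. pieces (D x) (us x) (i x))"
  unfolding pieces_def by (intro computable_intros)

lemma computable_piece_of [computable_intros]:
  assumes "computable D" "computable us" "computable i" "computable j" "computable h"
  shows "computable (\<lambda>x. piece_of (D x) (us x) (i x) (j x) (h x))"
proof -
  have "computable (\<lambda>p. piece_of (fst p) (fst (snd p)) (fst (snd (snd p))) (fst (snd (snd (snd p)))) (snd (snd (snd (snd p)))))"
    unfolding piece_of_def cut_below_def by (intro computable_intros)
  from computable_comp[OF this, of "\<lambda>x. (D x, us x, i x, j x, h x)"] show ?thesis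
    using assms by (simp add: computable_Pair)
qed

lemma computable_refinement: "computable refinement"
  unfolding refinement_def refined_rows_def refined_row_def strip_list_def fine_list_def block_list_def
  by (intro computable_intros)

section \<open>Monotone maps of the unit interval onto subintervals\<close>

text \<open>The flag records whether the map increases. The last clause makes the image an interval
  and takes the place of continuity.\<close>

definition seg :: "bool \<Rightarrow> (real \<Rightarrow> real) \<Rightarrow> bool"
  where "seg e \<phi> \<longleftrightarrow> \<phi> ` {0..1} \<subseteq> {0..1} \<and>
    (\<forall>x\<in>{0..1}. \<forall>y\<in>{0..1}. x < y \<longrightarrow> (if e then \<phi> x < \<phi> y else \<phi> y < \<phi> x)) \<and>
    (\<forall>x\<in>{0..1}. \<forall>y\<in>{0..1}. {\<phi> x..\<phi> y} \<subseteq> \<phi> ` {0..1})"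

lemma seg_range: "seg e \<phi> \<Longrightarrow> 0 \<le> x \<Longrightarrow> x \<le> 1 \<Longrightarrow> 0 \<le> \<phi> x \<and> \<phi> x \<le> 1"
  unfolding seg_def by (meson atLeastAtMost_iff image_subset_iff)

lemma seg_less_iff:
  assumes "seg e \<phi>" "0 \<le> x" "x \<le> 1" "0 \<le> y" "y \<le> 1"
  shows "\<phi> x < \<phi> y \<longleftrightarrow> (if e then x < y else y < x)"
proof -
  have m: "\<And>a b. a \<in> {0..1} \<Longrightarrow> b \<in> {0..1} \<Longrightarrow> a < b \<Longrightarrow> if e then \<phi> a < \<phi> b else \<phi> b < \<phi> a"
    using assms(1) unfolding seg_def by blast
  have "x \<in> {0..1}" "y \<in> {0..1}" using assms by auto
  with m[of x y] m[of y x] show ?thesis by (cases e; cases x y rule: linorder_cases) auto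
qed

lemma seg_le_iff:
  assumes "seg e \<phi>" "0 \<le> x" "x \<le> 1" "0 \<le> y" "y \<le> 1"
  shows "\<phi> x \<le> \<phi> y \<longleftrightarrow> (if e then x \<le> y else y \<le> x)"
  unfolding not_less[symmetric] seg_less_iff[OF assms(1,4,5,2,3)] by simp

lemma seg_eq_iff:
  assumes "seg e \<phi>" "0 \<le> x" "x \<le> 1" "0 \<le> y" "y \<le> 1"
  shows "\<phi> x = \<phi> y \<longleftrightarrow> x = y"
  unfolding order_eq_iff[of "\<phi> x"] order_eq_iff[of x] seg_le_iff[OF assms] seg_le_iff[OF assms(1,4,5,2,3)] by auto

lemma seg_onto:
  assumes "seg e \<phi>" "0 \<le> x" "x \<le> 1" "0 \<le> y" "y \<le> 1" "\<phi> x \<le> z" "z \<le> \<phi> y"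
  shows "\<exists>w. 0 \<le> w \<and> w \<le> 1 \<and> \<phi> w = z"
proof -
  have "z \<in> \<phi> ` {0..1}" using assms unfolding seg_def by (meson atLeastAtMost_iff subsetD)
  then show ?thesis by auto
qed

lemma seg_id: "seg True (\<lambda>x. x)"
  by (auto simp: seg_def)

text \<open>The flag \<open>e = e'\<close> is the product of the two signs.\<close>

lemma seg_comp:
  assumes "seg e \<phi>" "seg e' \<psi>"
  shows "seg (e = e') (\<lambda>x. \<phi> (\<psi> x))"
proof -
  note r = seg_range[OF assms(2)]
  have "{\<phi> (\<psi> x)..\<phi> (\<psi> y)} \<subseteq> (\<lambda>x. \<phi> (\<psi> x)) ` {0..1}"
    if xy: "0 \<le> x" "x \<le> 1" "0 \<le> y" "y \<le> 1" for x y
  proof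
    fix z assume z: "z \<in> {\<phi> (\<psi> x)..\<phi> (\<psi> y)}"
    obtain w where w: "0 \<le> w" "w \<le> 1" "\<phi> w = z"
      using seg_onto[OF assms(1), of "\<psi> x" "\<psi> y" z] r xy z by auto
    have bet: "if e then \<psi> x \<le> w \<and> w \<le> \<psi> y else \<psi> y \<le> w \<and> w \<le> \<psi> x"
      using z r[OF xy(1,2)] r[OF xy(3,4)] w seg_le_iff[OF assms(1), of "\<psi> x" w] seg_le_iff[OF assms(1), of w "\<psi> y"]
      by (auto split: if_splits)
    obtain v where "0 \<le> v" "v \<le> 1" "\<psi> v = w"
      using seg_onto[OF assms(2), of x y w] seg_onto[OF assms(2), of y x w] xy bet by (cases e) auto
    then show "z \<in> (\<lambda>x. \<phi> (\<psi> x)) ` {0..1}" using w by force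
  qed
  moreover have "if e = e' then \<phi> (\<psi> x) < \<phi> (\<psi> y) else \<phi> (\<psi> y) < \<phi> (\<psi> x)"
    if "0 \<le> x" "x \<le> 1" "0 \<le> y" "y \<le> 1" "x < y" for x y
    using that r seg_less_iff[OF assms(1), of "\<psi> x" "\<psi> y"] seg_less_iff[OF assms(1), of "\<psi> y" "\<psi> x"]
      seg_less_iff[OF assms(2), of x y] seg_less_iff[OF assms(2), of y x]
    by (auto split: if_splits)
  moreover have "(\<lambda>x. \<phi> (\<psi> x)) ` {0..1} \<subseteq> {0..1}"
    using r seg_range[OF assms(1)] by auto
  ultimately show ?thesis unfolding seg_def by auto
qed

lemma seg_image_Icc:
  assumes "seg e \<phi>" "0 \<le> c" "c \<le> d" "d \<le> 1"
  shows "\<phi> ` {c..d} = (if e then {\<phi> c..\<phi> d} else {\<phi> d..\<phi> c})"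
proof -
  have "\<exists>x\<in>{c..d}. z = \<phi> x" if z: "z \<in> (if e then {\<phi> c..\<phi> d} else {\<phi> d..\<phi> c})" for z
  proof -
    obtain w where w: "0 \<le> w" "w \<le> 1" "\<phi> w = z"
      using seg_onto[OF assms(1), of c d z] seg_onto[OF assms(1), of d c z] assms z by (cases e) auto
    with z assms seg_le_iff[OF assms(1), of c w] seg_le_iff[OF assms(1), of w d]
      seg_le_iff[OF assms(1), of d w] seg_le_iff[OF assms(1), of w c]
    show ?thesis by (intro bexI[of _ w]) (auto split: if_splits)
  qed
  then show ?thesis
    using assms seg_le_iff[OF assms(1)] by (auto simp: image_iff split: if_splits)
qed

lemma seg_image_Ioo:
  assumes "seg e \<phi>" "0 \<le> c" "c \<le> d" "d \<le> 1"
  shows "\<phi> ` {c<..<d} = (if e then {\<phi> c<..<\<phi> d} else {\<phi> d<..<\<phi> c})"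
proof -
  have "\<exists>x\<in>{c<..<d}. z = \<phi> x" if z: "z \<in> (if e then {\<phi> c<..<\<phi> d} else {\<phi> d<..<\<phi> c})" for z
  proof -
    obtain w where w: "0 \<le> w" "w \<le> 1" "\<phi> w = z"
      using seg_onto[OF assms(1), of c d z] seg_onto[OF assms(1), of d c z] assms z by (cases e) auto
    with z assms seg_less_iff[OF assms(1), of c w] seg_less_iff[OF assms(1), of w d]
      seg_less_iff[OF assms(1), of d w] seg_less_iff[OF assms(1), of w c]
    show ?thesis by (intro bexI[of _ w]) (auto split: if_splits)
  qed
  then show ?thesis
    using assms seg_less_iff[OF assms(1)] by (auto simp: image_iff split: if_splits)
qed

text \<open>A monotone bijection of open intervals extends to the closed ones; the values at the end
  points are forced.\<close>

lemma seg_extension: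
  fixes p :: "real \<Rightarrow> real"
  assumes im: "p ` {0<..<1} = {a<..<b}" and ab: "0 \<le> a" "a < b" "b \<le> 1"
    and mono: "\<And>x y. 0 < x \<Longrightarrow> x < y \<Longrightarrow> y < 1 \<Longrightarrow> if e then p x < p y else p y < p x"
  obtains \<phi> where "seg e \<phi>" "\<And>x. 0 < x \<Longrightarrow> x < 1 \<Longrightarrow> \<phi> x = p x" "\<phi> ` {0..1} = {a..b}"
    "\<phi> ` {0<..<1} = {a<..<b}"
proof -
  define \<phi> where "\<phi> = (\<lambda>x. if x \<le> 0 then (if e then a else b) else if 1 \<le> x then (if e then b else a) else p x)"
  have p: "a < p x \<and> p x < b" if "0 < x" "x < 1" for x using im that by force
  have eq: "\<phi> x = p x" if "0 < x" "x < 1" for x using that by (auto simp: \<phi>_def)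
  have \<phi>01: "\<phi> 0 = (if e then a else b)" "\<phi> 1 = (if e then b else a)" by (auto simp: \<phi>_def)
  have im': "\<phi> ` {0..1} = {a..b}"
  proof -
    have "{0..1} = {0<..<1} \<union> {0,1::real}" by auto
    then have "\<phi> ` {0..1} = p ` {0<..<1} \<union> {a, b}"
      using eq \<phi>01 by (auto simp: image_iff)
    then show ?thesis using im ab by auto
  qed
  have "if e then \<phi> x < \<phi> y else \<phi> y < \<phi> x" if "0 \<le> x" "x < y" "y \<le> 1" for x y
    using that p[of x] p[of y] mono[of x y] ab by (auto simp: \<phi>_def)
  then have "seg e \<phi>"
    unfolding seg_def im' using ab im' by auto
  moreover have "\<phi> ` {0<..<1} = {a<..<b}" using eq im by (auto simp: image_iff)
  ultimately show ?thesis using eq im' that by blast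
qed

text \<open>With inverse branches for \<open>\<phi>\<close>, the image of the unit interval under
  \<open>itin \<phi> u N\<close> consists of the coordinates whose orbit can follow
  \<open>u 0, ..., u N\<close>; this is why the first transition is applied last.\<close>

primrec itin :: "(nat \<Rightarrow> nat \<Rightarrow> real \<Rightarrow> real) \<Rightarrow> (nat \<Rightarrow> nat) \<Rightarrow> nat \<Rightarrow> real \<Rightarrow> real" where
  "itin \<phi> u 0 = (\<lambda>y. y)"
| "itin \<phi> u (Suc N) = (\<lambda>y. \<phi> (u 0) (u (Suc 0)) (itin \<phi> (\<lambda>m. u (Suc m)) N y))"

lemma itin_add: "itin \<phi> u (M + N) y = itin \<phi> u M (itin \<phi> (\<lambda>m. u (M + m)) N y)"
  by (induction M arbitrary: u) auto

lemma itin_Suc_right: "itin \<phi> u (Suc N) y = itin \<phi> u N (\<phi> (u N) (u (Suc N)) y)"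
  using itin_add[of \<phi> u N 1 y] by simp

lemma seg_itin:
  assumes "\<And>m. \<exists>e. seg e (\<phi> (u m) (u (Suc m)))"
  shows "\<exists>e. seg e (itin \<phi> u N)"
  using assms
proof (induction N arbitrary: u)
  case 0 show ?case unfolding itin.simps using seg_id by (rule exI)
next
  case (Suc N)
  have "\<exists>e. seg e (itin \<phi> (\<lambda>m. u (Suc m)) N)" by (rule Suc.IH) (rule Suc.prems)
  then obtain e where e: "seg e (itin \<phi> (\<lambda>m. u (Suc m)) N)" ..
  obtain e' where "seg e' (\<phi> (u 0) (u (Suc 0)))" using Suc.prems[of 0] ..
  from seg_comp[OF this e] show ?case unfolding itin.simps by (rule exI)
qed

definition limit_points :: "(nat \<Rightarrow> nat \<Rightarrow> real \<Rightarrow> real) \<Rightarrow> (nat \<Rightarrow> nat) \<Rightarrow> real set"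
  where "limit_points \<phi> u = (\<Inter>N. itin \<phi> u N ` {0..1})"

lemma itin_image_antimono:
  assumes "\<And>m. \<exists>e. seg e (\<phi> (u m) (u (Suc m)))" "M \<le> N"
  shows "itin \<phi> u N ` {0..1} \<subseteq> itin \<phi> u M ` {0..1}"
proof -
  obtain K where N: "N = M + K" using assms(2) le_Suc_ex by blast
  have "\<exists>e. seg e (itin \<phi> (\<lambda>m. u (M + m)) K)"
    using assms(1)[of "M + _"] by (intro seg_itin) simp
  then obtain e where "seg e (itin \<phi> (\<lambda>m. u (M + m)) K)" ..
  from seg_range[OF this] show ?thesis unfolding N itin_add by auto
qed

lemma limit_points_nonempty:
  assumes "\<And>m. \<exists>e. seg e (\<phi> (u m) (u (Suc m)))"
  shows "limit_points \<phi> u \<noteq> {}"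
  unfolding limit_points_def
proof (rule compact_nest)
  fix N
  obtain e where "seg e (itin \<phi> u N)" using seg_itin[of \<phi> u, OF assms] by blast
  then show "compact (itin \<phi> u N ` {0..1})" using seg_image_Icc[of e "itin \<phi> u N" 0 1] by auto
qed (use itin_image_antimono[of \<phi> u, OF assms] in auto)

lemma limit_points_step:
  assumes "\<And>m. \<exists>e. seg e (\<phi> (u m) (u (Suc m)))" "y \<in> limit_points \<phi> (\<lambda>m. u (Suc m))"
  shows "\<phi> (u 0) (u 1) y \<in> limit_points \<phi> u"
proof -
  have "\<phi> (u 0) (u 1) y \<in> itin \<phi> u (Suc N) ` {0..1}" for N
    using assms(2) unfolding limit_points_def by auto
  then show ?thesis
    using itin_image_antimono[of \<phi> u, OF assms(1) le_SucI[OF order_refl]] unfolding limit_points_def by blast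
qed

section \<open>Codes and cylinder ranks\<close>

declare upt_Suc [simp del]

lemma distinct_singletonD: "distinct xs \<Longrightarrow> set xs = {j} \<Longrightarrow> xs = [j]"
  using distinct_card[of xs] by (cases xs rule: remdups_adj.cases) simp_all

text \<open>The vertical dynamics alone: \<open>hb i j\<close> takes a height in the target
  rectangle back to a height in the \<open>j\<close>-th sub-rectangle of \<open>R_i\<close>.
  Neighbouring images may share an end point, hence the weak inequality in
  \<open>hb_ordered\<close>. The expansion of the measure is summarized by
  \<open>shrink\<close>.\<close>

locale interval_dynamics =
  fixes D :: type_rows and hb :: "nat \<Rightarrow> nat \<Rightarrow> real \<Rightarrow> real"
  assumes tgt_range: "i \<in> {1..length D} \<Longrightarrow> j \<in> {1..deg D i} \<Longrightarrow> tgt D i j \<in> {1..length D}"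
    and tgt_inj: "i \<in> {1..length D} \<Longrightarrow> j \<in> {1..deg D i} \<Longrightarrow> j' \<in> {1..deg D i} \<Longrightarrow> tgt D i j = tgt D i j' \<Longrightarrow> j = j'"
    and hb_seg: "i \<in> {1..length D} \<Longrightarrow> j \<in> {1..deg D i} \<Longrightarrow> seg (incr D i j) (hb i j)"
    and hb_ordered: "i \<in> {1..length D} \<Longrightarrow> j \<in> {1..deg D i} \<Longrightarrow> j' \<in> {1..deg D i} \<Longrightarrow> j < j' \<Longrightarrow>
      0 \<le> x \<Longrightarrow> x \<le> 1 \<Longrightarrow> 0 \<le> y \<Longrightarrow> y \<le> 1 \<Longrightarrow> hb i j x \<le> hb i j' y"
    and hb_cover: "i \<in> {1..length D} \<Longrightarrow> 0 \<le> y \<Longrightarrow> y \<le> 1 \<Longrightarrow> \<exists>j\<in>{1..deg D i}. y \<in> hb i j ` {0..1}"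
    and shrink: "(\<And>m. u m \<in> {1..length D} \<and> u (Suc m) \<in> tgt D (u m) ` {1..deg D (u m)}) \<Longrightarrow>
      y \<in> limit_points (\<lambda>i k. hb i (branch D i k)) u \<Longrightarrow>
      y' \<in> limit_points (\<lambda>i k. hb i (branch D i k)) u \<Longrightarrow> y = y'"
begin

definition code :: "(nat \<Rightarrow> nat) \<Rightarrow> bool"
  where "code u \<longleftrightarrow> (\<forall>m. u m \<in> {1..length D} \<and> u (Suc m) \<in> tgt D (u m) ` {1..deg D (u m)})"

abbreviation Hb :: "nat \<Rightarrow> nat \<Rightarrow> real \<Rightarrow> real"
  where "Hb i k \<equiv> hb i (branch D i k)"

definition height :: "(nat \<Rightarrow> nat) \<Rightarrow> real"
  where "height u = (THE y. y \<in> limit_points Hb u)"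

lemma branch_tgt:
  assumes "i \<in> {1..length D}" "j \<in> {1..deg D i}"
  shows "branch D i (tgt D i j) = j"
proof -
  let ?xs = "filter (\<lambda>j'. tgt D i j' = tgt D i j) [1..<Suc (deg D i)]"
  have s: "set ?xs = {j}" using tgt_inj[OF assms(1) _ assms(2)] assms(2) by (auto simp: less_Suc_eq_le)
  have "?xs = [j]" by (rule distinct_singletonD[OF _ s]) simp
  then show ?thesis unfolding branch_def by (simp add: nth_default_def)
qed

lemma codeD:
  assumes "code u"
  shows "u m \<in> {1..length D}" "branch D (u m) (u (Suc m)) \<in> {1..deg D (u m)}"
    "tgt D (u m) (branch D (u m) (u (Suc m))) = u (Suc m)"
proof -
  show u: "u m \<in> {1..length D}" using assms unfolding code_def by blast
  obtain j where j: "j \<in> {1..deg D (u m)}" "u (Suc m) = tgt D (u m) j" using assms unfolding code_def by blast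
  then have "branch D (u m) (u (Suc m)) = j" using branch_tgt[OF u j(1)] by simp
  then show "branch D (u m) (u (Suc m)) \<in> {1..deg D (u m)}"
    "tgt D (u m) (branch D (u m) (u (Suc m))) = u (Suc m)" using j by auto
qed

lemma code_Suc: "code u \<Longrightarrow> code (\<lambda>m. u (Suc m))"
  unfolding code_def by auto

lemma code_add: "code u \<Longrightarrow> code (\<lambda>m. u (t + m))"
  unfolding code_def by (metis add_Suc_right)

lemma Hb_seg: "code u \<Longrightarrow> seg (incr D (u m) (branch D (u m) (u (Suc m)))) (Hb (u m) (u (Suc m)))"
  using hb_seg codeD by blast

lemma Hb_seg': "code u \<Longrightarrow> \<exists>e. seg e (Hb (u m) (u (Suc m)))"
  using Hb_seg by blast

lemma itin_seg: "code u \<Longrightarrow> \<exists>e. seg e (itin Hb u N)"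
  using seg_itin[of Hb u] Hb_seg'[of u] by blast

lemma itin_range: "code u \<Longrightarrow> 0 \<le> y \<Longrightarrow> y \<le> 1 \<Longrightarrow> 0 \<le> itin Hb u N y \<and> itin Hb u N y \<le> 1"
  using itin_seg seg_range by blast

lemma limit_height:
  assumes "code u"
  shows "limit_points Hb u = {height u}"
proof -
  obtain y where y: "y \<in> limit_points Hb u" using limit_points_nonempty[of Hb u, OF Hb_seg'[OF assms]] by blast
  have "y' = y" if "y' \<in> limit_points Hb u" for y'
    using assms unfolding code_def by (intro shrink[OF _ that y]) simp
  then have "limit_points Hb u = {y}" using y by blast
  then show ?thesis unfolding height_def by simp
qed

lemma height_unique: "code u \<Longrightarrow> (\<And>N. y \<in> itin Hb u N ` {0..1}) \<Longrightarrow> height u = y"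
proof -
  assume "code u" "\<And>N. y \<in> itin Hb u N ` {0..1}"
  then have "y \<in> limit_points Hb u" unfolding limit_points_def by simp
  then show ?thesis using limit_height[OF \<open>code u\<close>] by simp
qed

lemma height_in: "code u \<Longrightarrow> height u \<in> itin Hb u N ` {0..1}"
proof -
  assume "code u"
  then have "height u \<in> limit_points Hb u" by (simp add: limit_height)
  then show ?thesis unfolding limit_points_def by (rule INT_D) simp
qed

lemma height_range: "code u \<Longrightarrow> 0 \<le> height u \<and> height u \<le> 1"
  using height_in[of u 0] by simp

lemma height_step: "code u \<Longrightarrow> height u = Hb (u 0) (u 1) (height (\<lambda>m. u (Suc m)))"
  using limit_points_step[of Hb u "height (\<lambda>m. u (Suc m))"] Hb_seg' limit_height[of u] limit_height[OF code_Suc, of u]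
  by auto

lemma height_itin: "code u \<Longrightarrow> height u = itin Hb u N (height (\<lambda>m. u (N + m)))"
proof (induction N arbitrary: u)
  case (Suc N)
  show ?case using height_step[OF Suc.prems] Suc.IH[OF code_Suc[OF Suc.prems]] by simp
qed simp

lemma deg_pos: "i \<in> {1..length D} \<Longrightarrow> 1 \<le> deg D i"
  using hb_cover[of i 0] by auto

lemma cyls_0: "i \<in> {1..length D} \<Longrightarrow> cyls D 0 i = 1"
  by (auto simp: cyls_def cylinder_counts_def nth_default_def)

lemma length_counts [simp]: "length (cylinder_counts D N) = length D"
  by (induction N) (auto simp: cylinder_counts_def)

lemma edge_nth: "map (edge D i) [1..<Suc (deg D i)] = snd (row D i)"
  by (rule nth_equalityI) (auto simp: edge_def deg_def nth_default_def)

lemma cyls_Suc: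
  assumes "i \<in> {1..length D}"
  shows "cyls D (Suc N) i = (\<Sum>j\<leftarrow>[1..<Suc (deg D i)]. cyls D N (tgt D i j))"
proof -
  have "cyls D (Suc N) i = (\<Sum>e\<leftarrow>snd (D ! (i - 1)). nth_default 0 (cylinder_counts D N) (fst (fst e) - 1))"
    using assms by (auto simp: cyls_def cylinder_counts_def nth_default_def)
  also have "D ! (i - 1) = row D i" using assms by (auto simp: row_def nth_default_def)
  finally show ?thesis
    unfolding edge_nth[of i, symmetric] by (simp add: cyls_def tgt_def o_def del: upt_Suc)
qed

lemma cyls_pos: "i \<in> {1..length D} \<Longrightarrow> 1 \<le> cyls D N i"
proof (induction N arbitrary: i)
  case 0 then show ?case by (simp add: cyls_0)
next
  case (Suc N)
  have "1 \<le> cyls D N (tgt D i 1)" using Suc deg_pos tgt_range by auto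
  also have "\<dots> \<le> cyls D (Suc N) i"
    unfolding cyls_Suc[OF Suc.prems] using deg_pos[OF Suc.prems]
    by (intro member_le_sum_list) (auto)
  finally show ?case .
qed

definition before :: "nat \<Rightarrow> nat \<Rightarrow> nat \<Rightarrow> nat"
  where "before N i j = (\<Sum>j'\<leftarrow>[1..<j]. cyls D N (tgt D i j'))"

lemma before_less:
  assumes "i \<in> {1..length D}" "j \<in> {1..deg D i}" "j < j'"
  shows "before N i j + cyls D N (tgt D i j) \<le> before N i j'"
proof -
  have "[1..<j'] = [1..<j] @ [j..<j']" using assms upt_add_eq_append[of 1 j "j' - j"] by auto
  also have "[j..<j'] = j # [Suc j..<j']" using assms by (simp add: upt_conv_Cons)
  finally show ?thesis unfolding before_def by simp
qed

lemma before_deg: "i \<in> {1..length D} \<Longrightarrow> before N i (deg D i) + cyls D N (tgt D i (deg D i)) = cyls D (Suc N) i"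
  using deg_pos[of i] unfolding before_def cyls_Suc by (simp add: upt_Suc_append)

lemma before_eq_0: 
  assumes "i \<in> {1..length D}" "j \<in> {1..deg D i}" shows "before N i j = 0 \<longleftrightarrow> j = 1"
proof (cases "j = 1")
  case False
  then have "before N i 1 + cyls D N (tgt D i 1) \<le> before N i j" using assms by (intro before_less) auto
  moreover have "1 \<le> cyls D N (tgt D i 1)" using assms by (intro cyls_pos tgt_range) auto
  ultimately show ?thesis using False by simp
qed (simp add: before_def)

text \<open>The rank unfolded from the front, which suits induction on the code. The executable
  \<open>rank\<close> starts at the far end of the window instead, since \<open>rec_nat\<close>
  cannot change its parameter between rounds.\<close>

primrec cyl_rank :: "nat \<Rightarrow> (nat \<Rightarrow> nat) \<Rightarrow> nat" where
  "cyl_rank 0 u = 0"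
| "cyl_rank (Suc N) u = below_step D N (u 0) (u (Suc 0)) (cyl_rank N (\<lambda>m. u (Suc m)))"

definition inner_rank :: "nat \<Rightarrow> (nat \<Rightarrow> nat) \<Rightarrow> nat"
  where "inner_rank N u = (if incr D (u 0) (branch D (u 0) (u 1)) then cyl_rank N (\<lambda>m. u (Suc m))
    else cyls D N (u 1) - 1 - cyl_rank N (\<lambda>m. u (Suc m)))"

lemma cyl_rank_Suc: "cyl_rank (Suc N) u = before N (u 0) (branch D (u 0) (u 1)) + inner_rank N u"
  by (simp add: below_step_def before_def inner_rank_def)

lemma cyl_rank_less: "code u \<Longrightarrow> cyl_rank N u < cyls D N (u 0)"
proof (induction N arbitrary: u)
  case 0 then show ?case using codeD(1)[of u 0] by (simp add: cyls_0)
next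
  case (Suc N)
  note c = codeD[OF Suc.prems, of 0]
  let ?j = "branch D (u 0) (u (Suc 0))"
  have "inner_rank N u < cyls D N (tgt D (u 0) ?j)"
    unfolding c(3) inner_rank_def
    using Suc.IH[OF code_Suc[OF Suc.prems]] cyls_pos[OF codeD(1)[OF Suc.prems, of 1], of N] by auto
  then have "cyl_rank (Suc N) u < before N (u 0) ?j + cyls D N (tgt D (u 0) ?j)"
    by (simp add: cyl_rank_Suc del: cyl_rank.simps)
  also have "\<dots> \<le> cyls D (Suc N) (u 0)"
    using c before_less[of "u 0" ?j "deg D (u 0)" N] before_deg[of "u 0" N]
    by (cases "?j = deg D (u 0)") auto
  finally show ?case .
qed

lemma inner_rank_less: "code u \<Longrightarrow> inner_rank N u < cyls D N (u 1)"
  using cyl_rank_less[OF code_Suc, of u N] cyls_pos[OF codeD(1), of u 1 N] by (auto simp: inner_rank_def)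

end

context interval_dynamics
begin

text \<open>Different branches occupy disjoint consecutive blocks of ranks, so the branch decides
  first; within a block the comparison passes to the shifted codes, reversed on a decreasing
  branch.\<close>

lemma cyl_rank_cases:
  assumes "code u" "code v" "u 0 = v 0" "cyl_rank (Suc N) u \<le> cyl_rank (Suc N) v"
  shows "branch D (u 0) (u 1) < branch D (v 0) (v 1) \<or>
    u 1 = v 1 \<and> (if incr D (u 0) (branch D (u 0) (u 1))
      then cyl_rank N (\<lambda>m. u (Suc m)) \<le> cyl_rank N (\<lambda>m. v (Suc m))
      else cyl_rank N (\<lambda>m. v (Suc m)) \<le> cyl_rank N (\<lambda>m. u (Suc m)))"
proof (cases "branch D (u 0) (u 1)" "branch D (v 0) (v 1)" rule: linorder_cases)
  case equal
  let ?u = "cyl_rank N (\<lambda>m. u (Suc m))" and ?v = "cyl_rank N (\<lambda>m. v (Suc m))"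
  have "u 1 = tgt D (u 0) (branch D (u 0) (u 1))" using codeD(3)[OF assms(1), of 0] by simp
  also have "\<dots> = tgt D (v 0) (branch D (v 0) (v 1))" by (subst equal, subst assms(3)) (rule refl)
  also have "\<dots> = v 1" using codeD(3)[OF assms(2), of 0] by simp
  finally have e: "u 1 = v 1" .
  have "before N (u 0) (branch D (u 0) (u 1)) = before N (v 0) (branch D (v 0) (v 1))"
    by (subst equal, subst assms(3)) (rule refl)
  then have "inner_rank N u \<le> inner_rank N v"
    using assms(4) unfolding cyl_rank_Suc by linarith
  moreover have "?u < cyls D N (u 1)" "?v < cyls D N (u 1)"
    using cyl_rank_less[OF code_Suc[OF assms(1)], of N] cyl_rank_less[OF code_Suc[OF assms(2)], of N] e by simp_all
  moreover have "incr D (v 0) (branch D (v 0) (v 1)) = incr D (u 0) (branch D (u 0) (u 1))"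
    by (subst equal, subst assms(3)) (rule refl)
  ultimately have "if incr D (u 0) (branch D (u 0) (u 1)) then ?u \<le> ?v else ?v \<le> ?u"
    unfolding inner_rank_def e[symmetric] by (cases "incr D (u 0) (branch D (u 0) (u 1))") simp_all
  then show ?thesis using e by blast
next
  case greater
  have "cyl_rank (Suc N) v < cyl_rank (Suc N) u"
    using before_less[OF codeD(1,2)[OF assms(2), of 0], of "branch D (u 0) (u 1)" N] greater
      inner_rank_less[OF assms(2), of N] codeD(3)[OF assms(2), of 0] assms(3)
    unfolding cyl_rank_Suc by simp
  then show ?thesis using assms(4) by simp
qed simp

text \<open>Only a weak inequality can hold, since adjacent cylinders may touch.\<close>

lemma cyl_rank_ordered:
  assumes "code u" "code v" "u 0 = v 0" "cyl_rank N u < cyl_rank N v"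
    "0 \<le> x" "x \<le> 1" "0 \<le> y" "y \<le> 1"
  shows "itin Hb u N x \<le> itin Hb v N y"
  using assms
proof (induction N arbitrary: u v x y)
  case (Suc N)
  let ?u = "\<lambda>m. u (Suc m)" and ?v = "\<lambda>m. v (Suc m)"
  have c: "code ?u" "code ?v" using Suc.prems code_Suc by auto
  note ru = itin_range[OF c(1) Suc.prems(5,6), of N] and rv = itin_range[OF c(2) Suc.prems(7,8), of N]
  consider "branch D (u 0) (u 1) < branch D (v 0) (v 1)" | "u 1 = v 1"
    "if incr D (u 0) (branch D (u 0) (u 1)) then cyl_rank N ?u < cyl_rank N ?v else cyl_rank N ?v < cyl_rank N ?u"
  proof -
    have "cyl_rank (Suc N) u \<le> cyl_rank (Suc N) v" using Suc.prems(4) by simp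
    from cyl_rank_cases[OF Suc.prems(1-3) this] show thesis
    proof
      assume u: "u 1 = v 1 \<and> (if incr D (u 0) (branch D (u 0) (u 1))
        then cyl_rank N ?u \<le> cyl_rank N ?v else cyl_rank N ?v \<le> cyl_rank N ?u)"
      have "cyl_rank N ?u \<noteq> cyl_rank N ?v"
      proof
        assume e: "cyl_rank N ?u = cyl_rank N ?v"
        have "cyl_rank (Suc N) u = cyl_rank (Suc N) v"
          using u Suc.prems(3) unfolding cyl_rank_Suc inner_rank_def e by simp
        then show False using Suc.prems(4) by simp
      qed
      moreover have "(if b then x \<le> y else y \<le> x) \<Longrightarrow> x \<noteq> y \<Longrightarrow> if b then x < y else y < x" for b and x y :: nat
        by (cases b) simp_all
      ultimately show thesis using that(2) u by blast
    qed (rule that(1))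
  qed
  then show ?case
  proof cases
    case 1
    then show ?thesis
      using hb_ordered[OF codeD(1,2)[OF Suc.prems(1), of 0] codeD(2)[OF Suc.prems(2), of 0, folded Suc.prems(3)], of "itin Hb ?u N x" "itin Hb ?v N y"]
        Suc.prems(3) ru rv by simp
  next
    case 2
    have hbeq: "Hb (v 0) (v (Suc 0)) = Hb (u 0) (u (Suc 0))"
      using 2(1) by (simp only: Suc.prems(3) One_nat_def)
    note s = seg_le_iff[OF Hb_seg[OF Suc.prems(1), of 0], of "itin Hb ?u N x" "itin Hb ?v N y"]
    show ?thesis
    proof (cases "incr D (u 0) (branch D (u 0) (u 1))")
      case True
      have "itin Hb ?u N x \<le> itin Hb ?v N y"
        using 2 True by (intro Suc.IH[OF c _ _ Suc.prems(5-8)]) simp_all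
      then show ?thesis using s True ru rv unfolding itin.simps hbeq by simp
    next
      case False
      have "itin Hb ?v N y \<le> itin Hb ?u N x"
        using 2 False by (intro Suc.IH[OF c(2,1) _ _ Suc.prems(7,8,5,6)]) simp_all
      then show ?thesis using s False ru rv unfolding itin.simps hbeq by simp
    qed
  qed
qed simp

text \<open>Using \<open>cyl_rank_cases\<close> in both directions excludes different branches and
  gives equal ranks of the shifted codes, so the letters agree one after the other.\<close>

lemma cyl_rank_inj:
  assumes "code u" "code v" "u 0 = v 0" "cyl_rank N u = cyl_rank N v" "m \<le> N"
  shows "u m = v m"
  using assms
proof (induction N arbitrary: u v m)
  case (Suc N)
  let ?u = "cyl_rank N (\<lambda>m. u (Suc m))" and ?v = "cyl_rank N (\<lambda>m. v (Suc m))"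
  have le: "cyl_rank (Suc N) u \<le> cyl_rank (Suc N) v" "cyl_rank (Suc N) v \<le> cyl_rank (Suc N) u"
    using Suc.prems(4) by simp_all
  have same: "branch D (u 0) (u 1) = branch D (v 0) (v 1)" if "u 1 = v 1"
    using that by (simp only: Suc.prems(3))
  have same': "incr D (u 0) (branch D (u 0) (u 1)) = incr D (v 0) (branch D (v 0) (v 1))" if "u 1 = v 1"
    using that by (simp only: Suc.prems(3))
  have "u 1 = v 1 \<and> ?u = ?v"
    using cyl_rank_cases[OF Suc.prems(1-3) le(1)] cyl_rank_cases[OF Suc.prems(2,1) Suc.prems(3)[symmetric] le(2)]
  proof (elim disjE)
    assume "u 1 = v 1 \<and> (if incr D (u 0) (branch D (u 0) (u 1)) then ?u \<le> ?v else ?v \<le> ?u)"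
      "v 1 = u 1 \<and> (if incr D (v 0) (branch D (v 0) (v 1)) then ?v \<le> ?u else ?u \<le> ?v)"
    then show ?thesis using same' by (metis le_antisym)
  qed (use same in \<open>metis less_irrefl less_asym\<close>)+
  then show ?case
    using Suc.IH[OF code_Suc[OF Suc.prems(1)] code_Suc[OF Suc.prems(2)], of "m - 1"] Suc.prems(3,5) by (cases m) auto
qed simp

text \<open>If a branch other than the first took the value 0, the order of the branches would force
  the first one to vanish at both ends, against injectivity. On the first branch the value 0 is
  taken at its lower end, which is 0 or 1 according to its direction.\<close>

lemma hb_eq_0_iff:
  assumes "i \<in> {1..length D}" "j \<in> {1..deg D i}" "0 \<le> y" "y \<le> 1"
  shows "hb i j y = 0 \<longleftrightarrow> j = 1 \<and> y = (if incr D i j then 0 else 1)"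
proof -
  obtain j0 y0 where 0: "j0 \<in> {1..deg D i}" "0 \<le> y0" "y0 \<le> 1" "hb i j0 y0 = 0"
    using hb_cover[OF assms(1), of 0] by force
  have only1: "j' = 1" if j': "j' \<in> {1..deg D i}" "0 \<le> x" "x \<le> 1" "hb i j' x = 0" for j' x
  proof (rule ccontr)
    assume "j' \<noteq> 1"
    then have "1 \<in> {1..deg D i}" "1 < j'" using j' by auto
    then have "hb i 1 0 \<le> 0" "hb i 1 1 \<le> 0" using hb_ordered[of i 1 j' 0 x] hb_ordered[of i 1 j' 1 x] assms j' by auto
    then show False using seg_range[OF hb_seg[OF assms(1) \<open>1 \<in> _\<close>], of 0] seg_range[OF hb_seg[OF assms(1) \<open>1 \<in> _\<close>], of 1]
        seg_eq_iff[OF hb_seg[OF assms(1) \<open>1 \<in> _\<close>], of 0 1] by auto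
  qed
  have s: "seg (incr D i 1) (hb i 1)" using hb_seg[OF assms(1)] only1 0 by metis
  have end0: "y' = (if incr D i 1 then 0 else 1)" if "0 \<le> y'" "y' \<le> 1" "hb i 1 y' = 0" for y'
    using seg_le_iff[OF s, of y' 0] seg_le_iff[OF s, of y' 1] seg_range[OF s, of 0] seg_range[OF s, of 1] that
    by (auto split: if_splits)
  show ?thesis using only1[OF assms(2-4)] end0 0 only1[OF 0] assms(3,4) by metis
qed

lemma hb_eq_1_iff:
  assumes "i \<in> {1..length D}" "j \<in> {1..deg D i}" "0 \<le> y" "y \<le> 1"
  shows "hb i j y = 1 \<longleftrightarrow> j = deg D i \<and> y = (if incr D i j then 1 else 0)"
proof -
  obtain j0 y0 where 0: "j0 \<in> {1..deg D i}" "0 \<le> y0" "y0 \<le> 1" "hb i j0 y0 = 1"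
    using hb_cover[OF assms(1), of 1] by force
  have only1: "j' = deg D i" if j': "j' \<in> {1..deg D i}" "0 \<le> x" "x \<le> 1" "hb i j' x = 1" for j' x
  proof (rule ccontr)
    let ?d = "deg D i"
    assume "j' \<noteq> deg D i"
    then have d: "?d \<in> {1..deg D i}" "j' < ?d" using j' by auto
    then have "hb i ?d 0 \<ge> 1" "hb i ?d 1 \<ge> 1"
      using hb_ordered[of i j' ?d x 0] hb_ordered[of i j' ?d x 1] assms j' by auto
    then show False using seg_range[OF hb_seg[OF assms(1) d(1)], of 0] seg_range[OF hb_seg[OF assms(1) d(1)], of 1]
        seg_eq_iff[OF hb_seg[OF assms(1) d(1)], of 0 1] by auto
  qed
  have s: "seg (incr D i (deg D i)) (hb i (deg D i))" using hb_seg[OF assms(1)] only1 0 by metis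
  have end0: "y' = (if incr D i (deg D i) then 1 else 0)" if "0 \<le> y'" "y' \<le> 1" "hb i (deg D i) y' = 1" for y'
    using seg_le_iff[OF s, of 0 y'] seg_le_iff[OF s, of 1 y'] seg_range[OF s, of 0] seg_range[OF s, of 1] that
    by (auto split: if_splits)
  show ?thesis using only1[OF assms(2-4)] end0 0 only1[OF 0] assms(3,4) by metis
qed

text \<open>Both ends are treated in one induction because a decreasing branch exchanges
  them.\<close>

lemma cyl_rank_ends:
  assumes "code u"
  shows "(0 \<in> itin Hb u N ` {0..1} \<longleftrightarrow> cyl_rank N u = 0) \<and>
    (1 \<in> itin Hb u N ` {0..1} \<longleftrightarrow> cyl_rank N u = cyls D N (u 0) - 1)"
  using assms
proof (induction N arbitrary: u)
  case 0 then show ?case using cyls_0 codeD(1) by auto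
next
  case (Suc N)
  let ?u = "\<lambda>m. u (Suc m)" and ?j = "branch D (u 0) (u (Suc 0))"
  have c: "code ?u" using Suc.prems code_Suc by auto
  note cd = codeD[OF Suc.prems, of 0]
  have r: "0 \<le> itin Hb ?u N y \<and> itin Hb ?u N y \<le> 1" if "y \<in> {0..1}" for y using itin_range[OF c] that by auto
  note h0 = hb_eq_0_iff[OF cd(1,2)] and h1 = hb_eq_1_iff[OF cd(1,2)]
  have mem: "z \<in> g ` {0..1} \<longleftrightarrow> (\<exists>y\<in>{0..1}. g y = z)" for z and g :: "real \<Rightarrow> real" by auto
  have "\<forall>y\<in>{0..1}. Hb (u 0) (u (Suc 0)) (itin Hb ?u N y) = 0 \<longleftrightarrow>
      ?j = 1 \<and> itin Hb ?u N y = (if incr D (u 0) ?j then 0 else 1)" using h0 r by blast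
  then have e0: "0 \<in> itin Hb u (Suc N) ` {0..1} \<longleftrightarrow> ?j = 1 \<and> (if incr D (u 0) ?j then 0 else 1) \<in> itin Hb ?u N ` {0..1}"
    unfolding mem itin.simps by blast
  have "\<forall>y\<in>{0..1}. Hb (u 0) (u (Suc 0)) (itin Hb ?u N y) = 1 \<longleftrightarrow>
      ?j = deg D (u 0) \<and> itin Hb ?u N y = (if incr D (u 0) ?j then 1 else 0)" using h1 r by blast
  then have e1: "1 \<in> itin Hb u (Suc N) ` {0..1} \<longleftrightarrow>
      ?j = deg D (u 0) \<and> (if incr D (u 0) ?j then 1 else 0) \<in> itin Hb ?u N ` {0..1}"
    unfolding mem itin.simps by blast
  note lt = cyl_rank_less[OF c, of N]
  have i0: "inner_rank N u = 0 \<longleftrightarrow> (if incr D (u 0) ?j then 0 else 1) \<in> itin Hb ?u N ` {0..1}"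
    using Suc.IH[OF c] lt unfolding inner_rank_def by auto
  have i1: "inner_rank N u = cyls D N (u 1) - 1 \<longleftrightarrow> (if incr D (u 0) ?j then 1 else 0) \<in> itin Hb ?u N ` {0..1}"
    using Suc.IH[OF c] lt unfolding inner_rank_def by auto
  have r0: "cyl_rank (Suc N) u = 0 \<longleftrightarrow> ?j = 1 \<and> inner_rank N u = 0"
    unfolding cyl_rank_Suc using before_eq_0[OF cd(1,2), of N] by auto
  have r1: "cyl_rank (Suc N) u = cyls D (Suc N) (u 0) - 1 \<longleftrightarrow> ?j = deg D (u 0) \<and> inner_rank N u = cyls D N (u 1) - 1"
  proof (cases "?j = deg D (u 0)")
    case True
    have "cyls D (Suc N) (u 0) = before N (u 0) ?j + cyls D N (u (Suc 0))"
      using before_deg[OF cd(1), of N] cd(3) True by simp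
    then show ?thesis unfolding cyl_rank_Suc using True inner_rank_less[OF Suc.prems, of N] by auto
  next
    case False
    then have "?j < deg D (u 0)" using cd(2) by auto
    from before_less[OF cd(1,2) this, of N] have "before N (u 0) ?j + cyls D N (u (Suc 0)) \<le> before N (u 0) (deg D (u 0))"
      using cd(3) by simp
    moreover have "1 \<le> cyls D N (tgt D (u 0) (deg D (u 0)))" using cd(1) deg_pos[OF cd(1)] by (intro cyls_pos tgt_range) auto
    ultimately show ?thesis
      using before_deg[OF cd(1), of N] inner_rank_less[OF Suc.prems, of N] False unfolding cyl_rank_Suc by auto
  qed
  show ?case by (simp only: e0 e1 i0 i1 r0 r1)
qed

end

context interval_dynamics
begin

lemma periodic_add:
  fixes u :: "nat \<Rightarrow> nat"
  assumes "\<And>m. u (P + m) = u m"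
  shows "u (n * P + m) = u m"
proof (induction n)
  case (Suc n)
  then show ?case using assms[of "n * P + m"] by (simp add: add.assoc)
qed simp

lemma return_seg:
  assumes "code u" "\<And>m. u (P + m) = u m"
  shows "seg True (itin Hb u (2 * P))"
proof -
  obtain e where "seg e (itin Hb u P)" using itin_seg[OF assms(1)] ..
  from seg_comp[OF this this] have "seg True (\<lambda>y. itin Hb u P (itin Hb u P y))" by simp
  moreover have "itin Hb u (2 * P) = (\<lambda>y. itin Hb u P (itin Hb u P y))"
    using itin_add[of Hb u P P] assms(2) by (auto simp: mult_2)
  ultimately show ?thesis by simp
qed

lemma return_fixes:
  assumes "code u" "\<And>m. u (P + m) = u m"
  shows "itin Hb u (2 * P) (height u) = height u"
proof -
  have "(\<lambda>m. u (2 * P + m)) = u" using periodic_add[of u P 2, OF assms(2)] by blast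
  with height_itin[OF assms(1), of "2 * P"] have "height u = itin Hb u (2 * P) (height u)" by (simp only:)
  then show ?thesis by (rule sym)
qed

text \<open>A fixed point of the return map lies in the image of each of its iterates, hence in all
  cylinders of the periodic code, and these have only the height in common.\<close>

lemma fixed_end_point:
  assumes "code u" "\<And>m. u (P + m) = u m" "0 < P" "itin Hb u (2 * P) z = z" "0 \<le> z" "z \<le> 1"
  shows "height u = z"
proof (rule height_unique[OF assms(1)])
  fix N
  have fx: "itin Hb u (N * (2 * P)) z = z"
  proof (induction N)
    case (Suc N)
    have e: "(\<lambda>m. u (N * (2 * P) + m)) = u"
      using periodic_add[of u P "N * 2", OF assms(2)] by (simp only: mult.assoc)
    have "itin Hb u (Suc N * (2 * P)) z = itin Hb u (N * (2 * P) + 2 * P) z" by (simp add: add.commute)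
    also have "\<dots> = itin Hb u (N * (2 * P)) (itin Hb u (2 * P) z)" unfolding itin_add e ..
    also have "\<dots> = z" by (simp only: assms(4) Suc)
    finally show ?case .
  qed simp
  have "z \<in> itin Hb u (N * (2 * P)) ` {0..1}" 
  proof (rule image_eqI)
    show "z = itin Hb u (N * (2 * P)) z" using fx by (rule sym)
  qed (use assms(5,6) in simp)
  moreover have "N \<le> N * (2 * P)" using assms(3) by simp
  note itin_image_antimono[of Hb u, OF Hb_seg'[OF assms(1)] this]
  ultimately show "z \<in> itin Hb u N ` {0..1}" by (rule rev_subsetD)
qed

text \<open>An increasing self-map of the unit interval that takes the value 0 takes it at 0. So for
  a cylinder of rank 0, which reaches the bottom, 0 is a fixed point of the return map.\<close>

lemma height_eq_0_iff:
  assumes "code u" "\<And>m. u (P + m) = u m" "0 < P"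
  shows "height u = 0 \<longleftrightarrow> cyl_rank (2 * P) u = 0"
proof
  assume "height u = 0"
  then show "cyl_rank (2 * P) u = 0" using height_in[OF assms(1), of "2 * P"] cyl_rank_ends[OF assms(1)] by metis
next
  assume "cyl_rank (2 * P) u = 0"
  then have "0 \<in> itin Hb u (2 * P) ` {0..1}" using cyl_rank_ends[OF assms(1)] by metis
  then obtain y where y: "0 \<le> y" "y \<le> 1" "itin Hb u (2 * P) y = 0" by auto
  have "itin Hb u (2 * P) 0 \<le> itin Hb u (2 * P) y" using seg_le_iff[OF return_seg[OF assms(1,2)], of 0 y] y by simp
  then have "itin Hb u (2 * P) 0 = 0" using y itin_range[OF assms(1), of 0 "2 * P"] by simp
  then show "height u = 0" using fixed_end_point[OF assms] by simp
qed

lemma height_eq_1_iff: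
  assumes "code u" "\<And>m. u (P + m) = u m" "0 < P"
  shows "height u = 1 \<longleftrightarrow> cyl_rank (2 * P) u = cyls D (2 * P) (u 0) - 1"
proof
  assume "height u = 1"
  then show "cyl_rank (2 * P) u = cyls D (2 * P) (u 0) - 1"
    using height_in[OF assms(1), of "2 * P"] cyl_rank_ends[OF assms(1)] by metis
next
  assume "cyl_rank (2 * P) u = cyls D (2 * P) (u 0) - 1"
  then have "1 \<in> itin Hb u (2 * P) ` {0..1}" using cyl_rank_ends[OF assms(1)] by metis
  then obtain y where y: "0 \<le> y" "y \<le> 1" "itin Hb u (2 * P) y = 1" by auto
  have "itin Hb u (2 * P) y \<le> itin Hb u (2 * P) 1" using seg_le_iff[OF return_seg[OF assms(1,2)], of y 1] y by simp
  then have "itin Hb u (2 * P) 1 = 1" using y itin_range[OF assms(1), of 1 "2 * P"] by simp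
  then show "height u = 1" using fixed_end_point[OF assms] by simp
qed

text \<open>If two distinct cylinders of the same depth shared the fixed points of their return maps, that
  point would be the top of one of them and the bottom of the other, hence both 1 and 0.\<close>

lemma height_less:
  assumes u: "code u" "\<And>m. u (P + m) = u m" and v: "code v" "\<And>m. v (P + m) = v m"
    and "u 0 = v 0" "cyl_rank (2 * P) u < cyl_rank (2 * P) v"
  shows "height u < height v"
proof -
  let ?U = "itin Hb u (2 * P)" and ?V = "itin Hb v (2 * P)"
  note ord = cyl_rank_ordered[OF u(1) v(1) assms(5,6)]
  note hu = height_range[OF u(1)] and hv = height_range[OF v(1)]
  have "height u \<le> height v"
    using ord[of "height u" "height v"] hu hv return_fixes[OF u] return_fixes[OF v] by simp
  moreover have "height u \<noteq> height v"
  proof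
    assume e: "height u = height v"
    have "?U 1 \<le> ?V (height v)" using ord[of 1 "height v"] hv by simp
    then have "?U 1 \<le> ?U (height u)" using return_fixes[OF u] return_fixes[OF v] e by simp
    then have 1: "height u = 1" using seg_le_iff[OF return_seg[OF u], of 1 "height u"] hu by simp
    have "?U (height u) \<le> ?V 0" using ord[of "height u" 0] hu by simp
    then have "?V (height v) \<le> ?V 0" using return_fixes[OF u] return_fixes[OF v] e by simp
    then have "height v = 0" using seg_le_iff[OF return_seg[OF v], of "height v" 0] hv by simp
    with 1 e show False by simp
  qed
  ultimately show ?thesis by simp
qed

text \<open>Equal ranks at depth \<open>2 * P\<close> give equal letters up to time
  \<open>2 * P\<close>, which covers a full period.\<close>

lemma cyl_rank_eqD:
  assumes "code u" "\<And>m. u (P + m) = u m" "code v" "\<And>m. v (P + m) = v m" "0 < P"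
    "u 0 = v 0" "cyl_rank (2 * P) u = cyl_rank (2 * P) v"
  shows "u = v"
proof
  fix m
  have "m mod P \<le> 2 * P" using assms(5) mod_less_divisor[of P m] by linarith
  then have "u (m mod P) = v (m mod P)" by (rule cyl_rank_inj[OF assms(1,3,6,7)])
  then show "u m = v m"
    using periodic_add[of u P "m div P" "m mod P", OF assms(2)] periodic_add[of v P "m div P" "m mod P", OF assms(4)] by simp
qed

lemma height_le_iff:
  assumes "code u" "\<And>m. u (P + m) = u m" "code v" "\<And>m. v (P + m) = v m" "0 < P" "u 0 = v 0"
  shows "height u \<le> height v \<longleftrightarrow> cyl_rank (2 * P) u \<le> cyl_rank (2 * P) v"
proof (cases "cyl_rank (2 * P) u" "cyl_rank (2 * P) v" rule: linorder_cases)
  case equal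
  then show ?thesis using cyl_rank_eqD[OF assms] by simp
next
  case less
  then show ?thesis using height_less[OF assms(1-4,6) less] by simp
next
  case greater
  then show ?thesis using height_less[OF assms(3,4,1,2) assms(6)[symmetric] greater] by simp
qed

end

section \<open>Cutting along a finite family of periodic codes\<close>

text \<open>Here \<open>U\<close> is the set of future itineraries of the given codes and of their iterates.\<close>

locale cut_dynamics = interval_dynamics +
  fixes U :: "(nat \<Rightarrow> nat) set"
  assumes finite_U: "finite U"
    and U_code: "u \<in> U \<Longrightarrow> code u"
    and U_shift: "u \<in> U \<Longrightarrow> (\<lambda>m. u (Suc m)) \<in> U"
begin

text \<open>Heights 0 and 1 are dropped because arcs at these heights already lie on the boundary of
  \<open>R_i\<close>.\<close>

definition cut_heights :: "nat \<Rightarrow> real set"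
  where "cut_heights i = height ` {u \<in> U. u 0 = i} \<inter> {0<..<1}"

definition num_pieces :: "nat \<Rightarrow> nat"
  where "num_pieces i = Suc (card (cut_heights i))"

definition cut_level :: "nat \<Rightarrow> nat \<Rightarrow> real"
  where "cut_level i h = (0 # sorted_list_of_set (cut_heights i) @ [1]) ! h"

text \<open>Together with \<open>fine_top\<close> this bounds the preimage in \<open>R_i\<close> of
  the \<open>h\<close>-th target piece; on a decreasing branch the upper level \<open>h\<close> of
  the target becomes the lower edge.\<close>

definition fine_bottom :: "nat \<Rightarrow> nat \<Rightarrow> nat \<Rightarrow> real"
  where "fine_bottom i j h = hb i j (cut_level (tgt D i j) (if incr D i j then h - 1 else h))"

definition fine_top :: "nat \<Rightarrow> nat \<Rightarrow> nat \<Rightarrow> real"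
  where "fine_top i j h = hb i j (cut_level (tgt D i j) (if incr D i j then h else h - 1))"

definition piece_index :: "nat \<Rightarrow> nat \<Rightarrow> nat \<Rightarrow> nat"
  where "piece_index i j h = Suc (card {c \<in> cut_heights i. c \<le> fine_bottom i j h})"

lemma finite_cut_heights: "finite (cut_heights i)"
  unfolding cut_heights_def using finite_U by simp

lemma cut_level_strict: "h < h' \<Longrightarrow> h' \<le> num_pieces i \<Longrightarrow> cut_level i h < cut_level i h'"
proof -
  let ?L = "0 # sorted_list_of_set (cut_heights i) @ [1]"
  have "sorted_wrt (<) ?L"
    using finite_cut_heights[of i] strict_sorted_list_of_set[of "cut_heights i"]
    by (auto simp: sorted_wrt_append cut_heights_def)
  then show "h < h' \<Longrightarrow> h' \<le> num_pieces i \<Longrightarrow> cut_level i h < cut_level i h'"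
    using sorted_wrt_nth_less[of "(<)" ?L h h'] unfolding cut_level_def num_pieces_def by simp
qed

lemma cut_level_less_iff: "h \<le> num_pieces i \<Longrightarrow> h' \<le> num_pieces i \<Longrightarrow> cut_level i h < cut_level i h' \<longleftrightarrow> h < h'"
  using cut_level_strict[of h h' i] cut_level_strict[of h' h i] by (cases h h' rule: linorder_cases) auto

lemma cut_level_le_iff: "h \<le> num_pieces i \<Longrightarrow> h' \<le> num_pieces i \<Longrightarrow> cut_level i h \<le> cut_level i h' \<longleftrightarrow> h \<le> h'"
  using cut_level_less_iff[of h' i h] by (simp add: not_less[symmetric] del: not_less linorder_not_less)

lemma cut_level_0 [simp]: "cut_level i 0 = 0"
  by (simp add: cut_level_def)

lemma cut_level_num_pieces [simp]: "cut_level i (num_pieces i) = 1"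
  by (simp add: cut_level_def num_pieces_def nth_append)

lemma cut_level_range: "h \<le> num_pieces i \<Longrightarrow> 0 \<le> cut_level i h \<and> cut_level i h \<le> 1"
  using cut_level_le_iff[of 0 i h] cut_level_le_iff[of h i "num_pieces i"] by simp

lemma cut_level_image: "cut_level i ` {1..<num_pieces i} = cut_heights i"
proof -
  have "cut_level i (Suc h) = sorted_list_of_set (cut_heights i) ! h" if "h < card (cut_heights i)" for h
    using that by (simp add: cut_level_def nth_append)
  then have "cut_level i ` Suc ` {..<card (cut_heights i)} = (!) (sorted_list_of_set (cut_heights i)) ` {..<card (cut_heights i)}"
    by (auto simp: image_iff)
  also have "\<dots> = set (sorted_list_of_set (cut_heights i))"
    by (simp add: set_conv_nth image_def) (auto intro: exI)
  also have "Suc ` {..<card (cut_heights i)} = {1..<num_pieces i}"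
    by (simp add: num_pieces_def lessThan_atLeast0)
  finally show ?thesis using finite_cut_heights by simp
qed

lemma height_level:
  assumes "u \<in> U"
  obtains h where "h \<le> num_pieces (u 0)" "height u = cut_level (u 0) h"
proof -
  consider "height u = 0" | "height u = 1" | "height u \<in> cut_heights (u 0)"
    using height_range[OF U_code[OF assms]] assms unfolding cut_heights_def by force
  then show ?thesis
  proof cases
    case 3
    then show ?thesis using that cut_level_image[of "u 0"] by (metis atLeastLessThan_iff imageE less_imp_le)
  qed (use that[of 0] that[of "num_pieces (u 0)"] in simp_all)
qed

context
  fixes i j h
  assumes ij: "i \<in> {1..length D}" "j \<in> {1..deg D i}" and h: "h \<in> {1..num_pieces (tgt D i j)}"
begin

lemma fine_levels:
  "0 \<le> cut_level (tgt D i j) (h - 1)" "cut_level (tgt D i j) (h - 1) < cut_level (tgt D i j) h"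
  "cut_level (tgt D i j) h \<le> 1" "0 \<le> cut_level (tgt D i j) h" "cut_level (tgt D i j) (h - 1) \<le> 1"
proof -
  have h': "h \<le> num_pieces (tgt D i j)" "h - 1 \<le> num_pieces (tgt D i j)" "h - 1 < h" using h by auto
  show "0 \<le> cut_level (tgt D i j) (h - 1)" "cut_level (tgt D i j) (h - 1) < cut_level (tgt D i j) h"
    "cut_level (tgt D i j) h \<le> 1" "0 \<le> cut_level (tgt D i j) h" "cut_level (tgt D i j) (h - 1) \<le> 1"
    using cut_level_range[OF h'(1)] cut_level_range[OF h'(2)] cut_level_strict[OF h'(3,1)] by blast+
qed

lemma fine_image_Ioo:
  "hb i j ` {cut_level (tgt D i j) (h - 1)<..<cut_level (tgt D i j) h} = {fine_bottom i j h<..<fine_top i j h}"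
  using seg_image_Ioo[OF hb_seg[OF ij] fine_levels(1) less_imp_le[OF fine_levels(2)] fine_levels(3)]
  unfolding fine_bottom_def fine_top_def by (cases "incr D i j") simp_all

lemma fine_bottom_less_top: "fine_bottom i j h < fine_top i j h"
  using seg_less_iff[OF hb_seg[OF ij] fine_levels(1,5,4,3)] seg_less_iff[OF hb_seg[OF ij] fine_levels(4,3,1,5)]
    fine_levels(2)
  unfolding fine_bottom_def fine_top_def by (cases "incr D i j") simp_all

lemma fine_range: "0 \<le> fine_bottom i j h" "fine_top i j h \<le> 1"
  using seg_range[OF hb_seg[OF ij] fine_levels(1,5)] seg_range[OF hb_seg[OF ij] fine_levels(4,3)]
  unfolding fine_bottom_def fine_top_def by (cases "incr D i j"; simp)+

text \<open>One step of the dynamics writes \<open>height u\<close> as the value of a branch at the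
  next height. Different branches are ordered by their index, equal ones by monotonicity. The test
  \<open>cut_below\<close> is this equivalence read in ranks.\<close>

lemma cut_le_fine_bottom_iff:
  assumes "u \<in> U" "u 0 = i"
  shows "height u \<le> fine_bottom i j h \<longleftrightarrow> branch D i (u 1) < j \<or> branch D i (u 1) = j \<and>
    (if incr D i j then height (\<lambda>m. u (Suc m)) \<le> cut_level (tgt D i j) (h - 1)
     else cut_level (tgt D i j) h \<le> height (\<lambda>m. u (Suc m)))"
proof -
  let ?b = "branch D i (u 1)" and ?v = "\<lambda>m. u (Suc m)"
  have c: "code u" "code ?v" using U_code U_shift assms by auto
  have b: "?b \<in> {1..deg D i}" using codeD(2)[OF c(1), of 0] assms(2) by simp
  have step: "height u = hb i ?b (height ?v)" using height_step[OF c(1)] assms(2) by simp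
  note r = height_range[OF c(2)]
  let ?l = "cut_level (tgt D i j)"
  have lr: "0 \<le> ?l (h - 1) \<and> ?l (h - 1) \<le> 1" "0 \<le> ?l h \<and> ?l h \<le> 1"
    using fine_levels by blast+
  show ?thesis
  proof (cases ?b j rule: linorder_cases)
    case less
    then have "height u \<le> fine_bottom i j h"
      unfolding step fine_bottom_def using hb_ordered[OF ij(1) b ij(2)] r lr by simp
    then show ?thesis using less by simp
  next
    case equal
    then show ?thesis
      unfolding step fine_bottom_def equal
      using seg_le_iff[OF hb_seg[OF ij], of "height ?v" "?l (h - 1)"] seg_le_iff[OF hb_seg[OF ij], of "height ?v" "?l h"] r lr
      by simp
  next
    case greater
    then have "fine_top i j h \<le> height u"
      unfolding step fine_top_def using hb_ordered[OF ij b] r lr by simp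
    then show ?thesis using greater fine_bottom_less_top by simp
  qed
qed

text \<open>No cut runs strictly inside a fine interval: a cut in the same branch is the preimage of
  the height of its shift, and this is 0, 1 or a cut height of the target because \<open>U\<close>
  is closed under the shift. It is the one-dimensional form of the Markov property.\<close>

lemma cut_ge_fine_top:
  assumes "u \<in> U" "u 0 = i" "fine_bottom i j h < height u"
  shows "fine_top i j h \<le> height u"
proof -
  let ?b = "branch D i (u 1)" and ?v = "\<lambda>m. u (Suc m)"
  have c: "code u" "code ?v" "?v \<in> U" using U_code U_shift assms by auto
  have b: "?b \<in> {1..deg D i}" using codeD(2)[OF c(1), of 0] assms(2) by simp
  have step: "height u = hb i ?b (height ?v)" using height_step[OF c(1)] assms(2) by simp
  note r = height_range[OF c(2)]
  let ?l = "cut_level (tgt D i j)"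
  have lr: "0 \<le> ?l (h - 1) \<and> ?l (h - 1) \<le> 1" "0 \<le> ?l h \<and> ?l h \<le> 1"
    using fine_levels by blast+
  note not = assms(3)[unfolded not_le[symmetric] cut_le_fine_bottom_iff[OF assms(1,2)]]
  show ?thesis
  proof (cases ?b j rule: linorder_cases)
    case less
    then show ?thesis using not by simp
  next
    case equal
    have t: "?v 0 = tgt D i j" using codeD(3)[OF c(1), of 0] assms(2) equal by simp
    obtain g where g: "g \<le> num_pieces (tgt D i j)" "height ?v = ?l g"
      using height_level[OF c(3)] unfolding t by blast
    have hh: "h - 1 \<le> num_pieces (tgt D i j)" "h \<le> num_pieces (tgt D i j)" using h by auto
    show ?thesis
    proof (cases "incr D i j")
      case True
      then have "\<not> ?l g \<le> ?l (h - 1)" using not equal g(2) by simp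
      then have "?l h \<le> ?l g" using cut_level_le_iff[OF g(1) hh(1)] cut_level_le_iff[OF hh(2) g(1)] by simp
      then show ?thesis unfolding step fine_top_def equal using True g(2) r lr seg_le_iff[OF hb_seg[OF ij], of "?l h" "height ?v"] by simp
    next
      case False
      then have "\<not> ?l h \<le> ?l g" using not equal g(2) by simp
      then have "?l g \<le> ?l (h - 1)" using cut_level_le_iff[OF g(1) hh(1)] cut_level_le_iff[OF hh(2) g(1)] by simp
      then show ?thesis unfolding step fine_top_def equal using False g(2) r lr seg_le_iff[OF hb_seg[OF ij], of "?l (h - 1)" "height ?v"] by simp
    qed
  next
    case greater
    then show ?thesis unfolding step fine_top_def using hb_ordered[OF ij b] r lr by simp
  qed
qed

lemma piece_index_range: "piece_index i j h \<in> {1..num_pieces i}"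
proof -
  have "card {c \<in> cut_heights i. c \<le> fine_bottom i j h} \<le> card (cut_heights i)"
    by (rule card_mono[OF finite_cut_heights]) auto
  then show ?thesis unfolding piece_index_def num_pieces_def by simp
qed

lemma card_cut_levels_below:
  assumes "g \<in> {1..num_pieces i}" "cut_level i (g - 1) \<le> z" "z < cut_level i g"
  shows "card {c \<in> cut_heights i. c \<le> z} = g - 1"
proof -
  have "{c \<in> cut_heights i. c \<le> z} = cut_level i ` {1..<g}"
  proof (intro equalityI subsetI)
    fix c assume "c \<in> {c \<in> cut_heights i. c \<le> z}"
    then obtain k where k: "k \<in> {1..<num_pieces i}" "c = cut_level i k" "c \<le> z" unfolding cut_level_image[symmetric] by auto
    then have "cut_level i k < cut_level i g" using assms(3) by simp
    then have "k < g" using cut_level_less_iff[of k i g] k assms(1) by simp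
    then show "c \<in> cut_level i ` {1..<g}" using k by auto
  next
    fix c assume "c \<in> cut_level i ` {1..<g}"
    then obtain k where k: "k \<in> {1..<g}" "c = cut_level i k" by auto
    then have "cut_level i k \<le> cut_level i (g - 1)" using cut_level_le_iff[of k i "g - 1"] assms(1) by auto
    then show "c \<in> {c \<in> cut_heights i. c \<le> z}" using k assms cut_level_image[of i] by auto
  qed
  moreover have "inj_on (cut_level i) {1..<g}"
  proof (rule inj_onI)
    fix a b assume "a \<in> {1..<g}" "b \<in> {1..<g}" "cut_level i a = cut_level i b"
    then show "a = b" using cut_level_less_iff[of a i b] cut_level_less_iff[of b i a] assms(1) by auto
  qed
  ultimately show ?thesis by (simp add: card_image)
qed

lemma piece_index_eqI:
  assumes "g \<in> {1..num_pieces i}" "cut_level i (g - 1) \<le> fine_bottom i j h" "fine_bottom i j h < cut_level i g"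
  shows "piece_index i j h = g"
  using card_cut_levels_below[OF assms] assms(1) unfolding piece_index_def by simp

lemma fine_in_piece:
  "cut_level i (piece_index i j h - 1) \<le> fine_bottom i j h" "fine_top i j h \<le> cut_level i (piece_index i j h)"
proof -
  have "fine_bottom i j h < 1" using fine_bottom_less_top fine_range by simp
  then have ex: "\<exists>g. g \<le> num_pieces i \<and> fine_bottom i j h < cut_level i g" by (intro exI[of _ "num_pieces i"]) simp
  \<comment> \<open>The lowest level above the fine bottom bounds the piece that contains it from
    above; it is not level 0, because the fine bottom is nonnegative.\<close>
  define g where "g = (LEAST g. g \<le> num_pieces i \<and> fine_bottom i j h < cut_level i g)"
  have g: "g \<le> num_pieces i" "fine_bottom i j h < cut_level i g" using LeastI_ex[OF ex] unfolding g_def by auto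
  have "g \<noteq> 0" using g(2) fine_range(1) by (intro notI) simp
  then have g1: "g \<in> {1..num_pieces i}" using g by auto
  have "g - 1 < g" using \<open>g \<noteq> 0\<close> by simp
  then have "\<not> (g - 1 \<le> num_pieces i \<and> fine_bottom i j h < cut_level i (g - 1))"
    unfolding g_def by (rule not_less_Least)
  moreover have "g - 1 \<le> num_pieces i" using g by simp
  ultimately have low: "cut_level i (g - 1) \<le> fine_bottom i j h" by (meson not_le)
  have e: "piece_index i j h = g" by (rule piece_index_eqI[OF g1 low g(2)])
  show "cut_level i (piece_index i j h - 1) \<le> fine_bottom i j h" using low e by simp
  show "fine_top i j h \<le> cut_level i (piece_index i j h)"
  proof (cases "g = num_pieces i")
    case True then show ?thesis using e fine_range by simp
  next
    case False
    then have "cut_level i g \<in> cut_heights i" using g1 cut_level_image[of i] by auto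
    then obtain u where "u \<in> U" "u 0 = i" "cut_level i g = height u" unfolding cut_heights_def by auto
    then show ?thesis using cut_ge_fine_top g(2) e by simp
  qed
qed

end

end

section \<open>Agreement of the computed cuts with the heights\<close>

text \<open>Blocks of at most one element are what makes the order strict: two elements of one block
  would have the same value of \<open>R\<close>.\<close>

lemma sorted_wrt_concat_blocks:
  assumes "sorted_wrt (<) bs" "\<And>b p. b \<in> set bs \<Longrightarrow> p \<in> set (F b) \<Longrightarrow> R p = b"
    "\<And>b. b \<in> set bs \<Longrightarrow> length (F b) \<le> Suc 0"
  shows "sorted_wrt (\<lambda>p q. R p < (R q :: nat)) (concat (map F bs))"
  using assms
proof (induction bs)
  case (Cons b bs)
  have "sorted_wrt (\<lambda>p q. R p < R q) (F b)" using Cons.prems(3)[of b] by (cases "F b") auto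
  moreover have "sorted_wrt (\<lambda>p q. R p < R q) (concat (map F bs))"
    using Cons.prems by (intro Cons.IH) simp_all
  moreover have "R p < R q" if "p \<in> set (F b)" "q \<in> set (concat (map F bs))" for p q
  proof -
    obtain c where c: "c \<in> set bs" "q \<in> set (F c)" using \<open>q \<in> _\<close> by auto
    have "b < c" using Cons.prems(1) c(1) by simp
    moreover have "R p = b" using Cons.prems(2)[of b p] that(1) by simp
    moreover have "R q = c" using Cons.prems(2)[of c q] c by simp
    ultimately show ?thesis by simp
  qed
  ultimately show ?case by (simp add: sorted_wrt_append)
qed simp

lemma length_first_of: "length (first_of xs) \<le> Suc 0"
  by (simp add: first_of_def)

lemma set_first_of: "set (first_of xs) \<subseteq> set xs"
  by (auto simp: first_of_def nth_default_def)

lemma first_of_ex: "x \<in> set xs \<Longrightarrow> \<exists>p. p \<in> set (first_of xs)"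
  by (cases xs) (auto simp: first_of_def)

locale presented_cuts = cut_dynamics +
  fixes us :: "nat list list"
  assumes words: "[] \<notin> set us"
    and U_eq: "U = {\<lambda>m. symbol us q (t + m) | q t. q < length us}"
begin

definition word_period :: nat
  where "word_period = prod_list (map length us)"

definition arc_code :: "nat \<times> nat \<Rightarrow> nat \<Rightarrow> nat"
  where "arc_code p = (\<lambda>m. symbol us (fst p) (snd p + m))"

abbreviation arc_rank :: "nat \<times> nat \<Rightarrow> nat"
  where "arc_rank p \<equiv> rank D us (fst p) (snd p)"

lemma word_period_pos: "0 < word_period"
  using words unfolding word_period_def by (induction us) auto

lemma symbol_period: "symbol us q (word_period + t) = symbol us q t"
proof (cases "q < length us")
  case True
  then have "length (us ! q) dvd word_period"
    unfolding word_period_def by (intro prod_list_dvd) simp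
  then obtain k where "word_period = length (us ! q) * k" ..
  then have "(word_period + t) mod length (us ! q) = t mod length (us ! q)" by simp
  then show ?thesis using True by (simp add: symbol_def nth_default_def)
qed (simp add: symbol_def nth_default_def)

lemma arc_code_period: "arc_code p (word_period + m) = arc_code p m"
  using symbol_period[of "fst p" "snd p + m"] by (simp add: arc_code_def add.left_commute)

lemma arc_code_0 [simp]: "arc_code p 0 = symbol us (fst p) (snd p)"
  by (simp add: arc_code_def)

lemma arc_code_Suc: "(\<lambda>m. arc_code p (Suc m)) = arc_code (fst p, Suc (snd p))"
  by (simp add: arc_code_def)

lemma arc_code_U: "fst p < length us \<Longrightarrow> arc_code p \<in> U"
  unfolding U_eq arc_code_def by blast

lemma code_arc_code: "fst p < length us \<Longrightarrow> code (arc_code p)"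
  using arc_code_U U_code by blast

lemma depth_eq: "depth us = 2 * word_period"
  by (simp add: depth_def word_period_def)

lemma rank_eq: "arc_rank p = cyl_rank (2 * word_period) (arc_code p)"
proof -
  let ?Q = "2 * word_period" and ?q = "fst p" and ?t = "snd p"
  have "rec_nat 0 (\<lambda>N b. below_step D N (symbol us ?q (?t + (?Q - Suc N))) (symbol us ?q (Suc (?t + (?Q - Suc N)))) b) N
      = cyl_rank N (arc_code (?q, ?t + (?Q - N)))" if "N \<le> ?Q" for N
    using that
  proof (induction N)
    case (Suc N)
    have e: "Suc (?t + (?Q - Suc N)) = ?t + (?Q - N)" using Suc.prems by simp
    have "(\<lambda>m. arc_code (?q, ?t + (?Q - Suc N)) (Suc m)) = arc_code (?q, ?t + (?Q - N))"
      unfolding arc_code_Suc fst_conv snd_conv e ..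
    moreover have "arc_code (?q, ?t + (?Q - Suc N)) (Suc 0) = symbol us ?q (Suc (?t + (?Q - Suc N)))"
      by (simp add: arc_code_def)
    ultimately show ?case using Suc by simp
  qed simp
  from this[of ?Q] show ?thesis unfolding rank_def depth_eq by simp
qed

lemma arc_rank_le_iff:
  assumes "fst p < length us" "fst q < length us" "symbol us (fst p) (snd p) = symbol us (fst q) (snd q)"
  shows "arc_rank p \<le> arc_rank q \<longleftrightarrow> height (arc_code p) \<le> height (arc_code q)"
  unfolding rank_eq using height_le_iff[OF code_arc_code[OF assms(1)] arc_code_period code_arc_code[OF assms(2)] arc_code_period]
    word_period_pos assms(3) by simp

lemma arc_rank_eq_0_iff: "fst p < length us \<Longrightarrow> arc_rank p = 0 \<longleftrightarrow> height (arc_code p) = 0"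
  unfolding rank_eq using height_eq_0_iff[OF code_arc_code arc_code_period word_period_pos] by simp

lemma arc_rank_eq_top_iff:
  "fst p < length us \<Longrightarrow> arc_rank p = cyls D (depth us) (symbol us (fst p) (snd p)) - 1 \<longleftrightarrow> height (arc_code p) = 1"
  unfolding rank_eq depth_eq using height_eq_1_iff[OF code_arc_code arc_code_period word_period_pos] by simp

lemma arc_rank_less:
  "fst p < length us \<Longrightarrow> arc_rank p < cyls D (depth us) (symbol us (fst p) (snd p))"
  unfolding rank_eq depth_eq using cyl_rank_less[OF code_arc_code] by simp

lemma set_cut_list:
  assumes "p \<in> set (cut_list D us i)"
  shows "fst p < length us" "symbol us (fst p) (snd p) = i" "height (arc_code p) \<in> cut_heights i"
proof -
  obtain b where b: "b \<in> {1..<cyls D (depth us) i - 1}"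
    "p \<in> set (first_of (filter (\<lambda>p. symbol us (fst p) (snd p) = i \<and> arc_rank p = b) (arcs us)))"
    using assms unfolding cut_list_def by auto
  then have p: "p \<in> set (arcs us)" "symbol us (fst p) (snd p) = i" "arc_rank p = b" using set_first_of by fastforce+
  then show q: "fst p < length us" "symbol us (fst p) (snd p) = i" by (auto simp: arcs_def)
  have "height (arc_code p) \<noteq> 0" "height (arc_code p) \<noteq> 1"
    using arc_rank_eq_0_iff[OF q(1)] arc_rank_eq_top_iff[OF q(1)] p b(1) by auto
  then show "height (arc_code p) \<in> cut_heights i"
    using height_range[OF code_arc_code[OF q(1)]] arc_code_U[OF q(1)] q(2) unfolding cut_heights_def by force
qed

text \<open>Both lists are strictly increasing, the first because ranks order heights, so it
  suffices to compare their sets.\<close>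

lemma cut_list_heights: "map (\<lambda>p. height (arc_code p)) (cut_list D us i) = sorted_list_of_set (cut_heights i)"
proof (rule strict_sorted_equal)
  have "sorted_wrt (\<lambda>p q. arc_rank p < arc_rank q) (cut_list D us i)"
    unfolding cut_list_def
  proof (rule sorted_wrt_concat_blocks)
    fix b p assume "p \<in> set (first_of (filter (\<lambda>p. symbol us (fst p) (snd p) = i \<and> arc_rank p = b) (arcs us)))"
    then show "arc_rank p = b" using set_first_of by fastforce
  qed (simp_all add: length_first_of)
  then have "sorted_wrt (\<lambda>p q. height (arc_code p) < height (arc_code q)) (cut_list D us i)"
  proof (rule sorted_wrt_mono_rel[rotated])
    fix p q assume pq: "p \<in> set (cut_list D us i)" "q \<in> set (cut_list D us i)" "arc_rank p < arc_rank q"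
    then have "\<not> arc_rank q \<le> arc_rank p" by simp
    then show "height (arc_code p) < height (arc_code q)"
      using arc_rank_le_iff[of q p] set_cut_list[OF pq(1)] set_cut_list[OF pq(2)] by simp
  qed
  then show "sorted_wrt (<) (map (\<lambda>p. height (arc_code p)) (cut_list D us i))" by (simp add: sorted_wrt_map)
  show "set (map (\<lambda>p. height (arc_code p)) (cut_list D us i)) = set (sorted_list_of_set (cut_heights i))"
    unfolding sorted_list_of_set.set_sorted_key_list_of_set[OF finite_cut_heights] set_map
  proof (intro equalityI subsetI)
    fix c assume "c \<in> (\<lambda>p. height (arc_code p)) ` set (cut_list D us i)"
    then show "c \<in> cut_heights i" using set_cut_list(3) by blast
  next
    fix c assume c: "c \<in> cut_heights i"
    then obtain u where u: "u \<in> U" "u 0 = i" "c = height u" "0 < c" "c < 1" unfolding cut_heights_def by auto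
    then obtain q t where q: "u = (\<lambda>m. symbol us q (t + m))" "q < length us" unfolding U_eq by blast
    \<comment> \<open>\<open>arcs\<close> lists the times of a single pass through each word; the
      reduced time has the same future.\<close>
    let ?t = "t mod length (us ! q)"
    have len: "0 < length (us ! q)" using words q(2) by (metis length_greater_0_conv nth_mem)
    have "symbol us q (?t + m) = symbol us q (t + m)" for m
      using q(2) by (simp add: symbol_def nth_default_def mod_add_left_eq)
    then have eq: "arc_code (q, ?t) = u" unfolding arc_code_def q(1) by simp
    have arc: "(q, ?t) \<in> set (arcs us)" using q(2) len by (auto simp: arcs_def nth_default_def intro!: bexI[of _ q] imageI)
    have s: "symbol us q ?t = i" using u(2) eq arc_code_0[of "(q, ?t)"] by simp
    let ?b = "arc_rank (q, ?t)"
    have ends: "?b \<noteq> 0" "?b \<noteq> cyls D (depth us) i - 1" "?b < cyls D (depth us) i"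
      using arc_rank_eq_0_iff[of "(q, ?t)"] arc_rank_eq_top_iff[of "(q, ?t)"] arc_rank_less[of "(q, ?t)"] q(2) eq s u by auto
    then have b: "?b \<in> set [1..<cyls D (depth us) i - 1]" by auto
    let ?F = "filter (\<lambda>p. symbol us (fst p) (snd p) = i \<and> arc_rank p = ?b) (arcs us)"
    have "(q, ?t) \<in> set ?F" using arc s by simp
    then have "\<exists>p. p \<in> set (first_of ?F)" by (rule first_of_ex)
    then obtain p where p: "p \<in> set (first_of ?F)" ..
    then have pp: "p \<in> set (cut_list D us i)"
      unfolding cut_list_def set_concat set_map UN_iff by (intro bexI[OF _ imageI[OF b]])
    have "p \<in> set ?F" using p set_first_of by (rule rev_subsetD)
    then have "arc_rank p = ?b" by simp
    \<comment> \<open>The representative kept by \<open>first_of\<close> may be another arc of the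
      same rank; equal ranks mean equal heights.\<close>
    then have "height (arc_code p) = height (arc_code (q, ?t))"
      using arc_rank_le_iff[of p "(q, ?t)"] arc_rank_le_iff[of "(q, ?t)" p] set_cut_list[OF pp] s q(2) by simp
    then show "c \<in> (\<lambda>p. height (arc_code p)) ` set (cut_list D us i)" using pp eq u(3) by (intro image_eqI[of _ _ p]) simp_all
  qed
qed (rule strict_sorted_list_of_set)

lemma length_cut_list: "length (cut_list D us i) = card (cut_heights i)"
  using arg_cong[OF cut_list_heights[of i], of length] by simp

lemma pieces_eq: "pieces D us = num_pieces"
  by (rule ext) (simp add: pieces_def num_pieces_def length_cut_list)

lemma cut_list_nth:
  assumes "h \<in> {1..<num_pieces i}"
  shows "cut_list D us i ! (h - 1) \<in> set (cut_list D us i)"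
    "height (arc_code (cut_list D us i ! (h - 1))) = cut_level i h"
proof -
  have h: "h - 1 < length (cut_list D us i)" using assms by (auto simp: length_cut_list num_pieces_def)
  then show "cut_list D us i ! (h - 1) \<in> set (cut_list D us i)" by (rule nth_mem)
  have "height (arc_code (cut_list D us i ! (h - 1))) = map (\<lambda>p. height (arc_code p)) (cut_list D us i) ! (h - 1)"
    using h by simp
  also have "\<dots> = sorted_list_of_set (cut_heights i) ! (h - 1)" unfolding cut_list_heights ..
  also have "\<dots> = cut_level i h"
    using assms h by (auto simp: cut_level_def nth_Cons' nth_append length_cut_list)
  finally show "height (arc_code (cut_list D us i ! (h - 1))) = cut_level i h" .
qed

text \<open>Stated for arbitrary arcs of the family and not only for the selected cuts: the shift of
  a cut need not be a kept representative, and its height may be 0 or 1.\<close>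

lemma level_iff:
  assumes "fst p < length us" "symbol us (fst p) (snd p) = k" "h \<le> num_pieces k"
  shows "arc_rank p \<le> level D us k h \<longleftrightarrow> height (arc_code p) \<le> cut_level k h"
    "level D us k h \<le> arc_rank p \<longleftrightarrow> cut_level k h \<le> height (arc_code p)"
proof -
  note hr = height_range[OF code_arc_code[OF assms(1)]]
  have "(arc_rank p \<le> level D us k h \<longleftrightarrow> height (arc_code p) \<le> cut_level k h) \<and>
    (level D us k h \<le> arc_rank p \<longleftrightarrow> cut_level k h \<le> height (arc_code p))"
  proof -
    consider "h = 0" | "h = num_pieces k" | "h \<in> {1..<num_pieces k}" using assms(3) by force
    then show ?thesis
    proof cases
      case 1
      then have "level D us k h = 0" by (simp add: level_def nth_default_def)
      then show ?thesis using 1 arc_rank_eq_0_iff[OF assms(1)] hr by auto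
    next
      case 2
      then have "level D us k h = cyls D (depth us) k - 1"
        by (simp add: level_def nth_default_def num_pieces_def length_cut_list nth_append)
      then show ?thesis
        using 2 arc_rank_eq_top_iff[OF assms(1)] arc_rank_less[OF assms(1)] hr assms(2) by auto
    next
      case 3
      let ?c = "cut_list D us k ! (h - 1)"
      note c = cut_list_nth[OF 3]
      have "level D us k h = arc_rank ?c"
        using 3 by (auto simp: level_def nth_default_def num_pieces_def length_cut_list nth_append nth_Cons')
      then show ?thesis
        using arc_rank_le_iff[of p ?c] arc_rank_le_iff[of ?c p] assms(1,2) set_cut_list[OF c(1)] c(2) by simp
    qed
  qed
  then show "arc_rank p \<le> level D us k h \<longleftrightarrow> height (arc_code p) \<le> cut_level k h"
    "level D us k h \<le> arc_rank p \<longleftrightarrow> cut_level k h \<le> height (arc_code p)" by blast+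
qed

text \<open>The program tests ranks, the definition compares real heights. The tests agree cut by
  cut, and since the list of heights has no repetitions, counting its entries gives the
  cardinality.\<close>

lemma piece_of_eq:
  assumes ij: "i \<in> {1..length D}" "j \<in> {1..deg D i}" and h: "h \<in> {1..num_pieces (tgt D i j)}"
  shows "piece_of D us i j h = piece_index i j h"
proof -
  let ?hgt = "\<lambda>p. height (arc_code p)"
  have below: "cut_below D us i j h p \<longleftrightarrow> ?hgt p \<le> fine_bottom i j h" if "p \<in> set (cut_list D us i)" for p
  proof -
    note p = set_cut_list[OF that]
    let ?s = "(fst p, Suc (snd p))"
    have s1: "arc_code p (Suc 0) = symbol us (fst ?s) (snd ?s)" by (simp add: arc_code_def)
    have eq: "branch D i (symbol us (fst p) (Suc (snd p))) = j \<Longrightarrow> symbol us (fst ?s) (snd ?s) = tgt D i j"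
      using codeD(3)[OF code_arc_code[OF p(1)], of 0] s1 p(2) by simp
    have hh: "h - 1 \<le> num_pieces (tgt D i j)" "h \<le> num_pieces (tgt D i j)" using h by auto
    have iff: "?hgt p \<le> fine_bottom i j h \<longleftrightarrow> branch D i (arc_code p 1) < j \<or> branch D i (arc_code p 1) = j \<and>
      (if incr D i j then height (arc_code ?s) \<le> cut_level (tgt D i j) (h - 1)
       else cut_level (tgt D i j) h \<le> height (arc_code ?s))"
      using cut_le_fine_bottom_iff[OF ij h arc_code_U[OF p(1)]] p(2) unfolding arc_code_Suc by simp
    show ?thesis
      unfolding iff cut_below_def using level_iff[of ?s "tgt D i j" "h - 1"] level_iff[of ?s "tgt D i j" h] p(1) hh eq s1
      by auto
  qed
  have "length (filter (cut_below D us i j h) (cut_list D us i)) = length (filter (\<lambda>p. ?hgt p \<le> fine_bottom i j h) (cut_list D us i))"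
    by (rule arg_cong[of _ _ length], rule filter_cong[OF refl], rule below)
  also have "\<dots> = length (filter (\<lambda>c. c \<le> fine_bottom i j h) (map ?hgt (cut_list D us i)))"
    by (simp add: filter_map o_def)
  also have "\<dots> = card (set (filter (\<lambda>c. c \<le> fine_bottom i j h) (sorted_list_of_set (cut_heights i))))"
    unfolding cut_list_heights by (rule distinct_card[symmetric]) simp
  also have "\<dots> = card {c \<in> cut_heights i. c \<le> fine_bottom i j h}"
    using finite_cut_heights[of i] by simp
  finally show ?thesis by (simp add: piece_of_def piece_index_def)
qed

text \<open>The two locators agree on admissible indices only, and the lists contain no
  others.\<close>

lemma refined_rows_eq:
  "refined_rows D (pieces D us) (piece_of D us) = refined_rows D num_pieces piece_index"
proof -
  have "refined_row D num_pieces (piece_of D us) i g = refined_row D num_pieces piece_index i g"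
    if "i \<in> {1..length D}" for i g
  proof -
    have "strip_list D num_pieces (piece_of D us) i g = strip_list D num_pieces piece_index i g"
      unfolding strip_list_def
    proof (rule filter_cong[OF refl])
      fix p assume "p \<in> set (fine_list D num_pieces i)"
      then have "fst p \<in> {1..deg D i}" "snd p \<in> {1..num_pieces (tgt D i (fst p))}"
        by (auto simp: fine_list_def less_Suc_eq_le split: if_splits)
      then show "(piece_of D us i (fst p) (snd p) = g) = (piece_index i (fst p) (snd p) = g)"
        using piece_of_eq[OF that] by simp
    qed
    then show ?thesis unfolding refined_row_def by simp
  qed
  then show ?thesis unfolding refined_rows_def pieces_eq
    by (intro map_cong refl) (auto simp: block_list_def less_Suc_eq_le)
qed

end

section \<open>Leaves and plaques\<close>

lemma leaf_sym: "y \<in> leaf \<A> x \<Longrightarrow> x \<in> leaf \<A> y"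
proof -
  have "sym ((\<Union>c\<in>\<A>. \<Union>P\<in>plaques c. P \<times> P)\<^sup>*)"
    by (rule sym_rtrancl) (auto simp: sym_def)
  then show "y \<in> leaf \<A> x \<Longrightarrow> x \<in> leaf \<A> y" unfolding leaf_def mem_Collect_eq by (rule symD)
qed

lemma leaf_trans: "y \<in> leaf \<A> x \<Longrightarrow> z \<in> leaf \<A> y \<Longrightarrow> z \<in> leaf \<A> x"
  unfolding leaf_def mem_Collect_eq by (rule rtrancl_trans)

lemma leaf_self: "x \<in> leaf \<A> x"
  unfolding leaf_def by simp

lemma leaf_eq: "y \<in> leaf \<A> x \<Longrightarrow> leaf \<A> y = leaf \<A> x"
  by (intro equalityI subsetI) (erule (1) leaf_trans, erule leaf_trans[OF leaf_sym])

lemma leaf_plaque: "c \<in> \<A> \<Longrightarrow> P \<in> plaques c \<Longrightarrow> x \<in> P \<Longrightarrow> y \<in> P \<Longrightarrow> y \<in> leaf \<A> x"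
  unfolding leaf_def by (blast intro: r_into_rtrancl)

lemma leaf_subset:
  assumes "singular_foliation S \<A>" "x \<in> S"
  shows "leaf \<A> x \<subseteq> S"
proof
  fix y assume "y \<in> leaf \<A> x"
  then have "(x, y) \<in> (\<Union>c\<in>\<A>. \<Union>P\<in>plaques c. P \<times> P)\<^sup>*" unfolding leaf_def by simp
  then show "y \<in> S"
  proof (induction rule: rtrancl_induct)
    case (step y z)
    then obtain k U \<phi> P where "(k, U, \<phi>) \<in> \<A>" "P \<in> plaques (k, U, \<phi>)" "z \<in> P" by auto
    moreover from this have "openin (top_of_set S) U" using assms(1) unfolding singular_foliation_def by fast
    ultimately show ?case unfolding plaques_def using openin_imp_subset by fastforce
  qed (rule assms(2))
qed

lemma plaque_in_self: "x \<in> D \<Longrightarrow> x \<in> plaque_in \<A> D x"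
  unfolding plaque_in_def using leaf_self by (simp add: connected_component_refl_eq)

lemma plaque_in_maximal:
  assumes "connected T" "x \<in> T" "T \<subseteq> leaf \<A> x" "T \<subseteq> D"
  shows "T \<subseteq> plaque_in \<A> D x"
  unfolding plaque_in_def using assms by (intro connected_component_maximal) auto

lemma plaque_in_mono: "D' \<subseteq> D \<Longrightarrow> plaque_in \<A> D' x \<subseteq> plaque_in \<A> D x"
  unfolding plaque_in_def by (rule connected_component_mono) auto

lemma plaque_in_subset: "plaque_in \<A> D x \<subseteq> leaf \<A> x \<inter> D"
  unfolding plaque_in_def by (rule connected_component_subset)

text \<open>For two prongs the model level function is \<open>2 (Im z)\<^sup>2\<close>.\<close>

lemma chord_in_plaque:
  assumes "homeomorphism V (ball 0 1) \<psi> \<psi>'" "K \<subseteq> ball 0 1" "connected K" "K \<noteq> {}" "\<And>z. z \<in> K \<Longrightarrow> Im z = v"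
  obtains P where "P \<in> plaques (2, V, \<psi>)" "\<psi>' ` K \<subseteq> P"
proof -
  have lev: "cmod z ^ 2 - Re (z ^ 2) = 2 * (Im z)\<^sup>2" for z by (simp add: cmod_power2 Re_power2)
  let ?L = "{z \<in> ball 0 1. cmod z ^ 2 - Re (z ^ 2) = 2 * v\<^sup>2}"
  have "K \<subseteq> ?L" using assms(2,5) unfolding lev by auto
  then obtain C where C: "C \<in> components ?L" "K \<subseteq> C"
    using exists_component_superset[of K ?L] assms(3,4) by blast
  have "V \<inter> \<psi> -` C \<in> plaques (2, V, \<psi>)"
    unfolding plaques_def model_plaques_def using C(1) by auto
  moreover have "\<psi>' ` K \<subseteq> V \<inter> \<psi> -` C"
    using C(2) assms(1,2) unfolding homeomorphism_def by (auto simp: subset_iff)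
  ultimately show ?thesis using that by blast
qed

lemma plaque_level:
  assumes "P \<in> plaques (k, U, \<phi>)"
  obtains c where "P \<subseteq> U" "\<And>q. q \<in> P \<Longrightarrow> cmod (\<phi> q) ^ k - Re (\<phi> q ^ k) = c"
proof -
  obtain C c where C: "C \<in> components {z \<in> ball 0 1. cmod z ^ k - Re (z ^ k) = c}" "P = U \<inter> \<phi> -` C"
    using assms unfolding plaques_def model_plaques_def by auto
  then have "C \<subseteq> {z \<in> ball 0 1. cmod z ^ k - Re (z ^ k) = c}" using in_components_subset by blast
  then show ?thesis using that[of c] C(2) by auto
qed

lemma chart_ball:
  fixes \<psi> :: "'a::t2_space \<Rightarrow> complex"
  assumes "openin (top_of_set S) V" "homeomorphism V (ball 0 1) \<psi> \<psi>'" "openin (top_of_set S) N"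
    "q \<in> N" "q \<in> V" "\<psi> q = 0"
  obtains \<delta> where "0 < \<delta>" "\<delta> \<le> 1" "\<psi>' ` ball 0 \<delta> \<subseteq> N \<inter> V" "openin (top_of_set S) (\<psi>' ` ball 0 \<delta>)" "q \<in> \<psi>' ` ball 0 \<delta>"
proof -
  have "openin (top_of_set V) (N \<inter> V)"
    using assms(1,3) openin_Int openin_imp_subset openin_subset_trans by (metis inf_le2)
  then have "openin (top_of_set (ball 0 1)) (\<psi> ` (N \<inter> V))"
    using homeomorphism_imp_open_map[OF assms(2)] by blast
  then have "open (\<psi> ` (N \<inter> V))" using openin_open_trans by blast
  moreover have "0 \<in> \<psi> ` (N \<inter> V)" using assms(4-6) by force
  ultimately obtain e where e: "0 < e" "ball 0 e \<subseteq> \<psi> ` (N \<inter> V)" by (meson openE)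
  define \<delta> where "\<delta> = min e 1"
  have \<delta>: "0 < \<delta>" "\<delta> \<le> 1" "ball 0 \<delta> \<subseteq> \<psi> ` (N \<inter> V)" using e by (auto simp: \<delta>_def subset_iff)
  have "\<psi>' ` ball 0 \<delta> \<subseteq> N \<inter> V"
  proof
    fix w assume "w \<in> \<psi>' ` ball 0 \<delta>"
    then obtain x where "x \<in> N \<inter> V" "w = \<psi>' (\<psi> x)" using \<delta>(3) by blast
    then show "w \<in> N \<inter> V" using assms(2) unfolding homeomorphism_def by auto
  qed
  moreover have "openin (top_of_set S) (\<psi>' ` ball 0 \<delta>)"
  proof -
    have "openin (top_of_set (ball 0 1)) (ball (0::complex) \<delta>)"
      using subset_ball[OF \<delta>(2), of "0::complex"] openin_open_eq[OF open_ball] open_ball by blast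
    then have "openin (top_of_set V) (\<psi>' ` ball 0 \<delta>)"
      by (rule homeomorphism_imp_open_map[OF homeomorphism_symD[OF assms(2)]])
    from openin_trans[OF this assms(1)] show ?thesis .
  qed
  moreover have "q \<in> \<psi>' ` ball 0 \<delta>"
  proof (rule image_eqI[where x = 0])
    show "q = \<psi>' 0" using assms(2,5,6) unfolding homeomorphism_def by metis
  qed (use \<delta>(1) in simp)
  ultimately show ?thesis using that \<delta>(1,2) by blast
qed

text \<open>The zero level of the \<open>k\<close>-prong model is a star of rays, and turning a
  nonzero point by a small angle leaves it. This excludes that a box is absorbed by the star of a
  singularity.\<close>

lemma no_open_star:
  fixes T :: "complex set"
  assumes "open T" "T \<noteq> {}" "1 \<le> k"
  shows "\<exists>z\<in>T. cmod z ^ k - Re (z ^ k) \<noteq> 0"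
proof (rule ccontr)
  assume "\<not> ?thesis"
  then have star: "Re (z ^ k) = cmod z ^ k" if "z \<in> T" for z using that by force
  have "T \<noteq> {0}" using assms(1) not_open_singleton[of "0::complex"] by metis
  then obtain z where z: "z \<in> T" "z \<noteq> 0" using assms(2) by blast
  let ?g = "\<lambda>t::real. z * cis t"
  have "continuous_on UNIV ?g" by (intro continuous_intros)
  then have "open (?g -` T)" using assms(1) by (simp add: open_vimage)
  moreover have "0 \<in> ?g -` T" using z by simp
  ultimately obtain e where e: "0 < e" "ball 0 e \<subseteq> ?g -` T" by (meson openE)
  \<comment> \<open>The bound keeps \<open>k * t\<close> positive and at most pi / 2, where the
    cosine is below 1.\<close>
  define t where "t = min (e / 2) (pi / (2 * k))"
  have t: "0 < t" "t < e" using e assms(3) by (auto simp: t_def)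
  have "k * t \<le> k * (pi / (2 * k))" unfolding t_def by (intro mult_left_mono) auto
  also have "\<dots> = pi / 2" using assms(3) by (simp add: field_simps)
  finally have kt: "k * t \<le> pi / 2" .
  have "t \<in> ball 0 e" using t by simp
  then have "z * cis t \<in> T" using e by auto
  then have "Re ((z * cis t) ^ k) = cmod (z * cis t) ^ k" by (rule star)
  moreover have "(z * cis t) ^ k = z ^ k * cis (k * t)" by (simp only: power_mult_distrib Complex.DeMoivre)
  moreover have "cmod (z * cis t) = cmod z" by (simp add: norm_mult)
  ultimately have 1: "Re (z ^ k * cis (k * t)) = cmod z ^ k" by (simp only:)
  have re: "Re (z ^ k) = cmod z ^ k" using star z by blast
  moreover have "cmod (z ^ k) = cmod z ^ k" by (simp add: norm_power)
  ultimately have "(Re (z ^ k))\<^sup>2 + (Im (z ^ k))\<^sup>2 = (Re (z ^ k))\<^sup>2" using cmod_power2[of "z ^ k"] by (simp only:)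
  then have "Im (z ^ k) = 0" by simp
  then have "cmod z ^ k * cos (k * t) = cmod z ^ k" using 1 re by simp
  then have "cos (k * t) = 1" using z by simp
  moreover have "0 < k * t" "k * t \<le> pi" using t kt assms(3) pi_gt_zero by (simp, linarith)
  then have "cos (k * t) < cos 0" by (intro cos_monotone_0_pi) auto
  ultimately show False by simp
qed

section \<open>Product rectangles\<close>

text \<open>A rectangle in coordinates, with the two foliations \<open>A\<close> (horizontal) and \<open>B\<close> (vertical)
  interchangeable. Orientations play no role here.\<close>

locale product_rectangle =
  fixes S :: "'a::t2_space set" and A B :: "'a foliated_chart set" and \<rho> :: "real \<Rightarrow> real \<Rightarrow> 'a"
  assumes cont: "continuous_on ({0..1} \<times> {0..1}) (\<lambda>p. \<rho> (fst p) (snd p))"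
    and homeo: "\<exists>g. homeomorphism ({0<..<1} \<times> {0<..<1}) ((\<lambda>p. \<rho> (fst p) (snd p)) ` ({0<..<1} \<times> {0<..<1}))
      (\<lambda>p. \<rho> (fst p) (snd p)) g"
    and openin_S: "openin (top_of_set S) ((\<lambda>p. \<rho> (fst p) (snd p)) ` ({0<..<1} \<times> {0<..<1}))"
    and in_S: "0 \<le> x \<Longrightarrow> x \<le> 1 \<Longrightarrow> 0 \<le> y \<Longrightarrow> y \<le> 1 \<Longrightarrow> \<rho> x y \<in> S"
    and A_leaf: "0 \<le> x \<Longrightarrow> x \<le> 1 \<Longrightarrow> 0 \<le> x' \<Longrightarrow> x' \<le> 1 \<Longrightarrow> 0 \<le> y \<Longrightarrow> y \<le> 1 \<Longrightarrow> \<rho> x' y \<in> leaf A (\<rho> x y)"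
    and B_leaf: "0 \<le> x \<Longrightarrow> x \<le> 1 \<Longrightarrow> 0 \<le> y \<Longrightarrow> y \<le> 1 \<Longrightarrow> 0 \<le> y' \<Longrightarrow> y' \<le> 1 \<Longrightarrow> \<rho> x y' \<in> leaf B (\<rho> x y)"
    and meet_once: "\<And>p q D. D = (\<lambda>p. \<rho> (fst p) (snd p)) ` ({0<..<1} \<times> {0<..<1}) \<Longrightarrow> p \<in> D \<Longrightarrow> q \<in> D \<Longrightarrow>
      card (plaque_in A D p \<inter> plaque_in B D q) = 1"
begin

abbreviation pr :: "real \<times> real \<Rightarrow> 'a" where "pr p \<equiv> \<rho> (fst p) (snd p)"

definition dom :: "'a set" where "dom = pr ` ({0<..<1} \<times> {0<..<1})"

lemma dom_iff: "q \<in> dom \<longleftrightarrow> (\<exists>x y. 0 < x \<and> x < 1 \<and> 0 < y \<and> y < 1 \<and> q = \<rho> x y)"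
  unfolding dom_def by force

lemma inj: "0 < x \<Longrightarrow> x < 1 \<Longrightarrow> 0 < y \<Longrightarrow> y < 1 \<Longrightarrow> 0 < x' \<Longrightarrow> x' < 1 \<Longrightarrow> 0 < y' \<Longrightarrow> y' < 1 \<Longrightarrow>
    \<rho> x y = \<rho> x' y' \<longleftrightarrow> x = x' \<and> y = y'"
proof -
  obtain g where "homeomorphism ({0<..<1} \<times> {0<..<1}) (pr ` ({0<..<1} \<times> {0<..<1})) pr g" using homeo by blast
  then have "g (pr p) = p" if "p \<in> {0<..<1} \<times> {0<..<1}" for p using that unfolding homeomorphism_def by blast
  from this[of "(x, y)"] this[of "(x', y')"]
  show "0 < x \<Longrightarrow> x < 1 \<Longrightarrow> 0 < y \<Longrightarrow> y < 1 \<Longrightarrow> 0 < x' \<Longrightarrow> x' < 1 \<Longrightarrow> 0 < y' \<Longrightarrow> y' < 1 \<Longrightarrow>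
    \<rho> x y = \<rho> x' y' \<longleftrightarrow> x = x' \<and> y = y'" by (metis fst_conv greaterThanLessThan_iff mem_Sigma_iff snd_conv)
qed

text \<open>Supplies the vertical counterpart of every statement about horizontal lines.\<close>

lemma swap: "product_rectangle S B A (\<lambda>x y. \<rho> y x)"
proof -
  have sw: "homeomorphism ({0<..<1} \<times> {0<..<1}) ({0<..<1} \<times> {0<..<1}) prod.swap (prod.swap :: real \<times> real \<Rightarrow> _)"
    by (auto simp: homeomorphism_def image_iff intro!: continuous_intros)
  have im: "(\<lambda>p. \<rho> (snd p) (fst p)) ` ({0<..<1} \<times> {0<..<1}) = pr ` ({0<..<1} \<times> {0<..<1})"
    by (force simp: image_iff)
  show ?thesis
  proof
    have "continuous_on ({0..1} \<times> {0..1}) (pr \<circ> prod.swap)"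
      by (intro continuous_on_compose continuous_on_subset[OF cont] continuous_intros) auto
    then show "continuous_on ({0..1} \<times> {0..1}) (\<lambda>p. \<rho> (snd p) (fst p))" by (simp add: o_def)
    obtain g where "homeomorphism ({0<..<1} \<times> {0<..<1}) (pr ` ({0<..<1} \<times> {0<..<1})) pr g" using homeo by blast
    from homeomorphism_compose[OF sw this]
    show "\<exists>g. homeomorphism ({0<..<1} \<times> {0<..<1}) ((\<lambda>p. \<rho> (snd p) (fst p)) ` ({0<..<1} \<times> {0<..<1}))
      (\<lambda>p. \<rho> (snd p) (fst p)) g" unfolding im by (auto simp: o_def)
  qed (unfold im, (rule openin_S in_S A_leaf B_leaf; assumption)+,
      use meet_once in \<open>simp add: Int_commute\<close>)
qed

lemma hline_connected: "0 \<le> y \<Longrightarrow> y \<le> 1 \<Longrightarrow> T \<subseteq> {0..1} \<Longrightarrow> connected T \<Longrightarrow> connected ((\<lambda>x. \<rho> x y) ` T)"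
proof (rule connected_continuous_image)
  assume "0 \<le> y" "y \<le> 1" "T \<subseteq> {0..1}"
  then have "continuous_on T (pr \<circ> (\<lambda>x. (x, y)))"
    by (intro continuous_on_compose continuous_on_subset[OF cont] continuous_intros) auto
  then show "continuous_on T (\<lambda>x. \<rho> x y)" by (simp add: o_def)
qed

definition box_im :: "real \<Rightarrow> real \<Rightarrow> real \<Rightarrow> real \<Rightarrow> 'a set"
  where "box_im a b c d = pr ` ({a<..<b} \<times> {c<..<d})"

lemma box_im_iff: "q \<in> box_im a b c d \<longleftrightarrow> (\<exists>x y. a < x \<and> x < b \<and> c < y \<and> y < d \<and> q = \<rho> x y)"
  unfolding box_im_def by force

lemma cont_h: "0 \<le> y \<Longrightarrow> y \<le> 1 \<Longrightarrow> continuous_on {0..1} (\<lambda>t. \<rho> t y)"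
  using continuous_on_compose2[OF cont, of "{0..1}" "\<lambda>t. (t, y)"] by (force intro!: continuous_intros)

lemma box_imI: "a < x \<Longrightarrow> x < b \<Longrightarrow> c < y \<Longrightarrow> y < d \<Longrightarrow> \<rho> x y \<in> box_im a b c d"
  unfolding box_im_iff by blast

lemma domI: "0 < x \<Longrightarrow> x < 1 \<Longrightarrow> 0 < y \<Longrightarrow> y < 1 \<Longrightarrow> \<rho> x y \<in> dom"
  unfolding dom_iff by blast

text \<open>If the plaque contained a point of another height, moving that point along its own
  horizontal line to the abscissa \<open>x\<close> would produce a second common point of a
  horizontal and a vertical plaque of \<open>dom\<close>, against \<open>meet_once\<close>.\<close>

lemma plaque_in_box:
  assumes ab: "0 \<le> a" "b \<le> 1" "0 \<le> c" "d \<le> 1" and xy: "a < x" "x < b" "c < y" "y < d"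
  shows "plaque_in A (box_im a b c d) (\<rho> x y) = (\<lambda>t. \<rho> t y) ` {a<..<b}"
proof
  let ?D = "box_im a b c d"
  show "(\<lambda>t. \<rho> t y) ` {a<..<b} \<subseteq> plaque_in A ?D (\<rho> x y)"
  proof (rule plaque_in_maximal)
    show "connected ((\<lambda>t. \<rho> t y) ` {a<..<b})" using assms by (intro hline_connected) auto
    show "(\<lambda>t. \<rho> t y) ` {a<..<b} \<subseteq> leaf A (\<rho> x y)" using assms A_leaf[of x _ y] by auto
    show "(\<lambda>t. \<rho> t y) ` {a<..<b} \<subseteq> ?D" using assms by (auto intro!: box_imI)
  qed (use assms in auto)
  show "plaque_in A ?D (\<rho> x y) \<subseteq> (\<lambda>t. \<rho> t y) ` {a<..<b}"
  proof
    fix q assume q: "q \<in> plaque_in A ?D (\<rho> x y)"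
    then have "q \<in> ?D" using plaque_in_subset by blast
    then obtain t s where ts: "a < t" "t < b" "c < s" "s < d" "q = \<rho> t s" unfolding box_im_iff by blast
    have "?D \<subseteq> dom" using ab by (auto simp: box_im_iff intro!: domI)
    have p: "\<rho> x y \<in> dom" using assms by (auto intro!: domI)
    have q': "q \<in> plaque_in A dom (\<rho> x y)" using q plaque_in_mono[OF \<open>?D \<subseteq> dom\<close>] by blast
    then have "q \<in> leaf A (\<rho> x y)" using plaque_in_subset[of A dom "\<rho> x y"] by blast
    then have leafq: "leaf A q = leaf A (\<rho> x y)" by (rule leaf_eq)
    have "\<rho> x s \<in> plaque_in A dom q"
    proof (rule subsetD[OF plaque_in_maximal])
      show "connected ((\<lambda>t. \<rho> t s) ` {0<..<1})" using ts assms by (intro hline_connected) auto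
      show "q \<in> (\<lambda>t. \<rho> t s) ` {0<..<1}" using ts assms by auto
      show "(\<lambda>t. \<rho> t s) ` {0<..<1} \<subseteq> leaf A q" using ts assms A_leaf[of t _ s] by auto
      show "(\<lambda>t. \<rho> t s) ` {0<..<1} \<subseteq> dom" using ts assms by (auto intro!: domI)
    qed (use xy ab in auto)
    also have "plaque_in A dom q = plaque_in A dom (\<rho> x y)"
      using q' unfolding plaque_in_def leafq by (rule connected_component_eq)
    finally have 1: "\<rho> x s \<in> plaque_in A dom (\<rho> x y)" .
    interpret sw: product_rectangle S B A "\<lambda>x y. \<rho> y x" by (rule swap)
    have 2: "\<rho> x s \<in> plaque_in B dom (\<rho> x y)"
    proof (rule subsetD[OF plaque_in_maximal])
      show "connected ((\<lambda>t. \<rho> x t) ` {0<..<1})" using assms by (intro sw.hline_connected) auto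
      show "\<rho> x y \<in> (\<lambda>t. \<rho> x t) ` {0<..<1}" using assms by auto
      show "(\<lambda>t. \<rho> x t) ` {0<..<1} \<subseteq> leaf B (\<rho> x y)" using assms B_leaf[of x y] by auto
      show "(\<lambda>t. \<rho> x t) ` {0<..<1} \<subseteq> dom" using assms by (auto intro!: domI)
    qed (use ts ab in auto)
    have 3: "\<rho> x y \<in> plaque_in A dom (\<rho> x y) \<inter> plaque_in B dom (\<rho> x y)"
      by (intro IntI plaque_in_self p)
    have "card (plaque_in A dom (\<rho> x y) \<inter> plaque_in B dom (\<rho> x y)) = 1" using meet_once[OF dom_def p p] .
    then obtain w where w: "plaque_in A dom (\<rho> x y) \<inter> plaque_in B dom (\<rho> x y) = {w}" by (rule card_1_singletonE)
    have "\<rho> x s \<in> {w}" unfolding w[symmetric] using 1 2 by (rule IntI)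
    moreover have "\<rho> x y \<in> {w}" unfolding w[symmetric] by (rule 3)
    ultimately have "\<rho> x s = \<rho> x y" by simp
    then have "s = y" using inj[of x s x y] ts assms by simp
    then show "q \<in> (\<lambda>t. \<rho> t y) ` {a<..<b}" using ts by auto
  qed
qed

lemma dom_box: "dom = box_im 0 1 0 1"
  unfolding dom_def box_im_def ..

lemma openin_box:
  assumes "0 \<le> a" "b \<le> 1" "0 \<le> c" "d \<le> 1"
  shows "openin (top_of_set S) (box_im a b c d)"
proof -
  obtain g where g: "homeomorphism ({0<..<1} \<times> {0<..<1}) dom pr g" using homeo unfolding dom_def by blast
  have "openin (top_of_set ({0<..<1} \<times> {0<..<1})) ({a<..<b} \<times> {c<..<d})"
    using assms by (subst openin_open_eq) (auto intro!: open_Times)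
  then have "openin (top_of_set dom) (box_im a b c d)"
    unfolding box_im_def by (rule homeomorphism_imp_open_map[OF g])
  from openin_trans[OF this openin_S[folded dom_def]] show ?thesis .
qed

text \<open>The parametrization may identify boundary points with each other, but not with interior
  ones. Along a path entering from the boundary, the inverse returns the path itself; if its
  starting point were in \<open>dom\<close>, continuity of the inverse would place that start in the
  open square.\<close>

lemma boundary_notin_dom:
  assumes "0 \<le> x" "x \<le> 1" "0 \<le> y" "y \<le> 1" "\<not> (0 < x \<and> x < 1 \<and> 0 < y \<and> y < 1)"
  shows "\<rho> x y \<notin> dom"
proof
  assume d: "\<rho> x y \<in> dom"
  obtain g where g: "homeomorphism ({0<..<1} \<times> {0<..<1}) dom pr g" using homeo unfolding dom_def by blast
  \<comment> \<open>The straight path to the centre \<open>(1/2, 1/2)\<close>, which is interior at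
    every positive time.\<close>
  define c where "c = (\<lambda>t::real. ((1 - t) * x + t / 2, (1 - t) * y + t / 2))"
  have c_in: "c t \<in> {0<..<1} \<times> {0<..<1}" if "0 < t" "t \<le> 1" for t
  proof -
    have "(1 - t) * z + t / 2 \<in> {0<..<1}" if "0 \<le> z" "z \<le> 1" for z
    proof -
      have "0 \<le> (1 - t) * z" "(1 - t) * z \<le> (1 - t) * 1" using that \<open>t \<le> 1\<close> by (simp, intro mult_left_mono) auto
      then show ?thesis using \<open>0 < t\<close> by auto
    qed
    then show ?thesis using assms unfolding c_def by blast
  qed
  have c_in': "c t \<in> {0..1} \<times> {0..1}" if "0 \<le> t" "t \<le> 1" for t
    using c_in[of t] that assms by (cases "t = 0") (auto simp: c_def)
  have cc: "continuous_on {0..1} c" unfolding c_def by (intro continuous_intros) auto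
  have c_im: "c ` {0..1} \<subseteq> {0..1} \<times> {0..1}" using c_in' by (metis atLeastAtMost_iff image_subsetI)
  have pc: "continuous_on {0..1} (\<lambda>t. pr (c t))"
    using continuous_on_compose2[OF cont cc c_im] by simp
  have c0: "pr (c 0) = \<rho> x y" by (simp add: c_def)
  have im: "(\<lambda>t. pr (c t)) ` {0..1} \<subseteq> dom"
  proof
    fix w assume "w \<in> (\<lambda>t. pr (c t)) ` {0..1}"
    then obtain t where t: "0 \<le> t" "t \<le> 1" "w = pr (c t)" by auto
    show "w \<in> dom"
    proof (cases "t = 0")
      case False
      then have "c t \<in> {0<..<1} \<times> {0<..<1}" using c_in[of t] t by simp
      then show ?thesis unfolding t(3) dom_def by (rule imageI)
    qed (use c0 d t in simp)
  qed
  have "continuous_on dom g" using g unfolding homeomorphism_def by blast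
  then have "continuous_on {0..1} (\<lambda>t. g (pr (c t)))"
    by (rule continuous_on_compose2[OF _ pc im])
  then have l1: "((\<lambda>t. g (pr (c t))) \<longlongrightarrow> g (pr (c 0))) (at 0 within {0..1})" unfolding continuous_on_def by simp
  have l2: "(c \<longlongrightarrow> c 0) (at 0 within {0..1})" using cc unfolding continuous_on_def by simp
  note hg = g[unfolded homeomorphism_def]
  note gi = hg[THEN conjunct1] and gr = hg[THEN conjunct2, THEN conjunct2, THEN conjunct2, THEN conjunct2, THEN conjunct1]
  have ev: "\<forall>\<^sub>F t in at 0 within {0..1}. g (pr (c t)) = c t"
    unfolding eventually_at_filter
  proof (intro always_eventually allI impI)
    fix t :: real assume "t \<noteq> 0" "t \<in> {0..1}"
    then have "c t \<in> {0<..<1} \<times> {0<..<1}" using c_in by simp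
    with gi show "g (pr (c t)) = c t" by (rule bspec)
  qed
  have "at (0::real) within {0..1} \<noteq> bot" by (simp add: at_within_Icc_at_right)
  from tendsto_unique[OF this l2 Lim_transform_eventually[OF l1 ev]]
  have "c 0 = g (pr (c 0))" .
  moreover have "g (pr (c 0)) \<in> {0<..<1} \<times> {0<..<1}" unfolding gr[symmetric] c0 using d by (rule imageI)
  ultimately have "c 0 \<in> {0<..<1} \<times> {0<..<1}" by (simp only:)
  moreover have "c 0 = (x, y)" by (simp add: c_def)
  ultimately show False using assms(5) by simp
qed

text \<open>Turns statements about the left side into statements about the right side.\<close>

lemma reflect: "product_rectangle S A B (\<lambda>x y. \<rho> (1 - x) y)"
proof -
  let ?r = "\<lambda>p::real \<times> real. (1 - fst p, snd p)"
  have sw: "homeomorphism ({0<..<1} \<times> {0<..<1}) ({0<..<1} \<times> {0<..<1}) ?r ?r"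
    by (rule homeomorphismI) (auto intro!: continuous_intros)
  have im: "(\<lambda>p. \<rho> (1 - fst p) (snd p)) ` ({0<..<1} \<times> {0<..<1}) = pr ` ({0<..<1} \<times> {0<..<1})"
  proof -
    have "(\<lambda>p. \<rho> (1 - fst p) (snd p)) ` ({0<..<1} \<times> {0<..<1}) = pr ` ?r ` ({0<..<1} \<times> {0<..<1})"
      by (simp add: image_image)
    also have "?r ` ({0<..<1} \<times> {0<..<1}) = {0<..<1} \<times> {0<..<1}" using sw unfolding homeomorphism_def by blast
    finally show ?thesis .
  qed
  show ?thesis
  proof
    have "continuous_on ({0..1} \<times> {0..1}) (pr \<circ> ?r)"
      by (intro continuous_on_compose continuous_on_subset[OF cont] continuous_intros) auto
    then show "continuous_on ({0..1} \<times> {0..1}) (\<lambda>p. \<rho> (1 - fst p) (snd p))" by (simp add: o_def)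
    obtain g where "homeomorphism ({0<..<1} \<times> {0<..<1}) (pr ` ({0<..<1} \<times> {0<..<1})) pr g" using homeo by blast
    from homeomorphism_compose[OF sw this]
    show "\<exists>g. homeomorphism ({0<..<1} \<times> {0<..<1}) ((\<lambda>p. \<rho> (1 - fst p) (snd p)) ` ({0<..<1} \<times> {0<..<1}))
      (\<lambda>p. \<rho> (1 - fst p) (snd p)) g" unfolding im by (auto simp: o_def)
  next
    fix p q D assume D: "D = (\<lambda>p. \<rho> (1 - fst p) (snd p)) ` ({0<..<1} \<times> {0<..<1})" "p \<in> D" "q \<in> D"
    show "card (plaque_in A D p \<inter> plaque_in B D q) = 1"
      by (rule meet_once[OF D(1)[unfolded im] D(2,3)])
  qed (unfold im, rule openin_S, auto intro!: in_S A_leaf B_leaf)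
qed

end

section \<open>Transverse measures and the widths of rectangles\<close>

lemma regular_chart:
  assumes "singular_foliation S F" "p \<in> S" "p \<notin> singular_points F"
  obtains V \<psi> \<psi>' where "(2, V, \<psi>) \<in> F" "openin (top_of_set S) V" "homeomorphism V (ball 0 1) \<psi> \<psi>'" "p \<in> V" "\<psi> p = 0"
proof -
  obtain k V \<psi> where c: "(k, V, \<psi>) \<in> F" "p \<in> V" "\<psi> p = 0"
    using assms(1,2) unfolding singular_foliation_def by metis
  have "k = 2"
  proof (rule ccontr)
    assume "k \<noteq> 2"
    then have "(p, k) \<in> prong_singularities F" unfolding prong_singularities_def using c by auto
    then have "p \<in> singular_points F" unfolding singular_points_def by force
    then show False using assms(3) by simp
  qed
  moreover have "\<forall>(k, U, \<phi>)\<in>F. 1 \<le> k \<and> openin (top_of_set S) U \<and> (\<exists>\<psi>. homeomorphism U (ball 0 1) \<phi> \<psi>)"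
    using assms(1) unfolding singular_foliation_def by simp
  then have "openin (top_of_set S) V \<and> (\<exists>\<psi>'. homeomorphism V (ball 0 1) \<psi> \<psi>')" using c(1) by auto
  ultimately show ?thesis using that c by blast
qed

text \<open>\<open>\<mu>\<close> is a set function that becomes a measure only on each single
  transverse arc. The inequalities are transported through the measure built on that arc, in which
  closed subsets are measurable.\<close>

lemma transverse_measure_on_arc:
  assumes "transverse_measure B \<mu>" "transverse_arc B \<gamma>"
  shows "X \<subseteq> Y \<Longrightarrow> closed X \<Longrightarrow> closed Y \<Longrightarrow> Y \<subseteq> path_image \<gamma> \<Longrightarrow> \<mu> X \<le> \<mu> Y"
    "closed X \<Longrightarrow> closed Y \<Longrightarrow> X \<union> Y \<subseteq> path_image \<gamma> \<Longrightarrow> \<mu> (X \<union> Y) \<le> \<mu> X + \<mu> Y"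
    "0 < \<mu> (path_image \<gamma>)" "\<mu> (path_image \<gamma>) < \<infinity>"
proof -
  let ?A = "sets (restrict_space borel (path_image \<gamma>))"
  have ms: "measure_space (path_image \<gamma>) ?A \<mu> \<and> 0 < \<mu> (path_image \<gamma>) \<and> \<mu> (path_image \<gamma>) < \<infinity>"
    using assms unfolding transverse_measure_def by blast
  then show "0 < \<mu> (path_image \<gamma>)" "\<mu> (path_image \<gamma>) < \<infinity>" by blast+
  have sa: "sigma_algebra (path_image \<gamma>) ?A" "positive ?A \<mu>" "countably_additive ?A \<mu>"
    using ms unfolding measure_space_def by blast+
  let ?M = "measure_of (path_image \<gamma>) ?A \<mu>"
  have sets: "sets ?M = ?A" by (rule sigma_algebra.sets_measure_of_eq[OF sa(1)])
  have em: "X \<in> ?A \<Longrightarrow> emeasure ?M X = \<mu> X" for X by (rule emeasure_measure_of_sigma[OF sa])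
  have cl: "X \<in> ?A" if "closed X" "X \<subseteq> path_image \<gamma>" for X
    unfolding sets_restrict_space using that by (intro image_eqI[where x = X]) auto
  show "\<mu> X \<le> \<mu> Y" if "X \<subseteq> Y" "closed X" "closed Y" "Y \<subseteq> path_image \<gamma>"
  proof -
    have "X \<in> ?A" "Y \<in> ?A" using cl that by auto
    then show ?thesis using emeasure_mono[OF that(1), of ?M] em[of X] em[of Y] sets by simp
  qed
  show "\<mu> (X \<union> Y) \<le> \<mu> X + \<mu> Y" if "closed X" "closed Y" "X \<union> Y \<subseteq> path_image \<gamma>"
  proof -
    have "X \<in> ?A" "Y \<in> ?A" using cl that by auto
    moreover from this have "X \<union> Y \<in> ?A" by (rule sets.Un)
    ultimately show ?thesis using emeasure_subadditive[of X ?M Y] em[of X] em[of Y] em[of "X \<union> Y"] sets by simp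
  qed
qed

text \<open>The measure belongs to \<open>B\<close> and measures arcs in leaves of \<open>A\<close>.
  The locale serves once with the stable and once with the unstable foliation as \<open>A\<close>;
  of the product charts it keeps that the coordinates separate points and that plaques are their
  level sets.\<close>

locale bifoliation =
  fixes S :: "'a::t2_space set" and A B :: "'a foliated_chart set" and Sing :: "'a set" and \<mu> :: "'a set \<Rightarrow> ennreal"
  assumes foliation_A: "singular_foliation S A" and foliation_B: "singular_foliation S B"
    and sing_A: "singular_points A = Sing" and sing_B: "singular_points B = Sing"
    and measure_B: "transverse_measure B \<mu>"
    and local_product: "p \<in> S \<Longrightarrow> p \<notin> Sing \<Longrightarrow> \<exists>U a b. openin (top_of_set S) U \<and> p \<in> U \<and>
      (\<forall>x\<in>U. \<forall>y\<in>U. a x = a y \<and> b x = b y \<longrightarrow> x = y) \<and>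
      (\<forall>x\<in>U. plaque_in A U x = {y \<in> U. b y = (b x :: real)} \<and> plaque_in B U x = {y \<in> U. a y = (a x :: real)})"
begin

lemma finite_Sing: "finite Sing"
  using foliation_A unfolding sing_A[symmetric] singular_points_def singular_foliation_def by simp

text \<open>If two nearby points of the arc had the same transverse coordinate for \<open>B\<close>,
  the chord between them would lie in one plaque of \<open>B\<close> and make \<open>a\<close>
  agree, while the arc itself lies in one leaf of \<open>A\<close> and makes \<open>b\<close> agree.
  So the points coincide.\<close>

lemma regular_arc_transverse:
  assumes "regular_leaf_arc S A \<gamma>"
  shows "transverse_arc B \<gamma>"
proof -
  obtain x0 where x0: "x0 \<in> S" "path_image \<gamma> \<subseteq> leaf A x0" and arc: "arc \<gamma>" and reg: "path_image \<gamma> \<inter> Sing = {}"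
    using assms unfolding regular_leaf_arc_def sing_A by blast
  have pS: "path_image \<gamma> \<subseteq> S" using x0 leaf_subset[OF foliation_A] by blast
  have "\<exists>U \<phi> e. (2, U, \<phi>) \<in> B \<and> 0 < e \<and> \<gamma> ` ({0..1} \<inter> ball t e) \<subseteq> U \<and>
      inj_on (\<lambda>s. Im (\<phi> (\<gamma> s))) ({0..1} \<inter> ball t e)" if t: "t \<in> {0..1}" for t
  proof -
    have p: "\<gamma> t \<in> S" "\<gamma> t \<notin> Sing" using pS reg t unfolding path_image_def by blast+
    obtain U a b where U: "openin (top_of_set S) U" "\<gamma> t \<in> U"
      "\<forall>x\<in>U. \<forall>y\<in>U. a x = a y \<and> b x = b y \<longrightarrow> x = y"
      "\<forall>x\<in>U. plaque_in A U x = {y \<in> U. b y = (b x :: real)} \<and> plaque_in B U x = {y \<in> U. a y = (a x :: real)}"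
      using local_product[OF p] by blast
    obtain V \<psi> \<psi>' where V: "(2, V, \<psi>) \<in> B" "openin (top_of_set S) V" "homeomorphism V (ball 0 1) \<psi> \<psi>'" "\<gamma> t \<in> V" "\<psi> (\<gamma> t) = 0"
      using regular_chart[OF foliation_B p(1)] p(2) unfolding sing_B by blast
    \<comment> \<open>The chart of \<open>B\<close> is restricted to a round disc whose image lies
      in the product chart \<open>U\<close>: discs are convex, so chords stay inside.\<close>
    obtain \<delta> where d: "0 < \<delta>" "\<delta> \<le> 1" "\<psi>' ` ball 0 \<delta> \<subseteq> U \<inter> V" "openin (top_of_set S) (\<psi>' ` ball 0 \<delta>)" "\<gamma> t \<in> \<psi>' ` ball 0 \<delta>"
      by (rule chart_ball[OF V(2,3) U(1,2) V(4,5)])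
    let ?W = "\<psi>' ` ball 0 \<delta>"
    obtain T where T: "open T" "?W = S \<inter> T" using d(4) unfolding openin_open by blast
    have cont: "continuous_on {0..1} \<gamma>" using arc unfolding arc_def path_def by blast
    have "\<gamma> t \<in> T" using d(5) T by blast
    then obtain O' where O': "open O'" "t \<in> O'" "\<forall>s\<in>{0..1}. s \<in> O' \<longrightarrow> \<gamma> s \<in> T"
      using cont t T(1) unfolding continuous_on_topological by metis
    obtain e where e: "0 < e" "ball t e \<subseteq> O'" using O' by (meson openE)
    let ?I = "{0..1} \<inter> ball t e"
    have IW: "\<gamma> s \<in> ?W" if "s \<in> ?I" for s
      using that O'(3) e(2) pS T(2) unfolding path_image_def by blast
    have "inj_on (\<lambda>s. Im (\<psi> (\<gamma> s))) ?I"
    proof (rule inj_onI)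
      fix s1 s2 assume s: "s1 \<in> ?I" "s2 \<in> ?I" "Im (\<psi> (\<gamma> s1)) = Im (\<psi> (\<gamma> s2))"
      have inW: "\<psi> w \<in> ball 0 \<delta> \<and> \<psi>' (\<psi> w) = w" if w: "w \<in> ?W" for w
      proof -
        obtain z where z: "z \<in> ball 0 \<delta>" "w = \<psi>' z" using w by blast
        moreover have "z \<in> ball 0 1" using z(1) d(2) by simp
        then have "\<psi> (\<psi>' z) = z" by (rule homeomorphism_apply2[OF V(3)])
        ultimately show ?thesis by simp
      qed
      let ?z1 = "\<psi> (\<gamma> s1)" and ?z2 = "\<psi> (\<gamma> s2)"
      let ?K = "closed_segment ?z1 ?z2"
      note w1 = inW[OF IW[OF s(1)]] and w2 = inW[OF IW[OF s(2)]]
      have K: "?K \<subseteq> ball 0 \<delta>" using w1 w2 by (intro closed_segment_subset convex_ball) auto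
      have K1: "?K \<subseteq> ball 0 1" using K subset_ball[OF d(2)] by blast
      have Im: "Im z = Im ?z1" if z: "z \<in> ?K" for z
      proof -
        obtain u where "z = (1 - u) *\<^sub>R ?z1 + u *\<^sub>R ?z2" using z unfolding closed_segment_def by blast
        then have "Im z = (1 - u) * Im ?z1 + u * Im ?z2" by simp
        then show ?thesis unfolding s(3) by (simp add: algebra_simps)
      qed
      obtain P where P: "P \<in> plaques (2, V, \<psi>)" "\<psi>' ` ?K \<subseteq> P"
        using chord_in_plaque[OF V(3) K1 connected_segment(1) _ Im] ends_in_segment(1) by blast
      have g1: "\<gamma> s1 \<in> \<psi>' ` ?K" using imageI[of ?z1 ?K \<psi>'] w1 by simp
      have g2: "\<gamma> s2 \<in> \<psi>' ` ?K" using imageI[of ?z2 ?K \<psi>'] w2 by simp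
      have "\<psi>' ` ?K \<subseteq> plaque_in B U (\<gamma> s1)"
      proof (rule plaque_in_maximal)
        have "continuous_on (ball 0 1) \<psi>'" using V(3) unfolding homeomorphism_def by blast
        then have "continuous_on ?K \<psi>'" using K1 by (rule continuous_on_subset)
        then show "connected (\<psi>' ` ?K)" by (rule connected_continuous_image) simp
        show "\<psi>' ` ?K \<subseteq> leaf B (\<gamma> s1)" using leaf_plaque[OF V(1) P(1)] P(2) g1 by blast
        show "\<psi>' ` ?K \<subseteq> U" using K d(3) by blast
      qed (rule g1)
      then have "\<gamma> s2 \<in> plaque_in B U (\<gamma> s1)" using g2 by blast
      moreover have U12: "\<gamma> s1 \<in> U" "\<gamma> s2 \<in> U" using IW[OF s(1)] IW[OF s(2)] d(3) by auto
      ultimately have a: "a (\<gamma> s1) = a (\<gamma> s2)" using U(4) by simp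
      have "\<gamma> ` ?I \<subseteq> plaque_in A U (\<gamma> s1)"
      proof (rule plaque_in_maximal)
        have "continuous_on ?I \<gamma>" by (rule continuous_on_subset[OF cont]) simp
        moreover have "connected ?I" by (intro convex_connected convex_Int convex_ball) simp
        ultimately show "connected (\<gamma> ` ?I)" by (rule connected_continuous_image)
        show "\<gamma> s1 \<in> \<gamma> ` ?I" using s(1) by (rule imageI)
        have pim: "\<gamma> ` ?I \<subseteq> path_image \<gamma>" unfolding path_image_def by (rule image_mono) simp
        then have "\<gamma> s1 \<in> leaf A x0" using x0(2) s(1) by blast
        then show "\<gamma> ` ?I \<subseteq> leaf A (\<gamma> s1)" unfolding leaf_eq[OF \<open>\<gamma> s1 \<in> leaf A x0\<close>] using pim x0(2) by simp
        show "\<gamma> ` ?I \<subseteq> U" using IW d(3) by blast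
      qed
      then have "\<gamma> s2 \<in> plaque_in A U (\<gamma> s1)" using imageI[OF s(2), of \<gamma>] by (rule subsetD)
      then have "b (\<gamma> s1) = b (\<gamma> s2)" using U(4) U12 by simp
      with a have "\<gamma> s1 = \<gamma> s2" using U(3) U12 by blast
      then show "s1 = s2" using arc s(1,2) unfolding arc_def inj_on_def by simp
    qed
    moreover have "\<gamma> ` ?I \<subseteq> V" using IW d(3) by blast
    ultimately show ?thesis using V(1) e(1) by blast
  qed
  then show ?thesis unfolding transverse_arc_def using arc by blast
qed

end

locale measured_rectangle = bifoliation S A B Sing \<mu> + product_rectangle S A B \<rho>
  for S :: "'a::t2_space set" and A B Sing \<mu> \<rho>
begin

definition hseg :: "real \<Rightarrow> real \<Rightarrow> real \<Rightarrow> 'a set"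
  where "hseg x1 x2 y = (\<lambda>t. \<rho> t y) ` {x1..x2}"

definition hpath :: "real \<Rightarrow> real \<Rightarrow> real \<Rightarrow> real \<Rightarrow> 'a"
  where "hpath x1 x2 y = (\<lambda>t. \<rho> (x1 + t * (x2 - x1)) y)"

lemma path_image_hpath: "x1 \<le> x2 \<Longrightarrow> path_image (hpath x1 x2 y) = hseg x1 x2 y"
proof -
  assume "x1 \<le> x2"
  then have e: "{x1..x2} = (\<lambda>t. x1 + t * (x2 - x1)) ` {0..1}"
    using image_affinity_atLeastAtMost[of "x2 - x1" x1 0 1] by (simp add: mult.commute add.commute)
  show ?thesis unfolding path_image_def hpath_def hseg_def e image_image ..
qed

lemma closed_hseg: "0 \<le> x1 \<Longrightarrow> x2 \<le> 1 \<Longrightarrow> 0 \<le> y \<Longrightarrow> y \<le> 1 \<Longrightarrow> closed (hseg x1 x2 y)"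
  unfolding hseg_def
  by (intro compact_imp_closed compact_continuous_image continuous_on_subset[OF cont_h]) auto

text \<open>The left end may lie on the side \<open>x = 0\<close>, which cannot meet the interior.
  The right end stays below 1, since the two sides might have points in common.\<close>

lemma hpath_arc:
  assumes "0 \<le> x1" "x1 < x2" "x2 < 1" "0 < y" "y < 1" "\<And>t. x1 \<le> t \<Longrightarrow> t \<le> x2 \<Longrightarrow> \<rho> t y \<notin> Sing"
  shows "regular_leaf_arc S A (hpath x1 x2 y)"
proof -
  have r: "x1 \<le> x1 + t * (x2 - x1) \<and> x1 + t * (x2 - x1) \<le> x2" if "0 \<le> t" "t \<le> 1" for t
  proof -
    have "0 \<le> t * (x2 - x1)" "t * (x2 - x1) \<le> 1 * (x2 - x1)" using that assms by (simp, intro mult_right_mono) auto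
    then show ?thesis by simp
  qed
  have "path (hpath x1 x2 y)"
    unfolding path_def hpath_def
    using r assms by (intro continuous_on_compose2[OF cont_h[of y]] continuous_intros) force+
  moreover have "inj_on (hpath x1 x2 y) {0..1}"
  proof (rule linorder_inj_onI)
    fix s t :: real assume st: "s < t" "s \<in> {0..1}" "t \<in> {0..1}"
    let ?s = "x1 + s * (x2 - x1)" and ?t = "x1 + t * (x2 - x1)"
    have lt: "?s < ?t" using st(1) assms(2) by (simp add: mult_strict_right_mono)
    have rst: "x1 \<le> ?s" "?t \<le> x2" using r[of s] r[of t] st by auto
    have pos: "0 < ?t" "?t < 1" "0 \<le> ?s" "?s < 1" using rst lt assms by linarith+
    have d: "\<rho> ?t y \<in> dom" using pos assms by (intro domI)
    show "hpath x1 x2 y s \<noteq> hpath x1 x2 y t"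
    proof (cases "?s = 0")
      case True
      then have "\<rho> ?s y \<notin> dom" using boundary_notin_dom[of 0 y] assms by simp
      then show ?thesis using d unfolding hpath_def by metis
    next
      case False
      then have "0 < ?s" using pos by linarith
      then have "\<rho> ?s y \<noteq> \<rho> ?t y" using inj[of ?s y ?t y] pos assms(4,5) lt by (metis less_irrefl)
      then show ?thesis unfolding hpath_def .
    qed
  qed (use linear in blast)
  ultimately have "arc (hpath x1 x2 y)" unfolding arc_def by blast
  moreover have "\<rho> x1 y \<in> S" using assms by (intro in_S) auto
  moreover have "hseg x1 x2 y \<subseteq> leaf A (\<rho> x1 y)" unfolding hseg_def using assms A_leaf[of x1 _ y] by auto
  moreover have "hseg x1 x2 y \<inter> Sing = {}" unfolding hseg_def using assms(6) by auto
  ultimately show ?thesis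
    unfolding regular_leaf_arc_def sing_A using path_image_hpath[of x1 x2 y] assms(2) by (metis less_imp_le)
qed

lemma hseg_measure:
  assumes "0 \<le> x1" "x1 < x2" "x2 < 1" "0 < y" "y < 1" "\<And>t. x1 \<le> t \<Longrightarrow> t \<le> x2 \<Longrightarrow> \<rho> t y \<notin> Sing"
  shows "transverse_arc B (hpath x1 x2 y)" "0 < \<mu> (hseg x1 x2 y)" "\<mu> (hseg x1 x2 y) < \<infinity>"
proof -
  show t: "transverse_arc B (hpath x1 x2 y)" by (rule regular_arc_transverse[OF hpath_arc[OF assms]])
  show "0 < \<mu> (hseg x1 x2 y)" "\<mu> (hseg x1 x2 y) < \<infinity>"
    using transverse_measure_on_arc(3,4)[OF measure_B t] path_image_hpath[of x1 x2 y] assms(2) by simp_all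
qed

lemma hseg_mono: "x1' \<le> x1 \<Longrightarrow> x2 \<le> x2' \<Longrightarrow> hseg x1 x2 y \<subseteq> hseg x1' x2' y"
  unfolding hseg_def by (rule image_mono) auto

lemma hseg_measure_mono:
  assumes "0 \<le> x1" "x1 < x2" "x2 < 1" "0 < y" "y < 1" "\<And>t. x1 \<le> t \<Longrightarrow> t \<le> x2 \<Longrightarrow> \<rho> t y \<notin> Sing"
    "x1 \<le> x1'" "x2' \<le> x2"
  shows "\<mu> (hseg x1' x2' y) \<le> \<mu> (hseg x1 x2 y)"
  using assms path_image_hpath[of x1 x2 y]
  by (intro transverse_measure_on_arc(1)[OF measure_B hseg_measure(1)[OF assms(1-6)]] hseg_mono closed_hseg) auto

text \<open>Sliding along leaves of \<open>B\<close> is an isotopy of the kind under which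
  \<open>\<mu>\<close> is invariant. The swept band must be free of singularities, because
  intermediate arcs are known to be transverse only if they avoid them.\<close>

lemma hseg_measure_holonomy:
  assumes x: "0 < x1" "x1 < x2" "x2 < 1" and y: "0 < y" "y < 1" "0 < y'" "y' < 1"
    and reg: "\<And>x s. 0 < x \<Longrightarrow> x < 1 \<Longrightarrow> s \<in> closed_segment y y' \<Longrightarrow> \<rho> x s \<notin> Sing"
  shows "\<mu> (hseg x1 x2 y) = \<mu> (hseg x1 x2 y')"
proof -
  define l where "l = (\<lambda>s. y + s * (y' - y))"
  have lseg: "l s \<in> closed_segment y y'" if "s \<in> {0..1}" for s
    using that unfolding closed_segment_def l_def by (auto simp: algebra_simps intro!: exI[of _ s])
  have "closed_segment y y' \<subseteq> {0<..<1}" using y by (intro closed_segment_subset) auto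
  then have l01: "0 < l s \<and> l s < 1" if "s \<in> {0..1}" for s using lseg[OF that] by auto
  define G where "G = (\<lambda>s. hpath x1 x2 (l s))"
  have xr: "0 < x1 + t * (x2 - x1) \<and> x1 + t * (x2 - x1) < 1" if "t \<in> {0..1}" for t
  proof -
    have "0 \<le> t * (x2 - x1)" "t * (x2 - x1) \<le> x2 - x1" using that x by (auto intro: mult_left_le_one_le)
    then show ?thesis using x by linarith
  qed
  have "continuous_on ({0..1} \<times> {0..1}) (\<lambda>p. \<rho> (x1 + snd p * (x2 - x1)) (l (fst p)))"
  proof -
    have "continuous_on ({0..1} \<times> {0..1}) (\<lambda>p. (x1 + snd p * (x2 - x1), l (fst p)))"
      unfolding l_def by (intro continuous_intros)
    from continuous_on_compose2[OF cont this]
    have "(\<lambda>p. (x1 + snd p * (x2 - x1), l (fst p))) ` ({0..1} \<times> {0..1}) \<subseteq> {0..1} \<times> {0..1} \<Longrightarrow> ?thesis" by simp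
    moreover have "(\<lambda>p. (x1 + snd p * (x2 - x1), l (fst p))) ` ({0..1} \<times> {0..1}) \<subseteq> {0..1} \<times> {0..1}"
    proof (rule image_subsetI)
      fix p :: "real \<times> real" assume "p \<in> {0..1} \<times> {0..1}"
      then show "(x1 + snd p * (x2 - x1), l (fst p)) \<in> {0..1} \<times> {0..1}" using xr[of "snd p"] l01[of "fst p"] by auto
    qed
    ultimately show ?thesis by blast
  qed
  then have 1: "continuous_on ({0..1} \<times> {0..1}) (\<lambda>(s, t). G s t)"
    unfolding G_def hpath_def by (simp add: case_prod_unfold)
  have 2: "\<forall>s\<in>{0..1}. transverse_arc B (G s)"
  proof
    fix s :: real assume "s \<in> {0..1}"
    then show "transverse_arc B (G s)"
      unfolding G_def using x l01[of s] reg lseg[of s] by (intro hseg_measure(1)) auto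
  qed
  have l0: "l 0 = y" "l 1 = y'" by (simp_all add: l_def)
  have 3: "\<forall>s\<in>{0..1}. \<forall>t\<in>{0..1}. G s t \<in> leaf B (G 0 t)"
  proof (intro ballI)
    fix s t :: real assume "s \<in> {0..1}" "t \<in> {0..1}"
    then show "G s t \<in> leaf B (G 0 t)"
      unfolding G_def hpath_def l0 using xr[of t] l01[of s] y by (intro B_leaf) auto
  qed
  have "\<mu> (path_image (G 0)) = \<mu> (path_image (G 1))"
    using measure_B 1 2 3 unfolding transverse_measure_def by blast
  then show ?thesis unfolding G_def l0 using path_image_hpath x(2) by simp
qed

text \<open>The level function of any chart is constant on its plaques. Near a regular point the
  horizontal line is a diameter of a two-prong chart, and the compatibility of charts places this
  diameter in one plaque of the given chart.\<close>

lemma level_locally_constant: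
  assumes chart: "(k, U, \<phi>) \<in> A" and x: "0 < x" "x < 1" and y: "0 < y" "y < 1"
    and q: "\<rho> x y \<in> U" "\<rho> x y \<notin> Sing"
  shows "\<forall>\<^sub>F t in at x. cmod (\<phi> (\<rho> t y)) ^ k - Re (\<phi> (\<rho> t y) ^ k) = cmod (\<phi> (\<rho> x y)) ^ k - Re (\<phi> (\<rho> x y) ^ k)"
proof -
  let ?q = "\<rho> x y"
  have qd: "?q \<in> dom" using x y by (rule domI)
  have qS: "?q \<in> S" using x y by (intro in_S) auto
  have U: "openin (top_of_set S) U" using chart foliation_A unfolding singular_foliation_def by fast
  obtain V \<psi> \<psi>' where V: "(2, V, \<psi>) \<in> A" "openin (top_of_set S) V" "homeomorphism V (ball 0 1) \<psi> \<psi>'" "?q \<in> V" "\<psi> ?q = 0"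
    using regular_chart[OF foliation_A qS] q(2) unfolding sing_A by blast
  have "openin (top_of_set S) (dom \<inter> U)" using openin_S[folded dom_def] U by (rule openin_Int)
  then obtain \<delta> where d: "0 < \<delta>" "\<delta> \<le> 1" "\<psi>' ` ball 0 \<delta> \<subseteq> (dom \<inter> U) \<inter> V"
    using chart_ball[OF V(2,3) _ _ V(4,5)] qd q(1) by blast
  define \<sigma> where "\<sigma> = (\<lambda>s::real. \<psi>' (of_real s))"
  let ?J = "{-\<delta><..<\<delta>}"
  let ?K = "of_real ` ?J :: complex set"
  have K: "?K \<subseteq> ball 0 \<delta>" by auto
  have K1: "?K \<subseteq> ball 0 1" using K subset_ball[OF d(2)] by blast
  have Kc: "connected ?K" by (intro connected_continuous_image continuous_intros) simp
  have "0 \<in> ?J" using d(1) by simp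
  then have Kne: "?K \<noteq> {}" by blast
  have Im0: "Im z = 0" if "z \<in> ?K" for z using that by auto
  obtain P where P: "P \<in> plaques (2, V, \<psi>)" "\<psi>' ` ?K \<subseteq> P"
    by (rule chord_in_plaque[OF V(3) K1 Kc Kne Im0])
  have \<sigma>_im: "\<psi>' ` ?K = \<sigma> ` ?J" unfolding \<sigma>_def by (simp add: image_image)
  have \<sigma>0: "\<sigma> 0 = ?q" using homeomorphism_apply1[OF V(3,4)] unfolding V(5) \<sigma>_def by simp
  have q\<sigma>: "?q \<in> \<psi>' ` ?K" unfolding \<sigma>_im using \<sigma>0 \<open>0 \<in> ?J\<close> by force
  have \<psi>'_cont: "continuous_on (ball 0 1) \<psi>'" using V(3) unfolding homeomorphism_def by blast
  have conn: "connected (\<psi>' ` ?K)" by (intro connected_continuous_image continuous_on_subset[OF \<psi>'_cont] K1 Kc)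
  have sub: "\<psi>' ` ?K \<subseteq> (dom \<inter> U) \<inter> V" using K d(3) by blast
  obtain c where c: "\<And>w. w \<in> \<psi>' ` ?K \<Longrightarrow> cmod (\<phi> w) ^ k - Re (\<phi> w ^ k) = c"
  proof -
    have "\<psi>' ` ?K \<subseteq> P \<inter> U" "\<psi>' ` ?K \<noteq> {}" using P(2) sub Kne by auto
    then obtain C where C: "C \<in> components (P \<inter> U)" "\<psi>' ` ?K \<subseteq> C"
      using exists_component_superset[of "\<psi>' ` ?K" "P \<inter> U"] conn by blast
    have compat: "\<forall>(k, U, \<phi>)\<in>A. \<forall>(l, V, \<psi>)\<in>A. (\<Union>P\<in>plaques (k, U, \<phi>). components (P \<inter> V)) =
       (\<Union>P\<in>plaques (l, V, \<psi>). components (P \<inter> U))"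
      using foliation_A unfolding singular_foliation_def by simp
    have "(\<Union>P\<in>plaques (k, U, \<phi>). components (P \<inter> V)) = (\<Union>P\<in>plaques (2, V, \<psi>). components (P \<inter> U))"
      using bspec[OF bspec[OF compat chart, simplified] V(1)] by simp
    moreover have "C \<in> (\<Union>P\<in>plaques (2, V, \<psi>). components (P \<inter> U))" using C(1) P(1) by blast
    ultimately obtain P' where P': "P' \<in> plaques (k, U, \<phi>)" "C \<in> components (P' \<inter> V)" by auto
    have "C \<subseteq> P'" using in_components_subset[OF P'(2)] by blast
    moreover obtain c where "\<And>q. q \<in> P' \<Longrightarrow> cmod (\<phi> q) ^ k - Re (\<phi> q ^ k) = c" using plaque_level[OF P'(1)] by metis
    ultimately show ?thesis using that[of c] C(2) by blast
  qed
  have line: "\<psi>' ` ?K \<subseteq> (\<lambda>t. \<rho> t y) ` {0<..<1}"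
  proof -
    have "\<psi>' ` ?K \<subseteq> plaque_in A dom ?q"
    proof (rule plaque_in_maximal[OF conn q\<sigma>])
      show "\<psi>' ` ?K \<subseteq> leaf A ?q" using leaf_plaque[OF V(1) P(1)] P(2) q\<sigma> by blast
    qed (use sub in blast)
    then show ?thesis using plaque_in_box[of 0 1 0 1 x y] x y unfolding dom_box by simp
  qed
  obtain g where g: "homeomorphism ({0<..<1} \<times> {0<..<1}) dom pr g" using homeo unfolding dom_def by blast
  have g_apply: "g (\<rho> t y) = (t, y)" if "0 < t" "t < 1" for t
    using homeomorphism_apply1[OF g, of "(t, y)"] that y by simp
  have g_cont: "continuous_on dom g" using g unfolding homeomorphism_def by blast
  define \<xi> where "\<xi> = (\<lambda>s. fst (g (\<sigma> s)))"
  have \<xi>: "0 < \<xi> s \<and> \<xi> s < 1 \<and> \<sigma> s = \<rho> (\<xi> s) y" if "s \<in> ?J" for s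
  proof -
    have "\<sigma> s \<in> (\<lambda>t. \<rho> t y) ` {0<..<1}" using line that unfolding \<sigma>_im by blast
    then obtain t where "0 < t" "t < 1" "\<sigma> s = \<rho> t y" by auto
    then show ?thesis unfolding \<xi>_def using g_apply by simp
  qed
  have "continuous_on ?J \<xi>"
  proof -
    have "continuous_on ?J \<sigma>" unfolding \<sigma>_def
      by (intro continuous_on_compose2[OF \<psi>'_cont] continuous_intros) (use K1 in blast)
    then have "continuous_on ?J (\<lambda>s. g (\<sigma> s))"
      by (rule continuous_on_compose2[OF g_cont]) (use sub \<sigma>_im in blast)
    then show ?thesis unfolding \<xi>_def by (rule continuous_on_fst)
  qed
  moreover have "inj_on \<xi> ?J"
  proof (rule inj_onI)
    fix s t assume st: "s \<in> ?J" "t \<in> ?J" "\<xi> s = \<xi> t"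
    then have "\<sigma> s = \<sigma> t" using \<xi>[of s] \<xi>[of t] by simp
    moreover have "\<psi> (\<sigma> u) = of_real u" if "u \<in> ?J" for u
      unfolding \<sigma>_def using homeomorphism_apply2[OF V(3), of "of_real u"] K1 that by blast
    ultimately have "(of_real s :: complex) = of_real t" using st by metis
    then show "s = t" by simp
  qed
  \<comment> \<open>Invariance of domain: the diameter covers a whole neighbourhood of
    \<open>x\<close> on the line.\<close>
  ultimately have "open (\<xi> ` ?J)" by (intro invariance_of_domain) auto
  moreover have "x \<in> \<xi> ` ?J"
  proof (rule image_eqI)
    show "x = \<xi> 0" unfolding \<xi>_def \<sigma>0 using g_apply x by simp
  qed (rule \<open>0 \<in> ?J\<close>)
  ultimately have "\<forall>\<^sub>F t in at x. t \<in> \<xi> ` ?J" by (rule eventually_at_in_open')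
  then show ?thesis
  proof (rule eventually_mono)
    fix t assume "t \<in> \<xi> ` ?J"
    then obtain s where s: "s \<in> ?J" "t = \<xi> s" by blast
    then have "\<rho> t y = \<sigma> s" using \<xi>[OF s(1)] by simp
    also have "\<dots> \<in> \<psi>' ` ?K" unfolding \<sigma>_im using s(1) by (rule imageI)
    finally show "cmod (\<phi> (\<rho> t y)) ^ k - Re (\<phi> (\<rho> t y) ^ k) = cmod (\<phi> ?q) ^ k - Re (\<phi> ?q ^ k)"
      using c q\<sigma> by simp
  qed
qed

text \<open>If all these points were singular, finiteness and connectedness would shrink this part
  of the side to one point \<open>p\<close>. The horizontal lines of a small box would then all end
  at \<open>p\<close> and stay in the zero level of a chart centred there, so the box would lie in
  the star of \<open>p\<close>, against \<open>no_open_star\<close>.\<close>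

lemma left_side_regular:
  assumes y: "0 \<le> y1" "y1 < y2" "y2 \<le> 1" and reg: "\<And>x s. 0 < x \<Longrightarrow> x < 1 \<Longrightarrow> y1 < s \<Longrightarrow> s < y2 \<Longrightarrow> \<rho> x s \<notin> Sing"
  shows "\<exists>s. y1 < s \<and> s < y2 \<and> \<rho> 0 s \<notin> Sing"
proof (rule ccontr)
  assume neg: "\<not> ?thesis"
  have cont0: "continuous_on {y1<..<y2} (\<lambda>s. \<rho> 0 s)"
    by (rule continuous_on_compose2[OF cont, of _ "\<lambda>s. (0, s)", simplified]) (use y in \<open>auto intro!: continuous_intros\<close>)
  let ?L = "(\<lambda>s. \<rho> 0 s) ` {y1<..<y2}"
  have "connected ?L" by (rule connected_continuous_image[OF cont0]) simp
  moreover have "finite ?L" by (rule finite_subset[OF _ finite_Sing]) (use neg in auto)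
  moreover obtain p where pL: "p \<in> ?L" using y by (metis dense greaterThanLessThan_iff imageI)
  ultimately have p: "?L = {p}"
  proof -
    assume conn: "connected ?L" and fin: "finite ?L"
    have cl: "closed {p}" "closed (?L - {p})" using fin by (auto intro: finite_imp_closed)
    have "?L - {p} = {}"
    proof (rule ccontr)
      assume "?L - {p} \<noteq> {}"
      then show False using conn cl pL unfolding connected_closed by blast
    qed
    then show ?thesis using pL by blast
  qed
  define y0 where "y0 = (y1 + y2) / 2"
  have y0: "y1 < y0" "y0 < y2" using y by (auto simp: y0_def)
  have p0: "\<rho> 0 s = p" if "y1 < s" "s < y2" for s
  proof -
    have "\<rho> 0 s \<in> ?L" using that by simp
    then show ?thesis unfolding p by simp
  qed
  have "p \<in> S" using p0[OF y0] in_S[of 0 y0] y y0 by simp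
  then obtain k U \<phi> where U: "(k, U, \<phi>) \<in> A" "p \<in> U" "\<phi> p = 0" using foliation_A unfolding singular_foliation_def by metis
  have "\<forall>(k, U, \<phi>)\<in>A. 1 \<le> k \<and> openin (top_of_set S) U \<and> (\<exists>\<psi>. homeomorphism U (ball 0 1) \<phi> \<psi>)"
    using foliation_A unfolding singular_foliation_def by simp
  then have "1 \<le> k \<and> openin (top_of_set S) U \<and> (\<exists>\<psi>. homeomorphism U (ball 0 1) \<phi> \<psi>)" using U(1) by auto
  then obtain \<psi> where k: "1 \<le> k" and Uo: "openin (top_of_set S) U" and hom: "homeomorphism U (ball 0 1) \<phi> \<psi>" by blast
  obtain T where T: "open T" "U = S \<inter> T" using Uo unfolding openin_open by blast
  have "(0::real, y0) \<in> {0..1} \<times> {0..1}" "pr (0, y0) \<in> T" using y y0 p0[OF y0] U(2) T by auto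
  then obtain O' where O': "open O'" "(0, y0) \<in> O'" "\<forall>w\<in>{0..1} \<times> {0..1}. w \<in> O' \<longrightarrow> pr w \<in> T"
    using cont T(1) unfolding continuous_on_topological by metis
  obtain X Y where "open X" "open Y" "(0, y0) \<in> X \<times> Y" "X \<times> Y \<subseteq> O'" by (rule open_prod_elim[OF O'(1,2)])
  then have XY: "open X" "open Y" "0 \<in> X" "y0 \<in> Y" "X \<times> Y \<subseteq> O'" by auto
  obtain e1 where e1: "0 < e1" "ball 0 e1 \<subseteq> X" using XY by (meson openE)
  obtain e2 where e2: "0 < e2" "ball y0 e2 \<subseteq> Y" using XY by (meson openE)
  define b where "b = min e1 1"
  define c where "c = max y1 (y0 - e2)"
  define d where "d = min y2 (y0 + e2)"
  have b: "0 < b" "b \<le> 1" using e1 by (auto simp: b_def)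
  have cd: "y1 \<le> c" "c < y0" "y0 < d" "d \<le> y2" using e2 y0 by (auto simp: c_def d_def)
  have inU: "\<rho> x s \<in> U" if "0 \<le> x" "x < b" "c < s" "s < d" for x s
  proof -
    have "x \<in> ball 0 e1" "s \<in> ball y0 e2" using that by (auto simp: b_def c_def d_def dist_real_def)
    then have "(x, s) \<in> O'" using e1 e2 XY by blast
    moreover have "(x, s) \<in> {0..1} \<times> {0..1}" using that b cd y by auto
    ultimately have "pr (x, s) \<in> T" using O'(3) by blast
    moreover have "\<rho> x s \<in> S" using that b cd y by (intro in_S) auto
    ultimately show ?thesis using T by simp
  qed
  let ?g = "\<lambda>q. cmod (\<phi> q) ^ k - Re (\<phi> q ^ k)"
  \<comment> \<open>The level is constant along the open line and continuous up to its end
    \<open>p\<close>, where it vanishes.\<close>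
  have zero: "?g (\<rho> x s) = 0" if xs: "0 < x" "x < b" "c < s" "s < d" for x s
  proof -
    have const: "?g (\<rho> t s) = ?g (\<rho> x s)" if t: "t \<in> {0<..<b}" for t
    proof (rule connected_local_const[of "{0<..<b}" t x "\<lambda>w. ?g (\<rho> w s)"])
      show "\<forall>a\<in>{0<..<b}. \<forall>\<^sub>F w in at a within {0<..<b}. ?g (\<rho> a s) = ?g (\<rho> w s)"
      proof
        fix a assume a: "a \<in> {0<..<b}"
        have "\<forall>\<^sub>F w in at a. ?g (\<rho> w s) = ?g (\<rho> a s)"
          using a b cd xs y inU[of a s] reg[of a s] by (intro level_locally_constant[OF U(1)]) auto
        then have "\<forall>\<^sub>F w in at a. ?g (\<rho> a s) = ?g (\<rho> w s)" by (rule eventually_mono) simp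
        then show "\<forall>\<^sub>F w in at a within {0<..<b}. ?g (\<rho> a s) = ?g (\<rho> w s)"
          by (rule filter_leD[OF at_le[OF subset_UNIV]])
      qed
    qed (use xs t in auto)
    have \<phi>_cont: "continuous_on U \<phi>" using hom unfolding homeomorphism_def by blast
    have s01: "0 \<le> s" "s \<le> 1" using xs cd y by auto
    have "continuous_on {0..<b} (\<lambda>t. \<rho> t s)" by (rule continuous_on_subset[OF cont_h[OF s01]]) (use b in auto)
    then have "continuous_on {0..<b} (\<lambda>t. \<phi> (\<rho> t s))"
      by (rule continuous_on_compose2[OF \<phi>_cont]) (use inU xs in auto)
    then have "continuous_on {0..<b} (\<lambda>t. ?g (\<rho> t s))" by (intro continuous_intros)
    then have "((\<lambda>t. ?g (\<rho> t s)) \<longlongrightarrow> ?g (\<rho> 0 s)) (at 0 within {0..<b})" using b unfolding continuous_on_def by simp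
    moreover have "at 0 within {0..<b} = at_right (0::real)" by (rule at_within_nhd[of _ "{..<b}"]) (use b in auto)
    ultimately have l1: "((\<lambda>t. ?g (\<rho> t s)) \<longlongrightarrow> ?g (\<rho> 0 s)) (at_right 0)" by simp
    have "\<forall>\<^sub>F t in at_right 0. t \<in> {0<..<b}" using b(1) by (rule eventually_at_right_real)
    then have ev: "\<forall>\<^sub>F t in at_right 0. ?g (\<rho> t s) = ?g (\<rho> x s)" by (rule eventually_mono) (rule const)
    have "((\<lambda>t. ?g (\<rho> x s)) \<longlongrightarrow> ?g (\<rho> 0 s)) (at_right (0::real))" by (rule Lim_transform_eventually[OF l1 ev])
    then have "?g (\<rho> x s) = ?g (\<rho> 0 s)" by (rule tendsto_const_iff[OF trivial_limit_at_right_real, THEN iffD1])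
    also have "\<rho> 0 s = p" using p0[of s] xs cd by simp
    also have "?g p = 0" using U(3) k by simp
    finally show ?thesis .
  qed
  have box_U: "box_im 0 b c d \<subseteq> U" using inU unfolding box_im_def by force
  have "openin (top_of_set S) (box_im 0 b c d)" using b cd y by (intro openin_box) auto
  then have "openin (top_of_set U) (box_im 0 b c d)" using box_U openin_imp_subset[OF Uo] by (rule openin_subset_trans)
  then have "openin (top_of_set (ball 0 1)) (\<phi> ` box_im 0 b c d)" by (rule homeomorphism_imp_open_map[OF hom])
  then have "open (\<phi> ` box_im 0 b c d)" using openin_open_trans[OF _ open_ball] by blast
  moreover have "\<rho> (b / 2) y0 \<in> box_im 0 b c d" using b cd by (intro box_imI) auto
  then have "\<phi> ` box_im 0 b c d \<noteq> {}" by blast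
  ultimately obtain z where z: "z \<in> \<phi> ` box_im 0 b c d" "cmod z ^ k - Re (z ^ k) \<noteq> 0" using no_open_star[OF _ _ k] by blast
  then obtain x s where "0 < x" "x < b" "c < s" "s < d" "z = \<phi> (\<rho> x s)" unfolding box_im_def by force
  then show False using zero[of x s] z(2) by simp
qed

text \<open>The line through a regular point of the side is a compact transverse arc, side included,
  and has finite measure. Every other line of the band slides onto a part of it. The abscissa 1/2
  merely keeps the other side away.\<close>

lemma left_half_bounded:
  assumes y: "0 \<le> y1" "y1 < y2" "y2 \<le> 1" and reg: "\<And>x s. 0 < x \<Longrightarrow> x < 1 \<Longrightarrow> y1 < s \<Longrightarrow> s < y2 \<Longrightarrow> \<rho> x s \<notin> Sing"
  shows "\<exists>M<\<infinity>. \<forall>s x. y1 < s \<longrightarrow> s < y2 \<longrightarrow> 0 < x \<longrightarrow> x < 1/2 \<longrightarrow> \<mu> (hseg x (1/2) s) \<le> M"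
proof -
  obtain l where l: "y1 < l" "l < y2" "\<rho> 0 l \<notin> Sing" using left_side_regular[OF assms] by blast
  have lreg: "\<rho> t l \<notin> Sing" if "0 \<le> t" "t \<le> 1/2" for t
    using that l reg[of t l] by (cases "t = 0") auto
  have l01: "0 < l" "l < 1" using l y by auto
  have fin: "\<mu> (hseg 0 (1/2) l) < \<infinity>" by (rule hseg_measure(3)) (use l01 lreg in auto)
  have "\<mu> (hseg x (1/2) s) \<le> \<mu> (hseg 0 (1/2) l)" if s: "y1 < s" "s < y2" and x: "0 < x" "x < 1/2" for s x
  proof -
    have s01: "0 < s" "s < 1" using s y by linarith+
    have "closed_segment s l \<subseteq> {y1<..<y2}" using s l by (intro closed_segment_subset) auto
    then have cs: "y1 < w \<and> w < y2" if "w \<in> closed_segment s l" for w using that by auto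
    have "\<mu> (hseg x (1/2) s) = \<mu> (hseg x (1/2) l)"
      by (rule hseg_measure_holonomy) (use x s01 l01 reg cs in auto)
    also have "\<dots> \<le> \<mu> (hseg 0 (1/2) l)" by (rule hseg_measure_mono) (use l01 lreg x in auto)
    finally show ?thesis .
  qed
  with fin show ?thesis by blast
qed

lemma band_bounded:
  assumes y: "0 \<le> y1" "y1 < y2" "y2 \<le> 1" and reg: "\<And>x s. 0 < x \<Longrightarrow> x < 1 \<Longrightarrow> y1 < s \<Longrightarrow> s < y2 \<Longrightarrow> \<rho> x s \<notin> Sing"
  shows "\<exists>M<\<infinity>. \<forall>s x1 x2. y1 < s \<longrightarrow> s < y2 \<longrightarrow> 0 < x1 \<longrightarrow> x1 < x2 \<longrightarrow> x2 < 1 \<longrightarrow> \<mu> (hseg x1 x2 s) \<le> M"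
proof -
  interpret R: measured_rectangle S A B Sing \<mu> "\<lambda>x y. \<rho> (1 - x) y"
    unfolding measured_rectangle_def using bifoliation_axioms reflect by blast
  obtain M1 where M1: "M1 < \<infinity>" "\<And>s x. y1 < s \<Longrightarrow> s < y2 \<Longrightarrow> 0 < x \<Longrightarrow> x < 1/2 \<Longrightarrow> \<mu> (hseg x (1/2) s) \<le> M1"
    using left_half_bounded[OF assms] by blast
  obtain M2 where M2: "M2 < \<infinity>" "\<And>s x. y1 < s \<Longrightarrow> s < y2 \<Longrightarrow> 0 < x \<Longrightarrow> x < 1/2 \<Longrightarrow> \<mu> (R.hseg x (1/2) s) \<le> M2"
    using R.left_half_bounded[OF y] reg by (metis (no_types, lifting) diff_gt_0_iff_gt diff_less_eq less_add_same_cancel1)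
  have refl: "R.hseg x (1/2) s = hseg (1/2) (1 - x) s" for x s
  proof -
    have "{1/2..1 - x} = (\<lambda>t. 1 - t) ` {x..1/2}" by (simp add: image_diff_atLeastAtMost)
    then show ?thesis unfolding R.hseg_def hseg_def by (simp only: image_image)
  qed
  have "\<mu> (hseg x1 x2 s) \<le> M1 + M2" if s: "y1 < s" "s < y2" and x: "0 < x1" "x1 < x2" "x2 < 1" for s x1 x2
  proof -
    \<comment> \<open>The segment is enlarged so as to contain 1/2; it then splits into a left half
      and a reflected left half.\<close>
    define a where "a = min x1 (1/4)"
    define b where "b = max x2 (3/4)"
    have ab: "0 < a" "a < 1/2" "1/2 < b" "b < 1" "a \<le> x1" "x2 \<le> b" using x by (auto simp: a_def b_def)
    have s01: "0 < s" "s < 1" using s y by auto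
    have regs: "\<rho> t s \<notin> Sing" if "a \<le> t" "t \<le> b" for t using reg[of t s] that ab s by auto
    have un: "hseg a (1/2) s \<union> hseg (1/2) b s = hseg a b s"
      unfolding hseg_def image_Un[symmetric] using ab by (simp add: ivl_disj_un_two_touch(4))
    have lt: "a < b" using ab by simp
    note arc = hseg_measure(1)[OF less_imp_le[OF ab(1)] lt ab(4) s01 regs]
    have "\<mu> (hseg x1 x2 s) \<le> \<mu> (hseg a b s)"
      using ab by (intro hseg_measure_mono[OF less_imp_le[OF ab(1)] lt ab(4) s01 regs]) auto
    also have "\<dots> \<le> \<mu> (hseg a (1/2) s) + \<mu> (hseg (1/2) b s)"
      unfolding un[symmetric] using un path_image_hpath[of a b s] lt ab s01
      by (intro transverse_measure_on_arc(2)[OF measure_B arc] closed_hseg) auto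
    also have "\<dots> \<le> M1 + M2"
      using M1(2)[OF s, of a] M2(2)[OF s, of "1 - b"] ab unfolding refl by (intro add_mono) auto
    finally show ?thesis .
  qed
  moreover have "M1 + M2 < \<infinity>" using M1(1) M2(1) by (simp add: ennreal_add_less_top)
  ultimately show ?thesis by blast
qed

text \<open>Instead of proving the interior regular, the argument avoids the finitely many heights
  at which a singularity could lie.\<close>

definition bad_heights :: "real set"
  where "bad_heights = {y \<in> {0<..<1}. \<exists>x\<in>{0<..<1}. \<rho> x y \<in> Sing}"

lemma finite_bad_heights: "finite bad_heights"
proof -
  obtain g where g: "homeomorphism ({0<..<1} \<times> {0<..<1}) dom pr g" using homeo unfolding dom_def by blast
  have "bad_heights \<subseteq> (\<lambda>q. snd (g q)) ` Sing"
  proof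
    fix y assume "y \<in> bad_heights"
    then obtain x where x: "0 < x" "x < 1" "0 < y" "y < 1" "\<rho> x y \<in> Sing" unfolding bad_heights_def by auto
    have "g (\<rho> x y) = (x, y)" using homeomorphism_apply1[OF g, of "(x, y)"] x by simp
    then show "y \<in> (\<lambda>q. snd (g q)) ` Sing" using x(5) by force
  qed
  then show ?thesis using finite_Sing by (rule finite_surj[rotated])
qed

text \<open>Sliding cannot cross a bad height. Each bad height splits the band in two, and the
  bounds of the two parts are combined by a maximum.\<close>

lemma bounded_width_aux:
  assumes "0 \<le> a" "a < b" "b \<le> 1"
  shows "\<exists>M<\<infinity>. \<forall>s x1 x2. a < s \<longrightarrow> s < b \<longrightarrow> s \<notin> bad_heights \<longrightarrow> 0 < x1 \<longrightarrow> x1 < x2 \<longrightarrow> x2 < 1 \<longrightarrow> \<mu> (hseg x1 x2 s) \<le> M"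
  using assms
proof (induction "card (bad_heights \<inter> {a<..<b})" arbitrary: a b rule: less_induct)
  case less
  show ?case
  proof (cases "bad_heights \<inter> {a<..<b} = {}")
    case True
    have "\<rho> x s \<notin> Sing" if "0 < x" "x < 1" "a < s" "s < b" for x s
    proof
      assume "\<rho> x s \<in> Sing"
      then have "s \<in> bad_heights \<inter> {a<..<b}" using that less.prems unfolding bad_heights_def by auto
      then show False using True by blast
    qed
    from band_bounded[OF less.prems this] show ?thesis by blast
  next
    case False
    then obtain c where c: "c \<in> bad_heights" "a < c" "c < b" by auto
    have fin: "finite (bad_heights \<inter> {a<..<b})" using finite_bad_heights by simp
    have "card (bad_heights \<inter> {a<..<c}) < card (bad_heights \<inter> {a<..<b})"
      by (rule psubset_card_mono[OF fin]) (use c in auto)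
    from less.hyps[OF this] obtain M1 where M1: "M1 < \<infinity>"
      "\<forall>s x1 x2. a < s \<longrightarrow> s < c \<longrightarrow> s \<notin> bad_heights \<longrightarrow> 0 < x1 \<longrightarrow> x1 < x2 \<longrightarrow> x2 < 1 \<longrightarrow> \<mu> (hseg x1 x2 s) \<le> M1"
      using less.prems c by auto
    have "card (bad_heights \<inter> {c<..<b}) < card (bad_heights \<inter> {a<..<b})"
      by (rule psubset_card_mono[OF fin]) (use c in auto)
    from less.hyps[OF this] obtain M2 where M2: "M2 < \<infinity>"
      "\<forall>s x1 x2. c < s \<longrightarrow> s < b \<longrightarrow> s \<notin> bad_heights \<longrightarrow> 0 < x1 \<longrightarrow> x1 < x2 \<longrightarrow> x2 < 1 \<longrightarrow> \<mu> (hseg x1 x2 s) \<le> M2"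
      using less.prems c by auto
    show ?thesis
    proof (intro exI[of _ "max M1 M2"] conjI allI impI)
      fix s x1 x2 :: real assume h: "a < s" "s < b" "s \<notin> bad_heights" "0 < x1" "x1 < x2" "x2 < 1"
      have "s \<noteq> c" using h c by blast
      then consider "s < c" | "c < s" by linarith
      then show "\<mu> (hseg x1 x2 s) \<le> max M1 M2"
        using M1(2) M2(2) h by cases (simp_all add: le_max_iff_disj)
    qed (use M1(1) M2(1) in simp)
  qed
qed

lemma bounded_width:
  obtains M where "M < \<infinity>" "\<And>y x1 x2. 0 < y \<Longrightarrow> y < 1 \<Longrightarrow> y \<notin> bad_heights \<Longrightarrow> 0 < x1 \<Longrightarrow> x1 < x2 \<Longrightarrow> x2 < 1 \<Longrightarrow>
    \<mu> (hseg x1 x2 y) \<le> M"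
  using bounded_width_aux[of 0 1] by auto

end

text \<open>A leafwise expanding map cannot keep a fixed leaf segment inside finitely many rectangles,
  whose widths are bounded.\<close>

lemma no_persistent_segment:
  fixes \<rho> :: "'i \<Rightarrow> real \<Rightarrow> real \<Rightarrow> 'a::t2_space"
  assumes rect: "\<And>i. i \<in> I \<Longrightarrow> measured_rectangle S A B Sing \<mu> (\<rho> i)" and "finite I"
    and expand: "\<And>J J'. regular_leaf_arc S A J \<Longrightarrow> regular_leaf_arc S A J' \<Longrightarrow> path_image J' = F ` path_image J \<Longrightarrow>
      \<mu> (path_image J') = ennreal \<Lambda> * \<mu> (path_image J)" and "1 < \<Lambda>"
    and idx: "\<And>N. ix N \<in> I" and x: "x1 < x2"
    and orbit: "\<And>N x y. x1 \<le> x \<Longrightarrow> x \<le> x2 \<Longrightarrow> 0 < y \<Longrightarrow> y < 1 \<Longrightarrow>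
      (F ^^ N) (\<rho> (ix 0) x y) = \<rho> (ix N) (\<xi> N x) (\<eta> N y)"
    and \<xi>: "\<And>N. \<xi> N ` {x1..x2} = {p N..q N}" "\<And>N. 0 < p N" "\<And>N. p N < q N" "\<And>N. q N < 1"
    and \<xi>0: "\<And>x. x1 \<le> x \<Longrightarrow> x \<le> x2 \<Longrightarrow> \<xi> 0 x = x"
    and \<eta>: "\<And>N y. 0 < y \<Longrightarrow> y < 1 \<Longrightarrow> 0 < \<eta> N y \<and> \<eta> N y < 1" "\<And>N. inj_on (\<eta> N) {0<..<1}"
  shows False
proof -
  define bad where "bad = (\<lambda>i. measured_rectangle.bad_heights Sing (\<rho> i))"
  define seg where "seg = (\<lambda>i x y z. measured_rectangle.hseg (\<rho> i) x y z)"
  have "\<exists>M<\<infinity>. \<forall>y x1 x2. 0 < y \<longrightarrow> y < 1 \<longrightarrow> y \<notin> bad i \<longrightarrow> 0 < x1 \<longrightarrow> x1 < x2 \<longrightarrow> x2 < 1 \<longrightarrow>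
    \<mu> (seg i x1 x2 y) \<le> M" if "i \<in> I" for i
    using measured_rectangle.bounded_width[OF rect[OF that]] unfolding bad_def seg_def by metis
  then have "\<forall>i. \<exists>M. i \<in> I \<longrightarrow> M < \<infinity> \<and> (\<forall>y x1 x2. 0 < y \<longrightarrow> y < 1 \<longrightarrow> y \<notin> bad i \<longrightarrow> 0 < x1 \<longrightarrow> x1 < x2 \<longrightarrow> x2 < 1 \<longrightarrow>
    \<mu> (seg i x1 x2 y) \<le> M)" by blast
  then obtain M where M: "\<And>i. i \<in> I \<Longrightarrow> M i < \<infinity>" "\<And>i y x1 x2. i \<in> I \<Longrightarrow> 0 < y \<Longrightarrow> y < 1 \<Longrightarrow> y \<notin> bad i \<Longrightarrow> 0 < x1 \<Longrightarrow>
    x1 < x2 \<Longrightarrow> x2 < 1 \<Longrightarrow> \<mu> (seg i x1 x2 y) \<le> M i" by metis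
  define K where "K = (\<Sum>i\<in>I. M i)"
  have K: "K < \<infinity>" unfolding K_def using M(1) \<open>finite I\<close> by (simp add: ennreal_sum_less_top)
  have MK: "M i \<le> K" if "i \<in> I" for i unfolding K_def using that \<open>finite I\<close> by (intro member_le_sum) auto
  \<comment> \<open>For each \<open>N\<close> only finitely many \<open>y\<close> are carried by
    \<open>\<eta> N\<close> to a bad height. All but countably many lines therefore avoid
    singularities along the whole orbit.\<close>
  have cb: "countable (\<Union>N. \<eta> N -` bad (ix N) \<inter> {0<..<1})"
  proof (rule countable_UN)
    fix N
    have "finite (bad (ix N))" unfolding bad_def by (rule measured_rectangle.finite_bad_heights[OF rect[OF idx]])
    then have "finite (\<eta> N -` bad (ix N) \<inter> {0<..<1})" by (rule finite_vimage_IntI[OF _ \<eta>(2)])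
    then show "countable (\<eta> N -` bad (ix N) \<inter> {0<..<1})" by (rule countable_finite)
  qed simp
  have "uncountable {0<..<1::real}" by (simp add: uncountable_open_interval)
  then have "\<not> {0<..<1} \<subseteq> (\<Union>N. \<eta> N -` bad (ix N) \<inter> {0<..<1})" using countable_subset[OF _ cb] by blast
  then obtain y where "y \<in> {0<..<1}" and yb: "y \<notin> (\<Union>N. \<eta> N -` bad (ix N) \<inter> {0<..<1})" by blast
  then have y: "0 < y" "y < 1" "\<eta> N y \<notin> bad (ix N)" for N by auto
  define J where "J = (\<lambda>N. measured_rectangle.hpath (\<rho> (ix N)) (p N) (q N) (\<eta> N y))"
  have im: "path_image (J N) = seg (ix N) (p N) (q N) (\<eta> N y)" for N
    unfolding J_def seg_def using measured_rectangle.path_image_hpath[OF rect[OF idx]] \<xi>(3) by (metis less_imp_le)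
  have regular: "\<rho> (ix N) t (\<eta> N y) \<notin> Sing" if "p N \<le> t" "t \<le> q N" for N t
  proof
    assume "\<rho> (ix N) t (\<eta> N y) \<in> Sing"
    then have "\<eta> N y \<in> bad (ix N)"
      unfolding bad_def measured_rectangle.bad_heights_def[OF rect[OF idx]]
      using \<eta>(1)[OF y(1,2), of N] \<xi>(2,4)[of N] that by force
    then show False using y(3) by blast
  qed
  have arc: "regular_leaf_arc S A (J N)" for N
    unfolding J_def
    by (rule measured_rectangle.hpath_arc[OF rect[OF idx] less_imp_le[OF \<xi>(2)] \<xi>(3,4)])
      (use \<eta>(1)[OF y(1,2), of N] regular in auto)
  have orb: "path_image (J N) = (F ^^ N) ` seg (ix 0) x1 x2 y" for N
  proof -
    have "(F ^^ N) ` seg (ix 0) x1 x2 y = (\<lambda>x. \<rho> (ix N) (\<xi> N x) (\<eta> N y)) ` {x1..x2}"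
      unfolding seg_def measured_rectangle.hseg_def[OF rect[OF idx]] image_image using orbit y by (intro image_cong) auto
    also have "\<dots> = (\<lambda>x. \<rho> (ix N) x (\<eta> N y)) ` {p N..q N}" unfolding \<xi>(1)[symmetric] image_image ..
    finally show ?thesis unfolding im unfolding seg_def measured_rectangle.hseg_def[OF rect[OF idx]] ..
  qed
  have grow: "\<mu> (path_image (J N)) = ennreal (\<Lambda> ^ N) * \<mu> (path_image (J 0))" for N
  proof (induction N)
    case (Suc N)
    have "path_image (J (Suc N)) = F ` path_image (J N)" unfolding orb by (simp add: image_comp)
    from expand[OF arc arc this] show ?case
      unfolding Suc using \<open>1 < \<Lambda>\<close> by (simp add: ennreal_mult mult.assoc)
  qed simp
  have "\<mu> (path_image (J 0)) > 0"
    unfolding im seg_def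
    by (rule measured_rectangle.hseg_measure(2)[OF rect[OF idx] less_imp_le[OF \<xi>(2)] \<xi>(3,4)])
      (use \<eta>(1)[OF y(1,2), of 0] regular in auto)
  moreover have bound: "\<mu> (path_image (J N)) \<le> K" for N
    using M(2)[OF idx, of "\<eta> N y" N "p N" "q N"] \<eta>(1)[OF y(1,2), of N] y(3) \<xi>(2-4)[of N] MK[OF idx, of N]
    unfolding im by (meson order_trans)
  moreover have "\<mu> (path_image (J 0)) < \<infinity>" using bound[of 0] K by (rule le_less_trans)
  ultimately obtain m where m: "\<mu> (path_image (J 0)) = ennreal m" "0 < m"
    by (metis ennreal_cases ennreal_less_zero_iff infinity_ennreal_def less_irrefl)
  obtain K' where K': "K = ennreal K'" "0 \<le> K'" using K by (cases K) auto
  obtain N where "K' / m < \<Lambda> ^ N" using real_arch_pow[OF \<open>1 < \<Lambda>\<close>] by blast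
  then have "K' < \<Lambda> ^ N * m" using m(2) by (simp add: field_simps)
  moreover have "ennreal (\<Lambda> ^ N * m) \<le> ennreal K'"
    using bound[of N] unfolding grow[of N] m(1) K'(1) using \<open>1 < \<Lambda>\<close> m(2) by (simp add: ennreal_mult)
  then have "\<Lambda> ^ N * m \<le> K'" using K'(2) by (simp add: ennreal_le_iff)
  ultimately show False by simp
qed

section \<open>Expanding maps in product coordinates\<close>

lemma seg_open_range:
  assumes "seg e \<phi>" "0 < x" "x < 1"
  shows "0 < \<phi> x \<and> \<phi> x < 1"
  using seg_less_iff[OF assms(1), of 0 x] seg_less_iff[OF assms(1), of x 0] seg_less_iff[OF assms(1), of x 1]
    seg_less_iff[OF assms(1), of 1 x] seg_range[OF assms(1), of 0] seg_range[OF assms(1), of 1] assms(2,3)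
  by (cases e) auto

lemma seg_inverse_image:
  assumes "seg e \<phi>" "0 \<le> c" "c \<le> d" "d \<le> 1" "\<And>x. 0 \<le> x \<Longrightarrow> x \<le> 1 \<Longrightarrow> \<psi> (\<phi> x) = x"
    "{\<phi> c, \<phi> d} = {x1, x2}" "x1 \<le> x2"
  shows "\<psi> ` {x1..x2} = {c..d}"
proof -
  have "{x1..x2} = \<phi> ` {c..d}"
    using seg_image_Icc[OF assms(1-4)] seg_le_iff[OF assms(1), of c d] seg_le_iff[OF assms(1), of d c] assms(2-4,6,7)
    by (cases e) (auto simp: doubleton_eq_iff)
  then have "\<psi> ` {x1..x2} = (\<lambda>x. \<psi> (\<phi> x)) ` {c..d}" by (simp add: image_image)
  also have "\<dots> = (\<lambda>x. x) ` {c..d}" using assms by (intro image_cong) auto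
  finally show ?thesis by simp
qed

text \<open>Written once for \<open>f\<close> and its inverse. The first coordinate of
  \<open>\<sigma>\<close> is the expanded one, \<open>\<phi>\<close> is its inverse branch, and
  \<open>\<psi>\<close> is the action on the other coordinate. The assumption \<open>exact\<close>
  says that a transition from \<open>i\<close> to \<open>k\<close> passes through the branch
  \<open>\<phi> i k\<close> only.\<close>

locale transition_system =
  fixes F :: "'a::t2_space \<Rightarrow> 'a" and \<sigma> :: "nat \<Rightarrow> real \<Rightarrow> real \<Rightarrow> 'a" and E :: "nat \<Rightarrow> nat \<Rightarrow> bool"
    and \<phi> \<psi> :: "nat \<Rightarrow> nat \<Rightarrow> real \<Rightarrow> real"
  assumes seg_\<phi>: "E i k \<Longrightarrow> \<exists>e. seg e (\<phi> i k)" and seg_\<psi>: "E i k \<Longrightarrow> \<exists>e. seg e (\<psi> i k)"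
    and move: "E i k \<Longrightarrow> 0 < x \<Longrightarrow> x < 1 \<Longrightarrow> 0 < y \<Longrightarrow> y < 1 \<Longrightarrow> F (\<sigma> i (\<phi> i k x) y) = \<sigma> k x (\<psi> i k y)"
    and exact: "E i k \<Longrightarrow> 0 < x \<Longrightarrow> x < 1 \<Longrightarrow> 0 < y \<Longrightarrow> y < 1 \<Longrightarrow> 0 < x' \<Longrightarrow> x' < 1 \<Longrightarrow> 0 < y' \<Longrightarrow> y' < 1 \<Longrightarrow>
      F (\<sigma> i x y) = \<sigma> k x' y' \<Longrightarrow> \<exists>t. 0 < t \<and> t < 1 \<and> x = \<phi> i k t"
    and \<sigma>_inj: "E i k \<Longrightarrow> 0 < x \<Longrightarrow> x < 1 \<Longrightarrow> 0 < y \<Longrightarrow> y < 1 \<Longrightarrow> 0 < x' \<Longrightarrow> x' < 1 \<Longrightarrow> 0 < y' \<Longrightarrow> y' < 1 \<Longrightarrow>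
      \<sigma> k x y = \<sigma> k x' y' \<Longrightarrow> x = x' \<and> y = y'"
begin

definition cell :: "nat \<Rightarrow> 'a set"
  where "cell i = {\<sigma> i x y | x y. 0 < x \<and> x < 1 \<and> 0 < y \<and> y < 1}"

primrec drift :: "(nat \<Rightarrow> nat) \<Rightarrow> nat \<Rightarrow> real \<Rightarrow> real" where
  "drift u 0 = (\<lambda>y. y)"
| "drift u (Suc N) = (\<lambda>y. drift (\<lambda>m. u (Suc m)) N (\<psi> (u 0) (u (Suc 0)) y))"

lemma \<psi>_open: "E i k \<Longrightarrow> 0 < x \<Longrightarrow> x < 1 \<Longrightarrow> 0 < \<psi> i k x \<and> \<psi> i k x < 1"
  using seg_\<psi> seg_open_range by blast

lemma itin_open: "(\<And>m. E (u m) (u (Suc m))) \<Longrightarrow> 0 < x \<Longrightarrow> x < 1 \<Longrightarrow> 0 < itin \<phi> u N x \<and> itin \<phi> u N x < 1"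
proof -
  assume "\<And>m. E (u m) (u (Suc m))" and x: "0 < x" "x < 1"
  then have "\<And>m. \<exists>e. seg e (\<phi> (u m) (u (Suc m)))" by (intro seg_\<phi>)
  then have "\<exists>e. seg e (itin \<phi> u N)" by (rule seg_itin[of \<phi> u])
  then show ?thesis using seg_open_range x by blast
qed

lemma seg_drift: "(\<And>m. E (u m) (u (Suc m))) \<Longrightarrow> \<exists>e. seg e (drift u N)"
proof (induction N arbitrary: u)
  case 0 show ?case unfolding drift.simps using seg_id by (rule exI)
next
  case (Suc N)
  have "\<exists>e. seg e (drift (\<lambda>m. u (Suc m)) N)" by (rule Suc.IH) (rule Suc.prems)
  then obtain e where e: "seg e (drift (\<lambda>m. u (Suc m)) N)" ..
  obtain e' where "seg e' (\<psi> (u 0) (u (Suc 0)))" using seg_\<psi>[OF Suc.prems[of 0]] ..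
  from seg_comp[OF e this] show ?case unfolding drift.simps by (rule exI)
qed

lemma orbit:
  assumes "\<And>m. E (u m) (u (Suc m))" "0 < x" "x < 1" "0 < y" "y < 1"
  shows "(F ^^ N) (\<sigma> (u 0) (itin \<phi> u N x) y) = \<sigma> (u N) x (drift u N y)"
  using assms(1,4,5)
proof (induction N arbitrary: u y)
  case (Suc N)
  let ?v = "\<lambda>m. u (Suc m)"
  have v: "\<And>m. E (?v m) (?v (Suc m))" by (rule Suc.prems(1))
  note i = itin_open[of ?v x N, OF v assms(2,3)]
  have "F (\<sigma> (u 0) (itin \<phi> u (Suc N) x) y) = \<sigma> (u (Suc 0)) (itin \<phi> ?v N x) (\<psi> (u 0) (u (Suc 0)) y)"
    using move[OF Suc.prems(1)[of 0]] i Suc.prems(2,3) by simp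
  moreover have "(F ^^ N) (\<sigma> (?v 0) (itin \<phi> ?v N x) (\<psi> (u 0) (u (Suc 0)) y)) = \<sigma> (?v N) x (drift ?v N (\<psi> (u 0) (u (Suc 0)) y))"
    using \<psi>_open[OF Suc.prems(1)[of 0] Suc.prems(2,3)] by (intro Suc.IH[of ?v, OF v]) auto
  ultimately show ?case by (simp add: funpow_swap1)
qed simp

text \<open>Each further letter narrows the expanded coordinate by one inverse branch and leaves the
  other coordinate free.\<close>

lemma itinerary_cell:
  assumes "\<And>m. E (u m) (u (Suc m))"
  shows "(\<forall>m\<le>N. (F ^^ m) q \<in> cell (u m)) \<longleftrightarrow>
    (\<exists>x y. 0 < x \<and> x < 1 \<and> 0 < y \<and> y < 1 \<and> q = \<sigma> (u 0) (itin \<phi> u N x) y)"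
  using assms
proof (induction N arbitrary: u q)
  case 0
  then show ?case unfolding cell_def by auto
next
  case (Suc N)
  let ?v = "\<lambda>m. u (Suc m)"
  have v: "\<And>m. E (?v m) (?v (Suc m))" by (rule Suc.prems(1))
  note E0 = Suc.prems[of 0]
  have split: "(\<forall>m\<le>Suc N. (F ^^ m) q \<in> cell (u m)) \<longleftrightarrow> q \<in> cell (u 0) \<and> (\<forall>m\<le>N. (F ^^ m) (F q) \<in> cell (?v m))"
  proof -
    have "(\<forall>m\<le>Suc N. P m) \<longleftrightarrow> P 0 \<and> (\<forall>m\<le>N. P (Suc m))" for P :: "nat \<Rightarrow> bool"
      by (metis Suc_le_mono le0 not0_implies_Suc)
    from this[of "\<lambda>m. (F ^^ m) q \<in> cell (u m)"] show ?thesis by (simp add: funpow_swap1)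
  qed
  note IH = Suc.IH[of ?v "F q", OF v]
  show ?case
    unfolding split IH
  proof
    assume h: "q \<in> cell (u 0) \<and> (\<exists>x y. 0 < x \<and> x < 1 \<and> 0 < y \<and> y < 1 \<and> F q = \<sigma> (?v 0) (itin \<phi> ?v N x) y)"
    then obtain a b where ab: "0 < a" "a < 1" "0 < b" "b < 1" "q = \<sigma> (u 0) a b" unfolding cell_def by blast
    obtain x y where xy: "0 < x" "x < 1" "0 < y" "y < 1" "F q = \<sigma> (u (Suc 0)) (itin \<phi> ?v N x) y" using h by blast
    note i = itin_open[of ?v x N, OF v xy(1,2)]
    obtain t where t: "0 < t" "t < 1" "a = \<phi> (u 0) (u (Suc 0)) t"
      using exact[OF E0 ab(1-4), of "itin \<phi> ?v N x" y] i xy unfolding ab(5) by blast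
    have "F q = \<sigma> (u (Suc 0)) t (\<psi> (u 0) (u (Suc 0)) b)" unfolding ab(5) t(3) by (rule move[OF E0 t(1,2) ab(3,4)])
    then have eq: "\<sigma> (u (Suc 0)) t (\<psi> (u 0) (u (Suc 0)) b) = \<sigma> (u (Suc 0)) (itin \<phi> ?v N x) y" using xy(5) by (rule subst)
    note \<psi>b = \<psi>_open[OF E0 ab(3,4)]
    have "t = itin \<phi> ?v N x"
      by (rule conjunct1[OF \<sigma>_inj[OF E0 t(1,2) conjunct1[OF \<psi>b] conjunct2[OF \<psi>b] conjunct1[OF i] conjunct2[OF i] xy(3,4) eq]])
    then have "q = \<sigma> (u 0) (itin \<phi> u (Suc N) x) b" using ab(5) t(3) by simp
    then show "\<exists>x y. 0 < x \<and> x < 1 \<and> 0 < y \<and> y < 1 \<and> q = \<sigma> (u 0) (itin \<phi> u (Suc N) x) y" using xy ab by blast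
  next
    assume "\<exists>x y. 0 < x \<and> x < 1 \<and> 0 < y \<and> y < 1 \<and> q = \<sigma> (u 0) (itin \<phi> u (Suc N) x) y"
    then obtain x y where xy: "0 < x" "x < 1" "0 < y" "y < 1" "q = \<sigma> (u 0) (itin \<phi> u (Suc N) x) y" by blast
    have "q \<in> cell (u 0)" unfolding cell_def using xy itin_open[of u x "Suc N", OF Suc.prems xy(1,2)] by blast
    moreover have "F q = \<sigma> (?v 0) (itin \<phi> ?v N x) (\<psi> (u 0) (u (Suc 0)) y)"
      using move[OF E0, of "itin \<phi> ?v N x" y] itin_open[of ?v x N, OF v xy(1,2)] xy by simp
    ultimately show "q \<in> cell (u 0) \<and> (\<exists>x y. 0 < x \<and> x < 1 \<and> 0 < y \<and> y < 1 \<and> F q = \<sigma> (?v 0) (itin \<phi> ?v N x) y)"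
      using xy \<psi>_open[OF E0 xy(3,4)] by blast
  qed
qed

text \<open>Two limit points span a segment that follows \<open>u\<close> forever. Its images all
  stay inside the finitely many rectangles, which \<open>no_persistent_segment\<close>
  excludes.\<close>

lemma limit_points_unique:
  assumes chain: "\<And>m. E (u m) (u (Suc m))"
    and rect: "\<And>i. i \<in> I \<Longrightarrow> measured_rectangle S A B Sing \<mu> (\<sigma> i)" and "finite I" and idx: "\<And>m. u m \<in> I"
    and expand: "\<And>J J'. regular_leaf_arc S A J \<Longrightarrow> regular_leaf_arc S A J' \<Longrightarrow> path_image J' = F ` path_image J \<Longrightarrow>
      \<mu> (path_image J') = ennreal \<Lambda> * \<mu> (path_image J)" and "1 < \<Lambda>"
    and z: "z1 \<in> limit_points \<phi> u" "z2 \<in> limit_points \<phi> u" "z1 < z2"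
  shows False
proof -
  have s\<phi>: "\<And>m. \<exists>e. seg e (\<phi> (u m) (u (Suc m)))" using chain by (rule seg_\<phi>)
  have "\<forall>N. \<exists>e. seg e (itin \<phi> u N)" by (intro allI seg_itin[of \<phi> u] s\<phi>)
  then obtain e where e: "\<And>N. seg (e N) (itin \<phi> u N)" by metis
  \<comment> \<open>The middle third is used: its points have preimages strictly between 0 and 1,
    and only there is the action of \<open>F\<close> on \<open>\<sigma>\<close> known.\<close>
  define x1 where "x1 = (2 * z1 + z2) / 3"
  define x2 where "x2 = (z1 + 2 * z2) / 3"
  have x: "z1 < x1" "x1 < x2" "x2 < z2" using z(3) by (auto simp: x1_def x2_def)
  have pre: "\<exists>c. 0 < c \<and> c < 1 \<and> itin \<phi> u N c = w" if w: "z1 < w" "w < z2" for N w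
  proof -
    have "z1 \<in> itin \<phi> u N ` {0..1}" "z2 \<in> itin \<phi> u N ` {0..1}" using z(1,2) unfolding limit_points_def by auto
    then obtain c1 c2 where c: "0 \<le> c1" "c1 \<le> 1" "itin \<phi> u N c1 = z1" "0 \<le> c2" "c2 \<le> 1" "itin \<phi> u N c2 = z2" by auto
    have "\<exists>c. 0 \<le> c \<and> c \<le> 1 \<and> itin \<phi> u N c = w" using seg_onto[OF e[of N] c(1,2,4,5), of w] c w by simp
    then obtain c where cc: "0 \<le> c" "c \<le> 1" "itin \<phi> u N c = w" by blast
    have "c \<noteq> 0" "c \<noteq> 1"
      using seg_less_iff[OF e[of N] cc(1,2) c(1,2)] seg_less_iff[OF e[of N] c(1,2) cc(1,2)]
        seg_less_iff[OF e[of N] cc(1,2) c(4,5)] seg_less_iff[OF e[of N] c(4,5) cc(1,2)] c cc w by (auto split: if_splits)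
    then show ?thesis using cc by (intro exI[of _ c]) auto
  qed
  \<comment> \<open>The inverse of the composed inverse branches, hence the action of
    \<open>N\<close> iterates on the expanded coordinate.\<close>
  define \<xi> where "\<xi> = (\<lambda>N w. THE c. 0 \<le> c \<and> c \<le> 1 \<and> itin \<phi> u N c = w)"
  have \<xi>_inv: "\<xi> N (itin \<phi> u N c) = c" if "0 \<le> c" "c \<le> 1" for N c
    unfolding \<xi>_def
  proof (rule the_equality)
    fix c' assume "0 \<le> c' \<and> c' \<le> 1 \<and> itin \<phi> u N c' = itin \<phi> u N c"
    then show "c' = c" using seg_eq_iff[OF e[of N], of c' c] that by simp
  qed (use that in simp)
  have \<xi>_in: "0 < \<xi> N w \<and> \<xi> N w < 1 \<and> itin \<phi> u N (\<xi> N w) = w" if w: "z1 < w" "w < z2" for N w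
  proof -
    obtain c where c: "0 < c" "c < 1" "itin \<phi> u N c = w" using pre[OF w] by blast
    then have "\<xi> N w = c" using \<xi>_inv[of c N] by simp
    then show ?thesis using c by simp
  qed
  define p where "p = (\<lambda>N. min (\<xi> N x1) (\<xi> N x2))"
  define q where "q = (\<lambda>N. max (\<xi> N x1) (\<xi> N x2))"
  have xx: "z1 < x1" "x1 < z2" "z1 < x2" "x2 < z2" using x by auto
  have ne: "\<xi> N x1 \<noteq> \<xi> N x2" for N
  proof
    assume h: "\<xi> N x1 = \<xi> N x2"
    have "x1 = itin \<phi> u N (\<xi> N x1)" using \<xi>_in[OF xx(1,2), of N] by simp
    also have "\<dots> = x2" unfolding h using \<xi>_in[OF xx(3,4), of N] by simp
    finally show False using x by simp
  qed
  have pq: "0 < p N" "p N < q N" "q N < 1" for N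
    using \<xi>_in[OF xx(1,2), of N] \<xi>_in[OF xx(3,4), of N] ne[of N] by (auto simp: p_def q_def min_def max_def)
  have im: "\<xi> N ` {x1..x2} = {p N..q N}" for N
  proof (rule seg_inverse_image[OF e])
    show "{itin \<phi> u N (p N), itin \<phi> u N (q N)} = {x1, x2}"
      using \<xi>_in[OF xx(1,2), of N] \<xi>_in[OF xx(3,4), of N] by (auto simp: p_def q_def min_def max_def)
  qed (use pq[of N] x \<xi>_inv in \<open>auto intro: less_imp_le\<close>)
  have drift_seg: "\<exists>e. seg e (drift u N)" for N by (rule seg_drift) (rule chain)
  show False
  proof (rule no_persistent_segment[of I S A B Sing \<mu> \<sigma> F \<Lambda> u x1 x2 \<xi> "drift u" p q])
    fix N' :: nat and w y :: real
    assume w: "x1 \<le> w" "w \<le> x2" and y: "0 < y" "y < 1"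
    have w': "z1 < w" "w < z2" using w x by auto
    note i = \<xi>_in[OF w', of N']
    have "(F ^^ N') (\<sigma> (u 0) (itin \<phi> u N' (\<xi> N' w)) y) = \<sigma> (u N') (\<xi> N' w) (drift u N' y)"
      using orbit[of u, OF chain _ _ y] i by blast
    then show "(F ^^ N') (\<sigma> (u 0) w y) = \<sigma> (u N') (\<xi> N' w) (drift u N' y)" using i by simp
  next
    fix w assume w: "x1 \<le> w" "w \<le> x2"
    have w': "z1 < w" "w < z2" using w x by auto
    show "\<xi> 0 w = w" using \<xi>_in[OF w', of 0] by simp
  next
    fix N :: nat and y :: real assume "0 < y" "y < 1"
    then show "0 < drift u N y \<and> drift u N y < 1" using drift_seg[of N] seg_open_range by blast
  next
    fix N :: nat
    obtain e' where e': "seg e' (drift u N)" using drift_seg[of N] ..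
    show "inj_on (drift u N) {0<..<1}" by (rule inj_onI) (use seg_eq_iff[OF e'] in auto)
  qed ((rule \<open>finite I\<close> \<open>1 < \<Lambda>\<close> idx x(2) im pq | (rule rect, assumption) | (rule expand, assumption+))+)
qed

end

section \<open>Product form of a leaf-preserving homeomorphism on strips\<close>

lemma monotone_on_sign:
  fixes h :: "real \<Rightarrow> real"
  assumes "strict_mono_on {a<..<b} h \<or> strict_antimono_on {a<..<b} h"
  shows "\<exists>e. \<forall>y y'. a < y \<longrightarrow> y < y' \<longrightarrow> y' < b \<longrightarrow> (if e then h y < h y' else h y' < h y)"
  using assms
proof
  assume "strict_mono_on {a<..<b} h"
  then show ?thesis by (intro exI[of _ True]) (auto simp: monotone_on_def)
next
  assume "strict_antimono_on {a<..<b} h"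
  then show ?thesis by (intro exI[of _ False]) (auto simp: monotone_on_def)
qed

context product_rectangle
begin

text \<open>Equality of the plaques means that \<open>C\<close> contains with each point its full
  horizontal line. So \<open>C\<close> is determined by its set of heights, which is open and
  connected, that is, an open interval.\<close>

lemma horizontal_strip:
  assumes C: "C \<subseteq> dom" "openin (top_of_set S) C" "connected C" "C \<noteq> {}"
    and pl: "\<And>q. q \<in> C \<Longrightarrow> plaque_in A C q = plaque_in A dom q"
  obtains a b where "0 \<le> a" "a < b" "b \<le> 1" "C = box_im 0 1 a b"
proof -
  obtain g where g: "homeomorphism ({0<..<1} \<times> {0<..<1}) dom pr g" using homeo unfolding dom_def by blast
  have g_apply: "g (\<rho> x y) = (x, y)" if "0 < x" "x < 1" "0 < y" "y < 1" for x y
    using homeomorphism_apply1[OF g, of "(x, y)"] that by simp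
  have g_cont: "continuous_on dom g" using g unfolding homeomorphism_def by blast
  let ?H = "snd ` g ` C"
  have line: "\<rho> t y \<in> C" if "\<rho> x y \<in> C" "0 < x" "x < 1" "0 < y" "y < 1" "0 < t" "t < 1" for x y t
  proof -
    have "\<rho> t y \<in> plaque_in A dom (\<rho> x y)" using plaque_in_box[of 0 1 0 1 x y] that unfolding dom_box by auto
    then have "\<rho> t y \<in> plaque_in A C (\<rho> x y)" using pl[OF that(1)] by simp
    then show ?thesis using plaque_in_subset by blast
  qed
  have H_iff: "y \<in> ?H \<longleftrightarrow> 0 < y \<and> y < 1 \<and> \<rho> (1/2) y \<in> C" for y
  proof
    assume "y \<in> ?H"
    then obtain w where w: "w \<in> C" "y = snd (g w)" by blast
    then obtain x y' where xy: "0 < x" "x < 1" "0 < y'" "y' < 1" "w = \<rho> x y'" using C(1) dom_iff by blast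
    then have "y = y'" using w g_apply by simp
    then show "0 < y \<and> y < 1 \<and> \<rho> (1/2) y \<in> C" using line[of x y' "1/2"] xy w by simp
  next
    assume h: "0 < y \<and> y < 1 \<and> \<rho> (1/2) y \<in> C"
    then have "g (\<rho> (1/2) y) = (1/2, y)" by (intro g_apply) auto
    then show "y \<in> ?H" using h by (metis imageI snd_conv)
  qed
  have "connected (g ` C)" by (rule connected_continuous_image[OF continuous_on_subset[OF g_cont C(1)] C(3)])
  moreover have "continuous_on (g ` C) snd" by (intro continuous_intros)
  ultimately have conn: "connected ?H" by (rule connected_continuous_image[rotated])
  have "openin (top_of_set dom) C" by (rule openin_subset_trans[OF C(2,1)]) (rule openin_imp_subset[OF openin_S[folded dom_def]])
  then have "openin (top_of_set ({0<..<1} \<times> {0<..<1})) (g ` C)" by (rule homeomorphism_imp_open_map[OF homeomorphism_symD[OF g]])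
  moreover have "open ({0<..<1::real} \<times> {0<..<1::real})" by (intro open_Times) auto
  ultimately have "open (g ` C)" by (rule openin_open_trans)
  then have op: "open ?H" by (rule open_image_snd)
  have ne: "?H \<noteq> {}" using C(4) by simp
  have H01: "?H \<subseteq> {0<..<1}"
  proof
    fix y assume "y \<in> ?H"
    then show "y \<in> {0<..<1}" unfolding H_iff by simp
  qed
  have H0: "0 \<le> y" and H1: "y \<le> 1" if "y \<in> ?H" for y using subsetD[OF H01 that] by simp_all
  have bdd: "bdd_below ?H" "bdd_above ?H" by (rule bdd_belowI[OF H0], assumption, rule bdd_aboveI[OF H1], assumption)
  define a where "a = Inf ?H"
  define b where "b = Sup ?H"
  have mem: "y \<in> ?H \<longleftrightarrow> a < y \<and> y < b" for y
  proof
    assume y: "y \<in> ?H"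
    then obtain e where e: "0 < e" "ball y e \<subseteq> ?H" using op by (meson openE)
    have "y - e / 2 \<in> ?H" "y + e / 2 \<in> ?H" using e by (auto simp: dist_real_def intro!: subsetD[OF e(2)])
    then have "a \<le> y - e / 2" "y + e / 2 \<le> b" unfolding a_def b_def using bdd by (auto intro: cInf_lower cSup_upper)
    then show "a < y \<and> y < b" using e(1) by linarith
  next
    assume "a < y \<and> y < b"
    then obtain h1 h2 where h: "h1 \<in> ?H" "h1 < y" "h2 \<in> ?H" "y < h2"
      unfolding a_def b_def using cInf_less_iff[OF ne bdd(1)] less_cSup_iff[OF ne bdd(2)] by blast
    then show "y \<in> ?H" using connected_contains_Icc[OF conn h(1,3)] by auto
  qed
  have ab: "0 \<le> a" "b \<le> 1"
    unfolding a_def b_def by (rule cInf_greatest[OF ne H0], assumption, rule cSup_least[OF ne H1], assumption)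
  obtain y where "y \<in> ?H" using ne by blast
  then have "a < b" using mem by (meson order_less_trans)
  moreover have "C = box_im 0 1 a b"
  proof (intro equalityI subsetI)
    fix w assume w: "w \<in> C"
    then obtain x y where xy: "0 < x" "x < 1" "0 < y" "y < 1" "w = \<rho> x y" using C(1) dom_iff by blast
    have "\<rho> (1/2) y \<in> C" using line[of x y "1/2"] xy w by simp
    then have "y \<in> ?H" unfolding H_iff using xy by simp
    then show "w \<in> box_im 0 1 a b" unfolding xy(5) using mem xy by (intro box_imI) auto
  next
    fix w assume "w \<in> box_im 0 1 a b"
    then obtain x y where xy: "0 < x" "x < 1" "a < y" "y < b" "w = \<rho> x y" unfolding box_im_iff by blast
    then have "y \<in> ?H" using mem by blast
    then show "w \<in> C" unfolding H_iff using line[of "1/2" y x] xy by simp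
  qed
  ultimately show ?thesis using that ab by blast
qed

text \<open>The image of a horizontal line is connected, lies in one leaf and stays in the target
  box; by \<open>plaque_in_box\<close> it stays in one horizontal line there.\<close>

lemma line_maps_into_line:
  assumes R': "product_rectangle S A B \<rho>'" and f: "continuous_on S f"
    and leaf: "\<And>p. p \<in> S \<Longrightarrow> f ` leaf A p = leaf A (f p)"
    and box: "0 \<le> a" "b \<le> 1" "0 \<le> c" "d \<le> 1" and box': "0 \<le> a'" "b' \<le> 1" "0 \<le> c'" "d' \<le> 1"
    and fC: "f ` box_im a b c d = product_rectangle.box_im \<rho>' a' b' c' d'"
    and xy: "a < x" "x < b" "c < y" "y < d" "a < t" "t < b"
    and im: "f (\<rho> x y) = \<rho>' u v" "a' < u" "u < b'" "c' < v" "v < d'"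
  shows "\<exists>u'. a' < u' \<and> u' < b' \<and> f (\<rho> t y) = \<rho>' u' v"
proof -
  interpret R': product_rectangle S A B \<rho>' by (rule R')
  let ?L = "(\<lambda>t. \<rho> t y) ` {a<..<b}"
  have LS: "?L \<subseteq> S" using box xy by (auto intro!: in_S)
  have "f ` ?L \<subseteq> plaque_in A (R'.box_im a' b' c' d') (f (\<rho> x y))"
  proof (rule plaque_in_maximal)
    have "connected ?L" using box xy by (intro hline_connected) auto
    then show "connected (f ` ?L)" by (rule connected_continuous_image[OF continuous_on_subset[OF f LS]])
    show "f (\<rho> x y) \<in> f ` ?L" using xy by auto
    have "?L \<subseteq> leaf A (\<rho> x y)" using box xy A_leaf[of x _ y] by auto
    then have "f ` ?L \<subseteq> f ` leaf A (\<rho> x y)" by (rule image_mono)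
    also have "\<dots> = leaf A (f (\<rho> x y))" using in_S[of x y] box xy by (intro leaf) auto
    finally show "f ` ?L \<subseteq> leaf A (f (\<rho> x y))" .
    have "?L \<subseteq> box_im a b c d" using xy by (auto intro!: box_imI)
    then show "f ` ?L \<subseteq> R'.box_im a' b' c' d'" unfolding fC[symmetric] by (rule image_mono)
  qed
  then have "f ` ?L \<subseteq> (\<lambda>t. \<rho>' t v) ` {a'<..<b'}" unfolding im(1) using R'.plaque_in_box[of a' b' c' d' u v] box' im by simp
  moreover have "f (\<rho> t y) \<in> f ` ?L" using xy by (intro imageI) auto
  ultimately have "f (\<rho> t y) \<in> (\<lambda>t. \<rho>' t v) ` {a'<..<b'}" by (rule subsetD)
  then show ?thesis by auto
qed

text \<open>A leaf-preserving homeomorphism of a full-width strip onto a full-height strip is a product map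
  in the coordinates.\<close>

lemma strip_product_form:
  assumes R': "product_rectangle S A B \<rho>'" and f: "continuous_on S f" "inj_on f S"
    and leafA: "\<And>p. p \<in> S \<Longrightarrow> f ` leaf A p = leaf A (f p)" and leafB: "\<And>p. p \<in> S \<Longrightarrow> f ` leaf B p = leaf B (f p)"
    and cd: "0 \<le> c" "c < d" "d \<le> 1" and ab: "0 \<le> a" "a < b" "b \<le> 1"
    and fC: "f ` box_im 0 1 c d = product_rectangle.box_im \<rho>' a b 0 1"
  obtains e e' hb gb where "seg e hb" "seg e' gb" "hb ` {0..1} = {c..d}" "hb ` {0<..<1} = {c<..<d}"
    "gb ` {0..1} = {a..b}" "gb ` {0<..<1} = {a<..<b}"
    "\<And>x y. 0 < x \<Longrightarrow> x < 1 \<Longrightarrow> 0 < y \<Longrightarrow> y < 1 \<Longrightarrow> f (\<rho> x (hb y)) = \<rho>' (gb x) y"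
proof -
  interpret R': product_rectangle S A B \<rho>' by (rule R')
  interpret sw: product_rectangle S B A "\<lambda>x y. \<rho> y x" by (rule swap)
  interpret R's: product_rectangle S B A "\<lambda>x y. \<rho>' y x" by (rule R'.swap)
  obtain g where g: "homeomorphism ({0<..<1} \<times> {0<..<1}) R'.dom R'.pr g" using R'.homeo unfolding R'.dom_def by blast
  have g_apply: "g (\<rho>' x y) = (x, y)" if "0 < x" "x < 1" "0 < y" "y < 1" for x y
    using homeomorphism_apply1[OF g, of "(x, y)"] that by simp
  have g_cont: "continuous_on R'.dom g" using g unfolding homeomorphism_def by blast
  define m where "m = (c + d) / 2"
  have m: "c < m" "m < d" using cd by (auto simp: m_def)
  have into: "\<exists>u v. a < u \<and> u < b \<and> 0 < v \<and> v < 1 \<and> f (\<rho> x y) = \<rho>' u v" if "0 < x" "x < 1" "c < y" "y < d" for x y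
  proof -
    have "f (\<rho> x y) \<in> R'.box_im a b 0 1" unfolding fC[symmetric] using that by (intro imageI box_imI)
    then show ?thesis unfolding R'.box_im_iff by blast
  qed
  have gin: "g (f (\<rho> x y)) = (u, v)" if "f (\<rho> x y) = \<rho>' u v" "a < u" "u < b" "0 < v" "v < 1" for x y u v
    using g_apply[of u v] that ab by simp
  \<comment> \<open>Reference lines: heights are tracked along \<open>x = 1/2\<close>, abscissas
    along \<open>y = m\<close>. Since both kinds of lines are preserved, every other line gives the
    same values.\<close>
  define \<eta> where "\<eta> = (\<lambda>y. snd (g (f (\<rho> (1/2) y))))"
  define \<xi> where "\<xi> = (\<lambda>x. fst (g (f (\<rho> x m))))"
  have form: "f (\<rho> x y) = \<rho>' (\<xi> x) (\<eta> y) \<and> a < \<xi> x \<and> \<xi> x < b \<and> 0 < \<eta> y \<and> \<eta> y < 1"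
    if xy: "0 < x" "x < 1" "c < y" "y < d" for x y
  proof -
    obtain u v where uv: "a < u" "u < b" "0 < v" "v < 1" "f (\<rho> x y) = \<rho>' u v" using into[OF xy] by blast
    have half: "(0::real) < 1/2" "1/2 < (1::real)" by simp_all
    obtain u' where u': "a < u'" "u' < b" "f (\<rho> (1/2) y) = \<rho>' u' v"
      using line_maps_into_line[OF R' f(1) leafA order_refl order_refl cd(1,3) ab(1,3) order_refl order_refl fC xy half uv(5,1-4)] by blast
    have boxes: "sw.box_im c d 0 1 = box_im 0 1 c d" "R's.box_im 0 1 a b = R'.box_im a b 0 1"
      unfolding sw.box_im_def box_im_def R's.box_im_def R'.box_im_def by (force simp: image_iff)+
    have fC': "f ` sw.box_im c d 0 1 = R's.box_im 0 1 a b" unfolding boxes by (rule fC)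
    obtain v' where v': "0 < v'" "v' < 1" "f (\<rho> x m) = \<rho>' u v'"
      using sw.line_maps_into_line[OF R's.product_rectangle_axioms f(1) leafB cd(1,3) order_refl order_refl order_refl order_refl ab(1,3)
          fC' xy(3,4,1,2) m uv(5,3,4,1,2)] by blast
    have "\<eta> y = v" unfolding \<eta>_def using gin[OF u'(3,1,2) uv(3,4)] by simp
    moreover have "\<xi> x = u" unfolding \<xi>_def using gin[OF v'(3) uv(1,2) v'(1,2)] by simp
    ultimately show ?thesis using uv by simp
  qed
  have f_dom: "f (\<rho> x y) \<in> R'.dom" if xy: "0 < x" "x < 1" "c < y" "y < d" for x y
  proof -
    obtain u v where uv: "a < u" "u < b" "0 < v" "v < 1" "f (\<rho> x y) = \<rho>' u v" using into[OF xy] by blast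
    show ?thesis unfolding uv(5) using uv(1-4) ab by (intro R'.domI) linarith+
  qed
  have half: "(0::real) < 1/2" "1/2 < (1::real)" by simp_all
  have eq_S: "\<rho> x y = \<rho> x' y'" if "f (\<rho> x y) = f (\<rho> x' y')" "0 < x" "x < 1" "c < y" "y < d" "0 < x'" "x' < 1" "c < y'" "y' < d" for x y x' y'
  proof (rule inj_onD[OF f(2) that(1)])
    show "\<rho> x y \<in> S" "\<rho> x' y' \<in> S" by (rule in_S; use that cd in simp)+
  qed
  have \<eta>_inj: "inj_on \<eta> {c<..<d}"
  proof (rule inj_onI)
    fix y y' assume y: "y \<in> {c<..<d}" "y' \<in> {c<..<d}" "\<eta> y = \<eta> y'"
    have "f (\<rho> (1/2) y) = f (\<rho> (1/2) y')" using form[OF half, of y] form[OF half, of y'] y by simp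
    then have "\<rho> (1/2) y = \<rho> (1/2) y'" using y half by (intro eq_S) auto
    then show "y = y'" using inj[of "1/2" y "1/2" y'] y cd by simp
  qed
  have \<xi>_inj: "inj_on \<xi> {0<..<1}"
  proof (rule inj_onI)
    fix x x' assume x: "x \<in> {0<..<1}" "x' \<in> {0<..<1}" "\<xi> x = \<xi> x'"
    have "f (\<rho> x m) = f (\<rho> x' m)" using form[of x m] form[of x' m] x m by simp
    then have "\<rho> x m = \<rho> x' m" using x m by (intro eq_S) auto
    then show "x = x'" using inj[of x m x' m] x m cd by simp
  qed
  have onto: "\<exists>x y. 0 < x \<and> x < 1 \<and> c < y \<and> y < d \<and> \<xi> x = u \<and> \<eta> y = v" if uv: "a < u" "u < b" "0 < v" "v < 1" for u v
  proof -
    have "\<rho>' u v \<in> f ` box_im 0 1 c d" unfolding fC using uv by (intro R'.box_imI)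
    then obtain x y where xy: "0 < x" "x < 1" "c < y" "y < d" "\<rho>' u v = f (\<rho> x y)" unfolding box_im_def by force
    have "\<rho>' u v = \<rho>' (\<xi> x) (\<eta> y)" using form[OF xy(1-4)] xy(5) by simp
    then have "u = \<xi> x \<and> v = \<eta> y" using R'.inj[of u v "\<xi> x" "\<eta> y"] form[OF xy(1-4)] uv ab by simp
    then show ?thesis using xy by blast
  qed
  have \<eta>_im: "\<eta> ` {c<..<d} = {0<..<1}"
  proof (intro equalityI subsetI)
    fix v :: real assume "v \<in> {0<..<1}"
    then obtain y where "c < y" "y < d" "\<eta> y = v" using onto[of "(a + b) / 2" v] ab by auto
    then show "v \<in> \<eta> ` {c<..<d}" by auto
  qed (use form[OF half] in auto)
  have \<xi>_im: "\<xi> ` {0<..<1} = {a<..<b}"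
  proof (intro equalityI subsetI)
    fix u assume "u \<in> {a<..<b}"
    then obtain x where "0 < x" "x < 1" "\<xi> x = u" using onto[of u "1/2"] by auto
    then show "u \<in> \<xi> ` {0<..<1}" by auto
  qed (use form[OF _ _ m] in auto)
  have \<eta>_cont: "continuous_on {c<..<d} \<eta>"
  proof -
    have "continuous_on {0..1} (\<lambda>y. \<rho> (1/2) y)" by (rule sw.cont_h) simp_all
    then have "continuous_on {c<..<d} (\<lambda>y. \<rho> (1/2) y)" by (rule continuous_on_subset) (use cd in auto)
    then have "continuous_on {c<..<d} (\<lambda>y. f (\<rho> (1/2) y))"
      by (rule continuous_on_compose2[OF f(1)]) (use cd in \<open>auto intro!: in_S\<close>)
    then have "continuous_on {c<..<d} (\<lambda>y. g (f (\<rho> (1/2) y)))"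
      by (rule continuous_on_compose2[OF g_cont]) (use f_dom[OF half] in auto)
    then show ?thesis unfolding \<eta>_def by (rule continuous_on_snd)
  qed
  have \<xi>_cont: "continuous_on {0<..<1} \<xi>"
  proof -
    have "continuous_on {0..1} (\<lambda>x. \<rho> x m)" by (rule cont_h) (use m cd in simp_all)
    then have "continuous_on {0<..<1} (\<lambda>x. \<rho> x m)" by (rule continuous_on_subset) auto
    then have "continuous_on {0<..<1} (\<lambda>x. f (\<rho> x m))"
      by (rule continuous_on_compose2[OF f(1)]) (use m cd in \<open>auto intro!: in_S\<close>)
    then have "continuous_on {0<..<1} (\<lambda>x. g (f (\<rho> x m)))"
      by (rule continuous_on_compose2[OF g_cont]) (use f_dom[OF _ _ m] in auto)
    then show ?thesis unfolding \<xi>_def by (rule continuous_on_fst)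
  qed
  have "strict_mono_on {c<..<d} \<eta> \<or> strict_antimono_on {c<..<d} \<eta>"
    using injective_eq_monotone_map[of "{c<..<d}" \<eta>] \<eta>_cont \<eta>_inj by (simp add: is_interval_oo)
  then obtain e where e: "\<And>y y'. c < y \<Longrightarrow> y < y' \<Longrightarrow> y' < d \<Longrightarrow> if e then \<eta> y < \<eta> y' else \<eta> y' < \<eta> y"
    using monotone_on_sign by blast
  have "strict_mono_on {0<..<1} \<xi> \<or> strict_antimono_on {0<..<1} \<xi>"
    using injective_eq_monotone_map[of "{0<..<1}" \<xi>] \<xi>_cont \<xi>_inj by (simp add: is_interval_oo)
  then obtain e' where e': "\<And>x x'. 0 < x \<Longrightarrow> x < x' \<Longrightarrow> x' < 1 \<Longrightarrow> if e' then \<xi> x < \<xi> x' else \<xi> x' < \<xi> x"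
    using monotone_on_sign by blast
  obtain gb where gb: "seg e' gb" "\<And>x. 0 < x \<Longrightarrow> x < 1 \<Longrightarrow> gb x = \<xi> x" "gb ` {0..1} = {a..b}" "gb ` {0<..<1} = {a<..<b}"
    by (rule seg_extension[where e = e', OF \<xi>_im ab]) ((rule e'; assumption), (rule that; blast))
  \<comment> \<open>\<open>hb\<close> goes from target heights back to source heights, so it is the
    inverse of \<open>\<eta>\<close> that is extended to the closed interval.\<close>
  define \<theta> where "\<theta> = the_inv_into {c<..<d} \<eta>"
  have \<theta>: "c < \<theta> v \<and> \<theta> v < d \<and> \<eta> (\<theta> v) = v" if "0 < v" "v < 1" for v
  proof -
    have v: "v \<in> \<eta> ` {c<..<d}" unfolding \<eta>_im using that by simp
    have "\<theta> v \<in> {c<..<d}" unfolding \<theta>_def by (rule the_inv_into_into[OF \<eta>_inj v order_refl])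
    moreover have "\<eta> (\<theta> v) = v" unfolding \<theta>_def by (rule f_the_inv_into_f[OF \<eta>_inj v])
    ultimately show ?thesis by simp
  qed
  have \<theta>_im: "\<theta> ` {0<..<1} = {c<..<d}"
    unfolding \<theta>_def \<eta>_im[symmetric] by (rule the_inv_into_onto[OF \<eta>_inj])
  have \<theta>_mono: "if e then \<theta> v < \<theta> w else \<theta> w < \<theta> v" if "0 < v" "v < w" "w < 1" for v w
  proof -
    have v: "c < \<theta> v" "\<theta> v < d" "\<eta> (\<theta> v) = v" and w: "c < \<theta> w" "\<theta> w < d" "\<eta> (\<theta> w) = w"
      using \<theta>[of v] \<theta>[of w] that by auto
    have "\<theta> v \<noteq> \<theta> w"
    proof
      assume "\<theta> v = \<theta> w"
      then have "\<eta> (\<theta> v) = \<eta> (\<theta> w)" by (rule arg_cong)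
      then show False using v(3) w(3) that by simp
    qed
    then show ?thesis using e[of "\<theta> v" "\<theta> w"] e[of "\<theta> w" "\<theta> v"] v w that by (cases e; cases "\<theta> v" "\<theta> w" rule: linorder_cases) auto
  qed
  obtain hb where hb: "seg e hb" "\<And>x. 0 < x \<Longrightarrow> x < 1 \<Longrightarrow> hb x = \<theta> x" "hb ` {0..1} = {c..d}" "hb ` {0<..<1} = {c<..<d}"
    by (rule seg_extension[where e = e, OF \<theta>_im cd]) ((rule \<theta>_mono; assumption), (rule that; blast))
  have "f (\<rho> x (hb y)) = \<rho>' (gb x) y" if "0 < x" "x < 1" "0 < y" "y < 1" for x y
    unfolding hb(2)[OF that(3,4)] gb(2)[OF that(1,2)] using form[OF that(1,2), of "\<theta> y"] \<theta>[OF that(3,4)] by simp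
  then show ?thesis using that hb(1,3,4) gb(1,3,4) by blast
qed

end

section \<open>Rectangles of the surface as product rectangles\<close>

lemma rect_interior_pr:
  "rect_interior r = (\<lambda>p. r (Complex (fst p) (snd p))) ` ({0<..<1} \<times> {0<..<1})"
proof -
  have "open_square = (\<lambda>p. Complex (fst p) (snd p)) ` ({0<..<1} \<times> {0<..<1})"
    by (auto simp: in_box_complex_iff image_iff complex_eq_iff intro!: bexI[of _ "(Re _, Im _)"])
  then show ?thesis unfolding rect_interior_def by (simp add: image_image)
qed

lemma rect_pr: "rect r = (\<lambda>p. r (Complex (fst p) (snd p))) ` ({0..1} \<times> {0..1})"
proof -
  have "square = (\<lambda>p. Complex (fst p) (snd p)) ` ({0..1} \<times> {0..1})"
    by (auto simp: in_cbox_complex_iff image_iff complex_eq_iff intro!: bexI[of _ "(Re _, Im _)"])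
  then show ?thesis unfolding rect_def by (simp add: image_image)
qed

lemma rectangle_product:
  assumes r: "rectangle X r" and fol: "singular_foliation (surf X) (stab X)" "singular_foliation (surf X) (unst X)"
  shows "product_rectangle (surf X) (stab X) (unst X) (\<lambda>x y. r (Complex x y))"
proof -
  note R = r[unfolded rectangle_def trivially_bifoliated_def]
  let ?C = "\<lambda>p. Complex (fst p) (snd p)"
  have C_cont: "continuous_on T ?C" for T by (intro continuous_intros)
  have hl: "\<exists>q\<in>surf X. r ` {z \<in> square. Im z = y} \<subseteq> leaf (stab X) q" if "0 \<le> y" "y \<le> 1" for y using R that by simp
  have vl: "\<exists>q\<in>surf X. r ` {z \<in> square. Re z = x} \<subseteq> leaf (unst X) q" if "0 \<le> x" "x \<le> 1" for x using R that by simp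
  show ?thesis
  proof
    have "continuous_on square r" using R by blast
    then show "continuous_on ({0..1} \<times> {0..1}) (\<lambda>p. r (?C p))"
      by (rule continuous_on_compose2[OF _ C_cont]) (auto simp: in_cbox_complex_iff)
    obtain g where g: "homeomorphism open_square (rect_interior r) r g" using R by blast
    have "homeomorphism ({0<..<1} \<times> {0<..<1}) open_square ?C (\<lambda>z. (Re z, Im z))"
      by (rule homeomorphismI) (auto simp: in_box_complex_iff intro!: C_cont continuous_intros)
    from homeomorphism_compose[OF this g]
    show "\<exists>g. homeomorphism ({0<..<1} \<times> {0<..<1}) ((\<lambda>p. r (?C p)) ` ({0<..<1} \<times> {0<..<1})) (\<lambda>p. r (?C p)) g"
      unfolding rect_interior_pr[symmetric] o_def by blast
    show "openin (top_of_set (surf X)) ((\<lambda>p. r (?C p)) ` ({0<..<1} \<times> {0<..<1}))"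
      unfolding rect_interior_pr[symmetric] using R by blast
  next
    fix x y :: real assume xy: "0 \<le> x" "x \<le> 1" "0 \<le> y" "y \<le> 1"
    obtain q where q: "q \<in> surf X" "r ` {z \<in> square. Im z = y} \<subseteq> leaf (stab X) q" using hl xy by blast
    have "Complex x y \<in> {z \<in> square. Im z = y}" using xy by (simp add: in_cbox_complex_iff)
    then have "r (Complex x y) \<in> leaf (stab X) q" using q(2) by blast
    then show "r (Complex x y) \<in> surf X" using leaf_subset[OF fol(1) q(1)] by blast
  next
    fix x x' y :: real assume xy: "0 \<le> x" "x \<le> 1" "0 \<le> x'" "x' \<le> 1" "0 \<le> y" "y \<le> 1"
    obtain q where q: "q \<in> surf X" "r ` {z \<in> square. Im z = y} \<subseteq> leaf (stab X) q" using hl xy by blast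
    have "Complex x y \<in> {z \<in> square. Im z = y}" "Complex x' y \<in> {z \<in> square. Im z = y}" using xy by (simp_all add: in_cbox_complex_iff)
    then have "r (Complex x y) \<in> leaf (stab X) q" "r (Complex x' y) \<in> leaf (stab X) q" using q(2) by blast+
    then show "r (Complex x' y) \<in> leaf (stab X) (r (Complex x y))" using leaf_eq[of "r (Complex x y)" "stab X" q] by simp
  next
    fix x y y' :: real assume xy: "0 \<le> x" "x \<le> 1" "0 \<le> y" "y \<le> 1" "0 \<le> y'" "y' \<le> 1"
    obtain q where q: "q \<in> surf X" "r ` {z \<in> square. Re z = x} \<subseteq> leaf (unst X) q" using vl xy by blast
    have "Complex x y \<in> {z \<in> square. Re z = x}" "Complex x y' \<in> {z \<in> square. Re z = x}" using xy by (simp_all add: in_cbox_complex_iff)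
    then have "r (Complex x y) \<in> leaf (unst X) q" "r (Complex x y') \<in> leaf (unst X) q" using q(2) by blast+
    then show "r (Complex x y') \<in> leaf (unst X) (r (Complex x y))" using leaf_eq[of "r (Complex x y)" "unst X" q] by simp
  next
    fix p q D assume "D = (\<lambda>p. r (?C p)) ` ({0<..<1} \<times> {0<..<1})" "p \<in> D" "q \<in> D"
    then show "card (plaque_in (stab X) D p \<inter> plaque_in (unst X) D q) = 1"
      using R unfolding rect_interior_pr[symmetric] by simp
  qed
qed

lemma pseudo_Anosov_bifoliation:
  assumes "generalized_pseudo_Anosov X \<mu>s \<mu>u f"
  shows "bifoliation (surf X) (stab X) (unst X) (singular_points (stab X)) \<mu>u"
    "bifoliation (surf X) (unst X) (stab X) (singular_points (stab X)) \<mu>s"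
proof -
  note G = assms[unfolded generalized_pseudo_Anosov_def transverse_foliations_def]
  have sing: "singular_points (unst X) = singular_points (stab X)" unfolding singular_points_def using G by simp
  have loc: "\<exists>U a b. openin (top_of_set (surf X)) U \<and> p \<in> U \<and> (\<forall>x\<in>U. \<forall>y\<in>U. a x = a y \<and> b x = b y \<longrightarrow> x = y) \<and>
      (\<forall>x\<in>U. plaque_in (stab X) U x = {y \<in> U. b y = (b x :: real)} \<and> plaque_in (unst X) U x = {y \<in> U. a y = (a x :: real)})"
    if p: "p \<in> surf X" "p \<notin> singular_points (stab X)" for p
  proof -
    have "\<exists>U \<phi> \<psi>. openin (top_of_set (surf X)) U \<and> p \<in> U \<and> homeomorphism U open_square \<phi> \<psi> \<and>
       (\<forall>x\<in>U. plaque_in (stab X) U x = {y\<in>U. Im (\<phi> y) = Im (\<phi> x)} \<and> plaque_in (unst X) U x = {y\<in>U. Re (\<phi> y) = Re (\<phi> x)})"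
      using G p by simp
    then obtain U \<phi> \<psi> where U: "openin (top_of_set (surf X)) U" "p \<in> U" "homeomorphism U open_square \<phi> \<psi>"
       "\<forall>x\<in>U. plaque_in (stab X) U x = {y\<in>U. Im (\<phi> y) = Im (\<phi> x)} \<and> plaque_in (unst X) U x = {y\<in>U. Re (\<phi> y) = Re (\<phi> x)}" by blast
    have inj: "x = y" if h: "x \<in> U" "y \<in> U" "Re (\<phi> x) = Re (\<phi> y) \<and> Im (\<phi> x) = Im (\<phi> y)" for x y
    proof -
      have "\<phi> x = \<phi> y" using h(3) by (simp add: complex_eq_iff)
      then have "\<psi> (\<phi> x) = \<psi> (\<phi> y)" by (rule arg_cong)
      then show ?thesis using homeomorphism_apply1[OF U(3)] h(1,2) by simp
    qed
    show ?thesis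
      by (rule exI[of _ U], rule exI[of _ "\<lambda>x. Re (\<phi> x)"], rule exI[of _ "\<lambda>x. Im (\<phi> x)"])
        (intro conjI U(1,2,4) ballI impI, rule inj, assumption+)
  qed
  show "bifoliation (surf X) (stab X) (unst X) (singular_points (stab X)) \<mu>u"
    unfolding bifoliation_def using G sing loc by simp
  have "\<exists>U a b. openin (top_of_set (surf X)) U \<and> p \<in> U \<and> (\<forall>x\<in>U. \<forall>y\<in>U. a x = a y \<and> b x = b y \<longrightarrow> x = y) \<and>
      (\<forall>x\<in>U. plaque_in (unst X) U x = {y \<in> U. b y = (b x :: real)} \<and> plaque_in (stab X) U x = {y \<in> U. a y = (a x :: real)})"
    if p: "p \<in> surf X" "p \<notin> singular_points (stab X)" for p
  proof -
    obtain U and a b :: "'a \<Rightarrow> real" where U: "openin (top_of_set (surf X)) U" "p \<in> U" "\<forall>x\<in>U. \<forall>y\<in>U. a x = a y \<and> b x = b y \<longrightarrow> x = y"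
      "\<forall>x\<in>U. plaque_in (stab X) U x = {y \<in> U. b y = b x} \<and> plaque_in (unst X) U x = {y \<in> U. a y = a x}"
      using loc[OF p] by blast
    show ?thesis by (rule exI[of _ U], rule exI[of _ b], rule exI[of _ a]) (use U in simp)
  qed
  then show "bifoliation (surf X) (unst X) (stab X) (singular_points (stab X)) \<mu>s"
    unfolding bifoliation_def using G sing by simp
qed

section \<open>Sub-rectangles\<close>

definition subpar :: "real \<Rightarrow> real \<Rightarrow> real \<Rightarrow> real \<Rightarrow> (complex \<Rightarrow> 'a) \<Rightarrow> complex \<Rightarrow> 'a"
  where "subpar a b c d r = (\<lambda>z. r (Complex (a + (b - a) * Re z) (c + (d - c) * Im z)))"

text \<open>Orientation is tested on round circles, which an affine change of scale turns into
  ellipses. The ellipse is deformed linearly into a small circle about its centre \<open>p\<close>,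
  and injectivity of \<open>h\<close> keeps the image loops away from \<open>h p\<close>.\<close>

lemma planar_orientation_affine:
  fixes h :: "complex \<Rightarrow> complex"
  assumes op: "planar_orientation_preserving V h" and cont: "continuous_on V h" and inj: "inj_on h V"
    and l: "0 < l" and m: "0 < m"
    and W: "\<And>w. w \<in> W \<Longrightarrow> Complex (a + l * Re w) (c + m * Im w) \<in> V"
  shows "planar_orientation_preserving W (\<lambda>w. h (Complex (a + l * Re w) (c + m * Im w)))"
  unfolding planar_orientation_preserving_def
proof (intro allI impI)
  fix z R assume R: "0 < R \<and> cball z R \<subseteq> W"
  define aff where "aff = (\<lambda>w. Complex (a + l * Re w) (c + m * Im w))"
  define p where "p = aff z"
  \<comment> \<open>The disc of this radius fits into the elliptic disc \<open>T\<close>, whose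
    semi-axes are \<open>l * R\<close> and \<open>m * R\<close>.\<close>
  define \<epsilon> where "\<epsilon> = R * min l m"
  have \<epsilon>: "0 < \<epsilon>" "\<epsilon> \<le> l * R" "\<epsilon> \<le> m * R" using R l m by (auto simp: \<epsilon>_def min_def)
  have lin: "p + Complex (l * x) (m * y) = aff (z + Complex x y)" for x y
    by (simp add: p_def aff_def complex_eq_iff algebra_simps)
  define T where "T = aff ` cball z R"
  have TV: "T \<subseteq> V" unfolding T_def aff_def using R W by blast
  have inT: "p + Complex (\<alpha> * Re w) (\<beta> * Im w) \<in> T"
    if h: "cmod w \<le> 1" "0 \<le> \<alpha>" "\<alpha> \<le> l * R" "0 \<le> \<beta>" "\<beta> \<le> m * R" for \<alpha> \<beta> w
  proof -
    let ?v = "Complex (\<alpha> / l * Re w) (\<beta> / m * Im w)"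
    have "\<alpha> / l \<le> R" "\<beta> / m \<le> R" "0 \<le> \<alpha> / l" "0 \<le> \<beta> / m" using h l m by (simp_all add: pos_divide_le_eq mult.commute)
    then have "(\<alpha> / l)\<^sup>2 \<le> R\<^sup>2" "(\<beta> / m)\<^sup>2 \<le> R\<^sup>2" by (simp_all add: power_mono)
    then have "(\<alpha> / l)\<^sup>2 * (Re w)\<^sup>2 + (\<beta> / m)\<^sup>2 * (Im w)\<^sup>2 \<le> R\<^sup>2 * (Re w)\<^sup>2 + R\<^sup>2 * (Im w)\<^sup>2"
      by (intro add_mono mult_right_mono) auto
    also have "\<dots> = R\<^sup>2 * (cmod w)\<^sup>2" by (simp add: cmod_power2 algebra_simps)
    also have "\<dots> \<le> R\<^sup>2 * 1" using h(1) by (intro mult_left_mono) (auto simp: power_le_one)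
    finally have "(cmod ?v)\<^sup>2 \<le> R\<^sup>2" by (simp add: cmod_power2 power_mult_distrib power_divide)
    then have "cmod ?v \<le> R" using R by (simp add: power2_le_iff_abs_le)
    then have "z + ?v \<in> cball z R" by (simp add: dist_norm)
    moreover have "p + Complex (\<alpha> * Re w) (\<beta> * Im w) = aff (z + ?v)" unfolding lin[symmetric] using l m by simp
    ultimately show ?thesis unfolding T_def by blast
  qed
  have ne: "p + Complex (\<alpha> * Re w) (\<beta> * Im w) \<noteq> p" if "0 < \<alpha>" "0 < \<beta>" "cmod w = 1" for \<alpha> \<beta> w
  proof
    assume "p + Complex (\<alpha> * Re w) (\<beta> * Im w) = p"
    then have "Re w = 0" "Im w = 0" using that by (auto simp: complex_eq_iff)
    then have "w = 0" by (simp add: complex_eq_iff)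
    then show False using that(3) by simp
  qed
  define w where "w = (\<lambda>t. exp (2 * of_real pi * \<i> * of_real t))"
  have w1: "cmod (w t) = 1" for t by (simp add: w_def)
  have c1: "circlepath p \<epsilon> t = p + Complex (\<epsilon> * Re (w t)) (\<epsilon> * Im (w t))" for t
    by (simp add: circlepath w_def complex_eq_iff)
  have c2: "aff (circlepath z R t) = p + Complex (l * R * Re (w t)) (m * R * Im (w t))" for t
    using lin[of "R * Re (w t)" "R * Im (w t)"] by (simp add: circlepath w_def aff_def p_def complex_eq_iff algebra_simps)
  have pT: "p \<in> T" unfolding T_def p_def using R by (intro imageI) simp
  have cb: "cball p \<epsilon> \<subseteq> V"
  proof
    fix q assume q: "q \<in> cball p \<epsilon>"
    define u where "u = (q - p) / of_real \<epsilon>"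
    have "cmod (q - p) \<le> \<epsilon>" using q by (simp add: dist_norm norm_minus_commute)
    then have "cmod u \<le> 1" using \<epsilon>(1) by (simp add: u_def norm_divide)
    moreover have "q = p + Complex (\<epsilon> * Re u) (\<epsilon> * Im u)" using \<epsilon>(1) by (simp add: u_def complex_eq_iff)
    ultimately have "q \<in> T" using inT[of u \<epsilon> \<epsilon>] \<epsilon> by simp
    then show "q \<in> V" using TV by blast
  qed
  have wind: "winding_number (h \<circ> circlepath p \<epsilon>) (h p) = 1"
    using op cb \<epsilon>(1) unfolding planar_orientation_preserving_def by blast
  have paff: "path (aff \<circ> circlepath z R)"
    unfolding aff_def by (intro path_continuous_image continuous_intros) simp_all
  have "homotopic_loops (T - {p}) (circlepath p \<epsilon>) (aff \<circ> circlepath z R)"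
  proof (rule homotopic_loops_linear)
    fix t :: real assume t: "t \<in> {0..1}"
    show "closed_segment (circlepath p \<epsilon> t) ((aff \<circ> circlepath z R) t) \<subseteq> T - {p}"
    proof
      fix q assume "q \<in> closed_segment (circlepath p \<epsilon> t) ((aff \<circ> circlepath z R) t)"
      then obtain u where u: "0 \<le> u" "u \<le> 1" "q = (1 - u) *\<^sub>R circlepath p \<epsilon> t + u *\<^sub>R aff (circlepath z R t)"
        unfolding closed_segment_def by auto
      \<comment> \<open>Interpolating between circle and ellipse gives axis-parallel ellipses again,
        with semi-axes between \<open>\<epsilon>\<close> and those of \<open>T\<close>.\<close>
      let ?\<alpha> = "(1 - u) * \<epsilon> + u * (l * R)" and ?\<beta> = "(1 - u) * \<epsilon> + u * (m * R)"
      have q: "q = p + Complex (?\<alpha> * Re (w t)) (?\<beta> * Im (w t))"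
        unfolding u(3) c1 c2 by (simp add: complex_eq_iff algebra_simps)
      have lm: "0 < l * R" "0 < m * R" using l m R by auto
      have conv: "0 < (1 - u) * \<epsilon> + u * k \<and> (1 - u) * \<epsilon> + u * k \<le> k" if k: "\<epsilon> \<le> k" for k
      proof -
        have "(1 - u) * \<epsilon> + u * \<epsilon> \<le> (1 - u) * \<epsilon> + u * k" using u k by (intro add_left_mono mult_left_mono) auto
        moreover have "(1 - u) * \<epsilon> + u * k \<le> (1 - u) * k + u * k" using u k by (intro add_right_mono mult_left_mono) auto
        ultimately show ?thesis using \<epsilon>(1) by (simp add: algebra_simps)
      qed
      show "q \<in> T - {p}"
        using inT[of "w t" ?\<alpha> ?\<beta>] ne[of ?\<alpha> ?\<beta> "w t"] conv[OF \<epsilon>(2)] conv[OF \<epsilon>(3)] w1[of t] unfolding q by simp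
    qed
  qed (simp_all add: paff pathstart_compose pathfinish_compose)
  moreover have "continuous_on (T - {p}) h" using cont TV by (rule_tac continuous_on_subset) auto
  moreover have "h \<in> (T - {p}) \<rightarrow> - {h p}"
    using inj TV pT unfolding inj_on_def by blast
  ultimately have "homotopic_loops (- {h p}) (h \<circ> circlepath p \<epsilon>) (h \<circ> (aff \<circ> circlepath z R))"
    by (rule homotopic_loops_continuous_image)
  then have "winding_number (h \<circ> (aff \<circ> circlepath z R)) (h p) = 1"
    using winding_number_homotopic_loops wind by metis
  then show "winding_number ((\<lambda>w. h (Complex (a + l * Re w) (c + m * Im w))) \<circ> circlepath z R) (h (Complex (a + l * Re z) (c + m * Im z))) = 1"
    unfolding p_def aff_def o_def .
qed

lemma affine_unit:
  fixes a b t :: real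
  assumes "0 \<le> a" "a < b" "b \<le> 1"
  shows "0 \<le> t \<Longrightarrow> t \<le> 1 \<Longrightarrow> a \<le> a + (b - a) * t \<and> a + (b - a) * t \<le> b"
    "0 < t \<Longrightarrow> t < 1 \<Longrightarrow> a < a + (b - a) * t \<and> a + (b - a) * t < b"
proof -
  assume "0 \<le> t" "t \<le> 1"
  then have "0 \<le> (b - a) * t" "(b - a) * t \<le> (b - a) * 1" using assms by (simp, intro mult_left_mono) auto
  then show "a \<le> a + (b - a) * t \<and> a + (b - a) * t \<le> b" by simp
next
  assume "0 < t" "t < 1"
  then have "0 < (b - a) * t" "(b - a) * t < (b - a) * 1" using assms by (simp, intro mult_strict_left_mono) auto
  then show "a < a + (b - a) * t \<and> a + (b - a) * t < b" by simp
qed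

lemma affine_image:
  fixes a b :: real
  assumes "0 \<le> a" "a < b" "b \<le> 1"
  shows "(\<lambda>t. a + (b - a) * t) ` {0..1} = {a..b}" "(\<lambda>t. a + (b - a) * t) ` {0<..<1} = {a<..<b}"
proof -
  have ex: "a + (b - a) * ((s - a) / (b - a)) = s" for s using assms by simp
  show "(\<lambda>t. a + (b - a) * t) ` {0..1} = {a..b}"
  proof (intro equalityI subsetI)
    fix s assume "s \<in> {a..b}"
    then have "(s - a) / (b - a) \<in> {0..1}" using assms by simp
    then show "s \<in> (\<lambda>t. a + (b - a) * t) ` {0..1}" using ex[of s] by (metis imageI)
  qed (use affine_unit(1)[OF assms] in auto)
  show "(\<lambda>t. a + (b - a) * t) ` {0<..<1} = {a<..<b}"
  proof (intro equalityI subsetI)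
    fix s assume "s \<in> {a<..<b}"
    then have "(s - a) / (b - a) \<in> {0<..<1}" using assms by simp
    then show "s \<in> (\<lambda>t. a + (b - a) * t) ` {0<..<1}" using ex[of s] by (metis imageI)
  qed (use affine_unit(2)[OF assms] in auto)
qed

context
  fixes X :: "'a::t2_space bifoliated_surface" and r :: "complex \<Rightarrow> 'a" and a b c d :: real
  assumes r: "rectangle X r" and surface: "closed_oriented_surface (surf X) (orient X)"
    and fol: "singular_foliation (surf X) (stab X)" "singular_foliation (surf X) (unst X)"
    and ab: "0 \<le> a" "a < b" "b \<le> 1" and cd: "0 \<le> c" "c < d" "d \<le> 1"
begin

interpretation P: product_rectangle "surf X" "stab X" "unst X" "\<lambda>x y. r (Complex x y)"
  by (rule rectangle_product[OF r fol])

interpretation Q: product_rectangle "surf X" "unst X" "stab X" "\<lambda>y x. r (Complex x y)"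
  by (rule P.swap)

lemma subpar_interior: "rect_interior (subpar a b c d r) = P.box_im a b c d"
proof -
  have "P.box_im a b c d = (\<lambda>p. r (Complex (fst p) (snd p))) ` (((\<lambda>t. a + (b - a) * t) ` {0<..<1}) \<times> ((\<lambda>t. c + (d - c) * t) ` {0<..<1}))"
    unfolding P.box_im_def affine_image[OF ab] affine_image[OF cd] ..
  also have "\<dots> = (\<lambda>p. subpar a b c d r (Complex (fst p) (snd p))) ` ({0<..<1} \<times> {0<..<1})"
    unfolding subpar_def by (force simp: image_iff)
  finally show ?thesis unfolding rect_interior_pr ..
qed

lemma subpar_rect: "rect (subpar a b c d r) = (\<lambda>p. r (Complex (fst p) (snd p))) ` ({a..b} \<times> {c..d})"
proof -
  have "(\<lambda>p. r (Complex (fst p) (snd p))) ` ({a..b} \<times> {c..d}) = (\<lambda>p. r (Complex (fst p) (snd p))) ` (((\<lambda>t. a + (b - a) * t) ` {0..1}) \<times> ((\<lambda>t. c + (d - c) * t) ` {0..1}))"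
    unfolding affine_image[OF ab] affine_image[OF cd] ..
  also have "\<dots> = (\<lambda>p. subpar a b c d r (Complex (fst p) (snd p))) ` ({0..1} \<times> {0..1})"
    unfolding subpar_def by (force simp: image_iff)
  finally show ?thesis unfolding rect_pr ..
qed

lemma box_im_swap: "Q.box_im c d a b = P.box_im a b c d"
  unfolding P.box_im_def Q.box_im_def by (force simp: image_iff)

lemma plaque_stab_box: "a < x \<Longrightarrow> x < b \<Longrightarrow> c < y \<Longrightarrow> y < d \<Longrightarrow>
    plaque_in (stab X) (P.box_im a b c d) (r (Complex x y)) = (\<lambda>t. r (Complex t y)) ` {a<..<b}"
  using P.plaque_in_box[of a b c d x y] ab cd by simp

lemma plaque_unst_box: "a < x \<Longrightarrow> x < b \<Longrightarrow> c < y \<Longrightarrow> y < d \<Longrightarrow>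
    plaque_in (unst X) (P.box_im a b c d) (r (Complex x y)) = (\<lambda>t. r (Complex x t)) ` {c<..<d}"
  using Q.plaque_in_box[of c d a b y x] ab cd unfolding box_im_swap by simp

lemma line_homeomorphic:
  assumes "homeomorphism open_square (rect_interior r) r g" "continuous_on UNIV k" "inj k" "u < v" "\<And>t. u < t \<Longrightarrow> t < v \<Longrightarrow> k t \<in> open_square"
    "\<And>t. u < t \<Longrightarrow> t < v \<Longrightarrow> l (k t) = (t::real)" "continuous_on UNIV l"
  shows "(\<lambda>t. r (k t)) ` {u<..<v} homeomorphic {0<..<1::real}"
proof -
  have "homeomorphism {u<..<v} ((\<lambda>t. r (k t)) ` {u<..<v}) (\<lambda>t. r (k t)) (\<lambda>q. l (g q))"
  proof (rule homeomorphismI)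
    have rc: "continuous_on open_square r" and gc: "continuous_on (rect_interior r) g" using assms(1) unfolding homeomorphism_def by auto
    show "continuous_on {u<..<v} (\<lambda>t. r (k t))"
      by (rule continuous_on_compose2[OF rc continuous_on_subset[OF assms(2)]]) (use assms(5) in auto)
    have sub: "(\<lambda>t. r (k t)) ` {u<..<v} \<subseteq> rect_interior r" unfolding rect_interior_def using assms(5) by auto
    show "continuous_on ((\<lambda>t. r (k t)) ` {u<..<v}) (\<lambda>q. l (g q))"
      by (rule continuous_on_compose2[OF assms(7) continuous_on_subset[OF gc sub]]) simp
  qed (use assms homeomorphism_apply1[OF assms(1)] in auto)
  then have "(\<lambda>t. r (k t)) ` {u<..<v} homeomorphic {u<..<v}" using homeomorphic_def homeomorphic_sym by blast
  also have "{u<..<v} homeomorphic {0<..<1::real}" 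
  proof -
    have "homeomorphism {u<..<v} {0<..<1} (\<lambda>t. (t - u) / (v - u)) (\<lambda>t. u + t * (v - u))"
    proof (rule homeomorphismI)
      show "(\<lambda>t. u + t * (v - u)) ` {0<..<1} \<subseteq> {u<..<v}"
      proof
        fix w assume "w \<in> (\<lambda>t. u + t * (v - u)) ` {0<..<1}"
        then obtain t where t: "0 < t" "t < 1" "w = u + t * (v - u)" by auto
        have "0 < t * (v - u)" "t * (v - u) < 1 * (v - u)" using t assms(4) by (simp, intro mult_strict_right_mono) auto
        then show "w \<in> {u<..<v}" using t(3) by simp
      qed
    qed (use assms(4) in \<open>auto intro!: continuous_intros simp: field_simps\<close>)
    then show ?thesis unfolding homeomorphic_def by blast
  qed
  finally show ?thesis .
qed

text \<open>The plaques of the box are segments of coordinate lines, which settles the bifoliation;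
  orientation is carried over by \<open>planar_orientation_affine\<close> in each chart of the
  surface.\<close>

lemma subpar_rectangle: "rectangle X (subpar a b c d r)"
proof -
  note R = r[unfolded rectangle_def trivially_bifoliated_def]
  let ?s = "subpar a b c d r" and ?D = "P.box_im a b c d"
  let ?aff = "\<lambda>z. Complex (a + (b - a) * Re z) (c + (d - c) * Im z)"
  obtain g where g: "homeomorphism open_square (rect_interior r) r g" using R by blast
  have rcont: "continuous_on square r" using R by blast
  have aff_sq: "?aff z \<in> square" if "z \<in> square" for z
    using affine_unit(1)[OF ab, of "Re z"] affine_unit(1)[OF cd, of "Im z"] that ab cd by (auto simp: in_cbox_complex_iff)
  have aff_osq: "?aff z \<in> open_square" if "z \<in> open_square" for z
  proof -
    have z: "0 < Re z" "Re z < 1" "0 < Im z" "Im z < 1" using that by (auto simp: in_box_complex_iff)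
    show ?thesis
      unfolding in_box_complex_iff complex.sel zero_complex.sel greaterThanLessThan_iff
      using affine_unit(2)[OF ab z(1,2)] affine_unit(2)[OF cd z(3,4)] ab cd by (intro conjI) linarith+
  qed
  have affc: "continuous_on T ?aff" for T by (intro continuous_intros)
  have Dop: "openin (top_of_set (surf X)) ?D" using ab cd by (intro P.openin_box) auto
  have Dcon: "connected ?D"
  proof -
    have "connected ({a<..<b} \<times> {c<..<d})" by (intro convex_connected convex_Times) auto
    moreover have "continuous_on ({a<..<b} \<times> {c<..<d}) P.pr" by (rule continuous_on_subset[OF P.cont]) (use ab cd in auto)
    ultimately show ?thesis unfolding P.box_im_def by (rule connected_continuous_image[rotated])
  qed
  have Dne: "?D \<noteq> {}" unfolding P.box_im_def using ab cd by simp
  have plq: "plaque_in (stab X) ?D x homeomorphic {0<..<1::real} \<and> plaque_in (unst X) ?D x homeomorphic {0<..<1::real}"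
    if xD: "x \<in> ?D" for x
  proof -
    obtain u v where uv: "a < u" "u < b" "c < v" "v < d" "x = r (Complex u v)" using xD unfolding P.box_im_iff by blast
    have "(\<lambda>t. r (Complex t v)) ` {a<..<b} homeomorphic {0<..<1::real}"
      by (rule line_homeomorphic[OF g, where l = Re]) (use uv ab cd in \<open>auto simp: in_box_complex_iff inj_def intro!: continuous_intros\<close>)
    moreover have "(\<lambda>t. r (Complex u t)) ` {c<..<d} homeomorphic {0<..<1::real}"
      by (rule line_homeomorphic[OF g, where l = Im]) (use uv ab cd in \<open>auto simp: in_box_complex_iff inj_def intro!: continuous_intros\<close>)
    ultimately show ?thesis unfolding uv(5) plaque_stab_box[OF uv(1-4)] plaque_unst_box[OF uv(1-4)] by blast
  qed
  have meet: "card (plaque_in (stab X) ?D x \<inter> plaque_in (unst X) ?D y) = 1" if xy: "x \<in> ?D" "y \<in> ?D" for x y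
  proof -
    obtain u v where uv: "a < u" "u < b" "c < v" "v < d" "x = r (Complex u v)" using xy(1) unfolding P.box_im_iff by blast
    obtain u' v' where uv': "a < u'" "u' < b" "c < v'" "v' < d" "y = r (Complex u' v')" using xy(2) unfolding P.box_im_iff by blast
    have "(\<lambda>t. r (Complex t v)) ` {a<..<b} \<inter> (\<lambda>t. r (Complex u' t)) ` {c<..<d} = {r (Complex u' v)}"
    proof (intro equalityI subsetI)
      fix q assume "q \<in> (\<lambda>t. r (Complex t v)) ` {a<..<b} \<inter> (\<lambda>t. r (Complex u' t)) ` {c<..<d}"
      then obtain s t where st: "a < s" "s < b" "c < t" "t < d" "q = r (Complex s v)" "q = r (Complex u' t)" by auto
      then have "r (Complex s v) = r (Complex u' t)" by simp
      then have "s = u'" using P.inj[of s v u' t] st(1-4) uv uv' ab cd by simp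
      then show "q \<in> {r (Complex u' v)}" using st(5) by simp
    qed (use uv uv' in auto)
    then show ?thesis unfolding uv(5) uv'(5) plaque_stab_box[OF uv(1-4)] plaque_unst_box[OF uv'(1-4)] by simp
  qed
  have triv: "trivially_bifoliated X ?D"
    unfolding trivially_bifoliated_def using Dop Dcon Dne plq meet by blast
  have scont: "continuous_on square ?s"
    unfolding subpar_def by (rule continuous_on_compose2[OF rcont affc]) (use aff_sq in auto)
  have inv: "continuous_on open_square (\<lambda>z. Complex ((Re z - a) / (b - a)) ((Im z - c) / (d - c)))"
    using ab cd by (intro continuous_intros) auto
  have gc: "continuous_on (rect_interior r) g" using g unfolding homeomorphism_def by blast
  have Dsub: "?D \<subseteq> rect_interior r"
    unfolding P.box_im_def rect_interior_pr using ab cd by (intro image_mono) auto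
  have hom: "homeomorphism open_square (rect_interior ?s) ?s (\<lambda>q. Complex ((Re (g q) - a) / (b - a)) ((Im (g q) - c) / (d - c)))"
  proof (rule homeomorphismI)
    show "continuous_on open_square ?s" by (rule continuous_on_subset[OF scont]) (rule box_subset_cbox)
    have gim: "g ` rect_interior r = open_square" using homeomorphism_image2[OF g] .
    show "continuous_on (rect_interior ?s) (\<lambda>q. Complex ((Re (g q) - a) / (b - a)) ((Im (g q) - c) / (d - c)))"
      unfolding subpar_interior by (rule continuous_on_compose2[OF inv continuous_on_subset[OF gc Dsub]]) (use gim Dsub in blast)
    show "?s ` open_square \<subseteq> rect_interior ?s" unfolding rect_interior_def by simp
    have gs: "Complex ((Re (g (?s z)) - a) / (b - a)) ((Im (g (?s z)) - c) / (d - c)) = z" if "z \<in> open_square" for z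
    proof -
      have "g (?s z) = ?aff z" unfolding subpar_def by (rule homeomorphism_apply1[OF g aff_osq[OF that]])
      then show ?thesis using ab cd by (simp add: complex_eq_iff)
    qed
    then show "\<And>z. z \<in> open_square \<Longrightarrow> Complex ((Re (g (?s z)) - a) / (b - a)) ((Im (g (?s z)) - c) / (d - c)) = z" .
    show "(\<lambda>q. Complex ((Re (g q) - a) / (b - a)) ((Im (g q) - c) / (d - c))) ` rect_interior ?s \<subseteq> open_square"
      unfolding rect_interior_def[of ?s] using gs by auto
    show "\<And>q. q \<in> rect_interior ?s \<Longrightarrow> ?s (Complex ((Re (g q) - a) / (b - a)) ((Im (g q) - c) / (d - c))) = q"
      unfolding rect_interior_def[of ?s] using gs by auto
  qed
  have orient: "orientation_preserving plane_orientation (orient X) open_square ?s"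
  proof -
    have "planar_orientation_preserving (id ` (UNIV \<inter> open_square \<inter> ?s -` V)) (\<psi> \<circ> ?s \<circ> inv id)"
      if V: "(V, \<psi>) \<in> orient X" for V \<psi>
    proof -
    have "\<forall>(U, \<phi>)\<in>orient X. openin (top_of_set (surf X)) U \<and> open (\<phi> ` U) \<and> (\<exists>\<psi>. homeomorphism U (\<phi> ` U) \<phi> \<psi>)"
      using surface unfolding closed_oriented_surface_def by simp
    then obtain \<psi>' where \<psi>: "homeomorphism V (\<psi> ` V) \<psi> \<psi>'" using V by auto
    have \<psi>c: "continuous_on V \<psi>" using \<psi> unfolding homeomorphism_def by blast
    have \<psi>i: "inj_on \<psi> V" by (rule inj_on_inverseI[of _ \<psi>']) (rule homeomorphism_apply1[OF \<psi>])
    have ri: "inj_on r open_square" by (rule inj_on_inverseI[of _ g]) (rule homeomorphism_apply1[OF g])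
    have "orientation_preserving plane_orientation (orient X) open_square r" using R by blast
    then have op: "planar_orientation_preserving (open_square \<inter> r -` V) (\<psi> \<circ> r)"
      unfolding orientation_preserving_def plane_orientation_def using V by (auto simp: inv_id)
    have "planar_orientation_preserving (open_square \<inter> ?s -` V)
      (\<lambda>w. (\<psi> \<circ> r) (Complex (a + (b - a) * Re w) (c + (d - c) * Im w)))"
    proof (rule planar_orientation_affine[OF op])
      show "continuous_on (open_square \<inter> r -` V) (\<psi> \<circ> r)"
        unfolding o_def by (rule continuous_on_compose2[OF \<psi>c continuous_on_subset[OF rcont]]) (use box_subset_cbox in auto)
      show "inj_on (\<psi> \<circ> r) (open_square \<inter> r -` V)"
        by (rule comp_inj_on[OF inj_on_subset[OF ri] inj_on_subset[OF \<psi>i]]) auto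
    qed (use ab cd aff_osq in \<open>auto simp: subpar_def\<close>)
    moreover have "\<psi> \<circ> ?s \<circ> inv id = (\<lambda>w. (\<psi> \<circ> r) (Complex (a + (b - a) * Re w) (c + (d - c) * Im w)))"
      unfolding inv_id by (simp add: subpar_def fun_eq_iff)
    moreover have "id ` (UNIV \<inter> open_square \<inter> ?s -` V) = open_square \<inter> ?s -` V" by simp
    ultimately show ?thesis by (simp only:)
    qed
    then show ?thesis unfolding orientation_preserving_def plane_orientation_def by auto
  qed
  have h: "\<exists>x\<in>surf X. ?s ` {z \<in> square. Im z = t} \<subseteq> leaf (stab X) x" if "t \<in> {0..1}" for t
  proof -
    let ?t = "c + (d - c) * t"
    have "?t \<in> {0..1}" using affine_unit(1)[OF cd, of t] that cd by auto
    then obtain x where x: "x \<in> surf X" "r ` {z \<in> square. Im z = ?t} \<subseteq> leaf (stab X) x" using R by blast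
    have "?s ` {z \<in> square. Im z = t} \<subseteq> r ` {z \<in> square. Im z = ?t}"
      unfolding subpar_def using aff_sq by auto
    then show ?thesis using x by blast
  qed
  have v: "\<exists>x\<in>surf X. ?s ` {z \<in> square. Re z = t} \<subseteq> leaf (unst X) x" if "t \<in> {0..1}" for t
  proof -
    let ?t = "a + (b - a) * t"
    have "?t \<in> {0..1}" using affine_unit(1)[OF ab, of t] that ab by auto
    then obtain x where x: "x \<in> surf X" "r ` {z \<in> square. Re z = ?t} \<subseteq> leaf (unst X) x" using R by blast
    have "?s ` {z \<in> square. Re z = t} \<subseteq> r ` {z \<in> square. Re z = ?t}"
      unfolding subpar_def using aff_sq by auto
    then show ?thesis using x by blast
  qed
  show ?thesis
    unfolding rectangle_def using triv[folded subpar_interior] scont hom orient h v by blast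
qed

end

lemma seg_interval:
  assumes "seg e \<phi>"
  obtains l h where "0 \<le> l" "l < h" "h \<le> 1" "\<phi> ` {0..1} = {l..h}" "\<phi> ` {0<..<1} = {l<..<h}"
proof -
  have "0 \<le> \<phi> 0" "\<phi> 0 \<le> 1" "0 \<le> \<phi> 1" "\<phi> 1 \<le> 1" using seg_range[OF assms] by simp_all
  moreover have "if e then \<phi> 0 < \<phi> 1 else \<phi> 1 < \<phi> 0"
    using seg_less_iff[OF assms, of 0 1] seg_less_iff[OF assms, of 1 0] by (cases e) simp_all
  moreover have "\<phi> ` {0..1} = (if e then {\<phi> 0..\<phi> 1} else {\<phi> 1..\<phi> 0})" by (rule seg_image_Icc[OF assms]) simp_all
  moreover have "\<phi> ` {0<..<1} = (if e then {\<phi> 0<..<\<phi> 1} else {\<phi> 1<..<\<phi> 0})" by (rule seg_image_Ioo[OF assms]) simp_all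
  ultimately show thesis using that[of "\<phi> 0" "\<phi> 1"] that[of "\<phi> 1" "\<phi> 0"] by (cases e) simp_all
qed

text \<open>Strict order of the open images forces the closed image intervals to follow one another,
  with at most an end point in common.\<close>

lemma seg_ordered:
  assumes "seg e \<phi>" "seg e' \<psi>" "\<And>x y. 0 < x \<Longrightarrow> x < 1 \<Longrightarrow> 0 < y \<Longrightarrow> y < 1 \<Longrightarrow> \<phi> x < \<psi> y"
    and xy: "0 \<le> x" "x \<le> 1" "0 \<le> y" "y \<le> 1"
  shows "\<phi> x \<le> \<psi> y"
proof -
  obtain l h where lh: "l < h" "\<phi> ` {0..1} = {l..h}" "\<phi> ` {0<..<1} = {l<..<h}" using seg_interval[OF assms(1)] by metis
  obtain l' h' where lh': "l' < h'" "\<psi> ` {0..1} = {l'..h'}" "\<psi> ` {0<..<1} = {l'<..<h'}" using seg_interval[OF assms(2)] by metis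
  have lt: "s < t" if "s \<in> {l<..<h}" "t \<in> {l'<..<h'}" for s t
    using that assms(3) unfolding lh(3)[symmetric] lh'(3)[symmetric] by auto
  have "h \<le> l'"
  proof (rule ccontr)
    assume "\<not> h \<le> l'"
    then obtain t where t: "l' < t" "t < min h h'" using dense[of l' "min h h'"] lh'(1) by auto
    obtain s where s: "max l t < s" "s < h" using dense[of "max l t" h] lh(1) t by auto
    then show False using lt[of s t] t by auto
  qed
  moreover have "\<phi> x \<in> {l..h}" "\<psi> y \<in> {l'..h'}" unfolding lh(2)[symmetric] lh'(2)[symmetric] using xy by auto
  ultimately show ?thesis by simp
qed

lemma rectangle_coords:
  assumes "rectangle X q" "0 < x" "x < 1" "0 < y" "y < 1"
  shows "vertical_coord q (q (Complex x y)) = y" "horizontal_coord q (q (Complex x y)) = x"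
proof -
  have sq: "Complex x y \<in> open_square" using assms by (simp add: in_box_complex_iff)
  obtain g where g: "homeomorphism open_square (rect_interior q) q g" using assms(1) unfolding rectangle_def by blast
  have "inj_on q open_square" by (rule inj_on_inverseI[of _ g]) (rule homeomorphism_apply1[OF g])
  from inv_into_f_f[OF this sq]
  show "vertical_coord q (q (Complex x y)) = y" "horizontal_coord q (q (Complex x y)) = x"
    unfolding vertical_coord_def horizontal_coord_def by simp_all
qed

text \<open>A finite union of compact intervals is closed; meeting every open subinterval, it leaves
  no gap.\<close>

lemma seg_cover:
  assumes fin: "finite J" and seg: "\<And>j. j \<in> J \<Longrightarrow> \<exists>e. seg e (\<phi> j)"
    and meet: "\<And>c d. 0 \<le> c \<Longrightarrow> c < d \<Longrightarrow> d \<le> 1 \<Longrightarrow> \<exists>j\<in>J. \<exists>t. 0 < t \<and> t < 1 \<and> c < \<phi> j t \<and> \<phi> j t < d"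
    and y: "0 \<le> y" "y \<le> 1"
  shows "\<exists>j\<in>J. y \<in> \<phi> j ` {0..1}"
proof (rule ccontr)
  assume neg: "\<not> ?thesis"
  let ?K = "\<Union>j\<in>J. \<phi> j ` {0..1}"
  have "closed (\<phi> j ` {0..1})" if j: "j \<in> J" for j
  proof -
    obtain e where "seg e (\<phi> j)" using seg[OF j] ..
    then show ?thesis using seg_image_Icc[of e "\<phi> j" 0 1] by auto
  qed
  then have "closed ?K" using fin by (intro closed_UN) auto
  then have "open (- ?K)" by (rule open_Compl)
  moreover have "y \<in> - ?K" using neg by auto
  ultimately obtain e where e: "0 < e" "ball y e \<subseteq> - ?K" by (meson openE)
  have "\<exists>j\<in>J. \<exists>t. 0 < t \<and> t < 1 \<and> max 0 (y - e) < \<phi> j t \<and> \<phi> j t < min 1 (y + e)"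
    by (rule meet) (use e y in \<open>auto simp: max_def min_def\<close>)
  then obtain j t where jt: "j \<in> J" "0 < t" "t < 1" "y - e < \<phi> j t" "\<phi> j t < y + e" by auto
  then have "\<phi> j t \<in> ball y e" by (auto simp: dist_real_def)
  moreover have "\<phi> j t \<in> ?K" using jt(1-3) by (intro UN_I[of j] imageI) auto
  ultimately show False using e(2) by blast
qed

section \<open>The Markov partition in interval coordinates\<close>

definition type_table :: "geometric_type \<Rightarrow> type_rows"
  where "type_table T = map (\<lambda>i. (gt_v T i, map (\<lambda>j. (gt_rho T (i, j), if gt_eps T (i, j) = 1 then 1 else 0))
    [1..<Suc (gt_h T i)])) [1..<Suc (gt_n T)]"

lemma length_type_table [simp]: "length (type_table T) = gt_n T"
  by (simp add: type_table_def)

lemma row_type_table: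
  assumes "i \<in> {1..gt_n T}"
  shows "row (type_table T) i = (gt_v T i, map (\<lambda>j. (gt_rho T (i, j), if gt_eps T (i, j) = 1 then 1 else 0)) [1..<Suc (gt_h T i)])"
  using assms unfolding row_def type_table_def nth_default_def by auto

lemma deg_type_table: "i \<in> {1..gt_n T} \<Longrightarrow> deg (type_table T) i = gt_h T i"
  by (simp add: deg_def row_type_table)

lemma edge_type_table:
  "i \<in> {1..gt_n T} \<Longrightarrow> j \<in> {1..gt_h T i} \<Longrightarrow> edge (type_table T) i j = (gt_rho T (i, j), if gt_eps T (i, j) = 1 then 1 else 0)"
  by (auto simp: edge_def row_type_table nth_default_def)

lemma branch_eqI:
  assumes "j \<in> {1..deg D i}" "\<And>j'. j' \<in> {1..deg D i} \<Longrightarrow> tgt D i j' = tgt D i j \<Longrightarrow> j' = j"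
  shows "branch D i (tgt D i j) = j"
proof -
  let ?xs = "filter (\<lambda>j'. tgt D i j' = tgt D i j) [1..<Suc (deg D i)]"
  have s: "set ?xs = {j}" using assms by (auto simp: less_Suc_eq_le)
  have "?xs = [j]" by (rule distinct_singletonD[OF _ s]) simp
  then show ?thesis unfolding branch_def by (simp add: nth_default_def)
qed

text \<open>\<open>H\<close> and \<open>V\<close> are the labellings whose existence
  \<open>has_geometric_type\<close> asserts; fixing them lets the branches become constants.\<close>

locale markov =
  fixes X :: "'a::t2_space bifoliated_surface" and \<mu>s \<mu>u :: "'a set \<Rightarrow> ennreal" and f :: "'a \<Rightarrow> 'a"
    and n :: nat and r :: "nat \<Rightarrow> complex \<Rightarrow> 'a" and T :: geometric_type and H V :: "nat \<Rightarrow> nat \<Rightarrow> 'a set"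
  assumes pA: "generalized_pseudo_Anosov X \<mu>s \<mu>u f" and GMP: "geometric_Markov_partition X f n r"
    and bin: "binary_incidence T" and gt_n: "gt_n T = n"
    and H_bij: "i \<in> {1..n} \<Longrightarrow> bij_betw (H i) {1..gt_h T i} (horizontal_subrectangles X f n r i)"
    and H_below: "i \<in> {1..n} \<Longrightarrow> j \<in> {1..gt_h T i} \<Longrightarrow> j' \<in> {1..gt_h T i} \<Longrightarrow> j < j' \<Longrightarrow> below_in (r i) (H i j) (H i j')"
    and V_bij: "k \<in> {1..n} \<Longrightarrow> bij_betw (V k) {1..gt_v T k} (vertical_subrectangles X f n r k)"
    and V_left: "k \<in> {1..n} \<Longrightarrow> l \<in> {1..gt_v T k} \<Longrightarrow> l' \<in> {1..gt_v T k} \<Longrightarrow> l < l' \<Longrightarrow> left_of_in (r k) (V k l) (V k l')"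
    and HV: "i \<in> {1..n} \<Longrightarrow> j \<in> {1..gt_h T i} \<Longrightarrow> \<exists>k\<in>{1..n}. \<exists>l\<in>{1..gt_v T k}.
         gt_rho T (i, j) = (k, l) \<and> f ` H i j = V k l \<and>
         gt_eps T (i, j) =
           (if \<forall>x\<in>H i j. \<forall>y\<in>H i j. vertical_coord (r i) x < vertical_coord (r i) y \<longrightarrow>
                 vertical_coord (r k) (f x) < vertical_coord (r k) (f y)
            then 1 else - 1)"
begin

abbreviation S :: "'a set" where "S \<equiv> surf X"
abbreviation D :: type_rows where "D \<equiv> type_table T"
abbreviation \<rho> :: "nat \<Rightarrow> real \<Rightarrow> real \<Rightarrow> 'a" where "\<rho> i x y \<equiv> r i (Complex x y)"
abbreviation R0 :: "nat \<Rightarrow> 'a set" where "R0 i \<equiv> rect_interior (r i)"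
abbreviation Sing :: "'a set" where "Sing \<equiv> singular_points (stab X)"
abbreviation f_inv :: "'a \<Rightarrow> 'a" where "f_inv \<equiv> inv_into S f"

lemma surface: "closed_oriented_surface S (orient X)"
  and fol: "singular_foliation S (stab X)" "singular_foliation S (unst X)"
  and leaf_image: "x \<in> S \<Longrightarrow> f ` leaf (stab X) x = leaf (stab X) (f x)" "x \<in> S \<Longrightarrow> f ` leaf (unst X) x = leaf (unst X) (f x)"
  using pA unfolding generalized_pseudo_Anosov_def by blast+

lemma f_homeo: "continuous_on S f" "inj_on f S" "f ` S = S" "continuous_on S f_inv"
proof -
  obtain g where g: "homeomorphism S S f g" using pA unfolding generalized_pseudo_Anosov_def by blast
  show c: "continuous_on S f" and s: "f ` S = S" using g unfolding homeomorphism_def by auto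
  show i: "inj_on f S" by (rule inj_on_inverseI[of _ g]) (rule homeomorphism_apply1[OF g])
  have "f_inv q = g q" if q: "q \<in> S" for q
  proof -
    have "g q \<in> S" "f (g q) = q" using g q unfolding homeomorphism_def by auto
    then show ?thesis using inv_into_f_f[OF i, of "g q"] by simp
  qed
  moreover have "continuous_on S g" using g unfolding homeomorphism_def by blast
  ultimately show "continuous_on S f_inv" using continuous_on_cong by metis
qed

lemma f_S: "x \<in> S \<Longrightarrow> f x \<in> S"
  using f_homeo(3) by blast

lemma f_inv_f: "x \<in> S \<Longrightarrow> f_inv (f x) = x"
  by (rule inv_into_f_f[OF f_homeo(2)])

lemma f_f_inv: "x \<in> S \<Longrightarrow> f (f_inv x) = x" and f_inv_S: "x \<in> S \<Longrightarrow> f_inv x \<in> S"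
  using f_homeo(3) by (auto intro: f_inv_into_f inv_into_into)

lemma f_open: "openin (top_of_set S) U \<Longrightarrow> openin (top_of_set S) (f ` U)"
proof -
  assume U: "openin (top_of_set S) U"
  have "homeomorphism S S f f_inv"
    by (rule homeomorphismI) (use f_homeo f_inv_f f_f_inv f_S f_inv_S in auto)
  from homeomorphism_imp_open_map[OF this U] show ?thesis .
qed

lemma rect_r: "i \<in> {1..n} \<Longrightarrow> rectangle X (r i)"
  using GMP unfolding geometric_Markov_partition_def by blast

lemma PR: "i \<in> {1..n} \<Longrightarrow> product_rectangle S (stab X) (unst X) (\<rho> i)"
  by (rule rectangle_product[OF rect_r fol])

lemma R0_iff: "q \<in> R0 i \<longleftrightarrow> (\<exists>x y. 0 < x \<and> x < 1 \<and> 0 < y \<and> y < 1 \<and> q = \<rho> i x y)"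
  unfolding rect_interior_pr by force

lemma R0_dom: "i \<in> {1..n} \<Longrightarrow> product_rectangle.dom (\<rho> i) = R0 i"
  unfolding product_rectangle.dom_def[OF PR] rect_interior_pr ..

lemma R0_S: "i \<in> {1..n} \<Longrightarrow> R0 i \<subseteq> S"
  using product_rectangle.openin_S[OF PR] openin_imp_subset unfolding rect_interior_pr by blast

lemma R0_disjoint: "i \<in> {1..n} \<Longrightarrow> k \<in> {1..n} \<Longrightarrow> q \<in> R0 i \<Longrightarrow> q \<in> R0 k \<Longrightarrow> i = k"
  using GMP unfolding geometric_Markov_partition_def by blast

lemma \<rho>_inj: "i \<in> {1..n} \<Longrightarrow> 0 < x \<Longrightarrow> x < 1 \<Longrightarrow> 0 < y \<Longrightarrow> y < 1 \<Longrightarrow> 0 < x' \<Longrightarrow> x' < 1 \<Longrightarrow> 0 < y' \<Longrightarrow> y' < 1 \<Longrightarrow>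
    \<rho> i x y = \<rho> i x' y' \<Longrightarrow> x = x' \<and> y = y'"
  using product_rectangle.inj[OF PR] by blast

lemma coords:
  assumes "i \<in> {1..n}" "0 < x" "x < 1" "0 < y" "y < 1"
  shows "vertical_coord (r i) (\<rho> i x y) = y" "horizontal_coord (r i) (\<rho> i x y) = x"
  by (rule rectangle_coords[OF rect_r[OF assms(1)] assms(2-5)])+

lemma deg_D: "i \<in> {1..n} \<Longrightarrow> deg D i = gt_h T i"
  using deg_type_table gt_n by simp

lemma transition:
  assumes i: "i \<in> {1..n}" and j: "j \<in> {1..deg D i}"
  shows "gt_rho T (i, j) = (tgt D i j, vpos D i j)" "tgt D i j \<in> {1..n}" "vpos D i j \<in> {1..gt_v T (tgt D i j)}"
    "f ` H i j = V (tgt D i j) (vpos D i j)"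
    "incr D i j \<longleftrightarrow> (\<forall>x\<in>H i j. \<forall>y\<in>H i j. vertical_coord (r i) x < vertical_coord (r i) y \<longrightarrow>
       vertical_coord (r (tgt D i j)) (f x) < vertical_coord (r (tgt D i j)) (f y))"
proof -
  have j': "j \<in> {1..gt_h T i}" using j deg_D[OF i] by simp
  have e: "edge D i j = (gt_rho T (i, j), if gt_eps T (i, j) = 1 then 1 else 0)"
    using edge_type_table[of i T j] i j' gt_n by simp
  obtain k l where kl: "k \<in> {1..n}" "l \<in> {1..gt_v T k}" "gt_rho T (i, j) = (k, l)" "f ` H i j = V k l"
    "gt_eps T (i, j) = (if \<forall>x\<in>H i j. \<forall>y\<in>H i j. vertical_coord (r i) x < vertical_coord (r i) y \<longrightarrow>
                 vertical_coord (r k) (f x) < vertical_coord (r k) (f y) then 1 else - 1)"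
    using HV[OF i j'] by blast
  have t: "tgt D i j = k" "vpos D i j = l" using e kl(3) by (simp_all add: tgt_def vpos_def)
  show "gt_rho T (i, j) = (tgt D i j, vpos D i j)" "tgt D i j \<in> {1..n}" "vpos D i j \<in> {1..gt_v T (tgt D i j)}"
    "f ` H i j = V (tgt D i j) (vpos D i j)" unfolding t using kl by auto
  have "incr D i j \<longleftrightarrow> gt_eps T (i, j) = 1" unfolding incr_def e by simp
  then show "incr D i j \<longleftrightarrow> (\<forall>x\<in>H i j. \<forall>y\<in>H i j. vertical_coord (r i) x < vertical_coord (r i) y \<longrightarrow>
       vertical_coord (r (tgt D i j)) (f x) < vertical_coord (r (tgt D i j)) (f y))"
    unfolding t kl(5) by (simp split: if_splits)
qed

text \<open>Two branches with the same target would make an incidence entry at least 2. From here on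
  a pair of consecutive letters stands for a branch.\<close>

lemma tgt_unique:
  assumes i: "i \<in> {1..n}" and j: "j \<in> {1..deg D i}" "j' \<in> {1..deg D i}" and e: "tgt D i j = tgt D i j'"
  shows "j = j'"
proof -
  let ?J = "{j\<in>{1..gt_h T i}. \<exists>l. gt_rho T (i, j) = (tgt D i j', l)}"
  have "incidence T i (tgt D i j') \<in> {0, 1}"
    using bin i transition(2)[OF i j(2)] gt_n unfolding binary_incidence_def by blast
  then have "incidence T i (tgt D i j') \<le> 1" by force
  then have c: "card ?J \<le> Suc 0" unfolding incidence_def One_nat_def .
  have "j \<in> ?J" "j' \<in> ?J" using transition(1)[OF i j(1)] transition(1)[OF i j(2)] j deg_D[OF i] e by auto
  then show ?thesis using card_le_Suc0_iff_eq[of ?J] c by auto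
qed

text \<open>\<open>f\<close> in coordinates on the \<open>j\<close>-th sub-rectangle: the first map
  takes target heights to source heights and carries the sign \<open>incr\<close>, the second takes
  source abscissas to target abscissas. Both live on the closed interval, while \<open>f\<close> is
  read at interior points only.\<close>

definition chart_pair :: "nat \<Rightarrow> nat \<Rightarrow> (real \<Rightarrow> real) \<times> (real \<Rightarrow> real) \<Rightarrow> bool"
  where "chart_pair i j p \<longleftrightarrow> seg (incr D i j) (fst p) \<and> (\<exists>e. seg e (snd p)) \<and>
    H i j = {\<rho> i x (fst p y) | x y. 0 < x \<and> x < 1 \<and> 0 < y \<and> y < 1} \<and>
    V (tgt D i j) (vpos D i j) = {\<rho> (tgt D i j) (snd p x) y | x y. 0 < x \<and> x < 1 \<and> 0 < y \<and> y < 1} \<and>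
    (\<forall>x y. 0 < x \<longrightarrow> x < 1 \<longrightarrow> 0 < y \<longrightarrow> y < 1 \<longrightarrow> f (\<rho> i x (fst p y)) = \<rho> (tgt D i j) (snd p x) y)"

lemma ex_chart_pair:
  assumes i: "i \<in> {1..n}" and j: "j \<in> {1..deg D i}"
  shows "\<exists>p. chart_pair i j p"
proof -
  let ?k = "tgt D i j" and ?l = "vpos D i j"
  note k = transition(2)[OF i j] and l = transition(3)[OF i j]
  interpret I: product_rectangle S "stab X" "unst X" "\<rho> i" by (rule PR[OF i])
  interpret K: product_rectangle S "stab X" "unst X" "\<rho> ?k" by (rule PR[OF k])
  interpret K': product_rectangle S "unst X" "stab X" "\<lambda>x y. \<rho> ?k y x" by (rule K.swap)
  have "j \<in> {1..gt_h T i}" using j deg_D[OF i] by simp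
  then have "H i j \<in> horizontal_subrectangles X f n r i" using bij_betwE[OF H_bij[OF i]] by blast
  then have hs: "horizontal_subrectangle X (r i) (H i j)" using GMP i unfolding geometric_Markov_partition_def by blast
  then obtain r1 where r1: "rectangle X r1" "rect_interior r1 = H i j" unfolding horizontal_subrectangle_def by blast
  have t1: "openin (top_of_set S) (H i j)" "connected (H i j)" "H i j \<noteq> {}"
    using r1 unfolding rectangle_def trivially_bifoliated_def by auto
  obtain c d where cd: "0 \<le> c" "c < d" "d \<le> 1" "H i j = I.box_im 0 1 c d"
  proof (rule I.horizontal_strip[OF _ t1])
    show "H i j \<subseteq> I.dom" unfolding R0_dom[OF i] using hs unfolding horizontal_subrectangle_def by blast
    show "plaque_in (stab X) (H i j) q = plaque_in (stab X) I.dom q" if "q \<in> H i j" for q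
      unfolding R0_dom[OF i] using hs that unfolding horizontal_subrectangle_def by blast
  qed blast
  have "V ?k ?l \<in> vertical_subrectangles X f n r ?k" using bij_betwE[OF V_bij[OF k]] l by blast
  then have vs: "vertical_subrectangle X (r ?k) (V ?k ?l)" using GMP k unfolding geometric_Markov_partition_def by blast
  then obtain r2 where r2: "rectangle X r2" "rect_interior r2 = V ?k ?l" unfolding vertical_subrectangle_def by blast
  have t2: "openin (top_of_set S) (V ?k ?l)" "connected (V ?k ?l)" "V ?k ?l \<noteq> {}"
    using r2 unfolding rectangle_def trivially_bifoliated_def by auto
  have dom': "K'.dom = R0 ?k" unfolding K'.dom_def rect_interior_pr by (force simp: image_iff)
  obtain a b where ab: "0 \<le> a" "a < b" "b \<le> 1" "V ?k ?l = K'.box_im 0 1 a b"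
  proof (rule K'.horizontal_strip[OF _ t2])
    show "V ?k ?l \<subseteq> K'.dom" unfolding dom' using vs unfolding vertical_subrectangle_def by blast
    show "plaque_in (unst X) (V ?k ?l) q = plaque_in (unst X) K'.dom q" if "q \<in> V ?k ?l" for q
      unfolding dom' using vs that unfolding vertical_subrectangle_def by blast
  qed blast
  have Vbox: "V ?k ?l = K.box_im a b 0 1" unfolding ab(4) K'.box_im_def K.box_im_def by (force simp: image_iff)
  have fC: "f ` I.box_im 0 1 c d = K.box_im a b 0 1" unfolding cd(4)[symmetric] Vbox[symmetric] by (rule transition(4)[OF i j])
  obtain e e' hb gb where hg: "seg e hb" "seg e' gb" "hb ` {0..1} = {c..d}" "hb ` {0<..<1} = {c<..<d}"
    "gb ` {0..1} = {a..b}" "gb ` {0<..<1} = {a<..<b}"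
    "\<And>x y. 0 < x \<Longrightarrow> x < 1 \<Longrightarrow> 0 < y \<Longrightarrow> y < 1 \<Longrightarrow> f (\<rho> i x (hb y)) = \<rho> ?k (gb x) y"
  proof (rule I.strip_product_form[OF K.product_rectangle_axioms f_homeo(1,2) leaf_image cd(1-3) ab(1-3) fC])
    fix e e' hb gb
    assume "seg e hb" "seg e' gb" "hb ` {0..1} = {c..d}" "hb ` {0<..<1} = {c<..<d}"
      "gb ` {0..1} = {a..b}" "gb ` {0<..<1} = {a<..<b}"
      "\<And>x y. 0 < x \<Longrightarrow> x < 1 \<Longrightarrow> 0 < y \<Longrightarrow> y < 1 \<Longrightarrow> f (\<rho> i x (hb y)) = \<rho> ?k (gb x) y"
    then show thesis by (rule that)
  qed
  have Heq: "H i j = {\<rho> i x (hb y) | x y. 0 < x \<and> x < 1 \<and> 0 < y \<and> y < 1}"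
  proof -
    have "H i j = (\<lambda>p. \<rho> i (fst p) (snd p)) ` ({0<..<1} \<times> hb ` {0<..<1})" unfolding cd(4) I.box_im_def hg(4) ..
    then show ?thesis by force
  qed
  have Veq: "V ?k ?l = {\<rho> ?k (gb x) y | x y. 0 < x \<and> x < 1 \<and> 0 < y \<and> y < 1}"
  proof -
    have "V ?k ?l = (\<lambda>p. \<rho> ?k (fst p) (snd p)) ` (gb ` {0<..<1} \<times> {0<..<1})" unfolding Vbox K.box_im_def hg(6) ..
    then show ?thesis by force
  qed
  have vc: "vertical_coord (r i) (\<rho> i x (hb y)) = hb y \<and> vertical_coord (r ?k) (f (\<rho> i x (hb y))) = y"
    if "0 < x" "x < 1" "0 < y" "y < 1" for x y
    using coords(1)[OF i that(1,2), of "hb y"] coords(1)[OF k _ _ that(3,4), of "gb x"] seg_open_range[OF hg(1) that(3,4)]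
      seg_open_range[OF hg(2) that(1,2)] hg(7)[OF that] by simp
  \<comment> \<open>\<open>incr\<close> quantifies over all pairs of points of \<open>H i j\<close>;
    on a decreasing branch the points over 1/3 and 2/3 refute it.\<close>
  have "incr D i j = e"
  proof (cases e)
    case True
    have "\<forall>x\<in>H i j. \<forall>y\<in>H i j. vertical_coord (r i) x < vertical_coord (r i) y \<longrightarrow>
       vertical_coord (r ?k) (f x) < vertical_coord (r ?k) (f y)"
    proof (intro ballI impI)
      fix p q assume "p \<in> H i j" "q \<in> H i j" and lt: "vertical_coord (r i) p < vertical_coord (r i) q"
      then obtain x y x' y' where p: "0 < x" "x < 1" "0 < y" "y < 1" "p = \<rho> i x (hb y)"
        and q: "0 < x'" "x' < 1" "0 < y'" "y' < 1" "q = \<rho> i x' (hb y')" unfolding Heq by blast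
      have "hb y < hb y'" using lt vc[OF p(1-4)] vc[OF q(1-4)] unfolding p(5) q(5) by simp
      then have "y < y'" using seg_less_iff[OF hg(1), of y y'] p q True by simp
      then show "vertical_coord (r ?k) (f p) < vertical_coord (r ?k) (f q)"
        using vc[OF p(1-4)] vc[OF q(1-4)] unfolding p(5) q(5) by simp
    qed
    then show ?thesis using transition(5)[OF i j] True by blast
  next
    case False
    let ?p = "\<rho> i (1/2) (hb (2/3))" and ?q = "\<rho> i (1/2) (hb (1/3))"
    have "?p \<in> H i j" "?q \<in> H i j" unfolding Heq by force+
    moreover have "vertical_coord (r i) ?p < vertical_coord (r i) ?q"
      using vc[of "1/2" "2/3"] vc[of "1/2" "1/3"] seg_less_iff[OF hg(1), of "2/3" "1/3"] False by simp
    moreover have "\<not> vertical_coord (r ?k) (f ?p) < vertical_coord (r ?k) (f ?q)"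
      using vc[of "1/2" "2/3"] vc[of "1/2" "1/3"] by simp
    ultimately show ?thesis using transition(5)[OF i j] False by blast
  qed
  then have "chart_pair i j (hb, gb)" unfolding chart_pair_def fst_conv snd_conv using hg Heq Veq by blast
  then show ?thesis ..
qed

definition hb :: "nat \<Rightarrow> nat \<Rightarrow> real \<Rightarrow> real" where "hb i j = fst (SOME p. chart_pair i j p)"
definition gb :: "nat \<Rightarrow> nat \<Rightarrow> real \<Rightarrow> real" where "gb i j = snd (SOME p. chart_pair i j p)"

lemma charts:
  assumes "i \<in> {1..n}" "j \<in> {1..deg D i}"
  shows "seg (incr D i j) (hb i j)" "\<exists>e. seg e (gb i j)"
    "H i j = {\<rho> i x (hb i j y) | x y. 0 < x \<and> x < 1 \<and> 0 < y \<and> y < 1}"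
    "V (tgt D i j) (vpos D i j) = {\<rho> (tgt D i j) (gb i j x) y | x y. 0 < x \<and> x < 1 \<and> 0 < y \<and> y < 1}"
    "0 < x \<Longrightarrow> x < 1 \<Longrightarrow> 0 < y \<Longrightarrow> y < 1 \<Longrightarrow> f (\<rho> i x (hb i j y)) = \<rho> (tgt D i j) (gb i j x) y"
proof -
  have "chart_pair i j (hb i j, gb i j)"
    using someI_ex[OF ex_chart_pair[OF assms]] unfolding hb_def gb_def prod.collapse .
  note c = this[unfolded chart_pair_def fst_conv snd_conv]
  show "seg (incr D i j) (hb i j)" using c by (elim conjE)
  show "\<exists>e. seg e (gb i j)" using c by (elim conjE)
  show "H i j = {\<rho> i x (hb i j y) | x y. 0 < x \<and> x < 1 \<and> 0 < y \<and> y < 1}" using c by (elim conjE)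
  show "V (tgt D i j) (vpos D i j) = {\<rho> (tgt D i j) (gb i j x) y | x y. 0 < x \<and> x < 1 \<and> 0 < y \<and> y < 1}"
    using c by (elim conjE)
  have "\<forall>x y. 0 < x \<longrightarrow> x < 1 \<longrightarrow> 0 < y \<longrightarrow> y < 1 \<longrightarrow> f (\<rho> i x (hb i j y)) = \<rho> (tgt D i j) (gb i j x) y"
    using c by (elim conjE)
  then show "0 < x \<Longrightarrow> x < 1 \<Longrightarrow> 0 < y \<Longrightarrow> y < 1 \<Longrightarrow> f (\<rho> i x (hb i j y)) = \<rho> (tgt D i j) (gb i j x) y"
    by (elim allE impE)
qed

lemma hb_open: "i \<in> {1..n} \<Longrightarrow> j \<in> {1..deg D i} \<Longrightarrow> 0 < y \<Longrightarrow> y < 1 \<Longrightarrow> 0 < hb i j y \<and> hb i j y < 1"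
  using charts(1) seg_open_range by blast

lemma gb_open: "i \<in> {1..n} \<Longrightarrow> j \<in> {1..deg D i} \<Longrightarrow> 0 < y \<Longrightarrow> y < 1 \<Longrightarrow> 0 < gb i j y \<and> gb i j y < 1"
  using charts(2) seg_open_range by blast

lemma enter:
  assumes i: "i \<in> {1..n}" and k: "k \<in> {1..n}" and q: "q \<in> R0 i" "f q \<in> R0 k"
  obtains j x y where "j \<in> {1..deg D i}" "tgt D i j = k" "0 < x" "x < 1" "0 < y" "y < 1" "q = \<rho> i x (hb i j y)"
proof -
  have "q \<in> R0 i \<inter> f -` R0 k" using q by simp
  then obtain C where C: "C \<in> components (R0 i \<inter> f -` R0 k)" "q \<in> C"
    using Union_components[of "R0 i \<inter> f -` R0 k"] by blast
  then have "C \<in> horizontal_subrectangles X f n r i" unfolding horizontal_subrectangles_def using k by blast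
  then obtain j where j: "j \<in> {1..gt_h T i}" "C = H i j" using H_bij[OF i] unfolding bij_betw_def by blast
  have j': "j \<in> {1..deg D i}" using j deg_D[OF i] by simp
  obtain x y where xy: "0 < x" "x < 1" "0 < y" "y < 1" "q = \<rho> i x (hb i j y)"
    using C(2) unfolding j(2) charts(3)[OF i j'] by blast
  have "f q = \<rho> (tgt D i j) (gb i j x) y" unfolding xy(5) by (rule charts(5)[OF i j' xy(1-4)])
  then have "f q \<in> R0 (tgt D i j)" unfolding R0_iff using xy gb_open[OF i j' xy(1,2)] by blast
  then have "tgt D i j = k" using R0_disjoint[OF transition(2)[OF i j'] k] q(2) by blast
  then show ?thesis using that j' xy by blast
qed

lemma rect_closure: "i \<in> {1..n} \<Longrightarrow> rect (r i) \<subseteq> closure (R0 i)"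
proof -
  assume i: "i \<in> {1..n}"
  have "closure open_square = square" by (intro closure_box) (auto simp: box_ne_empty Basis_complex_def)
  moreover have "continuous_on square (r i)" using rect_r[OF i] unfolding rectangle_def by blast
  ultimately have "r i ` closure open_square \<subseteq> closure (R0 i)"
    unfolding rect_interior_def by (intro image_closure_subset) (auto simp: closure_subset)
  then show ?thesis unfolding rect_def using \<open>closure open_square = square\<close> by simp
qed

lemma open_meets_interior:
  assumes "openin (top_of_set S) U" "U \<noteq> {}"
  obtains k q where "k \<in> {1..n}" "q \<in> U" "q \<in> R0 k"
proof -
  obtain W where W: "open W" "U = S \<inter> W" using assms(1) unfolding openin_open by blast
  obtain p where p: "p \<in> U" using assms(2) by blast
  have "(\<Union>i\<in>{1..n}. rect (r i)) = S" using GMP unfolding geometric_Markov_partition_def by blast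
  then obtain k where k: "k \<in> {1..n}" "p \<in> rect (r k)" using p W by blast
  then have "p \<in> closure (R0 k)" using rect_closure by blast
  then have "W \<inter> R0 k \<noteq> {}" using p W open_Int_closure_eq_empty[OF W(1), of "R0 k"] by blast
  then show ?thesis using that k(1) W(2) R0_S[OF k(1)] by blast
qed

text \<open>The interiors of the rectangles are dense, so the image of an arbitrarily thin strip of
  \<open>R_i\<close> meets one of them; hence the strip meets a branch, and \<open>seg_cover\<close>
  applies.\<close>

lemma hb_covers:
  assumes i: "i \<in> {1..n}" and y: "0 \<le> y" "y \<le> 1"
  shows "\<exists>j\<in>{1..deg D i}. y \<in> hb i j ` {0..1}"
proof (rule seg_cover[OF _ _ _ y])
  fix c d :: real assume cd: "0 \<le> c" "c < d" "d \<le> 1"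
  interpret I: product_rectangle S "stab X" "unst X" "\<rho> i" by (rule PR[OF i])
  have "openin (top_of_set S) (f ` I.box_im 0 1 c d)" using cd by (intro f_open I.openin_box) auto
  moreover have "\<rho> i (1/2) ((c + d) / 2) \<in> I.box_im 0 1 c d" using cd by (intro I.box_imI) auto
  then have "f ` I.box_im 0 1 c d \<noteq> {}" by blast
  ultimately obtain k q where k: "k \<in> {1..n}" "q \<in> f ` I.box_im 0 1 c d" "q \<in> R0 k" by (rule open_meets_interior)
  then obtain x y where xy: "0 < x" "x < 1" "c < y" "y < d" "q = f (\<rho> i x y)" unfolding I.box_im_def by force
  have y01: "0 < y" "y < 1" using xy cd by auto
  have "\<rho> i x y \<in> R0 i" unfolding R0_iff using xy y01 by blast
  then obtain j u v where j: "j \<in> {1..deg D i}" "0 < u" "u < 1" "0 < v" "v < 1" "\<rho> i x y = \<rho> i u (hb i j v)"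
    using enter[OF i k(1)] k(3) unfolding xy(5) by metis
  have "y = hb i j v" using \<rho>_inj[OF i xy(1,2) y01 j(2,3) _ _ j(6)] hb_open[OF i j(1,4,5)] by blast
  then show "\<exists>j\<in>{1..deg D i}. \<exists>t. 0 < t \<and> t < 1 \<and> c < hb i j t \<and> hb i j t < d" using j xy by blast
qed (use charts(1)[OF i] in auto)

text \<open>The same argument for the inverse of \<open>f\<close>, with all branches that end in
  \<open>R_k\<close> taken together.\<close>

lemma gb_covers:
  assumes k: "k \<in> {1..n}" and x: "0 \<le> x" "x \<le> 1"
  shows "\<exists>i\<in>{1..n}. \<exists>j\<in>{1..deg D i}. tgt D i j = k \<and> x \<in> gb i j ` {0..1}"
proof -
  define J where "J = {p \<in> (SIGMA i:{1..n}. {1..deg D i}). tgt D (fst p) (snd p) = k}"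
  have "\<exists>p\<in>J. x \<in> gb (fst p) (snd p) ` {0..1}"
  proof (rule seg_cover[OF _ _ _ x])
    show "finite J" unfolding J_def by simp
    show "\<exists>e. seg e (gb (fst p) (snd p))" if "p \<in> J" for p using that charts(2) unfolding J_def by auto
    fix c d :: real assume cd: "0 \<le> c" "c < d" "d \<le> 1"
    interpret K: product_rectangle S "stab X" "unst X" "\<rho> k" by (rule PR[OF k])
    let ?B = "K.box_im c d 0 1"
    have Bo: "openin (top_of_set S) ?B" using cd by (intro K.openin_box) auto
    have BS: "?B \<subseteq> S" using Bo by (rule openin_imp_subset)
    have hom: "homeomorphism S S f_inv f"
      by (rule homeomorphismI) (use f_homeo f_inv_f f_f_inv f_S f_inv_S in auto)
    have "openin (top_of_set S) (f_inv ` ?B)" by (rule homeomorphism_imp_open_map[OF hom Bo])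
    moreover have "\<rho> k ((c + d) / 2) (1/2) \<in> ?B" using cd by (intro K.box_imI) auto
    then have "f_inv ` ?B \<noteq> {}" by blast
    ultimately obtain i q where i: "i \<in> {1..n}" "q \<in> f_inv ` ?B" "q \<in> R0 i" by (rule open_meets_interior)
    then obtain p where p: "p \<in> ?B" "q = f_inv p" by blast
    have fq: "f q = p" unfolding p(2) using p(1) BS f_f_inv by blast
    obtain x y where xy: "c < x" "x < d" "0 < y" "y < 1" "p = \<rho> k x y" using p(1) unfolding K.box_im_iff by blast
    have x01: "0 < x" "x < 1" using xy cd by auto
    have "f q \<in> R0 k" unfolding fq xy(5) R0_iff using xy x01 by blast
    then obtain j u v where j: "j \<in> {1..deg D i}" "tgt D i j = k" "0 < u" "u < 1" "0 < v" "v < 1" "q = \<rho> i u (hb i j v)"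
      using enter[OF i(1) k i(3)] by metis
    have "\<rho> k x y = \<rho> k (gb i j u) v" using charts(5)[OF i(1) j(1,3-6)] fq unfolding j(2,7) xy(5) by simp
    then have "x = gb i j u" using \<rho>_inj[OF k x01 xy(3,4) _ _ j(5,6)] gb_open[OF i(1) j(1,3,4)] by blast
    moreover have "(i, j) \<in> J" unfolding J_def using i(1) j by simp
    ultimately show "\<exists>p\<in>J. \<exists>t. 0 < t \<and> t < 1 \<and> c < gb (fst p) (snd p) t \<and> gb (fst p) (snd p) t < d"
      using j(3,4) xy(1,2) by (intro bexI[of _ "(i, j)"]) auto
  qed
  then obtain i j where ij: "(i, j) \<in> J" and x': "x \<in> gb i j ` {0..1}" by auto
  have "i \<in> {1..n}" "j \<in> {1..deg D i}" "tgt D i j = k" using ij unfolding J_def by simp_all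
  then show ?thesis using x' by blast
qed

lemma hb_order:
  assumes i: "i \<in> {1..n}" and j: "j \<in> {1..deg D i}" "j' \<in> {1..deg D i}" "j < j'" and xy: "0 \<le> x" "x \<le> 1" "0 \<le> y" "y \<le> 1"
  shows "hb i j x \<le> hb i j' y"
proof (rule seg_ordered[OF charts(1)[OF i j(1)] charts(1)[OF i j(2)] _ xy])
  fix u v :: real assume uv: "0 < u" "u < 1" "0 < v" "v < 1"
  have half: "(0::real) < 1/2" "1/2 < (1::real)" by simp_all
  have "\<rho> i (1/2) (hb i j u) \<in> H i j" "\<rho> i (1/2) (hb i j' v) \<in> H i j'"
    unfolding charts(3)[OF i j(1)] charts(3)[OF i j(2)] using uv half by blast+
  moreover have "below_in (r i) (H i j) (H i j')" using H_below[OF i] j deg_D[OF i] by simp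
  ultimately have "vertical_coord (r i) (\<rho> i (1/2) (hb i j u)) < vertical_coord (r i) (\<rho> i (1/2) (hb i j' v))"
    unfolding below_in_def by blast
  then show "hb i j u < hb i j' v"
    using coords(1)[OF i half] hb_open[OF i j(1) uv(1,2)] hb_open[OF i j(2) uv(3,4)] by simp
qed

text \<open>The type only maps rows to columns. Conversely, each column contains an image point of
  some row, and two columns with a common point are equal because distinct columns are separated by
  their order.\<close>

lemma vpos_onto:
  assumes k: "k \<in> {1..n}" and l: "l \<in> {1..gt_v T k}"
  obtains i j where "i \<in> {1..n}" "j \<in> {1..deg D i}" "tgt D i j = k" "vpos D i j = l"
proof -
  have "V k l \<in> vertical_subrectangles X f n r k" using bij_betwE[OF V_bij[OF k]] l by blast
  then obtain i where i: "i \<in> {1..n}" "V k l \<in> components (f ` R0 i \<inter> R0 k)" unfolding vertical_subrectangles_def by blast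
  obtain q where q: "q \<in> V k l" using in_components_nonempty[OF i(2)] by blast
  then have "q \<in> f ` R0 i \<inter> R0 k" using in_components_subset[OF i(2)] by blast
  then obtain p where p: "p \<in> R0 i" "q = f p" "f p \<in> R0 k" by blast
  obtain j x y where j: "j \<in> {1..deg D i}" "tgt D i j = k" "0 < x" "x < 1" "0 < y" "y < 1" "p = \<rho> i x (hb i j y)"
    by (rule enter[OF i(1) k p(1,3)])
  have "p \<in> H i j" unfolding charts(3)[OF i(1) j(1)] j(7) using j(3-6) by blast
  then have q': "q \<in> V k (vpos D i j)" using transition(4)[OF i(1) j(1)] p(2) j(2) by blast
  have l': "vpos D i j \<in> {1..gt_v T k}" using transition(3)[OF i(1) j(1)] j(2) by simp
  have "\<not> (l < vpos D i j)"
  proof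
    assume "l < vpos D i j"
    then have "left_of_in (r k) (V k l) (V k (vpos D i j))" by (rule V_left[OF k l l'])
    then show False using q q' unfolding left_of_in_def by blast
  qed
  moreover have "\<not> (vpos D i j < l)"
  proof
    assume "vpos D i j < l"
    then have "left_of_in (r k) (V k (vpos D i j)) (V k l)" by (rule V_left[OF k l' l])
    then show False using q q' unfolding left_of_in_def by blast
  qed
  ultimately show ?thesis using that i(1) j(1,2) by simp
qed

section \<open>Symbolic dynamics of the partition\<close>

definition step :: "nat \<Rightarrow> nat \<Rightarrow> bool"
  where "step i k \<longleftrightarrow> i \<in> {1..n} \<and> k \<in> tgt D i ` {1..deg D i}"

lemma stepD:
  assumes "step i k"
  shows "i \<in> {1..n}" "k \<in> {1..n}" "branch D i k \<in> {1..deg D i}" "tgt D i (branch D i k) = k"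
proof -
  show i: "i \<in> {1..n}" using assms unfolding step_def by blast
  obtain j where j: "j \<in> {1..deg D i}" "k = tgt D i j" using assms unfolding step_def by blast
  have "branch D i k = j" unfolding j(2) by (rule branch_eqI[OF j(1)]) (rule tgt_unique[OF i _ j(1)])
  then show "k \<in> {1..n}" "branch D i k \<in> {1..deg D i}" "tgt D i (branch D i k) = k" using j transition(2)[OF i j(1)] by simp_all
qed

abbreviation Fb :: "nat \<Rightarrow> nat \<Rightarrow> real \<Rightarrow> real" where "Fb i k \<equiv> hb i (branch D i k)"
text \<open>The arguments are swapped so that \<open>itin\<close> applies to a past read backwards,
  whose consecutive letters are target and source.\<close>

abbreviation Gb :: "nat \<Rightarrow> nat \<Rightarrow> real \<Rightarrow> real" where "Gb k i \<equiv> gb i (branch D i k)"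

lemma step_enter:
  assumes "step i k" "q \<in> R0 i" "f q \<in> R0 k"
  obtains x y where "0 < x" "x < 1" "0 < y" "y < 1" "q = \<rho> i x (Fb i k y)"
proof -
  note st = stepD[OF assms(1)]
  obtain j x y where j: "j \<in> {1..deg D i}" "tgt D i j = k" "0 < x" "x < 1" "0 < y" "y < 1" "q = \<rho> i x (hb i j y)"
    by (rule enter[OF st(1,2) assms(2,3)])
  have "branch D i k = j" using tgt_unique[OF st(1) st(3) j(1)] st(4) j(2) by simp
  then show ?thesis using that j by simp
qed

text \<open>\<open>f\<close> expands heights, so the height comes first in
  \<open>\<sigma>\<close>.\<close>

sublocale fwd: transition_system f "\<lambda>i h x. \<rho> i x h" step Fb "\<lambda>i k. Gb k i"
proof
  fix i k assume st: "step i k"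
  note s = stepD[OF st]
  show "\<exists>e. seg e (Fb i k)" using charts(1)[OF s(1,3)] by blast
  show "\<exists>e. seg e (Gb k i)" by (rule charts(2)[OF s(1,3)])
  show "f (\<rho> i y (Fb i k x)) = \<rho> k (Gb k i y) x" if "0 < x" "x < 1" "0 < y" "y < 1" for x y
    using charts(5)[OF s(1,3) that(3,4,1,2)] unfolding s(4) .
  show "x = x' \<and> y = y'" if "0 < x" "x < 1" "0 < y" "y < 1" "0 < x'" "x' < 1" "0 < y'" "y' < 1" "\<rho> k y x = \<rho> k y' x'" for x y x' y'
    using \<rho>_inj[OF s(2) that(3,4,1,2,7,8,5,6,9)] by blast
  show "\<exists>t. 0 < t \<and> t < 1 \<and> x = Fb i k t"
    if xy: "0 < x" "x < 1" "0 < y" "y < 1" "0 < x'" "x' < 1" "0 < y'" "y' < 1" "f (\<rho> i y x) = \<rho> k y' x'" for x y x' y'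
  proof -
    have "\<rho> i y x \<in> R0 i" "f (\<rho> i y x) \<in> R0 k" unfolding xy(9) R0_iff using xy(1-8) by blast+
    from step_enter[OF st this] obtain u v where uv: "0 < u" "u < 1" "0 < v" "v < 1" "\<rho> i y x = \<rho> i u (Fb i k v)" by blast
    have "x = Fb i k v" using \<rho>_inj[OF s(1) xy(3,4,1,2) uv(1,2) _ _ uv(5)] hb_open[OF s(1,3) uv(3,4)] by blast
    then show ?thesis using uv by blast
  qed
qed

text \<open>The inverse of \<open>f\<close> expands abscissas, and the arrows are traversed
  backwards.\<close>

sublocale bwd: transition_system f_inv \<rho> "\<lambda>k i. step i k" Gb "\<lambda>k i. Fb i k"
proof
  fix k i assume st: "step i k"
  note s = stepD[OF st]
  show "\<exists>e. seg e (Fb i k)" using charts(1)[OF s(1,3)] by blast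
  show "\<exists>e. seg e (Gb k i)" by (rule charts(2)[OF s(1,3)])
  have inS: "\<rho> i x (Fb i k y) \<in> S" if "0 < x" "x < 1" "0 < y" "y < 1" for x y
    using R0_S[OF s(1)] hb_open[OF s(1,3) that(3,4)] that unfolding R0_iff subset_iff by blast
  show "f_inv (\<rho> k (Gb k i x) y) = \<rho> i x (Fb i k y)" if "0 < x" "x < 1" "0 < y" "y < 1" for x y
    using charts(5)[OF s(1,3) that] f_inv_f[OF inS[OF that]] unfolding s(4) by simp
  show "x = x' \<and> y = y'" if "0 < x" "x < 1" "0 < y" "y < 1" "0 < x'" "x' < 1" "0 < y'" "y' < 1" "\<rho> i x y = \<rho> i x' y'" for x y x' y'
    by (rule \<rho>_inj[OF s(1) that])
  show "\<exists>t. 0 < t \<and> t < 1 \<and> x = Gb k i t"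
    if xy: "0 < x" "x < 1" "0 < y" "y < 1" "0 < x'" "x' < 1" "0 < y'" "y' < 1" "f_inv (\<rho> k x y) = \<rho> i x' y'" for x y x' y'
  proof -
    have k0: "\<rho> k x y \<in> R0 k" and i0: "\<rho> i x' y' \<in> R0 i" unfolding R0_iff using xy(1-8) by blast+
    have fe: "f (\<rho> i x' y') = \<rho> k x y" unfolding xy(9)[symmetric] using f_f_inv k0 R0_S[OF s(2)] by blast
    from step_enter[OF st i0] obtain u v where uv: "0 < u" "u < 1" "0 < v" "v < 1" "\<rho> i x' y' = \<rho> i u (Fb i k v)"
      using k0 unfolding fe by blast
    have "\<rho> k x y = \<rho> k (Gb k i u) v" using charts(5)[OF s(1,3) uv(1-4)] fe unfolding uv(5) s(4) by simp
    then have "x = Gb k i u" using \<rho>_inj[OF s(2) xy(1-4) _ _ uv(3,4)] gb_open[OF s(1,3) uv(1,2)] by blast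
    then show ?thesis using uv by blast
  qed
qed

lemma measured_stab: "i \<in> {1..n} \<Longrightarrow> measured_rectangle S (stab X) (unst X) Sing \<mu>u (\<rho> i)"
  unfolding measured_rectangle_def using pseudo_Anosov_bifoliation(1)[OF pA] PR by blast

lemma measured_unst: "i \<in> {1..n} \<Longrightarrow> measured_rectangle S (unst X) (stab X) Sing \<mu>s (\<lambda>h x. \<rho> i x h)"
  unfolding measured_rectangle_def using pseudo_Anosov_bifoliation(2)[OF pA] product_rectangle.swap[OF PR] by blast

lemma limit_points_fwd:
  assumes u: "\<And>m. step (u m) (u (Suc m))" and z: "z1 \<in> limit_points Fb u" "z2 \<in> limit_points Fb u"
  shows "z1 = z2"
proof -
  obtain \<Lambda> where L: "1 < \<Lambda>" "\<And>J. regular_leaf_arc S (unst X) J \<Longrightarrow> \<mu>s (f ` path_image J) = ennreal \<Lambda> * \<mu>s (path_image J)"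
    using pA unfolding generalized_pseudo_Anosov_def by blast
  have "\<not> z < z'" if zz: "z \<in> limit_points Fb u" "z' \<in> limit_points Fb u" for z z'
  proof
    assume lt: "z < z'"
    show False
      by (rule fwd.limit_points_unique[OF u measured_unst finite_atLeastAtMost[of 1 n] stepD(1)[OF u] _ L(1) zz lt])
        (assumption, simp add: L(2))
  qed
  from this[OF z] this[OF z(2,1)] show ?thesis by simp
qed

text \<open>Contraction of stable arcs by \<open>f\<close> is expansion by its inverse: the law for
  \<open>f\<close> is applied to the arc \<open>J'\<close>, whose image is \<open>J\<close>.\<close>

lemma limit_points_bwd:
  assumes u: "\<And>m. step (u (Suc m)) (u m)" and z: "z1 \<in> limit_points Gb u" "z2 \<in> limit_points Gb u"
  shows "z1 = z2"
proof -
  obtain \<Lambda> where L: "1 < \<Lambda>" "\<And>I. regular_leaf_arc S (stab X) I \<Longrightarrow> \<mu>u (f ` path_image I) = ennreal (inverse \<Lambda>) * \<mu>u (path_image I)"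
    using pA unfolding generalized_pseudo_Anosov_def by blast
  have expand: "\<mu>u (path_image J') = ennreal \<Lambda> * \<mu>u (path_image J)"
    if J: "regular_leaf_arc S (stab X) J" "regular_leaf_arc S (stab X) J'" "path_image J' = f_inv ` path_image J" for J J'
  proof -
    have "path_image J \<subseteq> S" using J(1) leaf_subset[OF fol(1)] unfolding regular_leaf_arc_def by blast
    then have "f ` path_image J' = path_image J" unfolding J(3) image_image using f_f_inv by force
    then have "\<mu>u (path_image J) = ennreal (inverse \<Lambda>) * \<mu>u (path_image J')" using L(2)[OF J(2)] by simp
    then have "ennreal \<Lambda> * \<mu>u (path_image J) = (ennreal \<Lambda> * ennreal (inverse \<Lambda>)) * \<mu>u (path_image J')" by (simp add: mult.assoc)
    also have "ennreal \<Lambda> * ennreal (inverse \<Lambda>) = 1" using L(1) by (simp add: ennreal_mult[symmetric])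
    finally show ?thesis by simp
  qed
  have "\<not> z < z'" if zz: "z \<in> limit_points Gb u" "z' \<in> limit_points Gb u" for z z'
  proof
    assume lt: "z < z'"
    show False
      by (rule bwd.limit_points_unique[OF u measured_stab finite_atLeastAtMost[of 1 n] stepD(2)[OF u] expand L(1) zz lt])
  qed
  from this[OF z] this[OF z(2,1)] show ?thesis by simp
qed

sublocale interval_dynamics D hb
proof
  fix i j assume "i \<in> {1..length D}" "j \<in> {1..deg D i}"
  then show "tgt D i j \<in> {1..length D}" using transition(2) gt_n by simp
next
  fix i j j' assume "i \<in> {1..length D}" "j \<in> {1..deg D i}" "j' \<in> {1..deg D i}" "tgt D i j = tgt D i j'"
  then show "j = j'" by (intro tgt_unique[of i j j']) (simp_all only: length_type_table gt_n)
next
  fix i j assume "i \<in> {1..length D}" "j \<in> {1..deg D i}"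
  then show "seg (incr D i j) (hb i j)" using charts(1) gt_n by simp
next
  fix i j j' and x y :: real assume "i \<in> {1..length D}" "j \<in> {1..deg D i}" "j' \<in> {1..deg D i}" "j < j'" "0 \<le> x" "x \<le> 1" "0 \<le> y" "y \<le> 1"
  then show "hb i j x \<le> hb i j' y" using hb_order gt_n by simp
next
  fix i and y :: real assume "i \<in> {1..length D}" "0 \<le> y" "y \<le> 1"
  then show "\<exists>j\<in>{1..deg D i}. y \<in> hb i j ` {0..1}" using hb_covers gt_n by simp
next
  fix u :: "nat \<Rightarrow> nat" and y y' assume u: "\<And>m. u m \<in> {1..length D} \<and> u (Suc m) \<in> tgt D (u m) ` {1..deg D (u m)}"
    and y: "y \<in> limit_points Fb u" "y' \<in> limit_points Fb u"
  have "step (u m) (u (Suc m))" for m using u[of m] gt_n unfolding step_def by simp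
  then show "y = y'" using y by (rule limit_points_fwd)
qed

end

section \<open>Closed cylinders, the projection and the stable arcs\<close>

lemma closure_image_box:
  fixes P :: "real \<times> real \<Rightarrow> 'b::t2_space"
  assumes P: "continuous_on ({0..1} \<times> {0..1}) P" and lh: "0 \<le> l" "l < h" "h \<le> 1" "0 \<le> l'" "l' < h'" "h' \<le> 1"
  shows "closure (P ` ({l<..<h} \<times> {l'<..<h'})) = P ` ({l..h} \<times> {l'..h'})"
proof
  have sub: "{l..h} \<times> {l'..h'} \<subseteq> {0..1} \<times> {0..1}" using lh by auto
  note c = continuous_on_subset[OF P sub]
  have "compact (P ` ({l..h} \<times> {l'..h'}))" by (rule compact_continuous_image[OF c]) (intro compact_Times compact_Icc)
  then have "closed (P ` ({l..h} \<times> {l'..h'}))" by (rule compact_imp_closed)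
  then show "closure (P ` ({l<..<h} \<times> {l'<..<h'})) \<subseteq> P ` ({l..h} \<times> {l'..h'})"
    by (rule closure_minimal[rotated]) (rule image_mono, auto)
  have cl: "closure ({l<..<h} \<times> {l'<..<h'}) = {l..h} \<times> {l'..h'}"
    using lh by (simp add: closure_Times closure_greaterThanLessThan)
  have "P ` closure ({l<..<h} \<times> {l'<..<h'}) \<subseteq> closure (P ` ({l<..<h} \<times> {l'<..<h'}))"
    by (rule image_closure_subset) (use c cl in simp, rule closed_closure, rule closure_subset)
  then show "P ` ({l..h} \<times> {l'..h'}) \<subseteq> closure (P ` ({l<..<h} \<times> {l'<..<h'}))" unfolding cl .
qed

text \<open>\<open>P\<close> need not be injective on the boundary, so the preimage of
  \<open>q\<close> may vary with \<open>N\<close>. In each box the preimages form a nonempty compact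
  set, and the nested intersection contains one common preimage.\<close>

lemma nested_boxes_point:
  fixes P :: "real \<times> real \<Rightarrow> 'b::t2_space" and A B :: "nat \<Rightarrow> real set"
  assumes P: "continuous_on ({0..1} \<times> {0..1}) P"
    and A: "\<And>N. compact (A N)" "\<And>M N. M \<le> N \<Longrightarrow> A N \<subseteq> A M" "\<And>N. A N \<subseteq> {0..1}" "(\<Inter>N. A N) = {a}"
    and B: "\<And>N. compact (B N)" "\<And>M N. M \<le> N \<Longrightarrow> B N \<subseteq> B M" "\<And>N. B N \<subseteq> {0..1}" "(\<Inter>N. B N) = {b}"
    and q: "\<And>N. q \<in> P ` (A N \<times> B N)"
  shows "q = P (a, b)"
proof -
  define K where "K N = (A N \<times> B N) \<inter> P -` {q}" for N
  have cK: "compact (K N)" for N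
  proof -
    have cAB: "compact (A N \<times> B N)" by (intro compact_Times A B)
    have "closed (K N)" unfolding K_def
      by (rule continuous_closed_preimage[OF continuous_on_subset[OF P] compact_imp_closed[OF cAB]])
        (use A(3)[of N] B(3)[of N] in blast, simp)
    then have "compact ((A N \<times> B N) \<inter> K N)" by (rule compact_Int_closed[OF cAB])
    moreover have "(A N \<times> B N) \<inter> K N = K N" unfolding K_def by blast
    ultimately show ?thesis by simp
  qed
  have nK: "K N \<noteq> {}" for N using q[of N] unfolding K_def by blast
  have mK: "K N \<subseteq> K M" if MN: "M \<le> N" for M N using A(2)[OF MN] B(2)[OF MN] unfolding K_def by blast
  have "\<Inter>(range K) \<noteq> {}" by (rule compact_nest) (use cK nK mK in auto)
  then obtain p where p: "\<And>N. p \<in> K N" by blast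
  have "fst p \<in> A N" "snd p \<in> B N" "P p = q" for N using p[of N] unfolding K_def by auto
  then have "fst p \<in> (\<Inter>N. A N)" "snd p \<in> (\<Inter>N. B N)" "P p = q" by blast+
  then have "p = (a, b)" unfolding A(4) B(4) by (simp add: prod_eq_iff)
  then show ?thesis using \<open>P p = q\<close> by simp
qed

lemma shift_funpow: "(shift ^^ k) w z = w (z + int k)"
  by (induction k arbitrary: z) (simp_all add: shift_def algebra_simps)

lemma int_iterate_pos: "int_iterate S f (int m) = f ^^ m"
  unfolding int_iterate_def by simp

lemma int_iterate_neg: "int_iterate S f (- int m) = inv_into S f ^^ m"
  unfolding int_iterate_def by (cases "m = 0") simp_all

context markov
begin

abbreviation fut :: "(int \<Rightarrow> nat) \<Rightarrow> nat \<Rightarrow> nat" where "fut w \<equiv> \<lambda>m. w (int m)"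
abbreviation pst :: "(int \<Rightarrow> nat) \<Rightarrow> nat \<Rightarrow> nat" where "pst w \<equiv> \<lambda>m. w (- int m)"

lemma stepI: "i \<in> {1..n} \<Longrightarrow> j \<in> {1..deg D i} \<Longrightarrow> tgt D i j = k \<Longrightarrow> step i k"
  unfolding step_def by blast

lemma subshift_iff: "w \<in> subshift T \<longleftrightarrow> (\<forall>z. step (w z) (w (z + 1)))"
proof
  assume w: "w \<in> subshift T"
  show "\<forall>z. step (w z) (w (z + 1))"
  proof
    fix z
    have i: "w z \<in> {1..n}" and c: "incidence T (w z) (w (z + 1)) = 1" using w gt_n unfolding subshift_def by auto
    have "{j\<in>{1..gt_h T (w z)}. \<exists>l. gt_rho T (w z, j) = (w (z + 1), l)} \<noteq> {}"
      using c unfolding incidence_def by (metis card.empty zero_neq_one)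
    then obtain j l where j: "j \<in> {1..gt_h T (w z)}" "gt_rho T (w z, j) = (w (z + 1), l)" by blast
    have j': "j \<in> {1..deg D (w z)}" using j(1) deg_D[OF i] by simp
    have "tgt D (w z) j = w (z + 1)" using transition(1)[OF i j'] j(2) by simp
    then show "step (w z) (w (z + 1))" by (rule stepI[OF i j'])
  qed
next
  assume w: "\<forall>z. step (w z) (w (z + 1))"
  show "w \<in> subshift T" unfolding subshift_def
  proof (intro CollectI allI conjI)
    fix z
    have s: "step (w z) (w (z + 1))" using w by blast
    note i = stepD(1,2)[OF s]
    show "w z \<in> {1..gt_n T}" using i gt_n by simp
    let ?J = "{j\<in>{1..gt_h T (w z)}. \<exists>l. gt_rho T (w z, j) = (w (z + 1), l)}"
    have b: "branch D (w z) (w (z + 1)) \<in> ?J"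
      using transition(1)[OF i(1) stepD(3)[OF s]] stepD(3,4)[OF s] deg_D[OF i(1)] by simp
    have fin: "finite ?J" by simp
    have "card ?J \<noteq> 0" unfolding card_0_eq[OF fin] using b by blast
    moreover have "incidence T (w z) (w (z + 1)) = 0 \<or> incidence T (w z) (w (z + 1)) = 1"
      using bin i gt_n unfolding binary_incidence_def by blast
    ultimately show "incidence T (w z) (w (z + 1)) = 1" unfolding incidence_def by - (erule disjE, erule notE, assumption, assumption)
  qed
qed

lemma subshift_step: "w \<in> subshift T \<Longrightarrow> step (w z) (w (z + 1))"
  using subshift_iff by blast

lemma subshift_shift: "w \<in> subshift T \<Longrightarrow> (shift ^^ k) w \<in> subshift T"
  unfolding subshift_iff shift_funpow using add.assoc add.commute by metis

lemma fut_step: "w \<in> subshift T \<Longrightarrow> step (fut w m) (fut w (Suc m))"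
  using subshift_step[of w "int m"] by (simp add: add.commute)

lemma pst_step: "w \<in> subshift T \<Longrightarrow> step (pst w (Suc m)) (pst w m)"
  using subshift_step[of w "- int (Suc m)"] by simp

lemma Gb_seg: "step i k \<Longrightarrow> \<exists>e. seg e (Gb k i)"
  by (rule charts(2)[OF stepD(1,3)])

definition xpos :: "(nat \<Rightarrow> nat) \<Rightarrow> real"
  where "xpos u = (THE x. x \<in> limit_points Gb u)"

lemma limit_xpos:
  assumes u: "\<And>m. step (u (Suc m)) (u m)"
  shows "limit_points Gb u = {xpos u}"
proof -
  obtain x where x: "x \<in> limit_points Gb u" using limit_points_nonempty[of Gb u] Gb_seg[OF u] by blast
  have uq: "y = x" if y: "y \<in> limit_points Gb u" for y by (rule limit_points_bwd[OF u y x])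
  have "xpos u = x" unfolding xpos_def by (rule the_equality[of "\<lambda>x. x \<in> limit_points Gb u", OF x uq])
  then show ?thesis using x uq by blast
qed

lemma step_code: "(\<And>m. step (u m) (u (Suc m))) \<Longrightarrow> code u"
  unfolding code_def step_def using gt_n by simp

lemma code_fut: "w \<in> subshift T \<Longrightarrow> code (fut w)"
  by (rule step_code) (rule fut_step)

definition cylinder :: "nat \<Rightarrow> (int \<Rightarrow> nat) \<Rightarrow> 'a set"
  where "cylinder N w = {y\<in>S. \<forall>z\<in>{- int N..int N}. int_iterate S f z y \<in> R0 (w z)}"

lemma cylinder_cong: "(\<And>z. - int N \<le> z \<Longrightarrow> z \<le> int N \<Longrightarrow> w z = v z) \<Longrightarrow> cylinder N w = cylinder N v"
  unfolding cylinder_def by auto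

lemma fwd_cell: "fwd.cell i = R0 i"
  unfolding set_eq_iff fwd.cell_def mem_Collect_eq R0_iff by blast

lemma bwd_cell: "bwd.cell i = R0 i"
  unfolding set_eq_iff bwd.cell_def mem_Collect_eq R0_iff by blast

text \<open>The letters at nonnegative times restrict only the height, those at nonpositive times
  only the abscissa.\<close>

lemma cylinder_eq:
  assumes w: "w \<in> subshift T"
  shows "cylinder N w = (\<lambda>p. \<rho> (w 0) (fst p) (snd p)) ` (itin Gb (pst w) N ` {0<..<1} \<times> itin Hb (fut w) N ` {0<..<1})"
proof -
  have i: "w 0 \<in> {1..n}" using stepD(1)[OF subshift_step[OF w]] .
  have F: "(\<forall>m\<le>N. (f ^^ m) y \<in> R0 (w (int m))) \<longleftrightarrow>
    (\<exists>s t. 0 < s \<and> s < 1 \<and> 0 < t \<and> t < 1 \<and> y = \<rho> (w 0) t (itin Hb (fut w) N s))" for y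
    using fwd.itinerary_cell[of "fut w" N y, OF fut_step[OF w]] unfolding fwd_cell by simp
  have B: "(\<forall>m\<le>N. (f_inv ^^ m) y \<in> R0 (w (- int m))) \<longleftrightarrow>
    (\<exists>s t. 0 < s \<and> s < 1 \<and> 0 < t \<and> t < 1 \<and> y = \<rho> (w 0) (itin Gb (pst w) N s) t)" for y
    using bwd.itinerary_cell[of "pst w" N y, OF pst_step[OF w]] unfolding bwd_cell by simp
  have I: "(\<forall>z\<in>{- int N..int N}. int_iterate S f z y \<in> R0 (w z)) \<longleftrightarrow>
    (\<forall>m\<le>N. (f ^^ m) y \<in> R0 (w (int m))) \<and> (\<forall>m\<le>N. (f_inv ^^ m) y \<in> R0 (w (- int m)))" for y
  proof -
    note p = int_iterate_pos[of S f] and q = int_iterate_neg[of S f]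
    show ?thesis
    proof
      assume a: "\<forall>z\<in>{- int N..int N}. int_iterate S f z y \<in> R0 (w z)"
      have "(f ^^ m) y \<in> R0 (w (int m))" if "m \<le> N" for m using bspec[OF a, of "int m"] that unfolding p by simp
      moreover have "(f_inv ^^ m) y \<in> R0 (w (- int m))" if "m \<le> N" for m using bspec[OF a, of "- int m"] that unfolding q by simp
      ultimately show "(\<forall>m\<le>N. (f ^^ m) y \<in> R0 (w (int m))) \<and> (\<forall>m\<le>N. (f_inv ^^ m) y \<in> R0 (w (- int m)))" by blast
    next
      assume a: "(\<forall>m\<le>N. (f ^^ m) y \<in> R0 (w (int m))) \<and> (\<forall>m\<le>N. (f_inv ^^ m) y \<in> R0 (w (- int m)))"
      show "\<forall>z\<in>{- int N..int N}. int_iterate S f z y \<in> R0 (w z)"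
      proof
        fix z assume z: "z \<in> {- int N..int N}"
        obtain m where "z = int m \<or> z = - int m" by (cases z rule: int_cases2) blast+
        then show "int_iterate S f z y \<in> R0 (w z)" using a z p[of m] q[of m] by auto
      qed
    qed
  qed
  show ?thesis
  proof (intro set_eqI iffI)
    fix y assume "y \<in> cylinder N w"
    then have "(\<forall>m\<le>N. (f ^^ m) y \<in> R0 (w (int m)))" "(\<forall>m\<le>N. (f_inv ^^ m) y \<in> R0 (w (- int m)))"
      unfolding cylinder_def I by blast+
    then obtain s t s' t' where st: "0 < s" "s < 1" "0 < t" "t < 1" "y = \<rho> (w 0) t (itin Hb (fut w) N s)"
      and st': "0 < s'" "s' < 1" "0 < t'" "t' < 1" "y = \<rho> (w 0) (itin Gb (pst w) N s') t'"
      unfolding F B by blast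
    have hs: "0 < itin Hb (fut w) N s \<and> itin Hb (fut w) N s < 1" by (rule fwd.itin_open[of "fut w", OF fut_step[OF w] st(1,2)])
    have gs: "0 < itin Gb (pst w) N s' \<and> itin Gb (pst w) N s' < 1" by (rule bwd.itin_open[of "pst w", OF pst_step[OF w] st'(1,2)])
    \<comment> \<open>The future gives a representation with free abscissa, the past one with free
      height; injectivity of the parametrization merges them.\<close>
    have "t = itin Gb (pst w) N s'" using \<rho>_inj[OF i st(3,4) _ _ _ _ st'(3,4)] hs gs st(5) st'(5) by blast
    then show "y \<in> (\<lambda>p. \<rho> (w 0) (fst p) (snd p)) ` (itin Gb (pst w) N ` {0<..<1} \<times> itin Hb (fut w) N ` {0<..<1})"
      using st st' by (intro image_eqI[of _ _ "(itin Gb (pst w) N s', itin Hb (fut w) N s)"] SigmaI imageI) simp_all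
  next
    fix y assume "y \<in> (\<lambda>p. \<rho> (w 0) (fst p) (snd p)) ` (itin Gb (pst w) N ` {0<..<1} \<times> itin Hb (fut w) N ` {0<..<1})"
    then obtain s s' where s: "0 < s" "s < 1" "0 < s'" "s' < 1" "y = \<rho> (w 0) (itin Gb (pst w) N s') (itin Hb (fut w) N s)" by auto
    have hs: "0 < itin Hb (fut w) N s \<and> itin Hb (fut w) N s < 1" by (rule fwd.itin_open[of "fut w", OF fut_step[OF w] s(1,2)])
    have gs: "0 < itin Gb (pst w) N s' \<and> itin Gb (pst w) N s' < 1" by (rule bwd.itin_open[of "pst w", OF pst_step[OF w] s(3,4)])
    have "y \<in> R0 (w 0)" unfolding s(5) R0_iff using hs gs by blast
    then have "y \<in> S" using R0_S[OF i] by blast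
    then show "y \<in> cylinder N w" unfolding cylinder_def mem_Collect_eq I F B using s hs gs by blast
  qed
qed

lemma itin_G: "w \<in> subshift T \<Longrightarrow> \<exists>e. seg e (itin Gb (pst w) N)"
  by (rule seg_itin) (rule Gb_seg[OF pst_step])

lemma itin_H: "w \<in> subshift T \<Longrightarrow> \<exists>e. seg e (itin Hb (fut w) N)"
  by (rule itin_seg[OF code_fut])

lemma closure_cylinder:
  assumes w: "w \<in> subshift T"
  shows "closure (cylinder N w) = (\<lambda>p. \<rho> (w 0) (fst p) (snd p)) ` (itin Gb (pst w) N ` {0..1} \<times> itin Hb (fut w) N ` {0..1})"
proof -
  have i: "w 0 \<in> {1..n}" using stepD(1)[OF subshift_step[OF w]] .
  obtain e e' where e: "seg e (itin Gb (pst w) N)" "seg e' (itin Hb (fut w) N)" using itin_G[OF w] itin_H[OF w] by blast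
  obtain l h where lh: "0 \<le> l" "l < h" "h \<le> 1" "itin Gb (pst w) N ` {0..1} = {l..h}" "itin Gb (pst w) N ` {0<..<1} = {l<..<h}"
    by (rule seg_interval[OF e(1)])
  obtain l' h' where lh': "0 \<le> l'" "l' < h'" "h' \<le> 1" "itin Hb (fut w) N ` {0..1} = {l'..h'}" "itin Hb (fut w) N ` {0<..<1} = {l'<..<h'}"
    by (rule seg_interval[OF e(2)])
  show ?thesis unfolding cylinder_eq[OF w] lh(4,5) lh'(4,5)
    by (rule closure_image_box[OF product_rectangle.cont[OF PR[OF i]] lh(1-3) lh'(1-3)])
qed

lemma \<rho>_S: "i \<in> {1..n} \<Longrightarrow> 0 \<le> x \<Longrightarrow> x \<le> 1 \<Longrightarrow> 0 \<le> y \<Longrightarrow> y \<le> 1 \<Longrightarrow> \<rho> i x y \<in> S"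
  using product_rectangle.in_S[OF PR] by blast

abbreviation \<pi> :: "(int \<Rightarrow> nat) \<Rightarrow> 'a" where "\<pi> \<equiv> code_projection X f r"

lemma seg_image_compact:
  assumes "\<exists>e. seg e \<phi>" shows "compact (\<phi> ` {0..1})" "\<phi> ` {0..1} \<subseteq> {0..1}"
proof -
  obtain e where e: "seg e \<phi>" using assms ..
  obtain l h where "0 \<le> l" "h \<le> 1" "\<phi> ` {0..1} = {l..h}" by (rule seg_interval[OF e])
  then show "compact (\<phi> ` {0..1})" "\<phi> ` {0..1} \<subseteq> {0..1}" by auto
qed

lemma cylinder_point:
  assumes w: "w \<in> subshift T" and q: "\<And>N. q \<in> closure (cylinder N w)"
  shows "q = \<rho> (w 0) (xpos (pst w)) (height (fut w))"
proof -
  have i: "w 0 \<in> {1..n}" using stepD(1)[OF subshift_step[OF w]] .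
  have "q = (\<lambda>p. \<rho> (w 0) (fst p) (snd p)) (xpos (pst w), height (fut w))"
  proof (rule nested_boxes_point[OF product_rectangle.cont[OF PR[OF i]],
      of "\<lambda>N. itin Gb (pst w) N ` {0..1}" _ "\<lambda>N. itin Hb (fut w) N ` {0..1}"])
    show "compact (itin Gb (pst w) N ` {0..1})" "itin Gb (pst w) N ` {0..1} \<subseteq> {0..1}" for N
      by (rule seg_image_compact[OF itin_G[OF w]])+
    show "compact (itin Hb (fut w) N ` {0..1})" "itin Hb (fut w) N ` {0..1} \<subseteq> {0..1}" for N
      by (rule seg_image_compact[OF itin_H[OF w]])+
    show "itin Gb (pst w) N ` {0..1} \<subseteq> itin Gb (pst w) M ` {0..1}" if "M \<le> N" for M N
      by (rule itin_image_antimono[of Gb "pst w", OF Gb_seg[OF pst_step[OF w]] that])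
    show "itin Hb (fut w) N ` {0..1} \<subseteq> itin Hb (fut w) M ` {0..1}" if "M \<le> N" for M N
      by (rule itin_image_antimono[of Hb "fut w", OF Hb_seg'[OF code_fut[OF w]] that])
    show "(\<Inter>N. itin Gb (pst w) N ` {0..1}) = {xpos (pst w)}"
      using limit_xpos[of "pst w", OF pst_step[OF w]] unfolding limit_points_def .
    show "(\<Inter>N. itin Hb (fut w) N ` {0..1}) = {height (fut w)}"
      using limit_height[OF code_fut[OF w]] unfolding limit_points_def .
    show "q \<in> (\<lambda>p. \<rho> (w 0) (fst p) (snd p)) ` (itin Gb (pst w) N ` {0..1} \<times> itin Hb (fut w) N ` {0..1})" for N
      using q unfolding closure_cylinder[OF w] .
  qed
  then show ?thesis by simp
qed

lemma point_in_cylinder: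
  assumes w: "w \<in> subshift T"
  shows "\<rho> (w 0) (xpos (pst w)) (height (fut w)) \<in> closure (cylinder N w)"
proof -
  have "xpos (pst w) \<in> itin Gb (pst w) N ` {0..1}"
    using limit_xpos[of "pst w", OF pst_step[OF w]] unfolding limit_points_def by blast
  then show ?thesis unfolding closure_cylinder[OF w] using height_in[OF code_fut[OF w], of N]
    by (intro image_eqI[of _ _ "(xpos (pst w), height (fut w))"] SigmaI) simp_all
qed

text \<open>The closed cylinders have exactly one common point, so the definite description in
  \<open>code_projection\<close> picks it.\<close>

lemma projection_eq:
  assumes w: "w \<in> subshift T"
  shows "\<pi> w = \<rho> (w 0) (xpos (pst w)) (height (fut w))"
  unfolding code_projection_def cylinder_def[symmetric]
  by (rule the_equality) (use point_in_cylinder[OF w] cylinder_point[OF w] in blast)+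

lemma projection_in: "w \<in> subshift T \<Longrightarrow> \<pi> w \<in> closure (cylinder N w)"
  unfolding projection_eq by (rule point_in_cylinder)

lemma projection_unique: "w \<in> subshift T \<Longrightarrow> (\<And>N. q \<in> closure (cylinder N w)) \<Longrightarrow> q = \<pi> w"
  unfolding projection_eq by (rule cylinder_point)

lemma xpos_range:
  assumes "w \<in> subshift T" shows "0 \<le> xpos (pst w) \<and> xpos (pst w) \<le> 1"
proof -
  have "xpos (pst w) \<in> itin Gb (pst w) 0 ` {0..1}"
    using limit_xpos[of "pst w", OF pst_step[OF assms]] unfolding limit_points_def by blast
  then show ?thesis by simp
qed

lemma projection_S: "w \<in> subshift T \<Longrightarrow> \<pi> w \<in> S"
  unfolding projection_eq using \<rho>_S[OF stepD(1)[OF subshift_step]] xpos_range height_range[OF code_fut] by blast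

text \<open>\<open>f\<close> moves the cylinder of radius \<open>Suc N\<close> into the cylinder of
  radius \<open>N\<close> of the shifted code, and closures follow by continuity.\<close>

lemma f_projection:
  assumes w: "w \<in> subshift T"
  shows "f (\<pi> w) = \<pi> (shift w)"
proof (rule projection_unique)
  show sw: "shift w \<in> subshift T" using subshift_shift[OF w, of 1] by simp
  fix N
  have "f ` cylinder (Suc N) w \<subseteq> cylinder N (shift w)"
  proof (intro image_subsetI)
    fix y assume y: "y \<in> cylinder (Suc N) w"
    then have yS: "y \<in> S" unfolding cylinder_def by blast
    show "f y \<in> cylinder N (shift w)" unfolding cylinder_def mem_Collect_eq
    proof (intro conjI ballI)
      show "f y \<in> S" by (rule f_S[OF yS])
      fix z assume z: "z \<in> {- int N..int N}"
      have "int_iterate S f z (f y) = int_iterate S f (z + 1) y"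
      proof (cases "0 \<le> z")
        case True
        then have "nat (z + 1) = Suc (nat z)" by simp
        then show ?thesis using True unfolding int_iterate_def by (simp add: funpow_swap1)
      next
        case False
        define m where "m = nat (- (z + 1))"
        have m: "z = - int (Suc m)" using False unfolding m_def by simp
        have "int_iterate S f z (f y) = (f_inv ^^ Suc m) (f y)" unfolding m int_iterate_neg ..
        also have "\<dots> = (f_inv ^^ m) y" unfolding funpow_Suc_right comp_def f_inv_f[OF yS] ..
        also have "\<dots> = int_iterate S f (- int m) y" unfolding int_iterate_neg ..
        finally show ?thesis unfolding m by simp
      qed
      moreover have "int_iterate S f (z + 1) y \<in> R0 (w (z + 1))" using y z unfolding cylinder_def by auto
      ultimately show "int_iterate S f z (f y) \<in> R0 (shift w z)" unfolding shift_def by simp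
    qed
  qed
  then have sub: "f ` cylinder (Suc N) w \<subseteq> closure (cylinder N (shift w))" using closure_subset by blast
  have i: "w 0 \<in> {1..n}" using stepD(1)[OF subshift_step[OF w]] .
  have "closure (cylinder (Suc N) w) \<subseteq> S"
    unfolding closure_cylinder[OF w]
  proof (intro image_subsetI)
    fix p assume "p \<in> itin Gb (pst w) (Suc N) ` {0..1} \<times> itin Hb (fut w) (Suc N) ` {0..1}"
    then have "fst p \<in> itin Gb (pst w) (Suc N) ` {0..1}" "snd p \<in> itin Hb (fut w) (Suc N) ` {0..1}"
      unfolding mem_Times_iff by blast+
    then have "fst p \<in> {0..1}" "snd p \<in> {0..1}"
      using seg_image_compact(2)[OF itin_G[OF w]] seg_image_compact(2)[OF itin_H[OF w]] by (blast dest: subsetD)+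
    then show "\<rho> (w 0) (fst p) (snd p) \<in> S" by (intro \<rho>_S[OF i]) simp_all
  qed
  then have "f ` closure (cylinder (Suc N) w) \<subseteq> closure (cylinder N (shift w))"
    by (intro image_closure_subset[OF _ closed_closure sub] continuous_on_subset[OF f_homeo(1)])
  then show "f (\<pi> w) \<in> closure (cylinder N (shift w))" using projection_in[OF w] by blast
qed

lemma funpow_projection: "w \<in> subshift T \<Longrightarrow> (f ^^ k) (\<pi> w) = \<pi> ((shift ^^ k) w)"
proof (induction k)
  case (Suc k)
  then show ?case using f_projection[OF subshift_shift[OF Suc.prems, of k]] by simp
qed simp

text \<open>By \<open>gb_covers\<close> every abscissa is the image of another one in some preceding
  rectangle, so a past can be chosen letter by letter.\<close>

lemma exists_past:
  assumes k: "k \<in> {1..n}" and x: "0 \<le> x" "x \<le> 1"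
  obtains b where "b 0 = k" "\<And>m. step (b (Suc m)) (b m)" "x \<in> limit_points Gb b"
proof -
  have "\<exists>g. \<forall>m. (fst (g m) \<in> {1..n} \<and> 0 \<le> snd (g m) \<and> snd (g m) \<le> 1 \<and> (m = 0 \<longrightarrow> g m = (k, x))) \<and>
    (step (fst (g (Suc m))) (fst (g m)) \<and> snd (g m) = Gb (fst (g m)) (fst (g (Suc m))) (snd (g (Suc m))))"
  proof (rule dependent_nat_choice)
    show "\<exists>p. fst p \<in> {1..n} \<and> 0 \<le> snd p \<and> snd p \<le> 1 \<and> (0 = (0::nat) \<longrightarrow> p = (k, x))" using k x by (intro exI[of _ "(k, x)"]) simp
    fix p :: "nat \<times> real" and m :: nat
    assume p: "fst p \<in> {1..n} \<and> 0 \<le> snd p \<and> snd p \<le> 1 \<and> (m = 0 \<longrightarrow> p = (k, x))"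
    then obtain i j where i: "i \<in> {1..n}" "j \<in> {1..deg D i}" "tgt D i j = fst p" "snd p \<in> gb i j ` {0..1}"
      using gb_covers[of "fst p" "snd p"] by blast
    then obtain t where t: "0 \<le> t" "t \<le> 1" "snd p = gb i j t" by auto
    have st: "step i (fst p)" by (rule stepI[OF i(1-3)])
    have "branch D i (fst p) = j" using tgt_unique[OF i(1) stepD(3)[OF st] i(2)] stepD(4)[OF st] i(3) by simp
    then show "\<exists>q. (fst q \<in> {1..n} \<and> 0 \<le> snd q \<and> snd q \<le> 1 \<and> (Suc m = 0 \<longrightarrow> q = (k, x))) \<and>
      (step (fst q) (fst p) \<and> snd p = Gb (fst p) (fst q) (snd q))"
      using st i(1) t by (intro exI[of _ "(i, t)"]) simp
  qed
  then obtain g :: "nat \<Rightarrow> nat \<times> real" where g: "\<And>m. 0 \<le> snd (g m) \<and> snd (g m) \<le> 1" "g 0 = (k, x)"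
    "\<And>m. step (fst (g (Suc m))) (fst (g m))" "\<And>m. snd (g m) = Gb (fst (g m)) (fst (g (Suc m))) (snd (g (Suc m)))" by blast
  have "x = itin Gb (\<lambda>m. fst (g m)) N (snd (g N))" for N
  proof (induction N)
    case 0
    show ?case using g(2) by simp
  next
    case (Suc N)
    show ?case unfolding itin_Suc_right g(4)[of N, symmetric] by (rule Suc)
  qed
  then have "x \<in> limit_points Gb (\<lambda>m. fst (g m))" unfolding limit_points_def using g(1) by (auto intro!: image_eqI)
  then show thesis using that[of "\<lambda>m. fst (g m)"] g(2,3) by simp
qed

abbreviation line :: "nat \<Rightarrow> real \<Rightarrow> 'a set" where "line i y \<equiv> (\<lambda>x. \<rho> i x y) ` {0..1}"
abbreviation tail :: "(int \<Rightarrow> nat) \<Rightarrow> nat \<Rightarrow> nat \<Rightarrow> nat" where "tail w t \<equiv> \<lambda>m. w (int (t + m))"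

lemma code_tail: "w \<in> subshift T \<Longrightarrow> code (tail w t)"
  using code_add[OF code_fut] by simp

text \<open>The prescribed future fixes the height, and by \<open>exists_past\<close> every abscissa
  is realized by some past; so the arc is a full line.\<close>

lemma code_arc_eq:
  assumes w: "w \<in> subshift T"
  shows "code_arc X f r T t w = line (w (int t)) (height (tail w t))"
proof (intro set_eqI iffI)
  fix q assume "q \<in> code_arc X f r T t w"
  then obtain v where v: "v \<in> subshift T" "\<And>m::nat. v (int m) = w (int t + int m)" "q = \<pi> v" unfolding code_arc_def by blast
  have "fut v = tail w t" using v(2) by auto
  moreover have "v 0 = w (int t)" using v(2)[of 0] by simp
  ultimately have "q = \<rho> (w (int t)) (xpos (pst v)) (height (tail w t))" unfolding v(3) projection_eq[OF v(1)] by simp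
  then show "q \<in> line (w (int t)) (height (tail w t))" using xpos_range[OF v(1)] by auto
next
  fix q assume "q \<in> line (w (int t)) (height (tail w t))"
  then obtain x where x: "0 \<le> x" "x \<le> 1" "q = \<rho> (w (int t)) x (height (tail w t))" by auto
  have k: "w (int t) \<in> {1..n}" using stepD(1)[OF subshift_step[OF w]] .
  obtain b where b: "b 0 = w (int t)" "\<And>m. step (b (Suc m)) (b m)" "x \<in> limit_points Gb b" by (rule exists_past[OF k x(1,2)]) blast
  \<comment> \<open>The chosen past is glued to the shifted future of \<open>w\<close>; both have
    the letter \<open>w (int t)\<close> at time 0.\<close>
  define v where "v z = (if 0 \<le> z then w (int t + z) else b (nat (- z)))" for z
  have v: "v \<in> subshift T" unfolding subshift_iff
  proof
    fix z :: int
    have "0 \<le> z \<or> z = -1 \<or> z < -1" by arith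
    then consider "0 \<le> z" | "z = -1" | "z < -1" by blast
    then show "step (v z) (v (z + 1))"
    proof cases
      case 1
      then show ?thesis using subshift_step[OF w, of "int t + z"] unfolding v_def by (simp add: add.assoc)
    next
      case 2
      then show ?thesis using b(2)[of 0] b(1) unfolding v_def by simp
    next
      case 3
      define m where "m = nat (- (z + 1))"
      have "nat (- z) = Suc m" "nat (- (z + 1)) = m" using 3 unfolding m_def by simp_all
      then show ?thesis using b(2)[of m] 3 unfolding v_def by simp
    qed
  qed
  have fv: "fut v = tail w t" unfolding v_def by auto
  have pv: "pst v = b" unfolding v_def using b(1) by auto
  have "xpos (pst v) = x" using limit_xpos[of b, OF b(2)] b(3) unfolding pv by simp
  then have "q = \<pi> v" unfolding projection_eq[OF v] fv x(3) unfolding v_def by simp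
  moreover have "v (int m) = w (int t + int m)" for m unfolding v_def by simp
  ultimately show "q \<in> code_arc X f r T t w" unfolding code_arc_def using v by blast
qed

text \<open>A point may have several codes, so periodicity of \<open>q\<close> says nothing directly
  about its code \<open>v\<close>. But \<open>q\<close> is also fixed by \<open>K\<close> iterates
  for a common multiple \<open>K\<close> of both periods with \<open>N \<le> K\<close>, and shifting
  \<open>v\<close> by \<open>K\<close> brings its known future into the whole window from
  \<open>- N\<close> to \<open>N\<close>. Hence \<open>q\<close> lies in every closed cylinder of
  the periodic code.\<close>

lemma periodic_in_arc:
  assumes w: "w \<in> subshift T" "(shift ^^ P) w = w" "0 < P" and q: "q \<in> code_arc X f r T t w" "(f ^^ p) q = q" "0 < p"
  shows "q = \<pi> ((shift ^^ t) w)"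
proof (rule projection_unique[OF subshift_shift[OF w(1)]])
  fix N
  obtain v where v: "v \<in> subshift T" "\<And>m::nat. v (int m) = w (int t + int m)" "q = \<pi> v" using q(1) unfolding code_arc_def by blast
  define K where "K = p * (P * N)"
  have "(f ^^ (p * M)) q = q" for M by (induction M) (simp_all add: funpow_add q(2))
  then have qK: "q = \<pi> ((shift ^^ K) v)" using funpow_projection[OF v(1), of K] unfolding K_def v(3) by simp
  have "(shift ^^ (P * M)) w = w" for M by (induction M) (simp_all add: funpow_add w(2))
  then have "(shift ^^ K) w = w" unfolding K_def by (metis mult.left_commute)
  then have per: "w (z + int K) = w z" for z using shift_funpow[of K w z] by simp
  have N: "N \<le> K" unfolding K_def using w(3) q(3) by simp
  have "cylinder N ((shift ^^ K) v) = cylinder N ((shift ^^ t) w)"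
  proof (rule cylinder_cong)
    fix z assume z: "- int N \<le> z" "z \<le> int N"
    have "v (z + int K) = w (int t + (z + int K))" using v(2)[of "nat (z + int K)"] z N by simp
    also have "\<dots> = w (z + int t + int K)" by (simp add: algebra_simps)
    also have "\<dots> = w (z + int t)" by (rule per)
    finally show "(shift ^^ K) v z = (shift ^^ t) w z" unfolding shift_funpow .
  qed
  then show "q \<in> closure (cylinder N ((shift ^^ t) w))"
    using projection_in[OF subshift_shift[OF v(1), of K], of N] qK by simp
qed

lemma projection_in_arc:
  assumes "w \<in> subshift T" shows "\<pi> ((shift ^^ t) w) \<in> code_arc X f r T t w"
  unfolding code_arc_def
  by (rule imageI, rule CollectI, intro conjI allI, rule subshift_shift[OF assms], simp add: shift_funpow add.commute)

end

lemma rectangle_connected: "rectangle X q \<Longrightarrow> connected (rect_interior q) \<and> rect_interior q \<noteq> {}"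
  unfolding rectangle_def trivially_bifoliated_def by blast

lemma components_connected: "connected C \<Longrightarrow> C \<noteq> {} \<Longrightarrow> components C = {C}"
  by (simp add: components_eq_sing_iff)

subsection \<open>Lexicographic numbering\<close>

lemma nth_map_upt1:
  assumes "h \<in> {1..k}" shows "map F [1..<Suc k] ! (h - 1) = F h"
proof -
  have h: "1 \<le> h" "h \<le> k" using assms by simp_all
  have "h - 1 < k" "1 + (h - 1) < Suc k" "1 + (h - 1) = h" using h by arith+
  then have lt: "h - 1 < length [1..<Suc k]" and "[1..<Suc k] ! (h - 1) = h" using nth_upt[of 1 "h - 1" "Suc k"] by simp_all
  then show ?thesis unfolding nth_map[OF lt] by simp
qed

lemma block_list_Suc: "block_list H (Suc n) = block_list H n @ map (\<lambda>h. (Suc n, h)) [1..<Suc (H (Suc n))]"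
proof -
  have "[1..<Suc (Suc n)] = [1..<Suc n] @ [Suc n]" by (rule upt_Suc_append) simp
  then show ?thesis unfolding block_list_def by simp
qed

lemma length_block_list: "length (block_list H n) = (\<Sum>i\<in>{1..n}. H i)"
proof (induction n)
  case 0
  show ?case by (simp add: block_list_def)
next
  case (Suc n)
  then show ?case unfolding block_list_Suc by simp
qed

lemma lex_index_Suc: "lex_index H (Suc n) h = (\<Sum>i\<in>{1..n}. H i) + h"
  unfolding lex_index_def atLeastLessThanSuc_atLeastAtMost ..

lemma nth_block_list:
  "i \<in> {1..n} \<Longrightarrow> h \<in> {1..H i} \<Longrightarrow>
    lex_index H i h \<in> {1..\<Sum>i\<in>{1..n}. H i} \<and> block_list H n ! (lex_index H i h - 1) = (i, h)"
proof (induction n)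
  case (Suc n)
  show ?case
  proof (cases "i = Suc n")
    case True
    have h: "h \<in> {1..H (Suc n)}" using Suc.prems True by simp
    have e: "lex_index H (Suc n) h - 1 = length (block_list H n) + (h - 1)"
      unfolding lex_index_Suc length_block_list using h by simp
    have "map (\<lambda>h. (Suc n, h)) [1..<Suc (H (Suc n))] ! (h - 1) = (Suc n, h)" by (rule nth_map_upt1[OF h])
    then have "block_list H (Suc n) ! (lex_index H (Suc n) h - 1) = (Suc n, h)"
      unfolding block_list_Suc e nth_append_length_plus .
    moreover have "lex_index H (Suc n) h \<in> {1..\<Sum>i\<in>{1..Suc n}. H i}" using h unfolding lex_index_Suc by simp
    ultimately show ?thesis unfolding True by blast
  next
    case False
    then have i: "i \<in> {1..n}" using Suc.prems by simp
    note IH = Suc.IH[OF i Suc.prems(2)]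
    then have b: "1 \<le> lex_index H i h" "lex_index H i h \<le> (\<Sum>i\<in>{1..n}. H i)" by simp_all
    have "lex_index H i h - 1 < length (block_list H n)" unfolding length_block_list using b by arith
    then show ?thesis using IH unfolding block_list_Suc nth_append by simp
  qed
qed simp

lemma lex_index_cases:
  assumes "a \<in> {1..\<Sum>i\<in>{1..n}. H i}"
  obtains i h where "i \<in> {1..n}" "h \<in> {1..H i}" "a = lex_index H i h"
proof -
  have "a \<in> {1..\<Sum>i\<in>{1..n}. H i} \<Longrightarrow> \<exists>i\<in>{1..n}. \<exists>h\<in>{1..H i}. a = lex_index H i h" for a
  proof (induction n)
    case (Suc n)
    show ?case
    proof (cases "a \<le> (\<Sum>i\<in>{1..n}. H i)")
      case True
      then have "a \<in> {1..\<Sum>i\<in>{1..n}. H i}" using Suc.prems by simp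
      then obtain i h where "i \<in> {1..n}" "h \<in> {1..H i}" "a = lex_index H i h" using Suc.IH by blast
      then show ?thesis by (intro bexI[of _ i] bexI[of _ h]) simp_all
    next
      case False
      define h where "h = a - (\<Sum>i\<in>{1..n}. H i)"
      have "(\<Sum>i\<in>{1..Suc n}. H i) = (\<Sum>i\<in>{1..n}. H i) + H (Suc n)" by simp
      then have "a \<le> (\<Sum>i\<in>{1..n}. H i) + H (Suc n)" using Suc.prems by (simp only: atLeastAtMost_iff)
      then have h: "1 \<le> h" "h \<le> H (Suc n)" and a: "a = (\<Sum>i\<in>{1..n}. H i) + h" using False unfolding h_def by arith+
      have "h \<in> {1..H (Suc n)}" "Suc n \<in> {1..Suc n}" "a = lex_index H (Suc n) h" unfolding lex_index_Suc using h a by simp_all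
      then show ?thesis by blast
    qed
  qed simp
  from this[OF assms] show thesis using that by blast
qed

lemma sorted_wrt_concat_map:
  "(\<And>j. j \<in> set js \<Longrightarrow> sorted_wrt R (G j)) \<Longrightarrow> sorted_wrt (\<lambda>j j'. \<forall>p\<in>set (G j). \<forall>q\<in>set (G j'). R p q) js \<Longrightarrow>
    sorted_wrt R (concat (map G js))"
  by (induction js) (auto simp: sorted_wrt_append)

lemma bij_betw_numbering:
  assumes ord: "\<And>a b. a \<in> {1..m} \<Longrightarrow> b \<in> {1..m} \<Longrightarrow> a < b \<Longrightarrow> L (F a) (F b)"
    and irr: "\<And>a. a \<in> {1..m} \<Longrightarrow> \<not> L (F a) (F a)" and im: "F ` {1..m::nat} = A"
  shows "bij_betw F {1..m} A"
proof -
  have "inj_on F {1..m}"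
  proof (rule inj_onI)
    fix a b assume a: "a \<in> {1..m}" and b: "b \<in> {1..m}" and e: "F a = F b"
    have "\<not> a < b" using ord[OF a b] irr[OF b] e by auto
    moreover have "\<not> b < a" using ord[OF b a] irr[OF a] e by auto
    ultimately show "a = b" by simp
  qed
  then show ?thesis using im unfolding bij_betw_def by blast
qed

subsection \<open>Geometric types as tables\<close>

definition type_of_rows :: "type_rows \<Rightarrow> geometric_type"
  where "type_of_rows R = Geometric_Type (length R) (\<lambda>i. length (snd (R ! (i - 1)))) (\<lambda>i. fst (R ! (i - 1)))
    (\<lambda>(i, j). fst (snd (R ! (i - 1)) ! (j - 1))) (\<lambda>(i, j). if snd (snd (R ! (i - 1)) ! (j - 1)) = 1 then 1 else - 1)"

lemma map_nth_pred: "map (\<lambda>i. F (xs ! (i - 1))) [1..<Suc (length xs)] = map F xs"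
  by (rule nth_equalityI) simp_all

text \<open>\<open>encode_type\<close> remembers of a sign only whether it is 1, hence the
  restriction of the table entries to 0 and 1.\<close>

lemma encode_type_of_rows:
  assumes "\<And>v es e. (v, es) \<in> set R \<Longrightarrow> e \<in> set es \<Longrightarrow> snd e \<in> {0, 1}"
  shows "encode_type (type_of_rows R) = enc R"
proof -
  let ?E = "\<lambda>e :: (nat \<times> nat) \<times> nat. prod_encode (prod_encode (fst e), if (if snd e = 1 then 1 else - 1 :: int) = 1 then 1 else 0)"
  let ?G = "\<lambda>p :: nat \<times> ((nat \<times> nat) \<times> nat) list. prod_encode (fst p, list_encode (map ?E (snd p)))"
  have "encode_type (type_of_rows R) = list_encode (map (\<lambda>i. prod_encode (fst (R ! (i - 1)),
      list_encode (map (\<lambda>j. ?E (snd (R ! (i - 1)) ! (j - 1))) [1..<Suc (length (snd (R ! (i - 1))))]))) [1..<Suc (length R)])"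
    unfolding encode_type_def type_of_rows_def by simp
  also have "\<dots> = list_encode (map (\<lambda>i. ?G (R ! (i - 1))) [1..<Suc (length R)])"
    unfolding map_nth_pred[of ?E] ..
  also have "\<dots> = list_encode (map ?G R)" unfolding map_nth_pred[of ?G] ..
  also have "map ?G R = map enc R"
  proof (rule map_cong[OF refl])
    fix p assume p: "p \<in> set R"
    have "map ?E (snd p) = map enc (snd p)"
    proof (rule map_cong[OF refl])
      fix e assume "e \<in> set (snd p)"
      then have "snd e = 0 \<or> snd e = 1" using assms[of "fst p" "snd p" e] p by simp
      then show "?E e = enc e" by (cases e) (auto simp: enc_prod_def enc_nat_def)
    qed
    then show "?G p = enc p" by (simp only: enc_prod_def enc_list_def enc_nat_def)
  qed
  finally show ?thesis unfolding enc_list_def .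
qed

lemma encode_type_table: "encode_type T = enc (type_table T)"
  unfolding encode_type_def type_table_def enc_list_def by (simp add: comp_def enc_prod_def enc_list_def enc_nat_def)

section \<open>The refinement along periodic stable arcs\<close>

locale refined_markov = markov +
  fixes W :: "(int \<Rightarrow> nat) set"
  assumes finite_W: "finite W" and W_sub: "w \<in> W \<Longrightarrow> w \<in> subshift T" and W_per: "w \<in> W \<Longrightarrow> periodic_code w"
begin

definition tails :: "(nat \<Rightarrow> nat) set"
  where "tails = {tail w t | w t. w \<in> W}"

text \<open>Futures of a periodic code repeat, so times below a period suffice.\<close>

lemma finite_range_tail:
  assumes "w \<in> W" shows "finite (range (tail w))"
proof -
  obtain P where P: "0 < P" "(shift ^^ P) w = w" using W_per[OF assms] unfolding periodic_code_def by blast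
  have per: "w (z + int (P * k)) = w z" for z k
  proof (induction k)
    case (Suc k)
    have "w (z + int (P * Suc k)) = w (z + int (P * k) + int P)" by (simp add: algebra_simps)
    also have "\<dots> = w (z + int (P * k))" using shift_funpow[of P w "z + int (P * k)"] P(2) by simp
    finally show ?case using Suc by simp
  qed simp
  have "tail w t = tail w (t mod P)" for t
  proof
    fix m
    have "int (t + m) = int (t mod P + m) + int (P * (t div P))" unfolding of_nat_add[symmetric] by simp
    then show "w (int (t + m)) = w (int (t mod P + m))" using per by metis
  qed
  then have "range (tail w) \<subseteq> tail w ` {..<P}" using P(1) by (metis image_subsetI imageI lessThan_iff mod_less_divisor)
  then show ?thesis by (rule finite_subset) simp
qed

sublocale cut_dynamics D hb tails
proof
  have "tails = (\<Union>w\<in>W. range (tail w))" unfolding tails_def by blast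
  then show "finite tails" using finite_W finite_range_tail by simp
next
  fix u assume "u \<in> tails"
  then obtain w t where w: "w \<in> W" "u = tail w t" unfolding tails_def by blast
  show "code u" unfolding w(2) by (rule code_tail[OF W_sub[OF w(1)]])
  have "(\<lambda>m. u (Suc m)) = tail w (Suc t)" unfolding w(2) by simp
  then show "(\<lambda>m. u (Suc m)) \<in> tails" unfolding tails_def using w(1) by blast
qed

lemma len_D: "length D = n" by (simp add: gt_n)

lemmas fine_Ioo = fine_image_Ioo[unfolded len_D] and fine_less = fine_bottom_less_top[unfolded len_D]
  and fine_rng = fine_range[unfolded len_D] and fine_lev = fine_levels[unfolded len_D]
  and index_range = piece_index_range[unfolded len_D] and fine_piece = fine_in_piece[unfolded len_D]

definition piece :: "nat \<Rightarrow> nat \<Rightarrow> complex \<Rightarrow> 'a"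
  where "piece i h = subpar 0 1 (cut_level i (h - 1)) (cut_level i h) (r i)"

definition strip :: "nat \<Rightarrow> real \<Rightarrow> real \<Rightarrow> 'a set"
  where "strip i c d = {\<rho> i x y | x y. 0 < x \<and> x < 1 \<and> c < y \<and> y < d}"

abbreviation layer :: "nat \<Rightarrow> nat \<Rightarrow> 'a set"
  where "layer i h \<equiv> strip i (cut_level i (h - 1)) (cut_level i h)"

lemma stripI: "0 < x \<Longrightarrow> x < 1 \<Longrightarrow> c < y \<Longrightarrow> y < d \<Longrightarrow> \<rho> i x y \<in> strip i c d"
  unfolding strip_def by blast

lemma stripE:
  assumes "q \<in> strip i c d"
  obtains x y where "0 < x" "x < 1" "c < y" "y < d" "q = \<rho> i x y"
  using assms unfolding strip_def by blast

lemma strip_box: "i \<in> {1..n} \<Longrightarrow> strip i c d = product_rectangle.box_im (\<rho> i) 0 1 c d"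
  unfolding set_eq_iff strip_def mem_Collect_eq product_rectangle.box_im_iff[OF PR] by blast

lemma strip_rectangle:
  assumes "i \<in> {1..n}" "0 \<le> c" "c < d" "d \<le> 1"
  shows "rect_interior (subpar 0 1 c d (r i)) = strip i c d" "rectangle X (subpar 0 1 c d (r i))"
  using subpar_interior[OF rect_r[OF assms(1)] surface fol _ _ _ assms(2-4), of 0 1]
    subpar_rectangle[OF rect_r[OF assms(1)] surface fol _ _ _ assms(2-4), of 0 1] strip_box[OF assms(1)] by simp_all

lemma strip_plaque:
  assumes "i \<in> {1..n}" "0 \<le> c" "c < d" "d \<le> 1" "0 < x" "x < 1" "c < y" "y < d"
  shows "plaque_in (stab X) (strip i c d) (\<rho> i x y) = (\<lambda>t. \<rho> i t y) ` {0<..<1}"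
    "plaque_in (unst X) (strip i c d) (\<rho> i x y) = (\<lambda>t. \<rho> i x t) ` {c<..<d}"
  using plaque_stab_box[OF rect_r[OF assms(1)] surface fol _ _ _ assms(2-8)]
    plaque_unst_box[OF rect_r[OF assms(1)] surface fol _ _ _ assms(2-8)] strip_box[OF assms(1)] by simp_all

lemma strip_R0: "0 \<le> c \<Longrightarrow> d \<le> 1 \<Longrightarrow> strip i c d \<subseteq> R0 i"
proof
  fix q assume cd: "0 \<le> c" "d \<le> 1" and "q \<in> strip i c d"
  then obtain x y where "0 < x" "x < 1" "c < y" "y < d" "q = \<rho> i x y" by (elim stripE)
  then show "q \<in> R0 i" unfolding R0_iff using cd by (intro exI[of _ x] exI[of _ y]) simp
qed

lemma R0_strip: "R0 i = strip i 0 1"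
  unfolding set_eq_iff R0_iff strip_def by blast

lemma layer_levels:
  assumes "h \<in> {1..num_pieces i}"
  shows "0 \<le> cut_level i (h - 1)" "cut_level i (h - 1) < cut_level i h" "cut_level i h \<le> 1"
proof -
  have h: "1 \<le> h" "h \<le> num_pieces i" using assms by simp_all
  have "h - 1 \<le> num_pieces i" "h - 1 < h" using h by arith+
  then show "0 \<le> cut_level i (h - 1)" "cut_level i (h - 1) < cut_level i h" "cut_level i h \<le> 1"
    using cut_level_range[of "h - 1" i] cut_level_range[of h i] cut_level_strict[of "h - 1" h i] h(2) by blast+
qed

lemma layer_R0: "h \<in> {1..num_pieces i} \<Longrightarrow> layer i h \<subseteq> R0 i"
  by (rule strip_R0[OF layer_levels(1,3)])

lemma piece_interior: "i \<in> {1..n} \<Longrightarrow> h \<in> {1..num_pieces i} \<Longrightarrow> rect_interior (piece i h) = layer i h"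
  and piece_rectangle: "i \<in> {1..n} \<Longrightarrow> h \<in> {1..num_pieces i} \<Longrightarrow> rectangle X (piece i h)"
  unfolding piece_def using strip_rectangle[OF _ layer_levels] by blast+

lemma layer_disjoint:
  assumes i: "i \<in> {1..n}" "h \<in> {1..num_pieces i}" and k: "k \<in> {1..n}" "g \<in> {1..num_pieces k}"
    and q: "q \<in> layer i h" "q \<in> layer k g"
  shows "i = k \<and> h = g"
proof -
  have ik: "i = k" by (rule R0_disjoint[OF i(1) k(1)]) (use layer_R0 i(2) k(2) q in blast)+
  obtain x y where x: "0 < x" "x < 1" "cut_level i (h - 1) < y" "y < cut_level i h" "q = \<rho> i x y" using q(1) by (rule stripE)
  obtain x' y' where x': "0 < x'" "x' < 1" "cut_level i (g - 1) < y'" "y' < cut_level i g" "q = \<rho> i x' y'"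
    using q(2) unfolding ik by (rule stripE)
  have g: "g \<in> {1..num_pieces i}" using k ik by simp
  have "0 < y" "y < 1" "0 < y'" "y' < 1" using x(3,4) x'(3,4) layer_levels[OF i(2)] layer_levels[OF g] by simp_all
  then have "y = y'" using \<rho>_inj[OF i(1) x(1,2) _ _ x'(1,2)] x(5) x'(5) by simp
  then have "cut_level i (h - 1) < cut_level i g" "cut_level i (g - 1) < cut_level i h" using x(3,4) x'(3,4) by simp_all
  moreover have hg: "1 \<le> h" "1 \<le> g" "h \<le> num_pieces i" "g \<le> num_pieces i" using i(2) g by simp_all
  moreover have "h - 1 \<le> num_pieces i" "g - 1 \<le> num_pieces i" using hg by arith+
  ultimately have "h - 1 < g" "g - 1 < h" using cut_level_less_iff[of "h - 1" i g] cut_level_less_iff[of "g - 1" i h] by blast+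
  then have "h = g" using hg by arith
  then show ?thesis using ik by blast
qed

lemma layer_coords:
  assumes i: "i \<in> {1..n}" "h \<in> {1..num_pieces i}" and q: "0 < x" "x < 1" "cut_level i (h - 1) < y" "y < cut_level i h"
  shows "vertical_coord (piece i h) (\<rho> i x y) = (y - cut_level i (h - 1)) / (cut_level i h - cut_level i (h - 1))"
    "horizontal_coord (piece i h) (\<rho> i x y) = x" "vertical_coord (r i) (\<rho> i x y) = y" "horizontal_coord (r i) (\<rho> i x y) = x"
proof -
  let ?c = "cut_level i (h - 1)" and ?d = "cut_level i h"
  let ?t = "(y - ?c) / (?d - ?c)"
  have t: "0 < ?t" "?t < 1" using q by simp_all
  have "piece i h (Complex x ?t) = \<rho> i x y" using q unfolding piece_def subpar_def by simp
  then show "vertical_coord (piece i h) (\<rho> i x y) = ?t" "horizontal_coord (piece i h) (\<rho> i x y) = x"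
    using rectangle_coords[OF piece_rectangle[OF i] q(1,2) t] by simp_all
  have "0 < y" "y < 1" using q layer_levels[OF i(2)] by simp_all
  then show "vertical_coord (r i) (\<rho> i x y) = y" "horizontal_coord (r i) (\<rho> i x y) = x"
    using coords[OF i(1) q(1,2)] by simp_all
qed

lemma layer_order:
  assumes i: "i \<in> {1..n}" "h \<in> {1..num_pieces i}" and q: "p \<in> layer i h" "q \<in> layer i h"
  shows "vertical_coord (piece i h) p < vertical_coord (piece i h) q \<longleftrightarrow> vertical_coord (r i) p < vertical_coord (r i) q"
    "horizontal_coord (piece i h) p = horizontal_coord (r i) p"
proof -
  obtain x y where x: "0 < x" "x < 1" "cut_level i (h - 1) < y" "y < cut_level i h" "p = \<rho> i x y" using q(1) by (rule stripE)
  obtain x' y' where x': "0 < x'" "x' < 1" "cut_level i (h - 1) < y'" "y' < cut_level i h" "q = \<rho> i x' y'" using q(2) by (rule stripE)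
  show "vertical_coord (piece i h) p < vertical_coord (piece i h) q \<longleftrightarrow> vertical_coord (r i) p < vertical_coord (r i) q"
    unfolding x(5) x'(5) layer_coords[OF i x(1-4)] layer_coords[OF i x'(1-4)] using layer_levels(2)[OF i(2)]
    by (simp add: divide_less_cancel)
  show "horizontal_coord (piece i h) p = horizontal_coord (r i) p"
    unfolding x(5) layer_coords[OF i x(1-4)] ..
qed

text \<open>The part of \<open>H i j\<close> that \<open>f\<close> maps into piece \<open>g\<close>
  of the target. These sets become the horizontal sub-rectangles of the refinement, and their images
  \<open>fine_image\<close> become its vertical ones.\<close>

definition sliver :: "nat \<Rightarrow> nat \<Rightarrow> nat \<Rightarrow> 'a set"
  where "sliver i j g = strip i (fine_bottom i j g) (fine_top i j g)"

definition fine_image :: "nat \<Rightarrow> nat \<Rightarrow> nat \<Rightarrow> 'a set"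
  where "fine_image i j g = {\<rho> (tgt D i j) (gb i j x) y | x y. 0 < x \<and> x < 1 \<and> cut_level (tgt D i j) (g - 1) < y \<and> y < cut_level (tgt D i j) g}"

context
  fixes i j g
  assumes i: "i \<in> {1..n}" and j: "j \<in> {1..deg D i}" and g: "g \<in> {1..num_pieces (tgt D i j)}"
begin

lemma sliver_eq:
  "sliver i j g = {\<rho> i x (hb i j y) | x y. 0 < x \<and> x < 1 \<and> cut_level (tgt D i j) (g - 1) < y \<and> y < cut_level (tgt D i j) g}"
proof -
  have im: "t \<in> {fine_bottom i j g<..<fine_top i j g} \<longleftrightarrow> (\<exists>y. cut_level (tgt D i j) (g - 1) < y \<and> y < cut_level (tgt D i j) g \<and> t = hb i j y)" for t
    unfolding fine_Ioo[OF i j g, symmetric] image_iff Bex_def greaterThanLessThan_iff by blast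
  show ?thesis
  proof (intro set_eqI iffI)
    fix q assume "q \<in> sliver i j g"
    then obtain x t where x: "0 < x" "x < 1" "fine_bottom i j g < t" "t < fine_top i j g" "q = \<rho> i x t" unfolding sliver_def by (rule stripE)
    then obtain y where "cut_level (tgt D i j) (g - 1) < y" "y < cut_level (tgt D i j) g" "t = hb i j y" using im[of t] by auto
    then show "q \<in> {\<rho> i x (hb i j y) | x y. 0 < x \<and> x < 1 \<and> cut_level (tgt D i j) (g - 1) < y \<and> y < cut_level (tgt D i j) g}" using x by blast
  next
    fix q assume "q \<in> {\<rho> i x (hb i j y) | x y. 0 < x \<and> x < 1 \<and> cut_level (tgt D i j) (g - 1) < y \<and> y < cut_level (tgt D i j) g}"
    then obtain x y where x: "0 < x" "x < 1" "cut_level (tgt D i j) (g - 1) < y" "y < cut_level (tgt D i j) g" "q = \<rho> i x (hb i j y)" by blast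
    then have "hb i j y \<in> {fine_bottom i j g<..<fine_top i j g}" using im[of "hb i j y"] by blast
    then show "q \<in> sliver i j g" unfolding sliver_def x(5) using stripI[OF x(1,2)] by simp
  qed
qed

lemma sliver_nonempty: "sliver i j g \<noteq> {}"
  unfolding sliver_def using strip_rectangle[OF i fine_rng(1)[OF i j g] fine_less[OF i j g] fine_rng(2)[OF i j g]]
    rectangle_connected by metis

lemma sliver_connected: "connected (sliver i j g)"
  unfolding sliver_def using strip_rectangle[OF i fine_rng(1)[OF i j g] fine_less[OF i j g] fine_rng(2)[OF i j g]]
    rectangle_connected by metis

lemma f_line: "0 < x \<Longrightarrow> x < 1 \<Longrightarrow> cut_level (tgt D i j) (g - 1) < y \<Longrightarrow> y < cut_level (tgt D i j) g \<Longrightarrow>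
    f (\<rho> i x (hb i j y)) = \<rho> (tgt D i j) (gb i j x) y"
  using charts(5)[OF i j, of x y] fine_lev[OF i j g] by simp

lemma f_sliver: "f ` sliver i j g = fine_image i j g"
proof (intro set_eqI iffI)
  fix q assume "q \<in> f ` sliver i j g"
  then obtain x y where "0 < x" "x < 1" "cut_level (tgt D i j) (g - 1) < y" "y < cut_level (tgt D i j) g" "q = f (\<rho> i x (hb i j y))"
    unfolding sliver_eq by blast
  then show "q \<in> fine_image i j g" unfolding fine_image_def using f_line by blast
next
  fix q assume "q \<in> fine_image i j g"
  then obtain x y where xy: "0 < x" "x < 1" "cut_level (tgt D i j) (g - 1) < y" "y < cut_level (tgt D i j) g" "q = \<rho> (tgt D i j) (gb i j x) y"
    unfolding fine_image_def by blast
  then have "q = f (\<rho> i x (hb i j y))" using f_line by simp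
  moreover have "\<rho> i x (hb i j y) \<in> sliver i j g" unfolding sliver_eq using xy(1-4) by blast
  ultimately show "q \<in> f ` sliver i j g" by blast
qed

lemma sliver_sub: "sliver i j g \<subseteq> layer i (piece_index i j g)"
proof
  fix q assume "q \<in> sliver i j g"
  then obtain x y where "0 < x" "x < 1" "fine_bottom i j g < y" "y < fine_top i j g" "q = \<rho> i x y" unfolding sliver_def by (rule stripE)
  then show "q \<in> layer i (piece_index i j g)" using fine_piece[OF i j g] by (simp add: stripI)
qed

lemma fine_image_sub: "fine_image i j g \<subseteq> layer (tgt D i j) g"
  unfolding fine_image_def strip_def using gb_open[OF i j] by blast

lemma fine_image_box:
  obtains a b where "0 \<le> a" "a < b" "b \<le> 1"
    "fine_image i j g = product_rectangle.box_im (\<rho> (tgt D i j)) a b (cut_level (tgt D i j) (g - 1)) (cut_level (tgt D i j) g)"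
    "gb i j ` {0<..<1} = {a<..<b}"
proof -
  obtain e where "seg e (gb i j)" using charts(2)[OF i j] ..
  then obtain a b where ab: "0 \<le> a" "a < b" "b \<le> 1" "gb i j ` {0..1} = {a..b}" "gb i j ` {0<..<1} = {a<..<b}"
    by (rule seg_interval)
  have im: "t \<in> {a<..<b} \<longleftrightarrow> (\<exists>x. 0 < x \<and> x < 1 \<and> t = gb i j x)" for t
    unfolding ab(5)[symmetric] image_iff Bex_def greaterThanLessThan_iff by blast
  have "fine_image i j g = product_rectangle.box_im (\<rho> (tgt D i j)) a b (cut_level (tgt D i j) (g - 1)) (cut_level (tgt D i j) g)"
  proof (intro set_eqI iffI)
    fix q assume "q \<in> fine_image i j g"
    then obtain x y where x: "0 < x" "x < 1" "cut_level (tgt D i j) (g - 1) < y" "y < cut_level (tgt D i j) g" "q = \<rho> (tgt D i j) (gb i j x) y"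
      unfolding fine_image_def by blast
    have "gb i j x \<in> {a<..<b}" using im x(1,2) by blast
    then show "q \<in> product_rectangle.box_im (\<rho> (tgt D i j)) a b (cut_level (tgt D i j) (g - 1)) (cut_level (tgt D i j) g)"
      unfolding x(5) using product_rectangle.box_imI[OF PR[OF transition(2)[OF i j]]] x(3,4) by simp
  next
    fix q assume "q \<in> product_rectangle.box_im (\<rho> (tgt D i j)) a b (cut_level (tgt D i j) (g - 1)) (cut_level (tgt D i j) g)"
    then obtain t y where t: "a < t" "t < b" "cut_level (tgt D i j) (g - 1) < y" "y < cut_level (tgt D i j) g" "q = \<rho> (tgt D i j) t y"
      unfolding product_rectangle.box_im_iff[OF PR[OF transition(2)[OF i j]]] by blast
    then obtain x where "0 < x" "x < 1" "t = gb i j x" using im[of t] by auto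
    then show "q \<in> fine_image i j g" unfolding fine_image_def using t(3-5) by blast
  qed
  then show thesis using that ab by blast
qed

lemma fine_image_connected: "connected (fine_image i j g)" "fine_image i j g \<noteq> {}"
proof -
  have "sliver i j g \<subseteq> S" using sliver_sub layer_R0[OF index_range[OF i j g]] R0_S[OF i] by blast
  then show "connected (fine_image i j g)" unfolding f_sliver[symmetric]
    by (intro connected_continuous_image sliver_connected continuous_on_subset[OF f_homeo(1)])
  show "fine_image i j g \<noteq> {}" unfolding f_sliver[symmetric] using sliver_nonempty by simp
qed

lemma fine_subrectangle: "horizontal_subrectangle X (piece i (piece_index i j g)) (sliver i j g)"
proof -
  note h = index_range[OF i j g] and st = fine_rng(1)[OF i j g] fine_less[OF i j g] fine_rng(2)[OF i j g]
  show ?thesis unfolding horizontal_subrectangle_def piece_interior[OF i h]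
  proof (intro conjI ballI)
    show "\<exists>r'. rectangle X r' \<and> rect_interior r' = sliver i j g" unfolding sliver_def using strip_rectangle[OF i st] by blast
    show "sliver i j g \<subseteq> layer i (piece_index i j g)" by (rule sliver_sub)
    fix q assume "q \<in> sliver i j g"
    then obtain x y where q: "0 < x" "x < 1" "fine_bottom i j g < y" "y < fine_top i j g" "q = \<rho> i x y" unfolding sliver_def by (rule stripE)
    have y: "cut_level i (piece_index i j g - 1) < y" "y < cut_level i (piece_index i j g)" using q fine_piece[OF i j g] by simp_all
    show "plaque_in (stab X) (sliver i j g) q = plaque_in (stab X) (layer i (piece_index i j g)) q"
      unfolding sliver_def q(5) strip_plaque(1)[OF i st q(1-4)] strip_plaque(1)[OF i layer_levels[OF h] q(1,2) y] ..
  qed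
qed

text \<open>The image reaches from the bottom to the top of the target piece, because the sliver was
  cut out by the two levels that bound this piece.\<close>

lemma fine_image_subrectangle: "vertical_subrectangle X (piece (tgt D i j) g) (fine_image i j g)"
proof -
  let ?k = "tgt D i j" let ?c = "cut_level ?k (g - 1)" and ?d = "cut_level ?k g"
  note k = transition(2)[OF i j] and lev = layer_levels[OF g]
  obtain a b where ab: "0 \<le> a" "a < b" "b \<le> 1" "fine_image i j g = product_rectangle.box_im (\<rho> ?k) a b ?c ?d"
    by (rule fine_image_box)
  show ?thesis unfolding vertical_subrectangle_def piece_interior[OF k g]
  proof (intro conjI ballI)
    show "\<exists>r'. rectangle X r' \<and> rect_interior r' = fine_image i j g" unfolding ab(4)
      using subpar_interior[OF rect_r[OF k] surface fol ab(1-3) lev] subpar_rectangle[OF rect_r[OF k] surface fol ab(1-3) lev] by blast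
    show "fine_image i j g \<subseteq> layer ?k g" by (rule fine_image_sub)
    fix q assume "q \<in> fine_image i j g"
    then obtain x y where q: "a < x" "x < b" "?c < y" "y < ?d" "q = \<rho> ?k x y"
      unfolding ab(4) product_rectangle.box_im_iff[OF PR[OF k]] by blast
    have x: "0 < x" "x < 1" using q(1,2) ab(1,3) by simp_all
    show "plaque_in (unst X) (fine_image i j g) q = plaque_in (unst X) (layer ?k g) q"
      unfolding ab(4) q(5) plaque_unst_box[OF rect_r[OF k] surface fol ab(1-3) lev q(1-4)] strip_plaque(2)[OF k lev x q(3,4)] ..
  qed
qed

text \<open>The columns of a piece are the traces of the old columns, which is why the refined type
  keeps their number and labels.\<close>

lemma fine_image_V: "V (tgt D i j) (vpos D i j) \<inter> layer (tgt D i j) g = fine_image i j g"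
proof (intro set_eqI iffI)
  fix q assume "q \<in> V (tgt D i j) (vpos D i j) \<inter> layer (tgt D i j) g"
  then have qV: "q \<in> V (tgt D i j) (vpos D i j)" and qL: "q \<in> layer (tgt D i j) g" by blast+
  obtain x y where x: "0 < x" "x < 1" "0 < y" "y < 1" "q = \<rho> (tgt D i j) (gb i j x) y" using qV unfolding charts(4)[OF i j] by blast
  obtain x' y' where x': "0 < x'" "x' < 1" "cut_level (tgt D i j) (g - 1) < y'" "y' < cut_level (tgt D i j) g" "q = \<rho> (tgt D i j) x' y'"
    using qL by (rule stripE)
  have y': "0 < y'" "y' < 1" using x'(3,4) layer_levels[OF g] by simp_all
  have gx: "0 < gb i j x" "gb i j x < 1" using gb_open[OF i j x(1,2)] by simp_all
  have "\<rho> (tgt D i j) (gb i j x) y = \<rho> (tgt D i j) x' y'" using x(5) x'(5) by simp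
  then have "y = y'" using \<rho>_inj[OF transition(2)[OF i j] gx x(3,4) x'(1,2) y'] by blast
  then show "q \<in> fine_image i j g" unfolding fine_image_def using x x'(3,4) by blast
next
  fix q assume q: "q \<in> fine_image i j g"
  then obtain x y where x: "0 < x" "x < 1" "cut_level (tgt D i j) (g - 1) < y" "y < cut_level (tgt D i j) g" "q = \<rho> (tgt D i j) (gb i j x) y"
    unfolding fine_image_def by blast
  have "0 < y" "y < 1" using x(3,4) layer_levels[OF g] by simp_all
  then have "q \<in> V (tgt D i j) (vpos D i j)" unfolding charts(4)[OF i j] using x by blast
  then show "q \<in> V (tgt D i j) (vpos D i j) \<inter> layer (tgt D i j) g" using q fine_image_sub by blast
qed

text \<open>The new sign compares coordinates of pieces. By \<open>layer_order\<close> these order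
  points as the old rectangles do, so the sign of the branch is inherited.\<close>

lemma fine_orientation:
  assumes "piece_index i j g = h"
  shows "incr D i j \<longleftrightarrow> (\<forall>p\<in>sliver i j g. \<forall>q\<in>sliver i j g. vertical_coord (piece i h) p < vertical_coord (piece i h) q \<longrightarrow>
    vertical_coord (piece (tgt D i j) g) (f p) < vertical_coord (piece (tgt D i j) g) (f q))"
proof -
  let ?k = "tgt D i j" let ?c = "cut_level ?k (g - 1)" and ?d = "cut_level ?k g"
  note k = transition(2)[OF i j] and lev = layer_levels[OF g]
  have h: "h \<in> {1..num_pieces i}" using index_range[OF i j g] assms by simp
  have less: "(vertical_coord (piece i h) (\<rho> i x (hb i j y)) < vertical_coord (piece i h) (\<rho> i x' (hb i j y')) \<longleftrightarrow> hb i j y < hb i j y') \<and>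
    (vertical_coord (piece ?k g) (f (\<rho> i x (hb i j y))) < vertical_coord (piece ?k g) (f (\<rho> i x' (hb i j y'))) \<longleftrightarrow> y < y')"
    if x: "0 < x" "x < 1" "?c < y" "y < ?d" and x': "0 < x'" "x' < 1" "?c < y'" "y' < ?d" for x y x' y'
  proof -
    have F: "\<rho> i x (hb i j y) \<in> sliver i j g" "\<rho> i x' (hb i j y') \<in> sliver i j g" unfolding sliver_eq using x x' by blast+
    have L: "\<rho> i x (hb i j y) \<in> layer i h" "\<rho> i x' (hb i j y') \<in> layer i h" using F sliver_sub assms by auto
    have M: "f (\<rho> i x (hb i j y)) \<in> layer ?k g" "f (\<rho> i x' (hb i j y')) \<in> layer ?k g"
      using F fine_image_sub unfolding f_sliver[symmetric] by blast+
    have y: "0 < y" "y < 1" "0 < y'" "y' < 1" using x x' lev by simp_all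
    have hy: "0 < hb i j y" "hb i j y < 1" "0 < hb i j y'" "hb i j y' < 1"
      using hb_open[OF i j y(1,2)] hb_open[OF i j y(3,4)] by simp_all
    have gx: "0 < gb i j x" "gb i j x < 1" "0 < gb i j x'" "gb i j x' < 1"
      using gb_open[OF i j x(1,2)] gb_open[OF i j x'(1,2)] by simp_all
    have "vertical_coord (r ?k) (f (\<rho> i x (hb i j y))) = y" "vertical_coord (r ?k) (f (\<rho> i x' (hb i j y'))) = y'"
      unfolding f_line[OF x] f_line[OF x'] coords(1)[OF k gx(1,2) y(1,2)] coords(1)[OF k gx(3,4) y(3,4)] by blast+
    then show ?thesis unfolding layer_order(1)[OF i h L] layer_order(1)[OF k g M]
      coords(1)[OF i x(1,2) hy(1,2)] coords(1)[OF i x'(1,2) hy(3,4)] by simp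
  qed
  show ?thesis
  proof
    assume inc: "incr D i j"
    show "\<forall>p\<in>sliver i j g. \<forall>q\<in>sliver i j g. vertical_coord (piece i h) p < vertical_coord (piece i h) q \<longrightarrow>
      vertical_coord (piece ?k g) (f p) < vertical_coord (piece ?k g) (f q)"
    proof (intro ballI impI)
      fix p q assume "p \<in> sliver i j g" "q \<in> sliver i j g" and lt: "vertical_coord (piece i h) p < vertical_coord (piece i h) q"
      then obtain x y x' y' where x: "0 < x" "x < 1" "?c < y" "y < ?d" "p = \<rho> i x (hb i j y)"
        and x': "0 < x'" "x' < 1" "?c < y'" "y' < ?d" "q = \<rho> i x' (hb i j y')" unfolding sliver_eq by blast
      have "hb i j y < hb i j y'" using lt less[OF x(1-4) x'(1-4)] unfolding x(5) x'(5) by blast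
      then have "y < y'" using seg_less_iff[OF charts(1)[OF i j], of y y'] inc x x' lev by simp
      then show "vertical_coord (piece ?k g) (f p) < vertical_coord (piece ?k g) (f q)"
        using less[OF x(1-4) x'(1-4)] unfolding x(5) x'(5) by blast
    qed
  next
    assume all: "\<forall>p\<in>sliver i j g. \<forall>q\<in>sliver i j g. vertical_coord (piece i h) p < vertical_coord (piece i h) q \<longrightarrow>
      vertical_coord (piece ?k g) (f p) < vertical_coord (piece ?k g) (f q)"
    show "incr D i j"
    proof (rule ccontr)
      assume dec: "\<not> incr D i j"
      \<comment> \<open>Two heights in the target piece suffice: on a decreasing branch the
        corresponding points of the sliver violate the order.\<close>
      obtain y where y: "?c < y" "y < ?d" using dense[OF lev(2)] by blast
      obtain y' where y': "y < y'" "y' < ?d" using dense[OF y(2)] by blast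
      have half: "(0::real) < 1/2" "1/2 < (1::real)" by simp_all
      have cy': "?c < y'" using y y' by simp
      note l = less[OF half cy' y'(2) half y]
      have "hb i j y' < hb i j y" using seg_less_iff[OF charts(1)[OF i j], of y' y] dec y y' lev by simp
      moreover have "\<rho> i (1/2) (hb i j y) \<in> sliver i j g" "\<rho> i (1/2) (hb i j y') \<in> sliver i j g"
        unfolding sliver_eq using half y y' cy' by blast+
      ultimately have "y' < y" using all l by blast
      then show False using y' by simp
    qed
  qed
qed

end

lemma layer_transition:
  assumes i: "i \<in> {1..n}" "h \<in> {1..num_pieces i}" and k: "k \<in> {1..n}" "g \<in> {1..num_pieces k}"
    and q: "q \<in> layer i h" "f q \<in> layer k g"
  obtains j where "j \<in> {1..deg D i}" "tgt D i j = k" "piece_index i j g = h" "q \<in> sliver i j g"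
proof -
  have "q \<in> R0 i" "f q \<in> R0 k" using layer_R0[OF i(2)] layer_R0[OF k(2)] q by blast+
  then obtain j x y where j: "j \<in> {1..deg D i}" "tgt D i j = k" "0 < x" "x < 1" "0 < y" "y < 1" "q = \<rho> i x (hb i j y)"
    by (rule enter[OF i(1) k(1)])
  have g: "g \<in> {1..num_pieces (tgt D i j)}" using k(2) j(2) by simp
  have fq: "f q = \<rho> k (gb i j x) y" using charts(5)[OF i(1) j(1,3-6)] unfolding j(7) j(2) .
  obtain x' y' where x': "0 < x'" "x' < 1" "cut_level k (g - 1) < y'" "y' < cut_level k g" "f q = \<rho> k x' y'"
    using q(2) by (rule stripE)
  have y': "0 < y'" "y' < 1" using x'(3,4) layer_levels[OF k(2)] by simp_all
  have gx: "0 < gb i j x" "gb i j x < 1" using gb_open[OF i(1) j(1,3,4)] by simp_all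
  have "y = y'" using \<rho>_inj[OF k(1) gx j(5,6) x'(1,2) y'] fq x'(5) by simp
  then have qf: "q \<in> sliver i j g" unfolding sliver_eq[OF i(1) j(1) g] j(2,7) using j(3,4) x'(3,4) by blast
  then have "q \<in> layer i (piece_index i j g)" using sliver_sub[OF i(1) j(1) g] by blast
  then have "h = piece_index i j g" using layer_disjoint[OF i i(1) index_range[OF i(1) j(1) g] q(1)] by blast
  then show thesis using that j(1,2) qf by simp
qed

text \<open>By \<open>tgt_unique\<close> at most one branch leads from \<open>R_i\<close> to
  \<open>R_k\<close>, so the intersection is empty or a single sliver, which is connected.\<close>

lemma components_layer:
  assumes i: "i \<in> {1..n}" "h \<in> {1..num_pieces i}" and k: "k \<in> {1..n}" "g \<in> {1..num_pieces k}"
  shows "components (layer i h \<inter> f -` layer k g) = {sliver i j g | j. j \<in> {1..deg D i} \<and> tgt D i j = k \<and> piece_index i j g = h}"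
    "components (f ` layer i h \<inter> layer k g) = {fine_image i j g | j. j \<in> {1..deg D i} \<and> tgt D i j = k \<and> piece_index i j g = h}"
proof -
  let ?C = "layer i h \<inter> f -` layer k g"
  have im: "f ` layer i h \<inter> layer k g = f ` ?C" by blast
  have "components ?C = {sliver i j g | j. j \<in> {1..deg D i} \<and> tgt D i j = k \<and> piece_index i j g = h} \<and>
    components (f ` ?C) = {fine_image i j g | j. j \<in> {1..deg D i} \<and> tgt D i j = k \<and> piece_index i j g = h}"
  proof (cases "\<exists>j\<in>{1..deg D i}. tgt D i j = k \<and> piece_index i j g = h")
    case True
    then obtain j where j: "j \<in> {1..deg D i}" "tgt D i j = k" "piece_index i j g = h" by blast
    have g: "g \<in> {1..num_pieces (tgt D i j)}" using k(2) j(2) by simp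
    have uq: "j' = j" if "j' \<in> {1..deg D i}" "tgt D i j' = k" for j' using tgt_unique[OF i(1) that(1) j(1)] that(2) j(2) by simp
    have C: "?C = sliver i j g"
    proof
      show "?C \<subseteq> sliver i j g"
      proof
        fix q assume "q \<in> ?C"
        then have "q \<in> layer i h" "f q \<in> layer k g" by blast+
        then obtain j' where "j' \<in> {1..deg D i}" "tgt D i j' = k" "q \<in> sliver i j' g" by (rule layer_transition[OF i k])
        then show "q \<in> sliver i j g" using uq by blast
      qed
      have "f ` sliver i j g \<subseteq> layer k g" unfolding f_sliver[OF i(1) j(1) g] using fine_image_sub[OF i(1) j(1) g] j(2) by simp
      then show "sliver i j g \<subseteq> ?C" using sliver_sub[OF i(1) j(1) g] j(3) by blast
    qed
    have "{sliver i j g | j. j \<in> {1..deg D i} \<and> tgt D i j = k \<and> piece_index i j g = h} = {sliver i j g}"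
      "{fine_image i j g | j. j \<in> {1..deg D i} \<and> tgt D i j = k \<and> piece_index i j g = h} = {fine_image i j g}"
      using uq j by blast+
    then show ?thesis unfolding C f_sliver[OF i(1) j(1) g]
      using components_connected[OF sliver_connected[OF i(1) j(1) g] sliver_nonempty[OF i(1) j(1) g]]
        components_connected[OF fine_image_connected[OF i(1) j(1) g]] by simp
  next
    case False
    have "?C = {}"
    proof (rule ccontr)
      assume "?C \<noteq> {}"
      then obtain q where "q \<in> layer i h" "f q \<in> layer k g" by blast
      then obtain j where "j \<in> {1..deg D i}" "tgt D i j = k" "piece_index i j g = h" by (rule layer_transition[OF i k])
      then show False using False by blast
    qed
    then show ?thesis using False by auto
  qed
  then show "components ?C = {sliver i j g | j. j \<in> {1..deg D i} \<and> tgt D i j = k \<and> piece_index i j g = h}"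
    "components (f ` layer i h \<inter> layer k g) = {fine_image i j g | j. j \<in> {1..deg D i} \<and> tgt D i j = k \<and> piece_index i j g = h}"
    unfolding im by blast+
qed

end

section \<open>Enumeration and boundary sides of the pieces\<close>

lemma image_nth_pred: "(\<lambda>m. F (xs ! (m - 1))) ` {1..length xs} = F ` set xs"
proof -
  have "F ` set xs = set (map (\<lambda>m. F (xs ! (m - 1))) [1..<Suc (length xs)])" unfolding map_nth_pred by simp
  also have "\<dots> = (\<lambda>m. F (xs ! (m - 1))) ` {1..length xs}" by (simp add: atLeastLessThanSuc_atLeastAtMost)
  finally show ?thesis ..
qed

lemma pred_less_length: "m \<in> {1..length xs} \<Longrightarrow> m - 1 < length xs"
  unfolding atLeastAtMost_iff by arith

lemma nth_pred_mem: "m \<in> {1..length xs} \<Longrightarrow> xs ! (m - 1) \<in> set xs"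
  by (rule nth_mem) (rule pred_less_length)

lemma square_lines:
  "0 \<le> c \<Longrightarrow> c \<le> 1 \<Longrightarrow> {z\<in>square. Im z = c} = (\<lambda>x. Complex x c) ` {0..1}"
  "0 \<le> c \<Longrightarrow> c \<le> 1 \<Longrightarrow> {z\<in>square. Re z = c} = (\<lambda>y. Complex c y) ` {0..1}"
proof -
  assume c: "0 \<le> c" "c \<le> 1"
  show "{z\<in>square. Im z = c} = (\<lambda>x. Complex x c) ` {0..1}"
  proof (intro set_eqI iffI)
    fix z assume "z \<in> {z\<in>square. Im z = c}"
    then have "0 \<le> Re z" "Re z \<le> 1" "z = Complex (Re z) c" by (simp_all add: in_cbox_complex_iff complex_eq_iff)
    then show "z \<in> (\<lambda>x. Complex x c) ` {0..1}" by (intro image_eqI[of _ _ "Re z"]) simp_all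
  qed (use c in \<open>auto simp: in_cbox_complex_iff\<close>)
  show "{z\<in>square. Re z = c} = (\<lambda>y. Complex c y) ` {0..1}"
  proof (intro set_eqI iffI)
    fix z assume "z \<in> {z\<in>square. Re z = c}"
    then have "0 \<le> Im z" "Im z \<le> 1" "z = Complex c (Im z)" by (simp_all add: in_cbox_complex_iff complex_eq_iff)
    then show "z \<in> (\<lambda>y. Complex c y) ` {0..1}" by (intro image_eqI[of _ _ "Im z"]) simp_all
  qed (use c in \<open>auto simp: in_cbox_complex_iff\<close>)
qed

lemma subpar_sides:
  assumes "0 \<le> c" "c < d" "d \<le> 1"
  shows "bottom_side (subpar 0 1 c d q) = (\<lambda>x. q (Complex x c)) ` {0..1}"
    "top_side (subpar 0 1 c d q) = (\<lambda>x. q (Complex x d)) ` {0..1}"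
    "left_side (subpar 0 1 c d q) = (\<lambda>y. q (Complex 0 y)) ` {c..d}"
    "right_side (subpar 0 1 c d q) = (\<lambda>y. q (Complex 1 y)) ` {c..d}"
proof -
  show "bottom_side (subpar 0 1 c d q) = (\<lambda>x. q (Complex x c)) ` {0..1}"
    "top_side (subpar 0 1 c d q) = (\<lambda>x. q (Complex x d)) ` {0..1}"
    unfolding bottom_side_def top_side_def by (simp_all add: square_lines image_image subpar_def)
  have "left_side (subpar 0 1 c d q) = (\<lambda>y. q (Complex 0 y)) ` (\<lambda>t. c + (d - c) * t) ` {0..1}"
    "right_side (subpar 0 1 c d q) = (\<lambda>y. q (Complex 1 y)) ` (\<lambda>t. c + (d - c) * t) ` {0..1}"
    unfolding left_side_def right_side_def by (simp_all add: square_lines image_image subpar_def)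
  then show "left_side (subpar 0 1 c d q) = (\<lambda>y. q (Complex 0 y)) ` {c..d}"
    "right_side (subpar 0 1 c d q) = (\<lambda>y. q (Complex 1 y)) ` {c..d}" unfolding affine_image(1)[OF assms] .
qed

lemma rectangle_sides:
  "bottom_side q = (\<lambda>x. q (Complex x 0)) ` {0..1}" "top_side q = (\<lambda>x. q (Complex x 1)) ` {0..1}"
  "left_side q = (\<lambda>y. q (Complex 0 y)) ` {0..1}" "right_side q = (\<lambda>y. q (Complex 1 y)) ` {0..1}"
  unfolding bottom_side_def top_side_def left_side_def right_side_def by (simp_all add: square_lines image_image)

lemma enc_nat_id: "(enc :: nat \<Rightarrow> nat) = (\<lambda>x. x)"
  by (rule ext) (rule enc_nat_def)

lemma enc_pair: "(enc :: nat \<times> nat \<Rightarrow> nat) = prod_encode"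
  by (rule ext) (simp add: enc_prod_def enc_nat_def)

lemma enc_lists: "(enc :: 'b::encodable list \<Rightarrow> nat) = (\<lambda>xs. list_encode (map enc xs))"
  by (rule ext) (rule enc_list_def)

context refined_markov
begin

abbreviation N :: nat where "N \<equiv> \<Sum>i\<in>{1..n}. num_pieces i"
abbreviation lex :: "nat \<Rightarrow> nat \<Rightarrow> nat" where "lex \<equiv> lex_index num_pieces"

definition s :: "nat \<Rightarrow> complex \<Rightarrow> 'a"
  where "s a = (case block_list num_pieces n ! (a - 1) of (i, h) \<Rightarrow> piece i h)"

lemma block_lex: "i \<in> {1..n} \<Longrightarrow> h \<in> {1..num_pieces i} \<Longrightarrow> block_list num_pieces n ! (lex i h - 1) = (i, h)"
  and lex_N: "i \<in> {1..n} \<Longrightarrow> h \<in> {1..num_pieces i} \<Longrightarrow> lex i h \<in> {1..N}"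
  using nth_block_list by blast+

lemma s_lex: "i \<in> {1..n} \<Longrightarrow> h \<in> {1..num_pieces i} \<Longrightarrow> s (lex i h) = piece i h"
  unfolding s_def by (simp only: block_lex prod.case)

lemma s_interior: "i \<in> {1..n} \<Longrightarrow> h \<in> {1..num_pieces i} \<Longrightarrow> rect_interior (s (lex i h)) = layer i h"
  by (simp only: s_lex piece_interior)

lemma lex_ball: "(\<And>i h. i \<in> {1..n} \<Longrightarrow> h \<in> {1..num_pieces i} \<Longrightarrow> \<Phi> (lex i h)) \<Longrightarrow> \<forall>a\<in>{1..N}. \<Phi> a"
  by (metis lex_index_cases)

lemma num_pieces_pos: "1 \<le> num_pieces i"
  unfolding num_pieces_def by simp

subsection \<open>The Markov property\<close>

abbreviation strips :: "nat \<Rightarrow> nat \<Rightarrow> (nat \<times> nat) list"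
  where "strips i h \<equiv> strip_list D num_pieces piece_index i h"

lemma set_strips:
  "set (strips i h) = {(j, g). j \<in> {1..deg D i} \<and> g \<in> {1..num_pieces (tgt D i j)} \<and> piece_index i j g = h}"
  unfolding strip_list_def fine_list_def by (auto simp: less_Suc_eq_le image_iff split: if_splits)

lemma horizontal_pieces:
  assumes i: "i \<in> {1..n}" "h \<in> {1..num_pieces i}"
  shows "horizontal_subrectangles X f N s (lex i h) = (\<lambda>p. sliver i (fst p) (snd p)) ` set (strips i h)"
proof (intro set_eqI iffI)
  fix C assume "C \<in> horizontal_subrectangles X f N s (lex i h)"
  then obtain b where b: "b \<in> {1..N}" "C \<in> components (layer i h \<inter> f -` rect_interior (s b))"
    unfolding horizontal_subrectangles_def s_interior[OF i] by blast
  obtain k g where k: "k \<in> {1..n}" "g \<in> {1..num_pieces k}" "b = lex k g" by (rule lex_index_cases[OF b(1)])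
  obtain j where j: "C = sliver i j g" "j \<in> {1..deg D i}" "tgt D i j = k" "piece_index i j g = h"
    using b(2) unfolding k(3) s_interior[OF k(1,2)] components_layer(1)[OF i k(1,2)] by blast
  have "(j, g) \<in> set (strips i h)" unfolding set_strips using j k(2) by simp
  then show "C \<in> (\<lambda>p. sliver i (fst p) (snd p)) ` set (strips i h)" using j(1) by (intro image_eqI[of _ _ "(j, g)"]) simp_all
next
  fix C assume "C \<in> (\<lambda>p. sliver i (fst p) (snd p)) ` set (strips i h)"
  then obtain j g where j: "j \<in> {1..deg D i}" "g \<in> {1..num_pieces (tgt D i j)}" "piece_index i j g = h" "C = sliver i j g"
    unfolding set_strips by auto
  note k = transition(2)[OF i(1) j(1)]
  have "C \<in> components (layer i h \<inter> f -` rect_interior (s (lex (tgt D i j) g)))"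
    unfolding s_interior[OF k j(2)] components_layer(1)[OF i k j(2)] using j by blast
  then show "C \<in> horizontal_subrectangles X f N s (lex i h)"
    unfolding horizontal_subrectangles_def s_interior[OF i] using lex_N[OF k j(2)] by blast
qed

text \<open>The source piece can be recovered as \<open>piece_index i j g\<close>, so the columns of
  a piece of \<open>R_k\<close> correspond to the branches that end in \<open>R_k\<close>.\<close>

lemma vertical_pieces:
  assumes k: "k \<in> {1..n}" "g \<in> {1..num_pieces k}"
  shows "vertical_subrectangles X f N s (lex k g) = {fine_image i j g | i j. i \<in> {1..n} \<and> j \<in> {1..deg D i} \<and> tgt D i j = k}"
proof (intro set_eqI iffI)
  fix C assume "C \<in> vertical_subrectangles X f N s (lex k g)"
  then obtain b where b: "b \<in> {1..N}" "C \<in> components (f ` rect_interior (s b) \<inter> layer k g)"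
    unfolding vertical_subrectangles_def s_interior[OF k] by blast
  obtain i h where i: "i \<in> {1..n}" "h \<in> {1..num_pieces i}" "b = lex i h" by (rule lex_index_cases[OF b(1)])
  show "C \<in> {fine_image i j g | i j. i \<in> {1..n} \<and> j \<in> {1..deg D i} \<and> tgt D i j = k}"
    using b(2) i(1) unfolding i(3) s_interior[OF i(1,2)] components_layer(2)[OF i(1,2) k] by blast
next
  fix C assume "C \<in> {fine_image i j g | i j. i \<in> {1..n} \<and> j \<in> {1..deg D i} \<and> tgt D i j = k}"
  then obtain i j where i: "C = fine_image i j g" "i \<in> {1..n}" "j \<in> {1..deg D i}" "tgt D i j = k" by blast
  have h: "piece_index i j g \<in> {1..num_pieces i}" by (rule index_range[OF i(2,3)]) (use k i(4) in simp)
  have "C \<in> components (f ` rect_interior (s (lex i (piece_index i j g))) \<inter> layer k g)"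
    unfolding s_interior[OF i(2) h] components_layer(2)[OF i(2) h k] using i by blast
  then show "C \<in> vertical_subrectangles X f N s (lex k g)"
    unfolding vertical_subrectangles_def s_interior[OF k] using lex_N[OF i(2) h] by blast
qed

lemma levels_cover:
  assumes "0 \<le> y" "y \<le> 1"
  obtains h where "h \<in> {1..num_pieces i}" "cut_level i (h - 1) \<le> y" "y \<le> cut_level i h"
proof -
  define h where "h = (LEAST h. 1 \<le> h \<and> y \<le> cut_level i h)"
  have ex: "1 \<le> num_pieces i \<and> y \<le> cut_level i (num_pieces i)" using assms num_pieces_pos by simp
  have h: "1 \<le> h \<and> y \<le> cut_level i h" unfolding h_def by (rule LeastI[of _ "num_pieces i"]) (rule ex)
  have hn: "h \<le> num_pieces i" unfolding h_def by (rule Least_le) (rule ex)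
  have "cut_level i (h - 1) \<le> y"
  proof (cases "h = 1")
    case False
    have "h - 1 < (LEAST h. 1 \<le> h \<and> y \<le> cut_level i h)" unfolding h_def[symmetric] using h by arith
    then have "\<not> (1 \<le> h - 1 \<and> y \<le> cut_level i (h - 1))" by (rule not_less_Least)
    moreover have "1 \<le> h - 1" using h False by arith
    ultimately show ?thesis by linarith
  qed (use assms in simp)
  moreover have "h \<in> {1..num_pieces i}" using h hn by simp
  ultimately show thesis using that h by blast
qed

lemma rect_piece:
  "i \<in> {1..n} \<Longrightarrow> h \<in> {1..num_pieces i} \<Longrightarrow>
    rect (piece i h) = (\<lambda>p. \<rho> i (fst p) (snd p)) ` ({0..1} \<times> {cut_level i (h - 1)..cut_level i h})"
  unfolding piece_def by (rule subpar_rect[OF rect_r surface fol _ _ _ layer_levels]) simp_all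

lemma rect_pieces:
  assumes i: "i \<in> {1..n}"
  shows "(\<Union>h\<in>{1..num_pieces i}. rect (piece i h)) = rect (r i)"
proof (intro set_eqI iffI)
  fix q assume "q \<in> (\<Union>h\<in>{1..num_pieces i}. rect (piece i h))"
  then obtain h p where h: "h \<in> {1..num_pieces i}" "p \<in> {0..1} \<times> {cut_level i (h - 1)..cut_level i h}" "q = \<rho> i (fst p) (snd p)"
    using rect_piece[OF i] by auto
  have "p \<in> {0..1} \<times> {0..1}" using h(2) layer_levels[OF h(1)] by (cases p) simp
  then show "q \<in> rect (r i)" unfolding rect_pr using h(3) by blast
next
  fix q assume "q \<in> rect (r i)"
  then obtain p where p: "p \<in> {0..1} \<times> {0..1}" "q = \<rho> i (fst p) (snd p)" unfolding rect_pr by blast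
  have "0 \<le> snd p" "snd p \<le> 1" using p(1) by auto
  then obtain h where h: "h \<in> {1..num_pieces i}" "cut_level i (h - 1) \<le> snd p" "snd p \<le> cut_level i h" by (rule levels_cover)
  then have "p \<in> {0..1} \<times> {cut_level i (h - 1)..cut_level i h}" using p(1) by (cases p) simp
  then have "q \<in> rect (piece i h)" unfolding rect_piece[OF i h(1)] using p(2) by blast
  then show "q \<in> (\<Union>h\<in>{1..num_pieces i}. rect (piece i h))" using h(1) by blast
qed

lemma refined_Markov_partition: "geometric_Markov_partition X f N s"
  unfolding geometric_Markov_partition_def
proof (intro conjI)
  show "\<forall>a\<in>{1..N}. rectangle X (s a)" by (rule lex_ball) (simp only: s_lex piece_rectangle)
  have "(\<Union>a\<in>{1..N}. rect (s a)) = (\<Union>i\<in>{1..n}. \<Union>h\<in>{1..num_pieces i}. rect (piece i h))"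
  proof (intro set_eqI iffI)
    fix q assume "q \<in> (\<Union>a\<in>{1..N}. rect (s a))"
    then obtain a where a: "a \<in> {1..N}" "q \<in> rect (s a)" by blast
    obtain i h where i: "i \<in> {1..n}" "h \<in> {1..num_pieces i}" "a = lex i h" by (rule lex_index_cases[OF a(1)])
    have "q \<in> rect (piece i h)" using a(2) unfolding i(3) s_lex[OF i(1,2)] .
    then show "q \<in> (\<Union>i\<in>{1..n}. \<Union>h\<in>{1..num_pieces i}. rect (piece i h))" by (intro UN_I[OF i(1)] UN_I[OF i(2)])
  next
    fix q assume "q \<in> (\<Union>i\<in>{1..n}. \<Union>h\<in>{1..num_pieces i}. rect (piece i h))"
    then obtain i h where i: "i \<in> {1..n}" "h \<in> {1..num_pieces i}" "q \<in> rect (piece i h)" by blast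
    then show "q \<in> (\<Union>a\<in>{1..N}. rect (s a))" using lex_N[OF i(1,2)] s_lex[OF i(1,2)] by (intro UN_I[of "lex i h"]) simp_all
  qed
  also have "\<dots> = (\<Union>i\<in>{1..n}. rect (r i))" using rect_pieces by simp
  also have "\<dots> = S" using GMP unfolding geometric_Markov_partition_def by blast
  finally show "(\<Union>a\<in>{1..N}. rect (s a)) = S" .
  have disj: "rect_interior (s (lex i h)) \<inter> rect_interior (s (lex k g)) = {}"
    if i: "i \<in> {1..n}" "h \<in> {1..num_pieces i}" and k: "k \<in> {1..n}" "g \<in> {1..num_pieces k}" and ne: "lex i h \<noteq> lex k g" for i h k g
    unfolding s_interior[OF i] s_interior[OF k] using layer_disjoint[OF i k] ne by blast
  show "\<forall>a\<in>{1..N}. \<forall>b\<in>{1..N}. a \<noteq> b \<longrightarrow> rect_interior (s a) \<inter> rect_interior (s b) = {}"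
    by (intro lex_ball impI) (rule disj)
  have hs: "horizontal_subrectangle X (s (lex i h)) C"
    if i: "i \<in> {1..n}" "h \<in> {1..num_pieces i}" and C: "C \<in> horizontal_subrectangles X f N s (lex i h)" for i h C
  proof -
    obtain j g where "j \<in> {1..deg D i}" "g \<in> {1..num_pieces (tgt D i j)}" "piece_index i j g = h" "C = sliver i j g"
      using C unfolding horizontal_pieces[OF i] set_strips by auto
    then show ?thesis unfolding s_lex[OF i] using fine_subrectangle[OF i(1)] by blast
  qed
  show "\<forall>a\<in>{1..N}. \<forall>C\<in>horizontal_subrectangles X f N s a. horizontal_subrectangle X (s a) C"
    by (intro lex_ball ballI) (rule hs)
  have vs: "vertical_subrectangle X (s (lex k g)) C"
    if k: "k \<in> {1..n}" "g \<in> {1..num_pieces k}" and C: "C \<in> vertical_subrectangles X f N s (lex k g)" for k g C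
  proof -
    obtain i j where i: "C = fine_image i j g" "i \<in> {1..n}" "j \<in> {1..deg D i}" "tgt D i j = k" using C unfolding vertical_pieces[OF k] by blast
    have "g \<in> {1..num_pieces (tgt D i j)}" using k i(4) by simp
    from fine_image_subrectangle[OF i(2,3) this] show ?thesis unfolding s_lex[OF k] i(1,4) .
  qed
  show "\<forall>a\<in>{1..N}. \<forall>C\<in>vertical_subrectangles X f N s a. vertical_subrectangle X (s a) C"
    by (intro lex_ball ballI) (rule vs)
qed

lemma layer_nonempty: "i \<in> {1..n} \<Longrightarrow> h \<in> {1..num_pieces i} \<Longrightarrow> layer i h \<noteq> {}"
  using rectangle_connected[OF piece_rectangle] piece_interior by metis

lemma layers_below:
  assumes i: "i \<in> {1..n}" and h: "h \<in> {1..num_pieces i}" "h' \<in> {1..num_pieces i}" "h < h'"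
  shows "below_in (r i) (layer i h) (layer i h')"
  unfolding below_in_def
proof (intro ballI)
  fix p q assume "p \<in> layer i h" "q \<in> layer i h'"
  then obtain x y x' y' where x: "0 < x" "x < 1" "cut_level i (h - 1) < y" "y < cut_level i h" "p = \<rho> i x y"
    and x': "0 < x'" "x' < 1" "cut_level i (h' - 1) < y'" "y' < cut_level i h'" "q = \<rho> i x' y'" unfolding strip_def by blast
  have "h \<le> h' - 1" "h \<le> num_pieces i" "h' - 1 \<le> num_pieces i" using h unfolding atLeastAtMost_iff by arith+
  then have "cut_level i h \<le> cut_level i (h' - 1)" using cut_level_le_iff[of h i "h' - 1"] by blast
  then show "vertical_coord (r i) p < vertical_coord (r i) q"
    unfolding x(5) x'(5) layer_coords(3)[OF i h(1) x(1-4)] layer_coords(3)[OF i h(2) x'(1-4)] using x(4) x'(3) by simp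
qed

lemma refined_partition: "geometric_refinement X f n r num_pieces s"
  unfolding geometric_refinement_def
proof (intro conjI ballI)
  show "geometric_Markov_partition X f N s" by (rule refined_Markov_partition)
  fix i assume i: "i \<in> {1..n}"
  show "(\<Union>h\<in>{1..num_pieces i}. rect (s (lex i h))) = rect (r i)"
    unfolding rect_pieces[OF i, symmetric] by (rule SUP_cong[OF refl]) (simp only: s_lex[OF i])
  fix h assume h: "h \<in> {1..num_pieces i}"
  show "horizontal_subrectangle X (r i) (rect_interior (s (lex i h)))"
    unfolding s_interior[OF i h] horizontal_subrectangle_def
  proof (intro conjI ballI)
    show "\<exists>r'. rectangle X r' \<and> rect_interior r' = layer i h" using piece_rectangle[OF i h] piece_interior[OF i h] by blast
    show "layer i h \<subseteq> R0 i" by (rule layer_R0[OF h])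
    fix q assume "q \<in> layer i h"
    then obtain x y where q: "0 < x" "x < 1" "cut_level i (h - 1) < y" "y < cut_level i h" "q = \<rho> i x y" by (rule stripE)
    have y: "0 < y" "y < 1" using q layer_levels[OF h] by simp_all
    have "(0::real) \<le> 0" "(0::real) < 1" "(1::real) \<le> 1" by simp_all
    from strip_plaque(1)[OF i this q(1,2) y]
    show "plaque_in (stab X) (layer i h) q = plaque_in (stab X) (R0 i) q"
      unfolding q(5) R0_strip strip_plaque(1)[OF i layer_levels[OF h] q(1-4)] by simp
  qed
  show "vertical_coord (s (lex i h)) p < vertical_coord (s (lex i h)) q \<longleftrightarrow> vertical_coord (r i) p < vertical_coord (r i) q"
    if "p \<in> rect_interior (s (lex i h))" "q \<in> rect_interior (s (lex i h))" for p q
    using layer_order(1)[OF i h] that[unfolded s_interior[OF i h]] unfolding s_lex[OF i h] by blast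
  fix h' assume h': "h' \<in> {1..num_pieces i}"
  obtain p q where pq: "p \<in> layer i h" "q \<in> layer i h'" using layer_nonempty[OF i h] layer_nonempty[OF i h'] by blast
  show "below_in (r i) (rect_interior (s (lex i h))) (rect_interior (s (lex i h'))) \<longleftrightarrow> h < h'"
    unfolding s_interior[OF i h] s_interior[OF i h']
  proof
    assume b: "below_in (r i) (layer i h) (layer i h')"
    then have lt: "vertical_coord (r i) p < vertical_coord (r i) q" using pq unfolding below_in_def by blast
    show "h < h'"
    proof (rule ccontr)
      assume "\<not> h < h'"
      then consider "h = h'" | "h' < h" by linarith
      then show False
      proof cases
        case 1
        then show False using b pq(1) unfolding below_in_def by blast
      next
        case 2
        then have "vertical_coord (r i) q < vertical_coord (r i) p" using layers_below[OF i h' h] pq unfolding below_in_def by blast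
        then show False using lt by simp
      qed
    qed
  qed (rule layers_below[OF i h h'])
qed

subsection \<open>The geometric type of the refinement\<close>

definition rows :: type_rows where "rows = refined_rows D num_pieces piece_index"
abbreviation T' :: geometric_type where "T' \<equiv> type_of_rows rows"

lemma length_rows: "length rows = N"
  unfolding rows_def refined_rows_def len_D by (simp add: length_block_list)

lemma rows_lex:
  assumes "i \<in> {1..n}" "h \<in> {1..num_pieces i}"
  shows "rows ! (lex i h - 1) = refined_row D num_pieces piece_index i h"
proof -
  have lt: "lex i h - 1 < length (block_list num_pieces n)"
    using lex_N[OF assms] by (intro pred_less_length) (simp only: length_block_list)
  show ?thesis unfolding rows_def refined_rows_def len_D nth_map[OF lt] block_lex[OF assms] fst_conv snd_conv ..
qed

lemma type_rows_lex:
  assumes i: "i \<in> {1..n}" "h \<in> {1..num_pieces i}"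
  shows "gt_h T' (lex i h) = length (strips i h)" "gt_v T' (lex i h) = gt_v T i"
    "m \<in> {1..length (strips i h)} \<Longrightarrow> strips i h ! (m - 1) = (j, g) \<Longrightarrow>
      gt_rho T' (lex i h, m) = (lex (tgt D i j) g, vpos D i j) \<and> gt_eps T' (lex i h, m) = (if incr D i j then 1 else - 1)"
proof -
  show "gt_h T' (lex i h) = length (strips i h)"
    unfolding type_of_rows_def geometric_type.sel rows_lex[OF i] refined_row_def by simp
  have "fst (row D i) = gt_v T i" using row_type_table[of i T] i(1) gt_n by simp
  then show "gt_v T' (lex i h) = gt_v T i"
    unfolding type_of_rows_def geometric_type.sel rows_lex[OF i] refined_row_def by simp
  assume m: "m \<in> {1..length (strips i h)}" "strips i h ! (m - 1) = (j, g)"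
  have sum: "sum_list (map num_pieces [1..<k]) = sum num_pieces {1..<k}" for k by (simp add: interv_sum_list_conv_sum_set_nat)
  have e: "snd (refined_row D num_pieces piece_index i h) ! (m - 1) = ((lex (tgt D i j) g, vpos D i j), if incr D i j then 1 else 0)"
    unfolding refined_row_def snd_conv nth_map[OF pred_less_length[OF m(1)]] m(2) fst_conv lex_index_def sum ..
  show "gt_rho T' (lex i h, m) = (lex (tgt D i j) g, vpos D i j) \<and> gt_eps T' (lex i h, m) = (if incr D i j then 1 else - 1)"
    unfolding type_of_rows_def geometric_type.sel prod.case rows_lex[OF i] e by simp
qed

text \<open>Within one branch neighbouring target pieces have neighbouring preimages, in reverse
  order on a decreasing branch, which the reversed list anticipates; different branches are compared
  by \<open>hb_order\<close>.\<close>

lemma fine_list_sorted: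
  assumes i: "i \<in> {1..n}"
  shows "sorted_wrt (\<lambda>p q. fine_top i (fst p) (snd p) \<le> fine_bottom i (fst q) (snd q)) (fine_list D num_pieces i)"
  unfolding fine_list_def
proof (rule sorted_wrt_concat_map)
  let ?L = "\<lambda>p q. fine_top i (fst p) (snd p) \<le> fine_bottom i (fst q) (snd q)"
  let ?G = "\<lambda>j. map (Pair j) (if incr D i j then [1..<Suc (num_pieces (tgt D i j))] else rev [1..<Suc (num_pieces (tgt D i j))])"
  fix j assume "j \<in> set [1..<Suc (deg D i)]"
  then have j: "j \<in> {1..deg D i}" by auto
  let ?k = "tgt D i j" and ?xs = "[1..<Suc (num_pieces (tgt D i j))]"
  have srt: "sorted_wrt (<) ?xs" by simp
  have lev: "cut_level ?k g \<le> cut_level ?k (g' - 1) \<and> 0 \<le> cut_level ?k g \<and> cut_level ?k g \<le> 1 \<and> 0 \<le> cut_level ?k (g' - 1) \<and> cut_level ?k (g' - 1) \<le> 1"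
    if gg: "g \<in> set ?xs" "g' \<in> set ?xs" "g < g'" for g g'
  proof -
    have "g \<le> num_pieces ?k" "g' \<le> num_pieces ?k" using gg(1,2) by simp_all
    moreover have "g \<le> g' - 1" using gg(3) by arith
    moreover have "g' - 1 \<le> num_pieces ?k" using calculation by arith
    ultimately show ?thesis using cut_level_le_iff[of g ?k "g' - 1"] cut_level_range[of g ?k] cut_level_range[of "g' - 1" ?k] by blast
  qed
  show "sorted_wrt ?L (?G j)"
  proof (cases "incr D i j")
    case True
    have "sorted_wrt (\<lambda>g g'. ?L (j, g) (j, g')) ?xs"
      by (rule sorted_wrt_mono_rel[OF _ srt])
        (use lev seg_le_iff[OF charts(1)[OF i j]] True in \<open>simp only: fine_top_def fine_bottom_def fst_conv snd_conv if_True\<close>)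
    then show ?thesis using True by (simp add: sorted_wrt_map)
  next
    case False
    have "sorted_wrt (\<lambda>g g'. ?L (j, g') (j, g)) ?xs"
      by (rule sorted_wrt_mono_rel[OF _ srt])
        (use lev seg_le_iff[OF charts(1)[OF i j]] False in \<open>simp only: fine_top_def fine_bottom_def fst_conv snd_conv if_False\<close>)
    then show ?thesis using False by (simp add: sorted_wrt_map sorted_wrt_rev)
  qed
next
  let ?L = "\<lambda>p q. fine_top i (fst p) (snd p) \<le> fine_bottom i (fst q) (snd q)"
  let ?G = "\<lambda>j. map (Pair j) (if incr D i j then [1..<Suc (num_pieces (tgt D i j))] else rev [1..<Suc (num_pieces (tgt D i j))])"
  show "sorted_wrt (\<lambda>j j'. \<forall>p\<in>set (?G j). \<forall>q\<in>set (?G j'). ?L p q) [1..<Suc (deg D i)]"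
  proof (rule sorted_wrt_mono_rel[of _ "(<)"])
    fix j j' assume "j \<in> set [1..<Suc (deg D i)]" "j' \<in> set [1..<Suc (deg D i)]" and jj: "j < j'"
    then have j: "j \<in> {1..deg D i}" "j' \<in> {1..deg D i}" by auto
    have G: "fst p = j \<and> snd p \<in> {1..num_pieces (tgt D i j)}" if "p \<in> set (?G j)" for p j
      using that by (auto simp: less_Suc_eq_le split: if_splits)
    show "\<forall>p\<in>set (?G j). \<forall>q\<in>set (?G j'). ?L p q"
    proof (intro ballI)
      fix p q assume p: "p \<in> set (?G j)" and q: "q \<in> set (?G j')"
      note p' = G[OF p] and q' = G[OF q]
      note l = layer_levels[of "snd p" "tgt D i j"] and l' = layer_levels[of "snd q" "tgt D i j'"]
      show "?L p q" unfolding fine_top_def fine_bottom_def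
        by (simp only: p' q', rule hb_order[OF i j jj]) (use l l' p' q' in \<open>auto split: if_splits\<close>)
    qed
  qed simp
qed

lemma strips_sorted: "i \<in> {1..n} \<Longrightarrow> sorted_wrt (\<lambda>p q. fine_top i (fst p) (snd p) \<le> fine_bottom i (fst q) (snd q)) (strips i h)"
  unfolding strip_list_def by (rule sorted_wrt_filter) (rule fine_list_sorted)

lemma strips_below:
  assumes i: "i \<in> {1..n}" "h \<in> {1..num_pieces i}" and m: "m \<in> {1..length (strips i h)}" "m' \<in> {1..length (strips i h)}" "m < m'"
  shows "below_in (piece i h) (sliver i (fst (strips i h ! (m - 1))) (snd (strips i h ! (m - 1))))
    (sliver i (fst (strips i h ! (m' - 1))) (snd (strips i h ! (m' - 1))))"
proof -
  obtain j g where p: "strips i h ! (m - 1) = (j, g)" by (cases "strips i h ! (m - 1)")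
  obtain j' g' where q: "strips i h ! (m' - 1) = (j', g')" by (cases "strips i h ! (m' - 1)")
  have "(j, g) \<in> set (strips i h)" "(j', g') \<in> set (strips i h)" unfolding p[symmetric] q[symmetric] using m by (blast intro: nth_pred_mem)+
  then have j: "j \<in> {1..deg D i}" "g \<in> {1..num_pieces (tgt D i j)}" "piece_index i j g = h"
    and j': "j' \<in> {1..deg D i}" "g' \<in> {1..num_pieces (tgt D i j')}" "piece_index i j' g' = h" unfolding set_strips by auto
  have lt: "m - 1 < m' - 1" using m unfolding atLeastAtMost_iff by arith
  have le: "fine_top i j g \<le> fine_bottom i j' g'"
    using sorted_wrt_nth_less[OF strips_sorted[OF i(1), of h] lt pred_less_length[OF m(2)]] unfolding p q by simp
  show ?thesis unfolding p q fst_conv snd_conv below_in_def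
  proof (intro ballI)
    fix a b assume a: "a \<in> sliver i j g" and b: "b \<in> sliver i j' g'"
    have ab: "a \<in> layer i h" "b \<in> layer i h"
      using subsetD[OF sliver_sub[OF i(1) j(1,2)] a] subsetD[OF sliver_sub[OF i(1) j'(1,2)] b] unfolding j(3) j'(3) .
    obtain x y where x: "0 < x" "x < 1" "fine_bottom i j g < y" "y < fine_top i j g" "a = \<rho> i x y" using a unfolding sliver_def by (rule stripE)
    obtain x' y' where x': "0 < x'" "x' < 1" "fine_bottom i j' g' < y'" "y' < fine_top i j' g'" "b = \<rho> i x' y'" using b unfolding sliver_def by (rule stripE)
    have y: "0 < y" "y < 1" "0 < y'" "y' < 1" using x x' fine_rng[OF i(1) j(1,2)] fine_rng[OF i(1) j'(1,2)] by simp_all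
    have "vertical_coord (r i) a < vertical_coord (r i) b"
      unfolding x(5) x'(5) coords(1)[OF i(1) x(1,2) y(1,2)] coords(1)[OF i(1) x'(1,2) y(3,4)] using x(4) x'(3) le by simp
    then show "vertical_coord (piece i h) a < vertical_coord (piece i h) b" using layer_order(1)[OF i ab] by blast
  qed
qed

lemma layer_column:
  assumes k: "k \<in> {1..n}" "g \<in> {1..num_pieces k}" and l: "l \<in> {1..gt_v T k}"
  obtains i j where "i \<in> {1..n}" "j \<in> {1..deg D i}" "tgt D i j = k" "vpos D i j = l" "V k l \<inter> layer k g = fine_image i j g"
proof -
  obtain i j where i: "i \<in> {1..n}" "j \<in> {1..deg D i}" "tgt D i j = k" "vpos D i j = l" by (rule vpos_onto[OF k(1) l])
  have "g \<in> {1..num_pieces (tgt D i j)}" using k i(3) by simp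
  from fine_image_V[OF i(1,2) this] show thesis using that[OF i] unfolding i(3,4) by blast
qed

lemma columns_left:
  assumes k: "k \<in> {1..n}" "g \<in> {1..num_pieces k}" and l: "l \<in> {1..gt_v T k}" "l' \<in> {1..gt_v T k}" "l < l'"
  shows "left_of_in (piece k g) (V k l \<inter> layer k g) (V k l' \<inter> layer k g)"
  unfolding left_of_in_def
proof (intro ballI)
  fix p q assume p: "p \<in> V k l \<inter> layer k g" and q: "q \<in> V k l' \<inter> layer k g"
  then have pq: "p \<in> layer k g" "q \<in> layer k g" "p \<in> V k l" "q \<in> V k l'" by blast+
  have "horizontal_coord (r k) p < horizontal_coord (r k) q" using V_left[OF k(1) l] pq(3,4) unfolding left_of_in_def by blast
  then show "horizontal_coord (piece k g) p < horizontal_coord (piece k g) q"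
    unfolding layer_order(2)[OF k pq(1,1)] layer_order(2)[OF k pq(2,2)] .
qed

lemma refined_type: "has_geometric_type X f N s T'"
  unfolding has_geometric_type_def
proof (intro conjI exI)
  \<comment> \<open>Rows are numbered by their position in \<open>strips\<close>, columns by the
    number of the old column that they are cut from.\<close>
  define H' where "H' a m = (case block_list num_pieces n ! (a - 1) of (i, h) \<Rightarrow>
    sliver i (fst (strips i h ! (m - 1))) (snd (strips i h ! (m - 1))))" for a m
  define V' where "V' a l = (case block_list num_pieces n ! (a - 1) of (k, g) \<Rightarrow> V k l \<inter> layer k g)" for a l
  have H'_lex: "H' (lex i h) m = sliver i (fst (strips i h ! (m - 1))) (snd (strips i h ! (m - 1)))"
    if "i \<in> {1..n}" "h \<in> {1..num_pieces i}" for i h m unfolding H'_def block_lex[OF that] prod.case ..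
  have V'_lex: "V' (lex k g) l = V k l \<inter> layer k g" if "k \<in> {1..n}" "g \<in> {1..num_pieces k}" for k g l
    unfolding V'_def block_lex[OF that] prod.case ..
  show "gt_n T' = N" unfolding type_of_rows_def by (simp add: length_rows)
  have mem: "strips i h ! (m - 1) \<in> set (strips i h)" if "m \<in> {1..length (strips i h)}" for i h m using that by (rule nth_pred_mem)
  show "\<forall>a\<in>{1..N}. bij_betw (H' a) {1..gt_h T' a} (horizontal_subrectangles X f N s a) \<and>
    (\<forall>m\<in>{1..gt_h T' a}. \<forall>m'\<in>{1..gt_h T' a}. m < m' \<longrightarrow> below_in (s a) (H' a m) (H' a m'))"
  proof (rule lex_ball)
    fix i h assume i: "i \<in> {1..n}" "h \<in> {1..num_pieces i}"
    have ord: "below_in (piece i h) (H' (lex i h) m) (H' (lex i h) m')"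
      if "m \<in> {1..length (strips i h)}" "m' \<in> {1..length (strips i h)}" "m < m'" for m m'
      unfolding H'_lex[OF i] by (rule strips_below[OF i that])
    have irr: "\<not> below_in (piece i h) (H' (lex i h) m) (H' (lex i h) m)" if m: "m \<in> {1..length (strips i h)}" for m
    proof -
      obtain j g where p: "strips i h ! (m - 1) = (j, g)" by (cases "strips i h ! (m - 1)")
      have "j \<in> {1..deg D i}" "g \<in> {1..num_pieces (tgt D i j)}" using mem[OF m] unfolding p set_strips by auto
      from sliver_nonempty[OF i(1) this] show ?thesis unfolding H'_lex[OF i] p below_in_def by auto
    qed
    have im: "H' (lex i h) ` {1..length (strips i h)} = horizontal_subrectangles X f N s (lex i h)"
      unfolding horizontal_pieces[OF i] H'_lex[OF i] by (rule image_nth_pred)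
    show "bij_betw (H' (lex i h)) {1..gt_h T' (lex i h)} (horizontal_subrectangles X f N s (lex i h)) \<and>
      (\<forall>m\<in>{1..gt_h T' (lex i h)}. \<forall>m'\<in>{1..gt_h T' (lex i h)}. m < m' \<longrightarrow> below_in (s (lex i h)) (H' (lex i h) m) (H' (lex i h) m'))"
      unfolding type_rows_lex(1)[OF i] s_lex[OF i]
      using bij_betw_numbering[of _ "below_in (piece i h)", OF ord irr im] ord by blast
  qed
  show "\<forall>a\<in>{1..N}. bij_betw (V' a) {1..gt_v T' a} (vertical_subrectangles X f N s a) \<and>
    (\<forall>l\<in>{1..gt_v T' a}. \<forall>l'\<in>{1..gt_v T' a}. l < l' \<longrightarrow> left_of_in (s a) (V' a l) (V' a l'))"
  proof (rule lex_ball)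
    fix k g assume k: "k \<in> {1..n}" "g \<in> {1..num_pieces k}"
    have ord: "left_of_in (piece k g) (V' (lex k g) l) (V' (lex k g) l')"
      if "l \<in> {1..gt_v T k}" "l' \<in> {1..gt_v T k}" "l < l'" for l l'
      unfolding V'_lex[OF k] by (rule columns_left[OF k that])
    have irr: "\<not> left_of_in (piece k g) (V' (lex k g) l) (V' (lex k g) l)" if l: "l \<in> {1..gt_v T k}" for l
    proof -
      obtain i j where i: "i \<in> {1..n}" "j \<in> {1..deg D i}" "tgt D i j = k" "V k l \<inter> layer k g = fine_image i j g"
        by (rule layer_column[OF k l])
      have "g \<in> {1..num_pieces (tgt D i j)}" using k i(3) by simp
      from fine_image_connected(2)[OF i(1,2) this] show ?thesis unfolding V'_lex[OF k] i(4) left_of_in_def by auto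
    qed
    have im: "V' (lex k g) ` {1..gt_v T k} = vertical_subrectangles X f N s (lex k g)"
      unfolding vertical_pieces[OF k]
    proof (intro set_eqI iffI)
      fix C assume "C \<in> V' (lex k g) ` {1..gt_v T k}"
      then obtain l where l: "l \<in> {1..gt_v T k}" "C = V k l \<inter> layer k g" using V'_lex[OF k] by blast
      obtain i j where "i \<in> {1..n}" "j \<in> {1..deg D i}" "tgt D i j = k" "V k l \<inter> layer k g = fine_image i j g"
        by (rule layer_column[OF k l(1)])
      then show "C \<in> {fine_image i j g | i j. i \<in> {1..n} \<and> j \<in> {1..deg D i} \<and> tgt D i j = k}" using l(2) by blast
    next
      fix C assume "C \<in> {fine_image i j g | i j. i \<in> {1..n} \<and> j \<in> {1..deg D i} \<and> tgt D i j = k}"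
      then obtain i j where i: "C = fine_image i j g" "i \<in> {1..n}" "j \<in> {1..deg D i}" "tgt D i j = k" by blast
      have g: "g \<in> {1..num_pieces (tgt D i j)}" using k i(4) by simp
      have "C = V' (lex k g) (vpos D i j)" using fine_image_V[OF i(2,3) g] unfolding V'_lex[OF k] i(1,4) by simp
      then show "C \<in> V' (lex k g) ` {1..gt_v T k}" using transition(3)[OF i(2,3)] i(4) by simp
    qed
    show "bij_betw (V' (lex k g)) {1..gt_v T' (lex k g)} (vertical_subrectangles X f N s (lex k g)) \<and>
      (\<forall>l\<in>{1..gt_v T' (lex k g)}. \<forall>l'\<in>{1..gt_v T' (lex k g)}. l < l' \<longrightarrow> left_of_in (s (lex k g)) (V' (lex k g) l) (V' (lex k g) l'))"
      unfolding type_rows_lex(2)[OF k] s_lex[OF k]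
      using bij_betw_numbering[of _ "left_of_in (piece k g)", OF ord irr im] ord by blast
  qed
  show "\<forall>a\<in>{1..N}. \<forall>m\<in>{1..gt_h T' a}. \<exists>b\<in>{1..N}. \<exists>l\<in>{1..gt_v T' b}.
         gt_rho T' (a, m) = (b, l) \<and> f ` H' a m = V' b l \<and>
         gt_eps T' (a, m) =
           (if \<forall>x\<in>H' a m. \<forall>y\<in>H' a m. vertical_coord (s a) x < vertical_coord (s a) y \<longrightarrow>
                 vertical_coord (s b) (f x) < vertical_coord (s b) (f y)
            then 1 else - 1)"
  proof (intro lex_ball ballI)
    fix i h m assume i: "i \<in> {1..n}" "h \<in> {1..num_pieces i}" and "m \<in> {1..gt_h T' (lex i h)}"
    then have m: "m \<in> {1..length (strips i h)}" unfolding type_rows_lex(1)[OF i] by blast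
    obtain j g where p: "strips i h ! (m - 1) = (j, g)" by (cases "strips i h ! (m - 1)")
    have j: "j \<in> {1..deg D i}" and g: "g \<in> {1..num_pieces (tgt D i j)}" and h: "piece_index i j g = h"
      using mem[OF m] unfolding p set_strips by auto
    note k = transition(2)[OF i(1) j]
    have Hm: "H' (lex i h) m = sliver i j g" unfolding H'_lex[OF i] p by simp
    have "vpos D i j \<in> {1..gt_v T' (lex (tgt D i j) g)}" unfolding type_rows_lex(2)[OF k g] by (rule transition(3)[OF i(1) j])
    moreover have "f ` H' (lex i h) m = V' (lex (tgt D i j) g) (vpos D i j)"
      unfolding Hm V'_lex[OF k g] fine_image_V[OF i(1) j g] by (rule f_sliver[OF i(1) j g])
    moreover have "gt_eps T' (lex i h, m) =
       (if \<forall>x\<in>H' (lex i h) m. \<forall>y\<in>H' (lex i h) m. vertical_coord (s (lex i h)) x < vertical_coord (s (lex i h)) y \<longrightarrow>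
           vertical_coord (s (lex (tgt D i j) g)) (f x) < vertical_coord (s (lex (tgt D i j) g)) (f y) then 1 else - 1)"
      unfolding Hm s_lex[OF i] s_lex[OF k g] fine_orientation[OF i(1) j g h, symmetric]
      using type_rows_lex(3)[OF i m p] by blast
    moreover have "gt_rho T' (lex i h, m) = (lex (tgt D i j) g, vpos D i j)" using type_rows_lex(3)[OF i m p] by blast
    ultimately show "\<exists>b\<in>{1..N}. \<exists>l\<in>{1..gt_v T' b}.
         gt_rho T' (lex i h, m) = (b, l) \<and> f ` H' (lex i h) m = V' b l \<and>
         gt_eps T' (lex i h, m) =
           (if \<forall>x\<in>H' (lex i h) m. \<forall>y\<in>H' (lex i h) m. vertical_coord (s (lex i h)) x < vertical_coord (s (lex i h)) y \<longrightarrow>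
                 vertical_coord (s b) (f x) < vertical_coord (s b) (f y)
            then 1 else - 1)"
      by (intro bexI[of _ "lex (tgt D i j) g"] bexI[of _ "vpos D i j"] conjI lex_N[OF k g])
  qed
qed

subsection \<open>Boundary arcs and periodic boundary points\<close>

lemma piece_sides:
  assumes "h \<in> {1..num_pieces i}"
  shows "bottom_side (piece i h) = line i (cut_level i (h - 1))" "top_side (piece i h) = line i (cut_level i h)"
    "left_side (piece i h) = (\<lambda>y. \<rho> i 0 y) ` {cut_level i (h - 1)..cut_level i h}"
    "right_side (piece i h) = (\<lambda>y. \<rho> i 1 y) ` {cut_level i (h - 1)..cut_level i h}"
  unfolding piece_def by (rule subpar_sides[OF layer_levels[OF assms]])+

lemma arc_line: "w \<in> W \<Longrightarrow> code_arc X f r T t w = line (w (int t)) (height (tail w t))"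
  by (rule code_arc_eq[OF W_sub])

lemma level_line:
  assumes "h \<le> num_pieces i"
  shows "line i (cut_level i h) \<in> stable_boundary_components (r i) \<or> (\<exists>w\<in>W. \<exists>t. line i (cut_level i h) = code_arc X f r T t w)"
proof -
  consider "h = 0" | "h = num_pieces i" | "h \<in> {1..<num_pieces i}" using assms by fastforce
  then show ?thesis
  proof cases
    case 3
    then have "cut_level i h \<in> cut_heights i" using cut_level_image by blast
    then obtain u where u: "u \<in> tails" "u 0 = i" "cut_level i h = height u" unfolding cut_heights_def by blast
    then obtain w t where w: "w \<in> W" "u = tail w t" unfolding tails_def by blast
    have "line i (cut_level i h) = code_arc X f r T t w" unfolding arc_line[OF w(1)] u(3) using u(2) unfolding w(2) by simp
    then show ?thesis using w(1) by blast
  qed (simp_all add: stable_boundary_components_def rectangle_sides)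
qed

lemma arc_level:
  assumes w: "w \<in> W"
  obtains i h where "i \<in> {1..n}" "h \<in> {1..num_pieces i}" "code_arc X f r T t w \<in> stable_boundary_components (piece i h)"
proof -
  have "tail w t \<in> tails" unfolding tails_def using w by blast
  then obtain h where h: "h \<le> num_pieces (tail w t 0)" "height (tail w t) = cut_level (tail w t 0) h" by (rule height_level)
  have i: "w (int t) \<in> {1..n}" using stepD(1)[OF subshift_step[OF W_sub[OF w]]] .
  have arc: "code_arc X f r T t w = line (w (int t)) (cut_level (w (int t)) h)" unfolding arc_line[OF w] using h(2) by simp
  have hi: "h \<le> num_pieces (w (int t))" using h(1) by simp
  show thesis
  \<comment> \<open>An arc at level 0 is the bottom of the first piece; at any other level
    \<open>h\<close> it is the top of piece \<open>h\<close>.\<close>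
  proof (cases "h = 0")
    case True
    have 1: "1 \<in> {1..num_pieces (w (int t))}" using num_pieces_pos by simp
    show thesis by (rule that[OF i 1]) (unfold arc stable_boundary_components_def piece_sides[OF 1] True, simp)
  next
    case False
    then have 1: "h \<in> {1..num_pieces (w (int t))}" using hi by simp
    show thesis by (rule that[OF i 1]) (unfold arc stable_boundary_components_def piece_sides[OF 1], simp)
  qed
qed

lemma boundary_arcs:
  "\<forall>a\<in>{1..N}. \<forall>B\<in>stable_boundary_components (s a).
    (\<exists>i\<in>{1..n}. B \<in> stable_boundary_components (r i)) \<or> (\<exists>w\<in>W. \<exists>t. B = code_arc X f r T t w)"
proof (intro lex_ball ballI)
  fix i h B assume i: "i \<in> {1..n}" "h \<in> {1..num_pieces i}" and "B \<in> stable_boundary_components (s (lex i h))"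
  then have "B = line i (cut_level i (h - 1)) \<or> B = line i (cut_level i h)"
    unfolding s_lex[OF i] stable_boundary_components_def piece_sides[OF i(2)] by blast
  moreover have "h - 1 \<le> num_pieces i" "h \<le> num_pieces i" using i(2) unfolding atLeastAtMost_iff by arith+
  ultimately show "(\<exists>i\<in>{1..n}. B \<in> stable_boundary_components (r i)) \<or> (\<exists>w\<in>W. \<exists>t. B = code_arc X f r T t w)"
    using level_line i(1) by metis
qed

lemma arcs_in_boundary: "\<forall>w\<in>W. \<forall>t. \<exists>a\<in>{1..N}. code_arc X f r T t w \<in> stable_boundary_components (s a)"
proof (intro ballI allI)
  fix w t assume "w \<in> W"
  then obtain i h where i: "i \<in> {1..n}" "h \<in> {1..num_pieces i}" "code_arc X f r T t w \<in> stable_boundary_components (piece i h)"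
    by (rule arc_level)
  then show "\<exists>a\<in>{1..N}. code_arc X f r T t w \<in> stable_boundary_components (s a)"
    using lex_N[OF i(1,2)] s_lex[OF i(1,2)] by (intro bexI[of _ "lex i h"]) simp_all
qed

text \<open>The vertical sides are merely subdivided, and the interior cut lines are exactly full
  arcs of the family.\<close>

lemma refined_boundary:
  "(\<Union>a\<in>{1..N}. rectangle_boundary (s a)) = (\<Union>i\<in>{1..n}. rectangle_boundary (r i)) \<union> (\<Union>w\<in>W. \<Union>t. code_arc X f r T t w)"
proof
  show "(\<Union>a\<in>{1..N}. rectangle_boundary (s a)) \<subseteq> (\<Union>i\<in>{1..n}. rectangle_boundary (r i)) \<union> (\<Union>w\<in>W. \<Union>t. code_arc X f r T t w)"
  proof (rule UN_least)
    fix a assume a: "a \<in> {1..N}"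
    obtain i h where i: "i \<in> {1..n}" "h \<in> {1..num_pieces i}" "a = lex i h" by (rule lex_index_cases[OF a])
    have st: "B \<subseteq> (\<Union>i\<in>{1..n}. rectangle_boundary (r i)) \<union> (\<Union>w\<in>W. \<Union>t. code_arc X f r T t w)"
      if B: "B \<in> stable_boundary_components (s a)" for B
    proof -
      consider k where "k \<in> {1..n}" "B \<in> stable_boundary_components (r k)" | w t where "w \<in> W" "B = code_arc X f r T t w"
        using bspec[OF bspec[OF boundary_arcs a] B] by blast
      then show ?thesis
      proof cases
        case 1
        then have "B \<subseteq> rectangle_boundary (r k)" unfolding stable_boundary_components_def rectangle_boundary_def by blast
        then show ?thesis using 1(1) by blast
      qed blast
    qed
    have lev: "{cut_level i (h - 1)..cut_level i h} \<subseteq> {0..1}" using layer_levels[OF i(2)] by simp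
    have L: "left_side (s a) = (\<lambda>y. \<rho> i 0 y) ` {cut_level i (h - 1)..cut_level i h}"
      "right_side (s a) = (\<lambda>y. \<rho> i 1 y) ` {cut_level i (h - 1)..cut_level i h}"
      unfolding i(3) s_lex[OF i(1,2)] by (rule piece_sides(3,4)[OF i(2)])+
    have "left_side (s a) \<subseteq> left_side (r i)" "right_side (s a) \<subseteq> right_side (r i)"
      unfolding L rectangle_sides(3,4)[of "r i"] by (rule image_mono[OF lev])+
    then have "left_side (s a) \<union> right_side (s a) \<subseteq> rectangle_boundary (r i)" unfolding rectangle_boundary_def by blast
    moreover have "bottom_side (s a) \<in> stable_boundary_components (s a)" "top_side (s a) \<in> stable_boundary_components (s a)"
      unfolding stable_boundary_components_def by simp_all
    moreover have "rectangle_boundary (r i) \<subseteq> (\<Union>i\<in>{1..n}. rectangle_boundary (r i)) \<union> (\<Union>w\<in>W. \<Union>t. code_arc X f r T t w)"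
      by (rule le_supI1) (rule UN_upper[OF i(1)])
    ultimately show "rectangle_boundary (s a) \<subseteq> (\<Union>i\<in>{1..n}. rectangle_boundary (r i)) \<union> (\<Union>w\<in>W. \<Union>t. code_arc X f r T t w)"
      unfolding rectangle_boundary_def[of "s a"] using st[of "bottom_side (s a)"] st[of "top_side (s a)"]
      by (meson Un_least le_sup_iff order_trans)
  qed
  have piece_sub: "rectangle_boundary (piece i h) \<subseteq> (\<Union>a\<in>{1..N}. rectangle_boundary (s a))"
    if "i \<in> {1..n}" "h \<in> {1..num_pieces i}" for i h
    using lex_N[OF that] unfolding s_lex[OF that, symmetric] by blast
  have "rectangle_boundary (r i) \<subseteq> (\<Union>a\<in>{1..N}. rectangle_boundary (s a))" if i: "i \<in> {1..n}" for i
  proof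
    fix q assume "q \<in> rectangle_boundary (r i)"
    then consider "q \<in> line i 0" | "q \<in> line i 1" | y where "0 \<le> y" "y \<le> 1" "q = \<rho> i 0 y \<or> q = \<rho> i 1 y"
      unfolding rectangle_boundary_def rectangle_sides by auto
    then obtain h where h: "h \<in> {1..num_pieces i}" "q \<in> rectangle_boundary (piece i h)"
    proof cases
      case 1
      have "1 \<in> {1..num_pieces i}" using num_pieces_pos by simp
      then show thesis using that[of 1] 1 piece_sides(1)[of 1 i] unfolding rectangle_boundary_def by simp
    next
      case 2
      have "num_pieces i \<in> {1..num_pieces i}" using num_pieces_pos by simp
      then show thesis using that[of "num_pieces i"] 2 piece_sides(2)[of "num_pieces i" i] unfolding rectangle_boundary_def by simp
    next
      case 3
      obtain h where h: "h \<in> {1..num_pieces i}" "cut_level i (h - 1) \<le> y" "y \<le> cut_level i h" by (rule levels_cover[OF 3(1,2)])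
      then have "q \<in> left_side (piece i h) \<or> q \<in> right_side (piece i h)" unfolding piece_sides[OF h(1)] using 3(3) by auto
      then show thesis using that[OF h(1)] unfolding rectangle_boundary_def by blast
    qed
    then show "q \<in> (\<Union>a\<in>{1..N}. rectangle_boundary (s a))" using piece_sub[OF i] by blast
  qed
  moreover have "code_arc X f r T t w \<subseteq> (\<Union>a\<in>{1..N}. rectangle_boundary (s a))" if w: "w \<in> W" for w t
  proof -
    obtain i h where i: "i \<in> {1..n}" "h \<in> {1..num_pieces i}" "code_arc X f r T t w \<in> stable_boundary_components (piece i h)"
      by (rule arc_level[OF w])
    then have "code_arc X f r T t w \<subseteq> rectangle_boundary (piece i h)" unfolding stable_boundary_components_def rectangle_boundary_def by blast
    then show ?thesis using piece_sub[OF i(1,2)] by blast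
  qed
  ultimately show "(\<Union>i\<in>{1..n}. rectangle_boundary (r i)) \<union> (\<Union>w\<in>W. \<Union>t. code_arc X f r T t w) \<subseteq> (\<Union>a\<in>{1..N}. rectangle_boundary (s a))"
    by blast
qed

text \<open>A periodic point on a cut arc is the projection of the shifted code by
  \<open>periodic_in_arc\<close>; conversely that projection is periodic and lies on the
  arc.\<close>

lemma refined_periodic_boundary:
  "periodic_boundary_points X f N s = periodic_boundary_points X f n r \<union> {\<pi> ((shift ^^ t) w) | w t. w \<in> W}"
proof (intro set_eqI iffI)
  fix q assume q: "q \<in> periodic_boundary_points X f N s"
  then obtain p where p: "q \<in> S" "0 < p" "(f ^^ p) q = q" "q \<in> (\<Union>a\<in>{1..N}. rectangle_boundary (s a))"
    unfolding periodic_boundary_points_def by blast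
  from p(4) consider "q \<in> (\<Union>i\<in>{1..n}. rectangle_boundary (r i))" | w t where "w \<in> W" "q \<in> code_arc X f r T t w"
    unfolding refined_boundary by blast
  then show "q \<in> periodic_boundary_points X f n r \<union> {\<pi> ((shift ^^ t) w) | w t. w \<in> W}"
  proof cases
    case 1
    then show ?thesis using p(1-3) unfolding periodic_boundary_points_def by blast
  next
    case 2
    obtain P where P: "0 < P" "(shift ^^ P) w = w" using W_per[OF 2(1)] unfolding periodic_code_def by blast
    have "q = \<pi> ((shift ^^ t) w)" by (rule periodic_in_arc[OF W_sub[OF 2(1)] P(2,1) 2(2) p(3,2)])
    then show ?thesis using 2(1) by blast
  qed
next
  fix q assume "q \<in> periodic_boundary_points X f n r \<union> {\<pi> ((shift ^^ t) w) | w t. w \<in> W}"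
  then consider "q \<in> periodic_boundary_points X f n r" | w t where "w \<in> W" "q = \<pi> ((shift ^^ t) w)" by blast
  then show "q \<in> periodic_boundary_points X f N s"
  proof cases
    case 1
    then show ?thesis unfolding periodic_boundary_points_def refined_boundary by blast
  next
    case 2
    note w = W_sub[OF 2(1)]
    obtain P where P: "0 < P" "(shift ^^ P) w = w" using W_per[OF 2(1)] unfolding periodic_code_def by blast
    have "(f ^^ P) q = \<pi> ((shift ^^ P) ((shift ^^ t) w))" unfolding 2(2) by (rule funpow_projection[OF subshift_shift[OF w]])
    also have "(shift ^^ P) ((shift ^^ t) w) = (shift ^^ t) ((shift ^^ P) w)" by (metis add.commute comp_apply funpow_add)
    also have "\<dots> = (shift ^^ t) w" unfolding P(2) ..
    finally have "(f ^^ P) q = q" unfolding 2(2) .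
    moreover have "q \<in> S" unfolding 2(2) by (rule projection_S[OF subshift_shift[OF w]])
    moreover have "q \<in> code_arc X f r T t w" unfolding 2(2) by (rule projection_in_arc[OF w])
    ultimately show ?thesis unfolding periodic_boundary_points_def refined_boundary using P(1) 2(1) by blast
  qed
qed

subsection \<open>The output of the algorithm\<close>

lemma encode_rows: "encode_type T' = enc rows"
proof (rule encode_type_of_rows)
  fix v es e assume "(v, es) \<in> set rows" "e \<in> set es"
  then show "snd e \<in> {0, 1}" unfolding rows_def refined_rows_def refined_row_def by auto
qed

text \<open>The partition and \<open>T'\<close> depend on \<open>W\<close> alone; the words
  \<open>us\<close> only select which arcs represent the cuts. So every presentation of
  \<open>W\<close> leads to the code of the same type.\<close>

lemma algorithm_output:
  assumes F: "\<And>p. F (enc p) = enc (refinement p)" and us: "presents_codes us W"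
  shows "\<exists>cuts. F (encode_input T us) = encode_output cuts T' \<and> cut_along X f n r T us cuts num_pieces s"
proof -
  have ne: "[] \<notin> set us" and rep: "repeat_word ` set us = W" using us unfolding presents_codes_def by blast+
  have sym: "symbol us q t = repeat_word (us ! q) (int t)" if q: "q < length us" for q t
  proof -
    have "us ! q \<noteq> []" using ne q by (metis nth_mem)
    then have "t mod length (us ! q) < length (us ! q)" by simp
    then show ?thesis using q unfolding symbol_def repeat_word_def by (simp add: nth_default_def nat_mod_as_int)
  qed
  have inW: "repeat_word (us ! q) \<in> W" if "q < length us" for q using rep that by force
  interpret P: presented_cuts D hb tails us
  proof
    show "[] \<notin> set us" by (rule ne)
    show "tails = {\<lambda>m. symbol us q (t + m) | q t. q < length us}"
    proof (intro set_eqI iffI)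
      fix u assume "u \<in> tails"
      then obtain w t where w: "w \<in> W" "u = tail w t" unfolding tails_def by blast
      then obtain q where q: "q < length us" "w = repeat_word (us ! q)" using rep by (metis imageE in_set_conv_nth)
      have "u = (\<lambda>m. symbol us q (t + m))" unfolding w(2) q(2) sym[OF q(1)] ..
      then show "u \<in> {\<lambda>m. symbol us q (t + m) | q t. q < length us}" using q(1) by blast
    next
      fix u assume "u \<in> {\<lambda>m. symbol us q (t + m) | q t. q < length us}"
      then obtain q t where q: "q < length us" "u = (\<lambda>m. symbol us q (t + m))" by blast
      have "u = tail (repeat_word (us ! q)) t" unfolding q(2) sym[OF q(1)] ..
      then show "u \<in> tails" unfolding tails_def using inW[OF q(1)] by blast
    qed
  qed
  define cuts where "cuts = map (cut_list D us) [1..<Suc n]"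
  have nth: "cuts ! (i - 1) = cut_list D us i" if "i \<in> {1..n}" for i using that unfolding cuts_def by (rule nth_map_upt1)
  have "refinement (D, us) = (cuts, rows)"
    unfolding refinement_def fst_conv snd_conv P.refined_rows_eq cuts_def rows_def len_D ..
  then have "F (enc (D, us)) = enc (cuts, rows)" using F[of "(D, us)"] by simp
  moreover have "enc (D, us) = encode_input T us"
    unfolding encode_input_def encode_type_table enc_prod_def fst_conv snd_conv by (simp add: enc_lists enc_nat_id)
  moreover have "enc (cuts, rows) = encode_output cuts T'"
    unfolding encode_output_def encode_rows enc_prod_def fst_conv snd_conv by (simp add: enc_lists enc_pair)
  moreover have "cut_along X f n r T us cuts num_pieces s"
    unfolding cut_along_def
  proof (intro conjI ballI)
    show "length cuts = n" unfolding cuts_def by simp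
    fix i assume i: "i \<in> {1..n}"
    show "num_pieces i = Suc (length (cuts ! (i - 1)))" unfolding nth[OF i] P.length_cut_list num_pieces_def ..
    fix h assume h: "h \<in> {1..<num_pieces i}"
    obtain q t where qt: "cut_list D us i ! (h - 1) = (q, t)" by (cases "cut_list D us i ! (h - 1)")
    note c = P.cut_list_nth[OF h, unfolded qt]
    have q: "q < length us" and qi: "symbol us q t = i" using P.set_cut_list[OF c(1)] by simp_all
    have wi: "repeat_word (us ! q) (int t) = i" using qi unfolding sym[OF q] .
    have "P.arc_code (q, t) = tail (repeat_word (us ! q)) t" unfolding P.arc_code_def fst_conv snd_conv sym[OF q] ..
    then have arc: "code_arc X f r T t (repeat_word (us ! q)) = line i (cut_level i h)"
      unfolding arc_line[OF inW[OF q]] wi using c(2) by simp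
    have h1: "h \<in> {1..num_pieces i}" and h2: "Suc h \<in> {1..num_pieces i}" using h by simp_all
    show "\<exists>q t. cuts ! (i - 1) ! (h - 1) = (q, t) \<and> q < length us \<and> repeat_word (us ! q) (int t) = i \<and>
      top_side (s (lex i h)) = code_arc X f r T t (repeat_word (us ! q)) \<and>
      bottom_side (s (lex i (Suc h))) = code_arc X f r T t (repeat_word (us ! q))"
      by (rule exI[of _ q], rule exI[of _ t])
        (simp add: nth[OF i, simplified] qt[simplified] q wi arc s_lex[OF i h1] s_lex[OF i h2] piece_sides[OF h1] piece_sides[OF h2])
  qed
  ultimately show ?thesis by auto
qed

end

theorem theorem7:
  shows "\<exists>algorithm. total_recursive algorithm \<and>
    (\<forall>(X :: 'a::t2_space bifoliated_surface) \<mu>s \<mu>u f n r T W.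
      generalized_pseudo_Anosov X \<mu>s \<mu>u f \<and>
      geometric_Markov_partition X f n r \<and>
      has_geometric_type X f n r T \<and>
      binary_incidence T \<and>
      finite W \<and> W \<subseteq> subshift T \<and> (\<forall>w\<in>W. periodic_code w)
      \<longrightarrow>
      (\<exists>H s T' N. N = (\<Sum>i\<in>{1..n}. H i) \<and>
        geometric_refinement X f n r H s \<and>
        (\<forall>a\<in>{1..N}. \<forall>B\<in>stable_boundary_components (s a).
           (\<exists>i\<in>{1..n}. B \<in> stable_boundary_components (r i)) \<or>
           (\<exists>w\<in>W. \<exists>t. B = code_arc X f r T t w)) \<and>
        (\<forall>w\<in>W. \<forall>t. \<exists>a\<in>{1..N}. code_arc X f r T t w \<in> stable_boundary_components (s a)) \<and>
        periodic_boundary_points X f N s =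
          periodic_boundary_points X f n r \<union>
          {code_projection X f r ((shift ^^ t) w) | w t. w \<in> W} \<and>
        has_geometric_type X f N s T' \<and>
        (\<forall>us. presents_codes us W \<longrightarrow>
           (\<exists>cuts. algorithm (encode_input T us) = encode_output cuts T' \<and>
                   cut_along X f n r T us cuts H s))))"
proof -
  \<comment> \<open>One recursive function serves all surfaces, maps and partitions, since
    \<open>refinement\<close> sees only the table of the type and the words.\<close>
  obtain F where F: "total_recursive F" "\<And>p. F (enc p) = enc (refinement p)"
    using computableE[OF computable_refinement] by blast
  show ?thesis
  proof (rule exI[of _ F], intro conjI allI impI F(1), goal_cases)
    case (1 X \<mu>s \<mu>u f n r T W)
    then have ht: "has_geometric_type X f n r T" by blast
    have gt: "gt_n T = n" using ht unfolding has_geometric_type_def by (rule conjunct1)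
    obtain H V where HV: "(\<forall>i\<in>{1..n}. bij_betw (H i) {1..gt_h T i} (horizontal_subrectangles X f n r i) \<and>
         (\<forall>j\<in>{1..gt_h T i}. \<forall>j'\<in>{1..gt_h T i}. j < j' \<longrightarrow> below_in (r i) (H i j) (H i j')))"
      "(\<forall>k\<in>{1..n}. bij_betw (V k) {1..gt_v T k} (vertical_subrectangles X f n r k) \<and>
         (\<forall>l\<in>{1..gt_v T k}. \<forall>l'\<in>{1..gt_v T k}. l < l' \<longrightarrow> left_of_in (r k) (V k l) (V k l')))"
      "(\<forall>i\<in>{1..n}. \<forall>j\<in>{1..gt_h T i}. \<exists>k\<in>{1..n}. \<exists>l\<in>{1..gt_v T k}.
         gt_rho T (i, j) = (k, l) \<and> f ` H i j = V k l \<and>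
         gt_eps T (i, j) =
           (if \<forall>x\<in>H i j. \<forall>y\<in>H i j. vertical_coord (r i) x < vertical_coord (r i) y \<longrightarrow>
                 vertical_coord (r k) (f x) < vertical_coord (r k) (f y)
            then 1 else - 1))"
      using ht unfolding has_geometric_type_def by (elim conjE exE) blast
    interpret refined_markov X \<mu>s \<mu>u f n r T H V W
    proof (unfold_locales, goal_cases)
      case (9 i j)
      from bspec[OF bspec[OF HV(3) 9(1)] 9(2)] show ?case .
    qed (use 1 gt HV(1,2) in blast)+
    show ?case
      by (rule exI[of _ num_pieces], rule exI[of _ s], rule exI[of _ T'], rule exI[of _ N],
        intro conjI allI impI refl refined_partition boundary_arcs arcs_in_boundary
          refined_periodic_boundary refined_type algorithm_output[OF F(2)])
  qed
qed

end
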